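(* Assume Axioms 1–5 (see context). Let $X\subset G$ be such that $G\setminus X$ is the set of $\bar\alpha\in G$ for which the algebra $\mathcal U_{\bar\alpha}$ is semi-simple. Then there exists a family of central elements $\{z_{\bar\alpha}\in Z_{\bar\alpha}\}_{\bar\alpha\in G\setminus X}$ such that $\mu_{\bar\alpha}(x)=\mathrm{tr}^{\mathbb C}_{\mathcal U_{\bar\alpha}}(L_{z_{\bar\alpha}}L_x)$ for all $x\in\mathcal U_{\bar\alpha}$. Furthermore, there exists a modified integral on $G\setminus X$ defined by $$\mu'_{\bar\alpha}(z):=\mu_{\bar\alpha}(z_{\bar\alpha}z)=\mathrm{tr}^{\mathbb C}_{\mathcal U_{\bar\alpha}}\big(L_{z_{\bar\alpha}^2z}\big)\qquad\text{for all } z\in Z_{\bar\alpha}.$$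
   Context: $\ell\ge 1$ is an integer, $\xi=e^{2i\pi/\ell}$, $\xi^x:=\exp(2i\pi x/\ell)$. $\Lambda$ is a free abelian group of rank $r$, $\Lambda^*=\mathrm{Hom}(\Lambda,\mathbb Z)$, $\mathfrak H=\Lambda^*\otimes\mathbb C$, $\mathfrak H^*=\Lambda\otimes\mathbb C$, $G=\mathfrak H^*/\Lambda$. $H_a\in\mathfrak H$ corresponds to $a\in\Lambda^*$. $\mathbb C[\Lambda^*]$ has grouplike basis $K^a$. $W$ is a finite dimensional $\Lambda$-graded vector space with distinguished degree $0$ element $1_W$; $|x|$ is the degree of a homogeneous $x$. Axiom 1: $\mathcal U=W\otimes\mathbb C[\Lambda^*]$ is a $\Lambda$-graded Hopf algebra $(m,\Delta,\varepsilon,S)$ containing $\mathbb C[\Lambda^*]=1_W\otimes \mathbb C[\Lambda^*]$ as Hopf subalgebra in degree 0, $w\otimes K^a=wK^a$, $K^axK^{-a}=\xi^{a(|x|)}x$ for homogeneous $x\in W$, with a grouplike pivot $g$: $S^2(x)=gxg^{-1}$. $\mathcal U^H=\mathcal U\rtimes S\mathfrak H$ with $H_ax=x(H_a+a(|x|))$, elements of $\mathfrak H$ primitive. Fix $\mathsf Q\in\Lambda^*\otimes\Lambda^*$ whose associated bilinear form $\mathsf B$ on $\mathfrak H^*$ is symmetric; $B_\lambda=K^{\mathsf B(\lambda,\cdot)}$; $\widetilde{\mathcal H}(x\otimes y)=xB_{|y|}\otimes B_{|x|}y$. Axiom 2: there is an invertible $\check{\mathcal R}=\sum x_i\otimes y_i\in\mathcal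 U\otimes\mathcal U$ (homogeneous $x_i,y_i$) with $\tau(\Delta u)=\widetilde{\mathcal H}(\check{\mathcal R}\Delta u\check{\mathcal R}^{-1})$ for $u\in\mathcal U^H$; $(\Delta\otimes\mathrm{Id})\check{\mathcal R}=(\sum x_j\otimes B_{|y_j|}^{-1}\otimes y_j)\check{\mathcal R}_{23}$; $(\mathrm{Id}\otimes\Delta)\check{\mathcal R}=(\sum x_j\otimes B_{|x_j|}^{-1}\otimes y_j)\check{\mathcal R}_{12}$; $\sum y_igx_iB_{|x_i|}=\sum x_ig^{-1}y_iB_{|x_i|}^{-1}$. $G$-coalgebra: for $\bar\alpha\in G$, $\mathcal U_{\bar\alpha}=\mathcal U/(K^{\ell a}-\xi^{\ell a(\alpha)},\,a\in\Lambda^* )$ (finite dimensional); $\Delta,S$ induce $\Delta_{\bar\alpha,\bar\beta}:\mathcal U_{\bar\alpha+\bar\beta}\to\mathcal U_{\bar\alpha}\otimes\mathcal U_{\bar\beta}$, $S_{\bar\alpha}:\mathcal U_{\bar\alpha}\to\mathcal U_{-\bar\alpha}$; $g_{\bar\alpha}$ is the image of $g$. $\mathcal U_{\bar 0}$ is a Hopf algebra. Axiom 3: $\mathcal U_{\bar0}$ is unimodular: there is $\Upsilon\ne0$ with $x\Upsilon=\Upsilon x=\varepsilon(x)\Upsilon$. Then there is a unique right $G$-integral, i.e. family of linear forms $\lambda_{\bar\alpha}$ on $\mathcal U_{\bar\alpha}$ with $(\lambda_{\bar\alpha}\otimes\mathrm{Id})\Delta_{\bar\alpha,\bar\beta}(x)=\lambda_{\bar\alpha+\bar\beta}(x)1_{\bar\beta}$,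 such that $\lambda_{\bar0}(\Upsilon)=1$. Let $\mathcal H_0$ be the unique element of the span of the images of $K^a\otimes K^b$ in $\mathcal U_{\bar0}\otimes\mathcal U_{\bar0}$ sent to $\xi^{\mathsf B(\lambda,\mu)}$ by the character $K^a\otimes K^b\mapsto\xi^{a(\lambda)+b(\mu)}$ for all $\lambda,\mu\in\Lambda$; $\mathcal R_{\bar0}=\mathcal H_0\check{\mathcal R}$, $\theta_{\bar0}=g^{-1}m(S^2\otimes\mathrm{Id})(\mathcal R_{\bar0})$. Axiom 4: $\lambda_{\bar0}(\theta_{\bar0})\lambda_{\bar0}(\theta_{\bar0}^{-1})=1$. Axiom 5: in the category $\mathscr C^H$ of finite dimensional $\mathcal U^H$-modules with $S\mathfrak H$ acting semisimply and $K^a=\xi^{H_a}$, there is a nonzero projective object whose restriction to $\mathcal U$ is projective in $\bigoplus_{\bar\alpha}\mathcal U_{\bar\alpha}$-mod. The symmetrised $G$-integral is $\mu_{\bar\alpha}(x)=\lambda_{\bar\alpha}(g_{\bar\alpha}x)$. Notation: $L_x$ is left multiplication by $x$; $\mathrm{tr}^{\mathbb C}_{\mathcal U_{\bar\alpha}}$ is the usual trace of linear endomorphisms of $\mathcal U_{\bar\alpha}$. $Z_{\bar\alpha}$ is the center of $\mathcal U_{\bar\alpha}$ and $Z_{(\bar\alpha,\bar\beta)}\subset\mathcal U_{\bar\alpha}\otimes\mathcal U_{\bar\beta}$ is the centralizer of $\Delta_{\bar\alpha,\bar\beta}(\mathcal U_{\bar\alpha+\bar\beta})$. One has $(\mu_{\bar\alpha}L_{g_{\bar\alpha}^{-1}}\otimes\mathrm{Id})(Z_{(\bar\alpha,\bar\beta)})\subset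 Z_{\bar\beta}$ and $(\mathrm{Id}\otimes\mu_{\bar\beta}L_{g_{\bar\beta}})(Z_{(\bar\alpha,\bar\beta)})\subset Z_{\bar\alpha}$. Definition: for $X\subset G$, a modified integral on $G\setminus X$ is a family of linear maps $\{\mu'_{\bar\alpha}:Z_{\bar\alpha}\to\mathbb C\}_{\bar\alpha\in G\setminus X}$ such that for all $\bar\alpha,\bar\beta\in G\setminus X$ the linear forms $\mu_{\bar\alpha}L_{g_{\bar\alpha}^{-1}}\otimes\mu'_{\bar\beta}$ and $\mu'_{\bar\alpha}\otimes\mu_{\bar\beta}L_{g_{\bar\beta}}$ are equal on $Z_{(\bar\alpha,\bar\beta)}$. *)

theory Defs
  imports
    "HOL-Library.Poly_Mapping"
    "HOL-Algebra.QuotRing"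
    "Jordan_Normal_Form.VS_Connect"
    Complex_Main
begin

section \<open>Complex algebras and tensor products\<close>

text \<open>
  Complex vector spaces and algebras are records of type \<open>(complex, 'a) module\<close> over the
  ring \<open>class_ring\<close> of complex numbers. For bare vector spaces, the fields
  \<open>mult\<close> and \<open>one\<close> are irrelevant.
\<close>

type_synonym 'a calg = "(complex, 'a) module"

abbreviation cspan :: "'a calg \<Rightarrow> 'a set \<Rightarrow> 'a set" where
  "cspan A S \<equiv> LinearCombinations.module.span class_ring A S"

abbreviation clinear :: "'a calg \<Rightarrow> 'b calg \<Rightarrow> ('a \<Rightarrow> 'b) set" where
  "clinear A B \<equiv> LinearCombinations.module_hom class_ring A B"

definition complex_algebra :: "'a calg \<Rightarrow> bool" where
  "complex_algebra A \<longleftrightarrow> ring A \<and> vectorspace class_ring A \<and>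
     (\<forall>c. \<forall>x\<in>carrier A. \<forall>y\<in>carrier A.
        (c \<odot>\<^bsub>A\<^esub> x) \<otimes>\<^bsub>A\<^esub> y = c \<odot>\<^bsub>A\<^esub> (x \<otimes>\<^bsub>A\<^esub> y) \<and>
        x \<otimes>\<^bsub>A\<^esub> (c \<odot>\<^bsub>A\<^esub> y) = c \<odot>\<^bsub>A\<^esub> (x \<otimes>\<^bsub>A\<^esub> y))"

definition Calg :: "complex calg" where
  "Calg = \<lparr>carrier = UNIV, mult = (*), one = 1, zero = 0, add = (+), smult = (*)\<rparr>"

definition alg_hom :: "'a calg \<Rightarrow> 'b calg \<Rightarrow> ('a \<Rightarrow> 'b) set" where
  "alg_hom A B = Ring.ring_hom A B \<inter> clinear A B"

text \<open>
  The tensor product is the free vector space on pairs modulo the bilinearity relations: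
  its elements are cosets of finitely supported formal sums.
\<close>

type_synonym ('a, 'b) formal = "('a \<times> 'b) \<Rightarrow>\<^sub>0 complex"
type_synonym ('a, 'b) tens = "('a, 'b) formal set"

definition fscale :: "complex \<Rightarrow> ('k \<Rightarrow>\<^sub>0 complex) \<Rightarrow> ('k \<Rightarrow>\<^sub>0 complex)" where
  "fscale c p = Poly_Mapping.map ((*) c) p"

inductive_set tens_null :: "'a calg \<Rightarrow> 'b calg \<Rightarrow> ('a, 'b) formal set"
  for A :: "'a calg" and B :: "'b calg" where
  zero: "0 \<in> tens_null A B"
| add: "p \<in> tens_null A B \<Longrightarrow> q \<in> tens_null A B \<Longrightarrow> p + q \<in> tens_null A B"
| scale: "p \<in> tens_null A B \<Longrightarrow> fscale c p \<in> tens_null A B"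
| add_left: "x \<in> carrier A \<Longrightarrow> x' \<in> carrier A \<Longrightarrow> y \<in> carrier B \<Longrightarrow>
    Poly_Mapping.single (x \<oplus>\<^bsub>A\<^esub> x', y) 1
      - Poly_Mapping.single (x, y) 1 - Poly_Mapping.single (x', y) 1 \<in> tens_null A B"
| add_right: "x \<in> carrier A \<Longrightarrow> y \<in> carrier B \<Longrightarrow> y' \<in> carrier B \<Longrightarrow>
    Poly_Mapping.single (x, y \<oplus>\<^bsub>B\<^esub> y') 1
      - Poly_Mapping.single (x, y) 1 - Poly_Mapping.single (x, y') 1 \<in> tens_null A B"
| smult_left: "x \<in> carrier A \<Longrightarrow> y \<in> carrier B \<Longrightarrow>
    Poly_Mapping.single (c \<odot>\<^bsub>A\<^esub> x, y) 1 - Poly_Mapping.single (x, y) c \<in> tens_null A B"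
| smult_right: "x \<in> carrier A \<Longrightarrow> y \<in> carrier B \<Longrightarrow>
    Poly_Mapping.single (x, c \<odot>\<^bsub>B\<^esub> y) 1 - Poly_Mapping.single (x, y) c \<in> tens_null A B"

definition tens_class :: "'a calg \<Rightarrow> 'b calg \<Rightarrow> ('a, 'b) formal \<Rightarrow> ('a, 'b) tens" where
  "tens_class A B p = {p + q | q. q \<in> tens_null A B}"

definition ptens :: "'a calg \<Rightarrow> 'b calg \<Rightarrow> 'a \<Rightarrow> 'b \<Rightarrow> ('a, 'b) tens" where
  "ptens A B x y = tens_class A B (Poly_Mapping.single (x, y) 1)"

definition rep :: "'x set \<Rightarrow> 'x" where
  "rep X = (SOME x. x \<in> X)"

definition formal_mult ::
  "'a calg \<Rightarrow> 'b calg \<Rightarrow> ('a, 'b) formal \<Rightarrow> ('a, 'b) formal \<Rightarrow> ('a, 'b) formal" where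
  "formal_mult A B p q =
     (\<Sum>k\<in>Poly_Mapping.keys p. \<Sum>l\<in>Poly_Mapping.keys q.
        Poly_Mapping.single (fst k \<otimes>\<^bsub>A\<^esub> fst l, snd k \<otimes>\<^bsub>B\<^esub> snd l)
          (Poly_Mapping.lookup p k * Poly_Mapping.lookup q l))"

definition tensor_alg :: "'a calg \<Rightarrow> 'b calg \<Rightarrow> ('a, 'b) tens calg" (infixr \<open>\<otimes>\<^sub>A\<close> 72) where
  "A \<otimes>\<^sub>A B =
     \<lparr>carrier = {tens_class A B p | p. Poly_Mapping.keys p \<subseteq> carrier A \<times> carrier B},
      mult = (\<lambda>s t. tens_class A B (formal_mult A B (rep s) (rep t))),
      one = ptens A B \<one>\<^bsub>A\<^esub> \<one>\<^bsub>B\<^esub>,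
      zero = tens_class A B 0,
      add = (\<lambda>s t. tens_class A B (rep s + rep t)),
      smult = (\<lambda>c t. tens_class A B (fscale c (rep t)))\<rparr>"

text \<open>
  The linear map on a tensor product induced by a bilinear map \<open>h\<close> into \<open>C\<close>
  (independent of the representative exactly because \<open>h\<close> is bilinear).
\<close>

definition tens_lift :: "'c calg \<Rightarrow> ('a \<Rightarrow> 'b \<Rightarrow> 'c) \<Rightarrow> ('a, 'b) tens \<Rightarrow> 'c" where
  "tens_lift C h t =
     (\<Oplus>\<^bsub>C\<^esub> k\<in>Poly_Mapping.keys (rep t). Poly_Mapping.lookup (rep t) k \<odot>\<^bsub>C\<^esub> h (fst k) (snd k))"

definition tens_map ::
  "'c calg \<Rightarrow> 'd calg \<Rightarrow> ('a \<Rightarrow> 'c) \<Rightarrow> ('b \<Rightarrow> 'd) \<Rightarrow> ('a, 'b) tens \<Rightarrow> ('c, 'd) tens" where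
  "tens_map C D f g = tens_lift (C \<otimes>\<^sub>A D) (\<lambda>x y. ptens C D (f x) (g y))"

definition tens_flip :: "'a calg \<Rightarrow> 'b calg \<Rightarrow> ('a, 'b) tens \<Rightarrow> ('b, 'a) tens" where
  "tens_flip A B = tens_lift (B \<otimes>\<^sub>A A) (\<lambda>x y. ptens B A y x)"

definition tens_assoc ::
  "'a calg \<Rightarrow> 'b calg \<Rightarrow> 'c calg \<Rightarrow> (('a, 'b) tens, 'c) tens \<Rightarrow> ('a, ('b, 'c) tens) tens" where
  "tens_assoc A B C = tens_lift (A \<otimes>\<^sub>A (B \<otimes>\<^sub>A C))
     (\<lambda>t z. tens_lift (A \<otimes>\<^sub>A (B \<otimes>\<^sub>A C)) (\<lambda>x y. ptens A (B \<otimes>\<^sub>A C) x (ptens B C y z)) t)"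

text \<open>\<open>f \<otimes> Id\<close> and \<open>Id \<otimes> f\<close> for a linear form \<open>f\<close>.\<close>

definition form_left :: "'b calg \<Rightarrow> ('a \<Rightarrow> complex) \<Rightarrow> ('a, 'b) tens \<Rightarrow> 'b" where
  "form_left B f = tens_lift B (\<lambda>x y. f x \<odot>\<^bsub>B\<^esub> y)"

definition form_right :: "'a calg \<Rightarrow> ('b \<Rightarrow> complex) \<Rightarrow> ('a, 'b) tens \<Rightarrow> 'a" where
  "form_right A f = tens_lift A (\<lambda>x y. f y \<odot>\<^bsub>A\<^esub> x)"

definition hopf_algebra ::
  "'a calg \<Rightarrow> ('a \<Rightarrow> ('a, 'a) tens) \<Rightarrow> ('a \<Rightarrow> complex) \<Rightarrow> ('a \<Rightarrow> 'a) \<Rightarrow> bool" where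
  "hopf_algebra A \<Delta> \<epsilon> S \<longleftrightarrow>
     complex_algebra A \<and> \<Delta> \<in> alg_hom A (A \<otimes>\<^sub>A A) \<and> \<epsilon> \<in> alg_hom A Calg \<and> S \<in> clinear A A \<and>
     (\<forall>u\<in>carrier A.
        tens_assoc A A A (tens_map (A \<otimes>\<^sub>A A) A \<Delta> (\<lambda>x. x) (\<Delta> u))
          = tens_map A (A \<otimes>\<^sub>A A) (\<lambda>x. x) \<Delta> (\<Delta> u) \<and>
        form_left A \<epsilon> (\<Delta> u) = u \<and> form_right A \<epsilon> (\<Delta> u) = u \<and>
        tens_lift A (\<lambda>x y. S x \<otimes>\<^bsub>A\<^esub> y) (\<Delta> u) = \<epsilon> u \<odot>\<^bsub>A\<^esub> \<one>\<^bsub>A\<^esub> \<and>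
        tens_lift A (\<lambda>x y. x \<otimes>\<^bsub>A\<^esub> S y) (\<Delta> u) = \<epsilon> u \<odot>\<^bsub>A\<^esub> \<one>\<^bsub>A\<^esub>)"

text \<open>
  Quotient of an algebra by a two-sided ideal: the library's quotient ring, with the
  induced scalar multiplication.
\<close>

definition quot_alg :: "'a calg \<Rightarrow> 'a set \<Rightarrow> 'a set calg" where
  "quot_alg A I =
     ring.extend (A Quot I) (Module.module.fields (\<lambda>c X. I +>\<^bsub>A\<^esub> (c \<odot>\<^bsub>A\<^esub> rep X)))"

text \<open>
  Every \<open>v \<in> T\<close> is, in a unique way, a finite sum of \<open>\<phi> j d\<^sub>j\<close> with \<open>d\<^sub>j \<in> D j\<close>;
  i.e. the sum of the maps \<open>\<phi> j\<close> identifies the direct sum of the subspaces \<open>D j\<close> of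
  \<open>B\<close> with \<open>T\<close>.
\<close>

definition direct_sum ::
  "'b calg \<Rightarrow> 'a calg \<Rightarrow> 'a set \<Rightarrow> 'j set \<Rightarrow> ('j \<Rightarrow> 'b set) \<Rightarrow> ('j \<Rightarrow> 'b \<Rightarrow> 'a) \<Rightarrow> bool" where
  "direct_sum B A T J D \<phi> \<longleftrightarrow>
     (\<forall>j\<in>J. \<forall>d\<in>D j. \<phi> j d \<in> T) \<and>
     (\<forall>v\<in>T. \<exists>!f. f \<in> (\<Pi>\<^sub>E j\<in>J. D j) \<and> finite {j\<in>J. f j \<noteq> \<zero>\<^bsub>B\<^esub>} \<and>
        v = (\<Oplus>\<^bsub>A\<^esub> j\<in>{j\<in>J. f j \<noteq> \<zero>\<^bsub>B\<^esub>}. \<phi> j (f j)))"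

definition alg_center :: "'a calg \<Rightarrow> 'a set" where
  "alg_center A = {z \<in> carrier A. \<forall>x\<in>carrier A. z \<otimes>\<^bsub>A\<^esub> x = x \<otimes>\<^bsub>A\<^esub> z}"

definition left_ideal :: "'a calg \<Rightarrow> 'a set \<Rightarrow> bool" where
  "left_ideal A L \<longleftrightarrow> additive_subgroup L A \<and> (\<forall>a\<in>carrier A. \<forall>x\<in>L. a \<otimes>\<^bsub>A\<^esub> x \<in> L)"

definition simple_left_ideal :: "'a calg \<Rightarrow> 'a set \<Rightarrow> bool" where
  "simple_left_ideal A L \<longleftrightarrow> left_ideal A L \<and> L \<noteq> {\<zero>\<^bsub>A\<^esub>} \<and>
     (\<forall>L'. left_ideal A L' \<and> L' \<subseteq> L \<longrightarrow> L' = {\<zero>\<^bsub>A\<^esub>} \<or> L' = L)"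

text \<open>The left regular module is a direct sum of simple submodules.\<close>

definition semisimple_algebra :: "'a calg \<Rightarrow> bool" where
  "semisimple_algebra A \<longleftrightarrow>
     (\<exists>J. (\<forall>L\<in>J. simple_left_ideal A L) \<and>
          direct_sum A A (carrier A) J (\<lambda>L. L) (\<lambda>L x. x))"

definition coord :: "'a calg \<Rightarrow> 'a set \<Rightarrow> 'a \<Rightarrow> 'a \<Rightarrow> complex" where
  "coord A B v = (THE c. c \<in> B \<rightarrow>\<^sub>E UNIV \<and> LinearCombinations.module.lincomb A c B = v)"

definition lin_trace :: "'a calg \<Rightarrow> ('a \<Rightarrow> 'a) \<Rightarrow> complex" where
  "lin_trace A f =
     (let B = (SOME B. finite B \<and> vectorspace.basis class_ring A B)
      in \<Sum>b\<in>B. coord A B (f b) b)"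


section \<open>Finite dimensional modules\<close>

text \<open>
  A finite dimensional left \<open>A\<close>-module of dimension \<open>n\<close> is given, up to isomorphism, by a
  matrix representation \<open>A \<rightarrow> Mat\<^sub>n\<close>. A full subcategory of the finite
  dimensional modules is a predicate on pairs \<open>(n, \<rho>)\<close>.
\<close>

definition fd_rep :: "'a calg \<Rightarrow> nat \<Rightarrow> ('a \<Rightarrow> complex mat) \<Rightarrow> bool" where
  "fd_rep A n \<rho> \<longleftrightarrow>
     (\<forall>x\<in>carrier A. \<rho> x \<in> carrier_mat n n) \<and> \<rho> \<one>\<^bsub>A\<^esub> = 1\<^sub>m n \<and>
     (\<forall>x\<in>carrier A. \<forall>y\<in>carrier A.
        \<rho> (x \<oplus>\<^bsub>A\<^esub> y) = \<rho> x + \<rho> y \<and> \<rho> (x \<otimes>\<^bsub>A\<^esub> y) = \<rho> x * \<rho> y) \<and>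
     (\<forall>c. \<forall>x\<in>carrier A. \<rho> (c \<odot>\<^bsub>A\<^esub> x) = c \<cdot>\<^sub>m \<rho> x)"

definition intertwiner ::
  "'a calg \<Rightarrow> nat \<Rightarrow> ('a \<Rightarrow> complex mat) \<Rightarrow> nat \<Rightarrow> ('a \<Rightarrow> complex mat) \<Rightarrow> complex mat \<Rightarrow> bool" where
  "intertwiner A n \<rho> m \<sigma> F \<longleftrightarrow>
     F \<in> carrier_mat m n \<and> (\<forall>x\<in>carrier A. F * \<rho> x = \<sigma> x * F)"

definition projective_in ::
  "'a calg \<Rightarrow> (nat \<Rightarrow> ('a \<Rightarrow> complex mat) \<Rightarrow> bool) \<Rightarrow> nat \<Rightarrow> ('a \<Rightarrow> complex mat) \<Rightarrow> bool" where
  "projective_in A Cat n \<rho> \<longleftrightarrow> Cat n \<rho> \<and>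
     (\<forall>m \<sigma> k \<tau> F H. Cat m \<sigma> \<and> Cat k \<tau> \<and>
        intertwiner A m \<sigma> k \<tau> F \<and> (\<forall>w\<in>carrier_vec k. \<exists>v\<in>carrier_vec m. F *\<^sub>v v = w) \<and>
        intertwiner A n \<rho> k \<tau> H
        \<longrightarrow> (\<exists>H'. intertwiner A n \<rho> m \<sigma> H' \<and> F * H' = H))"


section \<open>Lattice, weights and the group G\<close>

text \<open>
  A basis of the free abelian group \<open>\<Lambda>\<close> of rank \<open>r\<close> is fixed, and the dual basis of
  \<open>\<Lambda>\<^sup>*\<close>. In coordinates \<open>\<HH> = \<Lambda>\<^sup>* \<otimes> \<complex>\<close> and its dual \<open>\<Lambda> \<otimes> \<complex>\<close> both become
  \<open>wspace r\<close>, the lattices \<open>\<Lambda>\<^sup>*\<close> and \<open>\<Lambda>\<close> both become \<open>lat r\<close>, and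
  evaluation \<open>a(v)\<close> becomes \<open>pairing r a v\<close>.
\<close>

type_synonym cvec = "nat \<Rightarrow>\<^sub>0 complex"

definition wspace :: "nat \<Rightarrow> cvec set" where
  "wspace r = {v. Poly_Mapping.keys v \<subseteq> {..<r}}"

definition lat :: "nat \<Rightarrow> cvec set" where
  "lat r = {v \<in> wspace r. \<forall>i. Poly_Mapping.lookup v i \<in> \<int>}"

definition pairing :: "nat \<Rightarrow> cvec \<Rightarrow> cvec \<Rightarrow> complex" where
  "pairing r a v = (\<Sum>i<r. Poly_Mapping.lookup a i * Poly_Mapping.lookup v i)"

definition xi :: "nat \<Rightarrow> complex \<Rightarrow> complex" where
  "xi l x = exp (2 * \<i> * of_real pi * x / of_nat l)"

definition gclass :: "nat \<Rightarrow> cvec \<Rightarrow> cvec set" where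
  "gclass r v = {v + m | m. m \<in> lat r}"

definition ggroup :: "nat \<Rightarrow> cvec set set" where
  "ggroup r = gclass r ` wspace r"

definition gplus :: "cvec set \<Rightarrow> cvec set \<Rightarrow> cvec set" where
  "gplus \<alpha> \<beta> = {v + w | v w. v \<in> \<alpha> \<and> w \<in> \<beta>}"


section \<open>The data and the axioms\<close>

text \<open>
  \<open>Kel a\<close> is \<open>K\<^sup>a\<close> for \<open>a \<in> \<Lambda>\<^sup>*\<close>; \<open>Wdeg\<close> gives the graded pieces of \<open>W\<close>.
  \<open>UHalg\<close> is a realisation of the semidirect product of \<open>U\<close> with \<open>S\<HH>\<close>, \<open>incl\<close> the
  embedding of \<open>U\<close> and \<open>Hgen i\<close> the images of the basis vectors of \<open>\<HH>\<close>.
  \<open>Qmat\<close> contains the coefficients of \<open>\<Q>\<close>. The truncated R-matrix is the sum over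
  \<open>i < nR\<close> of the \<open>Rx i \<otimes> Ry i\<close>, with \<open>Rx i\<close>, \<open>Ry i\<close> homogeneous of degrees
  \<open>Rdx i\<close>, \<open>Rdy i\<close>.
\<close>

record ('u, 'v) unrolled_data =
  ell :: nat
  rnk :: nat
  Ualg :: "'u calg"
  cop :: "'u \<Rightarrow> ('u, 'u) tens"
  cou :: "'u \<Rightarrow> complex"
  ant :: "'u \<Rightarrow> 'u"
  Wsp :: "'u set"
  Wdeg :: "cvec \<Rightarrow> 'u set"
  Kel :: "cvec \<Rightarrow> 'u"
  piv :: 'u
  UHalg  :: "'v calg"
  incl :: "'u \<Rightarrow> 'v"
  Hgen :: "nat \<Rightarrow> 'v"
  copH :: "'v \<Rightarrow> ('v, 'v) tens"
  Qmat :: "nat \<Rightarrow> nat \<Rightarrow> int"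
  nR :: nat
  Rx :: "nat \<Rightarrow> 'u"
  Ry :: "nat \<Rightarrow> 'u"
  Rdx :: "nat \<Rightarrow> cvec"
  Rdy :: "nat \<Rightarrow> cvec"

abbreviation Lam :: "('u, 'v) unrolled_data \<Rightarrow> cvec set" where
  "Lam D \<equiv> lat (rnk D)"

definition Udeg :: "('u, 'v) unrolled_data \<Rightarrow> cvec \<Rightarrow> 'u set" where
  "Udeg D m = cspan (Ualg D) {w \<otimes>\<^bsub>Ualg D\<^esub> Kel D a | w a. w \<in> Wdeg D m \<and> a \<in> Lam D}"

text \<open>
  In the following definition \<open>1\<^sub>W\<close> is the unit of \<open>U\<close>, since \<open>1\<^sub>W = 1\<^sub>W \<otimes> K\<^sup>0\<close>.
  The second use of \<open>direct_sum\<close> says that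
  \<open>w \<otimes> K\<^sup>a \<mapsto> wK\<^sup>a\<close> is an isomorphism from \<open>W \<otimes> \<complex>[\<Lambda>\<^sup>*]\<close> to \<open>U\<close>.
\<close>

definition axiom1 :: "('u, 'v) unrolled_data \<Rightarrow> bool" where
  "axiom1 D \<longleftrightarrow>
     hopf_algebra (Ualg D) (cop D) (cou D) (ant D) \<and>
     VectorSpace.subspace class_ring (Wsp D) (Ualg D) \<and>
     (\<exists>F. finite F \<and> F \<subseteq> Wsp D \<and> cspan (Ualg D) F = Wsp D) \<and>
     (\<forall>m\<in>Lam D. VectorSpace.subspace class_ring (Wdeg D m) (Ualg D)) \<and>
     direct_sum (Ualg D) (Ualg D) (Wsp D) (Lam D) (Wdeg D) (\<lambda>m w. w) \<and>
     \<one>\<^bsub>Ualg D\<^esub> \<in> Wdeg D 0 \<and>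
     Kel D 0 = \<one>\<^bsub>Ualg D\<^esub> \<and>
     (\<forall>a\<in>Lam D. Kel D a \<in> carrier (Ualg D) \<and> cop D (Kel D a) = ptens (Ualg D) (Ualg D) (Kel D a) (Kel D a)) \<and>
     (\<forall>a\<in>Lam D. \<forall>b\<in>Lam D. Kel D (a + b) = Kel D a \<otimes>\<^bsub>Ualg D\<^esub> Kel D b) \<and>
     direct_sum (Ualg D) (Ualg D) (carrier (Ualg D)) (Lam D) (\<lambda>a. Wsp D) (\<lambda>a w. w \<otimes>\<^bsub>Ualg D\<^esub> Kel D a) \<and>
     (\<forall>m\<in>Lam D. \<forall>n\<in>Lam D. \<forall>x\<in>Udeg D m. \<forall>y\<in>Udeg D n. x \<otimes>\<^bsub>Ualg D\<^esub> y \<in> Udeg D (m + n)) \<and>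
     (\<forall>m\<in>Lam D. \<forall>x\<in>Udeg D m.
        cop D x \<in> cspan (Ualg D \<otimes>\<^sub>A Ualg D)
          {ptens (Ualg D) (Ualg D) y z | y z p q. p \<in> Lam D \<and> q \<in> Lam D \<and> p + q = m \<and>
             y \<in> Udeg D p \<and> z \<in> Udeg D q} \<and>
        (m \<noteq> 0 \<longrightarrow> cou D x = 0) \<and>
        ant D x \<in> Udeg D m) \<and>
     (\<forall>a\<in>Lam D. \<forall>m\<in>Lam D. \<forall>x\<in>Wdeg D m.
        Kel D a \<otimes>\<^bsub>Ualg D\<^esub> x \<otimes>\<^bsub>Ualg D\<^esub> Kel D (- a) = xi (ell D) (pairing (rnk D) a m) \<odot>\<^bsub>Ualg D\<^esub> x) \<and>
     piv D \<in> carrier (Ualg D) \<and> cou D (piv D) = 1 \<and>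
     cop D (piv D) = ptens (Ualg D) (Ualg D) (piv D) (piv D) \<and>
     (\<forall>x\<in>carrier (Ualg D). ant D (ant D x) = piv D \<otimes>\<^bsub>Ualg D\<^esub> x \<otimes>\<^bsub>Ualg D\<^esub> inv\<^bsub>Ualg D\<^esub> (piv D))"

definition Hel :: "('u, 'v) unrolled_data \<Rightarrow> cvec \<Rightarrow> 'v" where
  "Hel D a = (\<Oplus>\<^bsub>UHalg D\<^esub> i\<in>{..<rnk D}. Poly_Mapping.lookup a i \<odot>\<^bsub>UHalg D\<^esub> Hgen D i)"

definition monomials :: "('u, 'v) unrolled_data \<Rightarrow> (nat \<Rightarrow>\<^sub>0 nat) set" where
  "monomials D = {e. Poly_Mapping.keys e \<subseteq> {..<rnk D}}"

definition Hmon :: "('u, 'v) unrolled_data \<Rightarrow> (nat \<Rightarrow>\<^sub>0 nat) \<Rightarrow> 'v" where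
  "Hmon D e = foldr (\<lambda>i p. (Hgen D i [^]\<^bsub>UHalg D\<^esub> Poly_Mapping.lookup e i) \<otimes>\<^bsub>UHalg D\<^esub> p)
                [0..<rnk D] \<one>\<^bsub>UHalg D\<^esub>"

text \<open>
  \<open>UHalg\<close> is the semidirect product \<open>U \<rtimes> S\<HH>\<close>: as a vector space it is \<open>U \<otimes> S\<HH>\<close>
  (unique expansion in the monomials in the \<open>Hgen i\<close>), with \<open>U\<close> and the commutative
  \<open>S\<HH>\<close> as subalgebras and the stated commutation relation. The coproduct is then
  determined by its values on \<open>U\<close> and \<open>\<HH>\<close>; counit and antipode are not needed below.
\<close>

definition unrolled_algebra :: "('u, 'v) unrolled_data \<Rightarrow> bool" where
  "unrolled_algebra D \<longleftrightarrow>
     complex_algebra (UHalg D) \<and> incl D \<in> alg_hom (Ualg D) (UHalg D) \<and>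
     (\<forall>i<rnk D. Hgen D i \<in> carrier (UHalg D)) \<and>
     (\<forall>a\<in>wspace (rnk D). \<forall>b\<in>wspace (rnk D).
        Hel D a \<otimes>\<^bsub>UHalg D\<^esub> Hel D b = Hel D b \<otimes>\<^bsub>UHalg D\<^esub> Hel D a) \<and>
     (\<forall>a\<in>wspace (rnk D). \<forall>m\<in>Lam D. \<forall>x\<in>Udeg D m.
        Hel D a \<otimes>\<^bsub>UHalg D\<^esub> incl D x =
        incl D x \<otimes>\<^bsub>UHalg D\<^esub> (Hel D a \<oplus>\<^bsub>UHalg D\<^esub> pairing (rnk D) a m \<odot>\<^bsub>UHalg D\<^esub> \<one>\<^bsub>UHalg D\<^esub>)) \<and>
     direct_sum (Ualg D) (UHalg D) (carrier (UHalg D)) (monomials D) (\<lambda>e. carrier (Ualg D))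
       (\<lambda>e x. incl D x \<otimes>\<^bsub>UHalg D\<^esub> Hmon D e) \<and>
     copH D \<in> alg_hom (UHalg D) (UHalg D \<otimes>\<^sub>A UHalg D) \<and>
     (\<forall>x\<in>carrier (Ualg D). copH D (incl D x) = tens_map (UHalg D) (UHalg D) (incl D) (incl D) (cop D x)) \<and>
     (\<forall>a\<in>wspace (rnk D). copH D (Hel D a) =
        ptens (UHalg D) (UHalg D) (Hel D a) \<one>\<^bsub>UHalg D\<^esub> \<oplus>\<^bsub>UHalg D \<otimes>\<^sub>A UHalg D\<^esub>
        ptens (UHalg D) (UHalg D) \<one>\<^bsub>UHalg D\<^esub> (Hel D a))"

definition UHdeg :: "('u, 'v) unrolled_data \<Rightarrow> cvec \<Rightarrow> 'v set" where
  "UHdeg D m = cspan (UHalg D)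
     {incl D x \<otimes>\<^bsub>UHalg D\<^esub> Hmon D e | x e. x \<in> Udeg D m \<and> e \<in> monomials D}"

definition Bform :: "('u, 'v) unrolled_data \<Rightarrow> cvec \<Rightarrow> cvec \<Rightarrow> complex" where
  "Bform D v w = (\<Sum>i<rnk D. \<Sum>j<rnk D.
     of_int (Qmat D i j) * Poly_Mapping.lookup v i * Poly_Mapping.lookup w j)"

text \<open>The element \<open>B(m, \<cdot>)\<close> of \<open>\<Lambda>\<^sup>*\<close>, and \<open>B\<^sub>m = K\<^bsup>B(m, \<cdot>)\<^esup>\<close>.\<close>

definition Bdual :: "('u, 'v) unrolled_data \<Rightarrow> cvec \<Rightarrow> cvec" where
  "Bdual D m = (\<Sum>j<rnk D.
     Poly_Mapping.single j (\<Sum>i<rnk D. of_int (Qmat D i j) * Poly_Mapping.lookup m i))"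

definition Bel :: "('u, 'v) unrolled_data \<Rightarrow> cvec \<Rightarrow> 'u" where
  "Bel D m = Kel D (Bdual D m)"

text \<open>The operator \<open>\<H>\<close> with tilde; it is determined by this property.\<close>

definition is_Htilde ::
  "('u, 'v) unrolled_data \<Rightarrow> (('v, 'v) tens \<Rightarrow> ('v, 'v) tens) \<Rightarrow> bool" where
  "is_Htilde D f \<longleftrightarrow> f \<in> clinear (UHalg D \<otimes>\<^sub>A UHalg D) (UHalg D \<otimes>\<^sub>A UHalg D) \<and>
     (\<forall>m\<in>Lam D. \<forall>n\<in>Lam D. \<forall>x\<in>UHdeg D m. \<forall>y\<in>UHdeg D n.
        f (ptens (UHalg D) (UHalg D) x y) =
        ptens (UHalg D) (UHalg D) (x \<otimes>\<^bsub>UHalg D\<^esub> incl D (Bel D n)) (incl D (Bel D m) \<otimes>\<^bsub>UHalg D\<^esub> y))"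

definition Rcheck :: "('u, 'v) unrolled_data \<Rightarrow> ('u, 'u) tens" where
  "Rcheck D = (\<Oplus>\<^bsub>Ualg D \<otimes>\<^sub>A Ualg D\<^esub> i\<in>{..<nR D}. ptens (Ualg D) (Ualg D) (Rx D i) (Ry D i))"

definition RcheckH :: "('u, 'v) unrolled_data \<Rightarrow> ('v, 'v) tens" where
  "RcheckH D = tens_map (UHalg D) (UHalg D) (incl D) (incl D) (Rcheck D)"

text \<open>
  The two hexagon-type identities live in \<open>(U \<otimes> U) \<otimes> U\<close> and \<open>U \<otimes> (U \<otimes> U)\<close>
  respectively, which avoids reassociating.
\<close>

definition axiom2 :: "('u, 'v) unrolled_data \<Rightarrow> bool" where
  "axiom2 D \<longleftrightarrow>
     (\<forall>v\<in>wspace (rnk D). \<forall>w\<in>wspace (rnk D). Bform D v w = Bform D w v) \<and>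
     (\<forall>i<nR D. Rdx D i \<in> Lam D \<and> Rdy D i \<in> Lam D \<and>
        Rx D i \<in> Udeg D (Rdx D i) \<and> Ry D i \<in> Udeg D (Rdy D i)) \<and>
     Rcheck D \<in> Units (Ualg D \<otimes>\<^sub>A Ualg D) \<and>
     (\<exists>Ht. is_Htilde D Ht \<and>
        (\<forall>u\<in>carrier (UHalg D).
           tens_flip (UHalg D) (UHalg D) (copH D u) =
           Ht (RcheckH D \<otimes>\<^bsub>UHalg D \<otimes>\<^sub>A UHalg D\<^esub> copH D u \<otimes>\<^bsub>UHalg D \<otimes>\<^sub>A UHalg D\<^esub>
               inv\<^bsub>UHalg D \<otimes>\<^sub>A UHalg D\<^esub> (RcheckH D)))) \<and>
     (let T = Ualg D \<otimes>\<^sub>A Ualg D; T3 = T \<otimes>\<^sub>A Ualg D in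
        tens_map T (Ualg D) (cop D) (\<lambda>x. x) (Rcheck D) =
        (\<Oplus>\<^bsub>T3\<^esub> j\<in>{..<nR D}.
           ptens T (Ualg D) (ptens (Ualg D) (Ualg D) (Rx D j) (inv\<^bsub>Ualg D\<^esub> (Bel D (Rdy D j)))) (Ry D j))
        \<otimes>\<^bsub>T3\<^esub>
        (\<Oplus>\<^bsub>T3\<^esub> i\<in>{..<nR D}. ptens T (Ualg D) (ptens (Ualg D) (Ualg D) \<one>\<^bsub>Ualg D\<^esub> (Rx D i)) (Ry D i))) \<and>
     (let T = Ualg D \<otimes>\<^sub>A Ualg D; T3 = Ualg D \<otimes>\<^sub>A T in
        tens_map (Ualg D) T (\<lambda>x. x) (cop D) (Rcheck D) =
        (\<Oplus>\<^bsub>T3\<^esub> j\<in>{..<nR D}.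
           ptens (Ualg D) T (Rx D j) (ptens (Ualg D) (Ualg D) (inv\<^bsub>Ualg D\<^esub> (Bel D (Rdx D j))) (Ry D j)))
        \<otimes>\<^bsub>T3\<^esub>
        (\<Oplus>\<^bsub>T3\<^esub> i\<in>{..<nR D}. ptens (Ualg D) T (Rx D i) (ptens (Ualg D) (Ualg D) (Ry D i) \<one>\<^bsub>Ualg D\<^esub>))) \<and>
     (\<Oplus>\<^bsub>Ualg D\<^esub> i\<in>{..<nR D}.
        Ry D i \<otimes>\<^bsub>Ualg D\<^esub> piv D \<otimes>\<^bsub>Ualg D\<^esub> Rx D i \<otimes>\<^bsub>Ualg D\<^esub> Bel D (Rdx D i)) =
     (\<Oplus>\<^bsub>Ualg D\<^esub> i\<in>{..<nR D}.
        Rx D i \<otimes>\<^bsub>Ualg D\<^esub> inv\<^bsub>Ualg D\<^esub> (piv D) \<otimes>\<^bsub>Ualg D\<^esub> Ry D i \<otimes>\<^bsub>Ualg D\<^esub> inv\<^bsub>Ualg D\<^esub> (Bel D (Rdx D i)))"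


subsection \<open>The G-coalgebra\<close>

text \<open>
  The generators do not depend on the choice of \<open>v\<close> in the coset \<open>\<alpha>\<close>.
\<close>

definition quot_ideal :: "('u, 'v) unrolled_data \<Rightarrow> cvec set \<Rightarrow> 'u set" where
  "quot_ideal D \<alpha> = Idl\<^bsub>Ualg D\<^esub>
     {Kel D (fscale (of_nat (ell D)) a) \<ominus>\<^bsub>Ualg D\<^esub>
      xi (ell D) (of_nat (ell D) * pairing (rnk D) a v) \<odot>\<^bsub>Ualg D\<^esub> \<one>\<^bsub>Ualg D\<^esub>
      | a v. a \<in> Lam D \<and> v \<in> \<alpha>}"

definition Uq :: "('u, 'v) unrolled_data \<Rightarrow> cvec set \<Rightarrow> 'u set calg" where
  "Uq D \<alpha> = quot_alg (Ualg D) (quot_ideal D \<alpha>)"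

definition proj :: "('u, 'v) unrolled_data \<Rightarrow> cvec set \<Rightarrow> 'u \<Rightarrow> 'u set" where
  "proj D \<alpha> x = quot_ideal D \<alpha> +>\<^bsub>Ualg D\<^esub> x"

abbreviation GG :: "('u, 'v) unrolled_data \<Rightarrow> cvec set set" where
  "GG D \<equiv> ggroup (rnk D)"

abbreviation gzero :: "('u, 'v) unrolled_data \<Rightarrow> cvec set" where
  "gzero D \<equiv> gclass (rnk D) 0"

definition copq ::
  "('u, 'v) unrolled_data \<Rightarrow> cvec set \<Rightarrow> cvec set \<Rightarrow> 'u set \<Rightarrow> ('u set, 'u set) tens" where
  "copq D \<alpha> \<beta> x = tens_map (Uq D \<alpha>) (Uq D \<beta>) (proj D \<alpha>) (proj D \<beta>) (cop D (rep x))"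

definition pivq :: "('u, 'v) unrolled_data \<Rightarrow> cvec set \<Rightarrow> 'u set" where
  "pivq D \<alpha> = proj D \<alpha> (piv D)"

definition cou0 :: "('u, 'v) unrolled_data \<Rightarrow> 'u set \<Rightarrow> complex" where
  "cou0 D x = cou D (rep x)"

definition ant0 :: "('u, 'v) unrolled_data \<Rightarrow> 'u set \<Rightarrow> 'u set" where
  "ant0 D x = proj D (gzero D) (ant D (rep x))"

definition axiom3 :: "('u, 'v) unrolled_data \<Rightarrow> 'u set \<Rightarrow> bool" where
  "axiom3 D \<Upsilon> \<longleftrightarrow>
     (let A = Uq D (gzero D) in
        \<Upsilon> \<in> carrier A \<and> \<Upsilon> \<noteq> \<zero>\<^bsub>A\<^esub> \<and>
        (\<forall>x\<in>carrier A. x \<otimes>\<^bsub>A\<^esub> \<Upsilon> = cou0 D x \<odot>\<^bsub>A\<^esub> \<Upsilon> \<and> \<Upsilon> \<otimes>\<^bsub>A\<^esub> x = cou0 D x \<odot>\<^bsub>A\<^esub> \<Upsilon>))"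

definition right_G_integral ::
  "('u, 'v) unrolled_data \<Rightarrow> (cvec set \<Rightarrow> 'u set \<Rightarrow> complex) \<Rightarrow> bool" where
  "right_G_integral D lam \<longleftrightarrow>
     (\<forall>\<alpha>\<in>GG D. lam \<alpha> \<in> clinear (Uq D \<alpha>) Calg) \<and>
     (\<forall>\<alpha>\<in>GG D. \<forall>\<beta>\<in>GG D. \<forall>x\<in>carrier (Uq D (gplus \<alpha> \<beta>)).
        form_left (Uq D \<beta>) (lam \<alpha>) (copq D \<alpha> \<beta> x) =
        lam (gplus \<alpha> \<beta>) x \<odot>\<^bsub>Uq D \<beta>\<^esub> \<one>\<^bsub>Uq D \<beta>\<^esub>)"

definition is_H0 :: "('u, 'v) unrolled_data \<Rightarrow> ('u set, 'u set) tens \<Rightarrow> bool" where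
  "is_H0 D t \<longleftrightarrow>
     (let A = Uq D (gzero D); \<pi> = proj D (gzero D) in
      \<exists>c :: (cvec \<times> cvec) \<Rightarrow>\<^sub>0 complex.
        Poly_Mapping.keys c \<subseteq> Lam D \<times> Lam D \<and>
        t = (\<Oplus>\<^bsub>A \<otimes>\<^sub>A A\<^esub> k\<in>Poly_Mapping.keys c.
               Poly_Mapping.lookup c k \<odot>\<^bsub>A \<otimes>\<^sub>A A\<^esub>
               ptens A A (\<pi> (Kel D (fst k))) (\<pi> (Kel D (snd k)))) \<and>
        (\<forall>m\<in>Lam D. \<forall>n\<in>Lam D.
           (\<Sum>k\<in>Poly_Mapping.keys c. Poly_Mapping.lookup c k *
              xi (ell D) (pairing (rnk D) (fst k) m + pairing (rnk D) (snd k) n))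
           = xi (ell D) (Bform D m n)))"

definition H0 :: "('u, 'v) unrolled_data \<Rightarrow> ('u set, 'u set) tens" where
  "H0 D = (THE t. is_H0 D t)"

definition R0 :: "('u, 'v) unrolled_data \<Rightarrow> ('u set, 'u set) tens" where
  "R0 D = (let A = Uq D (gzero D); \<pi> = proj D (gzero D) in
     H0 D \<otimes>\<^bsub>A \<otimes>\<^sub>A A\<^esub> tens_map A A \<pi> \<pi> (Rcheck D))"

definition theta0 :: "('u, 'v) unrolled_data \<Rightarrow> 'u set" where
  "theta0 D = (let A = Uq D (gzero D) in
     inv\<^bsub>A\<^esub> (pivq D (gzero D)) \<otimes>\<^bsub>A\<^esub>
     tens_lift A (\<lambda>x y. ant0 D (ant0 D x) \<otimes>\<^bsub>A\<^esub> y) (R0 D))"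

text \<open>Invertibility of \<open>\<theta>\<close> (a consequence of the other axioms) makes \<open>inv\<close> meaningful.\<close>

definition axiom4 ::
  "('u, 'v) unrolled_data \<Rightarrow> (cvec set \<Rightarrow> 'u set \<Rightarrow> complex) \<Rightarrow> bool" where
  "axiom4 D lam \<longleftrightarrow>
     (let A = Uq D (gzero D) in
        theta0 D \<in> Units A \<and>
        lam (gzero D) (theta0 D) * lam (gzero D) (inv\<^bsub>A\<^esub> (theta0 D)) = 1)"

text \<open>
  The category \<open>\<C>\<^sup>H\<close>: \<open>S\<HH>\<close> acts semisimply iff the weight vectors span, and
  \<open>K\<^sup>a = \<xi>\<^bsup>H\<^sub>a\<^esup>\<close> is an equality of operators on each weight space.
\<close>

definition weight_space ::
  "('u, 'v) unrolled_data \<Rightarrow> nat \<Rightarrow> ('v \<Rightarrow> complex mat) \<Rightarrow> cvec \<Rightarrow> complex vec set" where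
  "weight_space D n \<rho> v = {w \<in> carrier_vec n.
     \<forall>a\<in>wspace (rnk D). \<rho> (Hel D a) *\<^sub>v w = pairing (rnk D) a v \<cdot>\<^sub>v w}"

definition cat_CH :: "('u, 'v) unrolled_data \<Rightarrow> nat \<Rightarrow> ('v \<Rightarrow> complex mat) \<Rightarrow> bool" where
  "cat_CH D n \<rho> \<longleftrightarrow> fd_rep (UHalg D) n \<rho> \<and>
     cspan (module_vec TYPE(complex) n) (\<Union>v\<in>wspace (rnk D). weight_space D n \<rho> v)
       = carrier_vec n \<and>
     (\<forall>v\<in>wspace (rnk D). \<forall>w\<in>weight_space D n \<rho> v. \<forall>a\<in>Lam D.
        \<rho> (incl D (Kel D a)) *\<^sub>v w = xi (ell D) (pairing (rnk D) a v) \<cdot>\<^sub>v w)"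

text \<open>
  Direct sums of modules over the \<open>Uq D \<alpha>\<close>, as \<open>U\<close>-modules: spanned by the vectors
  annihilated by one of the ideals. (The annihilated subspaces for distinct \<open>\<alpha>\<close> are
  submodules in direct sum, since the \<open>K\<^bsup>\<ell>a\<^esup>\<close> act on them by distinct characters.)
\<close>

definition cat_GU :: "('u, 'v) unrolled_data \<Rightarrow> nat \<Rightarrow> ('u \<Rightarrow> complex mat) \<Rightarrow> bool" where
  "cat_GU D n \<rho> \<longleftrightarrow> fd_rep (Ualg D) n \<rho> \<and>
     cspan (module_vec TYPE(complex) n)
       (\<Union>\<alpha>\<in>GG D. {w \<in> carrier_vec n. \<forall>u\<in>quot_ideal D \<alpha>. \<rho> u *\<^sub>v w = 0\<^sub>v n})
       = carrier_vec n"

definition axiom5 :: "('u, 'v) unrolled_data \<Rightarrow> bool" where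
  "axiom5 D \<longleftrightarrow>
     (\<exists>n \<rho>. n > 0 \<and> projective_in (UHalg D) (cat_CH D) n \<rho> \<and>
        projective_in (Ualg D) (cat_GU D) n (\<lambda>x. \<rho> (incl D x)))"


subsection \<open>Symmetrised and modified integrals\<close>

definition symm_integral ::
  "('u, 'v) unrolled_data \<Rightarrow> (cvec set \<Rightarrow> 'u set \<Rightarrow> complex) \<Rightarrow> cvec set \<Rightarrow> 'u set \<Rightarrow> complex" where
  "symm_integral D lam \<alpha> x = lam \<alpha> (pivq D \<alpha> \<otimes>\<^bsub>Uq D \<alpha>\<^esub> x)"

definition Zcop :: "('u, 'v) unrolled_data \<Rightarrow> cvec set \<Rightarrow> cvec set \<Rightarrow> ('u set, 'u set) tens set" where
  "Zcop D \<alpha> \<beta> =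
     (let T = Uq D \<alpha> \<otimes>\<^sub>A Uq D \<beta> in
      {t \<in> carrier T. \<forall>x\<in>carrier (Uq D (gplus \<alpha> \<beta>)).
         t \<otimes>\<^bsub>T\<^esub> copq D \<alpha> \<beta> x = copq D \<alpha> \<beta> x \<otimes>\<^bsub>T\<^esub> t})"

text \<open>
  \<open>\<mu>'\<close> is only defined on centers, so \<open>f \<otimes> \<mu>'\<close> means \<open>\<mu>' \<circ> (f \<otimes> Id)\<close>, and
  similarly on the other side.
\<close>

definition modified_integral ::
  "('u, 'v) unrolled_data \<Rightarrow> (cvec set \<Rightarrow> 'u set \<Rightarrow> complex) \<Rightarrow> cvec set set \<Rightarrow>
   (cvec set \<Rightarrow> 'u set \<Rightarrow> complex) \<Rightarrow> bool" where
  "modified_integral D lam X \<mu>' \<longleftrightarrow>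
     (\<forall>\<alpha>\<in>GG D - X. \<mu>' \<alpha> \<in> clinear (Uq D \<alpha>\<lparr>carrier := alg_center (Uq D \<alpha>)\<rparr>) Calg) \<and>
     (\<forall>\<alpha>\<in>GG D - X. \<forall>\<beta>\<in>GG D - X. \<forall>t\<in>Zcop D \<alpha> \<beta>.
        \<mu>' \<beta> (form_left (Uq D \<beta>)
          (\<lambda>x. symm_integral D lam \<alpha> (inv\<^bsub>Uq D \<alpha>\<^esub> (pivq D \<alpha>) \<otimes>\<^bsub>Uq D \<alpha>\<^esub> x)) t) =
        \<mu>' \<alpha> (form_right (Uq D \<alpha>)
          (\<lambda>y. symm_integral D lam \<beta> (pivq D \<beta> \<otimes>\<^bsub>Uq D \<beta>\<^esub> y)) t))"

end

theory Submission
  imports Defs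
begin

text \<open>
  Write \<open>\<lambda>\<close> for the integral. Elements of the quotients and of tensor products are only tested
  against linear forms on \<open>U\<close> vanishing on the defining ideals; these separate points. Moving elements
  across \<open>\<Delta> \<Upsilon>\<close> gives \<open>\<lambda>(xy) = \<lambda>(S\<^sup>2(y)x)\<close>, and shows that \<open>\<lambda>\<close> is determined by its
  values on \<open>\<Upsilon>\<close>, hence homogeneous of some degree \<open>d\<close>.

  The key point is that the distinguished element \<open>a = \<Upsilon>\<^sub>1 \<lambda>(\<Upsilon>\<^sub>2)\<close> equals \<open>g\<^sup>2\<close>. Comparing
  \<open>\<Delta> \<Upsilon>\<close> with its conjugate by the R-matrix yields, with \<open>\<Theta> = \<Sum> y g x B\<close>, \<open>z = B\<^sub>d\<close> inverse
  and a suitable \<open>Q\<close>, the equations \<open>a g\<inverse> \<Theta> = \<Theta> g z\<close>, \<open>g \<Theta> = \<Theta> g\<inverse> z a\<close> and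
  \<open>a = \<Theta> g Q\<close>. The last one makes \<open>\<Theta>\<close> right invertible, so \<open>a = g\<^sup>2 z\<close> and \<open>z\<^sup>2 = 1\<close> in every
  quotient, which forces \<open>z = 1\<close>. It follows that \<open>\<lambda>\<^sub>\<alpha>(g\<^sup>2 x) = \<lambda>(S x)\<close>, the form on the right being
  that of index \<open>-\<alpha>\<close>, and from this that \<open>\<Sum> \<mu>(p) tr(g q) = \<Sum> tr(g\<inverse> p) \<mu>(q)\<close> whenever
  \<open>\<Sum> p \<otimes> q\<close> centralises the coproduct.

  In a semisimple algebra the trace form is nondegenerate, so \<open>\<mu> = tr(z _)\<close> with \<open>z\<close> central, and
  the last identity applied to \<open>\<Sum> p z \<otimes> q z\<close> is the defining property of a modified integral.
\<close>

section \<open>Linear forms, bilinear forms and linear maps as predicates on carriers\<close>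

section \<open>Linear and bilinear forms\<close>

text \<open>The truncated R-matrix conjugates the coproduct to its opposite only up to the
  degree-dependent operator \<open>Ht\<close>. That operator is explicit on each bidegree, so every
  use of the braiding is cut into homogeneous components. This is why homogeneity of the integral
  matters: if the cointegral \<open>Y\<close> has degree d, degree m in one leg of its coproduct
  forces degree d - m in the other. Flipping the legs then costs \<open>K (- Bd m)\<close> and
  \<open>K (- Bd (d - m))\<close>, whose product is the element z whatever m is; z is the only
  deviation from the computation for an honest R-matrix. It is removed at the very end: the
  condition on z holds in all quotients at once, and the form \<open>phi v\<close>, which restricts
  to a character on the elements \<open>K a\<close>, turns it into an exponential of a function of v
  that is linear over the complex numbers. Such an exponential is constant only if
  \<open>Bd d\<close> vanishes. Working with forms on U lets all quotients share one coproduct: Hopf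
  identities are used in U itself, and a quotient enters only as the condition that a form vanishes
  on an ideal.\<close>

definition cspace :: "'a calg \<Rightarrow> bool" where
  "cspace A \<longleftrightarrow> abelian_group A \<and> (\<forall>c. \<forall>x\<in>carrier A. c \<odot>\<^bsub>A\<^esub> x \<in> carrier A)"

definition lform :: "'a calg \<Rightarrow> ('a \<Rightarrow> complex) \<Rightarrow> bool" where
  "lform A f \<longleftrightarrow> (\<forall>x\<in>carrier A. \<forall>y\<in>carrier A. f (x \<oplus>\<^bsub>A\<^esub> y) = f x + f y) \<and>
     (\<forall>c. \<forall>x\<in>carrier A. f (c \<odot>\<^bsub>A\<^esub> x) = c * f x)"

definition bform :: "'a calg \<Rightarrow> 'b calg \<Rightarrow> ('a \<Rightarrow> 'b \<Rightarrow> complex) \<Rightarrow> bool" where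
  "bform A B h \<longleftrightarrow> (\<forall>y\<in>carrier B. lform A (\<lambda>x. h x y)) \<and> (\<forall>x\<in>carrier A. lform B (h x))"

definition lmap :: "'a calg \<Rightarrow> 'b calg \<Rightarrow> ('a \<Rightarrow> 'b) \<Rightarrow> bool" where
  "lmap A B E \<longleftrightarrow> (\<forall>x\<in>carrier A. E x \<in> carrier B) \<and>
     (\<forall>x\<in>carrier A. \<forall>y\<in>carrier A. E (x \<oplus>\<^bsub>A\<^esub> y) = E x \<oplus>\<^bsub>B\<^esub> E y) \<and>
     (\<forall>c. \<forall>x\<in>carrier A. E (c \<odot>\<^bsub>A\<^esub> x) = c \<odot>\<^bsub>B\<^esub> E x)"

lemma lformI:
  "(\<And>x y. x \<in> carrier A \<Longrightarrow> y \<in> carrier A \<Longrightarrow> f (x \<oplus>\<^bsub>A\<^esub> y) = f x + f y) \<Longrightarrow>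
   (\<And>c x. x \<in> carrier A \<Longrightarrow> f (c \<odot>\<^bsub>A\<^esub> x) = c * f x) \<Longrightarrow> lform A f"
  by (simp add: lform_def)

lemma lform_add: "lform A f \<Longrightarrow> x \<in> carrier A \<Longrightarrow> y \<in> carrier A \<Longrightarrow> f (x \<oplus>\<^bsub>A\<^esub> y) = f x + f y"
  by (simp add: lform_def)

lemma lform_smult: "lform A f \<Longrightarrow> x \<in> carrier A \<Longrightarrow> f (c \<odot>\<^bsub>A\<^esub> x) = c * f x"
  by (simp add: lform_def)

lemma bformI:
  "(\<And>y. y \<in> carrier B \<Longrightarrow> lform A (\<lambda>x. h x y)) \<Longrightarrow> (\<And>x. x \<in> carrier A \<Longrightarrow> lform B (\<lambda>y. h x y)) \<Longrightarrow>
   bform A B h"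
  by (simp add: bform_def)

lemma bform1: "bform A B h \<Longrightarrow> y \<in> carrier B \<Longrightarrow> lform A (\<lambda>x. h x y)"
  and bform2: "bform A B h \<Longrightarrow> x \<in> carrier A \<Longrightarrow> lform B (\<lambda>y. h x y)"
  by (simp_all add: bform_def)

lemma lmapI:
  "(\<And>x. x \<in> carrier A \<Longrightarrow> E x \<in> carrier B) \<Longrightarrow>
   (\<And>x y. x \<in> carrier A \<Longrightarrow> y \<in> carrier A \<Longrightarrow> E (x \<oplus>\<^bsub>A\<^esub> y) = E x \<oplus>\<^bsub>B\<^esub> E y) \<Longrightarrow>
   (\<And>c x. x \<in> carrier A \<Longrightarrow> E (c \<odot>\<^bsub>A\<^esub> x) = c \<odot>\<^bsub>B\<^esub> E x) \<Longrightarrow> lmap A B E"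
  by (simp add: lmap_def)

lemma lmap_closed: "lmap A B E \<Longrightarrow> x \<in> carrier A \<Longrightarrow> E x \<in> carrier B"
  and lmap_add: "lmap A B E \<Longrightarrow> x \<in> carrier A \<Longrightarrow> y \<in> carrier A \<Longrightarrow> E (x \<oplus>\<^bsub>A\<^esub> y) = E x \<oplus>\<^bsub>B\<^esub> E y"
  and lmap_smult: "lmap A B E \<Longrightarrow> x \<in> carrier A \<Longrightarrow> E (c \<odot>\<^bsub>A\<^esub> x) = c \<odot>\<^bsub>B\<^esub> E x"
  by (simp_all add: lmap_def)

lemma lform_lmap: "lform B f \<Longrightarrow> lmap A B E \<Longrightarrow> lform A (\<lambda>x. f (E x))"
  by (simp add: lform_def lmap_def)

lemma lmap_comp: "lmap B C F \<Longrightarrow> lmap A B E \<Longrightarrow> lmap A C (\<lambda>x. F (E x))"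
  by (simp add: lmap_def)

lemma lform_mult_right: "lform A f \<Longrightarrow> lform A (\<lambda>x. f x * c)"
  and lform_mult_left: "lform A f \<Longrightarrow> lform A (\<lambda>x. c * f x)"
  and lform_plus: "lform A f \<Longrightarrow> lform A f' \<Longrightarrow> lform A (\<lambda>x. f x + f' x)"
  and lform_minus: "lform A f \<Longrightarrow> lform A f' \<Longrightarrow> lform A (\<lambda>x. f x - f' x)"
  by (auto simp: lform_def algebra_simps)

lemma lform_sum: "(\<And>k. k \<in> K \<Longrightarrow> lform A (f k)) \<Longrightarrow> lform A (\<lambda>x. \<Sum>k\<in>K. f k x)"
  by (simp add: lform_def sum.distrib sum_distrib_left)

lemma lform_cong:
  assumes "cspace A" "lform A f" "\<And>x. x \<in> carrier A \<Longrightarrow> f x = f' x"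
  shows "lform A f'"
proof -
  interpret abelian_group A using assms(1) by (simp add: cspace_def)
  show ?thesis using assms(1,2)
    by (intro lformI) (simp_all add: cspace_def lform_add lform_smult flip: assms(3))
qed

lemma lform_zero:
  assumes "cspace A" "lform A f" shows "f \<zero>\<^bsub>A\<^esub> = 0"
proof -
  interpret abelian_group A using assms by (simp add: cspace_def)
  show ?thesis using lform_add[OF assms(2), of "\<zero>\<^bsub>A\<^esub>" "\<zero>\<^bsub>A\<^esub>"] by simp
qed

lemma lform_finsum:
  assumes "cspace A" "lform A f" "g \<in> K \<rightarrow> carrier A"
  shows "f (\<Oplus>\<^bsub>A\<^esub>k\<in>K. g k) = (\<Sum>k\<in>K. f (g k))"
proof -
  interpret abelian_group A using assms by (simp add: cspace_def)
  show ?thesis using assms(3)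
    by (induction K rule: infinite_finite_induct)
      (auto simp: lform_zero[OF assms(1,2)] lform_add[OF assms(2)] finsum_infinite)
qed

lemma lform_uminus:
  assumes "cspace A" "lform A f" "x \<in> carrier A" shows "f (\<ominus>\<^bsub>A\<^esub> x) = - f x"
proof -
  interpret abelian_group A using assms by (simp add: cspace_def)
  have "f x + f (\<ominus>\<^bsub>A\<^esub> x) = 0"
    using lform_add[OF assms(2), of x "\<ominus>\<^bsub>A\<^esub> x"] lform_zero[OF assms(1,2)] assms(3) by (simp add: r_neg)
  then show ?thesis by (simp add: add_eq_0_iff)
qed

lemma lform_a_minus:
  assumes "cspace A" "lform A f" "x \<in> carrier A" "y \<in> carrier A"
  shows "f (x \<ominus>\<^bsub>A\<^esub> y) = f x - f y"
proof -
  interpret abelian_group A using assms by (simp add: cspace_def)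
  show ?thesis using assms by (simp add: a_minus_def lform_add lform_uminus)
qed

lemma bform_lmap:
  assumes h: "bform C E h" and "lmap A C f" "lmap B E g"
  shows "bform A B (\<lambda>x y. h (f x) (g y))"
proof (rule bformI)
  show "lform A (\<lambda>x. h (f x) (g y))" if "y \<in> carrier B" for y
    using lform_lmap[OF bform1[OF h] assms(2)] lmap_closed[OF assms(3) that] by blast
  show "lform B (\<lambda>y. h (f x) (g y))" if "x \<in> carrier A" for x
    using lform_lmap[OF bform2[OF h] assms(3)] lmap_closed[OF assms(2) that] by blast
qed

lemma bform_prod: "lform A f \<Longrightarrow> lform B g \<Longrightarrow> bform A B (\<lambda>x y. f x * g y)"
  by (intro bformI lform_mult_left lform_mult_right)

lemma cspace_complex_algebra:
  assumes "complex_algebra A" shows "cspace A"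
proof -
  interpret ring A using assms by (simp add: complex_algebra_def)
  interpret V: vectorspace class_ring A using assms by (simp add: complex_algebra_def)
  show ?thesis using abelian_group_axioms V.smult_closed by (auto simp: cspace_def)
qed

section \<open>Tensors seen through bilinear forms\<close>

section \<open>Evaluation of bilinear forms on tensors\<close>

definition fev :: "('a \<Rightarrow> 'b \<Rightarrow> complex) \<Rightarrow> ('a, 'b) formal \<Rightarrow> complex" where
  "fev h p = (\<Sum>k\<in>Poly_Mapping.keys p. Poly_Mapping.lookup p k * h (fst k) (snd k))"

text \<open>For bilinear h this is the canonical pairing of h with t. For other h the value depends
  on the representative chosen by \<open>rep\<close>, which is why evaluation rules ask for
  \<open>bform\<close>.\<close>

definition tev :: "('a \<Rightarrow> 'b \<Rightarrow> complex) \<Rightarrow> ('a, 'b) tens \<Rightarrow> complex" where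
  "tev h t = fev h (rep t)"

lemma fev_superset:
  "finite K \<Longrightarrow> Poly_Mapping.keys p \<subseteq> K \<Longrightarrow>
   fev h p = (\<Sum>k\<in>K. Poly_Mapping.lookup p k * h (fst k) (snd k))"
  unfolding fev_def by (rule sum.mono_neutral_left) (auto simp: in_keys_iff)

lemma fev_zero [simp]: "fev h 0 = 0"
  by (simp add: fev_def)

lemma fev_single [simp]: "fev h (Poly_Mapping.single k c) = c * h (fst k) (snd k)"
  by (subst fev_superset[of "{k}"]) (auto simp: lookup_single)

lemma fev_add: "fev h (p + q) = fev h p + fev h q"
proof -
  let ?K = "Poly_Mapping.keys p \<union> Poly_Mapping.keys q"
  have "Poly_Mapping.keys (p + q) \<subseteq> ?K" by (rule keys_add)
  then show ?thesis
    by (simp add: fev_superset[of ?K] lookup_add sum.distrib algebra_simps)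
qed

lemma lookup_fscale [simp]: "Poly_Mapping.lookup (fscale c p) k = c * Poly_Mapping.lookup p k"
  by (simp add: fscale_def Poly_Mapping.map.rep_eq when_def)

lemma keys_fscale: "Poly_Mapping.keys (fscale c p) \<subseteq> Poly_Mapping.keys p"
  by (auto simp: in_keys_iff)

lemma fev_scale: "fev h (fscale c p) = c * fev h p"
  by (subst fev_superset[OF _ keys_fscale]) (auto simp: fev_def sum_distrib_left mult.assoc)

text \<open>\<open>tens_null\<close> is closed under sums and scalar multiples by its rules; this
  brings differences within their reach.\<close>

lemma diff_fscale: "p - q = p + fscale (- 1) q"
  by (rule poly_mapping_eqI) (simp add: lookup_minus lookup_add)

lemma fev_diff: "fev h (p - q) = fev h p - fev h q"
  by (simp add: diff_fscale fev_add fev_scale)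

lemma fev_sum: "fev h (\<Sum>i\<in>I. p i) = (\<Sum>i\<in>I. fev h (p i))"
  by (induction I rule: infinite_finite_induct) (auto simp: fev_add)

lemma keys_minus: "Poly_Mapping.keys (p - q) \<subseteq> Poly_Mapping.keys p \<union> Poly_Mapping.keys q"
  by (auto simp: in_keys_iff lookup_minus)

lemma tens_null_diff: "p \<in> tens_null A B \<Longrightarrow> q \<in> tens_null A B \<Longrightarrow> p - q \<in> tens_null A B"
  unfolding diff_fscale by (intro tens_null.add tens_null.scale)

locale two_spaces =
  fixes A :: "'a calg" and B :: "'b calg"
  assumes A: "cspace A" and B: "cspace B"
begin

sublocale A: abelian_group A using A by (simp add: cspace_def)
sublocale B: abelian_group B using B by (simp add: cspace_def)

lemma smult_closed_A [simp]: "x \<in> carrier A \<Longrightarrow> c \<odot>\<^bsub>A\<^esub> x \<in> carrier A"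
  using A by (simp add: cspace_def)

lemma smult_closed_B [simp]: "x \<in> carrier B \<Longrightarrow> c \<odot>\<^bsub>B\<^esub> x \<in> carrier B"
  using B by (simp add: cspace_def)

abbreviation "formals \<equiv> {p. Poly_Mapping.keys p \<subseteq> carrier A \<times> carrier B}"

lemma formals_add: "p \<in> formals \<Longrightarrow> q \<in> formals \<Longrightarrow> p + q \<in> formals"
  using keys_add[of p q] by auto

lemma formals_diff: "p \<in> formals \<Longrightarrow> q \<in> formals \<Longrightarrow> p - q \<in> formals"
  using keys_minus[of p q] by auto

lemma formals_scale: "p \<in> formals \<Longrightarrow> fscale c p \<in> formals"
  using keys_fscale[of c p] by auto

lemma formals_single: "x \<in> carrier A \<Longrightarrow> y \<in> carrier B \<Longrightarrow> Poly_Mapping.single (x, y) c \<in> formals"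
  by (auto split: if_splits)

lemma tens_null_formals: "p \<in> tens_null A B \<Longrightarrow> p \<in> formals"
  by (induction rule: tens_null.induct)
    (simp_all only: formals_add formals_diff formals_scale formals_single
      A.add.m_closed B.add.m_closed smult_closed_A smult_closed_B, simp)

lemma fev_tens_null: "p \<in> tens_null A B \<Longrightarrow> bform A B h \<Longrightarrow> fev h p = 0"
  by (induction rule: tens_null.induct)
    (auto simp: fev_add fev_scale fev_diff bform_def lform_def)

lemma rep_tens_class:
  obtains q where "q \<in> tens_null A B" "rep (tens_class A B p) = p + q"
proof -
  have "p + 0 \<in> tens_class A B p" unfolding tens_class_def using tens_null.zero by blast
  then have "rep (tens_class A B p) \<in> tens_class A B p" unfolding rep_def by (rule someI)
  then show ?thesis using that by (auto simp: tens_class_def)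
qed

lemma tev_class: "bform A B h \<Longrightarrow> tev h (tens_class A B p) = fev h p"
  by (rule rep_tens_class[of p]) (simp add: tev_def fev_add fev_tens_null)

lemma tens_class_eqI: "p - q \<in> tens_null A B \<Longrightarrow> tens_class A B p = tens_class A B q"
proof -
  assume d: "p - q \<in> tens_null A B"
  have "p + r = q + (p - q + r)" "q + r = p + (r - (p - q))" for r by simp_all
  then show ?thesis
    unfolding tens_class_def using tens_null.add[OF d] tens_null_diff[OF _ d] by blast
qed

text \<open>The representative differs from a supported formal sum by a null one, and null sums are
  themselves supported in the carriers; the arbitrary choice made by \<open>rep\<close> therefore
  stays inside them.\<close>

lemma rep_formals: "t \<in> carrier (A \<otimes>\<^sub>A B) \<Longrightarrow> rep t \<in> formals"
proof -
  assume "t \<in> carrier (A \<otimes>\<^sub>A B)"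
  then obtain p where "t = tens_class A B p" "p \<in> formals" by (auto simp: tensor_alg_def)
  then show ?thesis
    by (metis rep_tens_class tens_null_formals formals_add)
qed

lemma tens_class_rep: "t \<in> carrier (A \<otimes>\<^sub>A B) \<Longrightarrow> tens_class A B (rep t) = t"
proof -
  assume "t \<in> carrier (A \<otimes>\<^sub>A B)"
  then obtain p where t: "t = tens_class A B p" by (auto simp: tensor_alg_def)
  obtain q where "q \<in> tens_null A B" "rep t = p + q" using rep_tens_class t by metis
  then show ?thesis using tens_class_eqI[of "p + q" p] t by simp
qed

lemma tens_class_closed: "p \<in> formals \<Longrightarrow> tens_class A B p \<in> carrier (A \<otimes>\<^sub>A B)"
  by (auto simp: tensor_alg_def)

lemma ptens_closed [simp]:
  "x \<in> carrier A \<Longrightarrow> y \<in> carrier B \<Longrightarrow> ptens A B x y \<in> carrier (A \<otimes>\<^sub>A B)"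
  unfolding ptens_def by (intro tens_class_closed formals_single)

lemma tens_class_add:
  "tens_class A B p \<oplus>\<^bsub>A \<otimes>\<^sub>A B\<^esub> tens_class A B q = tens_class A B (p + q)"
proof -
  obtain p' where p': "p' \<in> tens_null A B" "rep (tens_class A B p) = p + p'" by (rule rep_tens_class)
  obtain q' where q': "q' \<in> tens_null A B" "rep (tens_class A B q) = q + q'" by (rule rep_tens_class)
  show ?thesis using p' q' tens_null.add[OF p'(1) q'(1)]
    by (auto simp: tensor_alg_def intro!: tens_class_eqI)
qed

lemma tens_class_smult: "c \<odot>\<^bsub>A \<otimes>\<^sub>A B\<^esub> tens_class A B p = tens_class A B (fscale c p)"
proof -
  obtain p' where p': "p' \<in> tens_null A B" "rep (tens_class A B p) = p + p'" by (rule rep_tens_class)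
  have "fscale c (p + p') = fscale c p + fscale c p'"
    by (rule poly_mapping_eqI) (simp add: lookup_add algebra_simps)
  then show ?thesis using p' tens_null.scale[OF p'(1), of c]
    by (auto simp: tensor_alg_def intro!: tens_class_eqI)
qed

lemma tens_class_cases:
  assumes "t \<in> carrier (A \<otimes>\<^sub>A B)"
  obtains p where "p \<in> formals" "t = tens_class A B p"
  using assms by (auto simp: tensor_alg_def)

lemma cspace_tensor: "cspace (A \<otimes>\<^sub>A B)"
  unfolding cspace_def
proof (intro conjI allI ballI abelian_groupI)
  let ?T = "A \<otimes>\<^sub>A B"
  have z: "\<zero>\<^bsub>?T\<^esub> = tens_class A B 0" by (simp add: tensor_alg_def)
  show "\<zero>\<^bsub>?T\<^esub> \<in> carrier ?T" unfolding z by (rule tens_class_closed) simp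
  fix x assume "x \<in> carrier ?T"
  then obtain p where p: "p \<in> formals" "x = tens_class A B p" by (rule tens_class_cases)
  show "\<zero>\<^bsub>?T\<^esub> \<oplus>\<^bsub>?T\<^esub> x = x" by (simp add: z p(2) tens_class_add)
  have "tens_class A B (fscale (- 1) p) \<in> carrier ?T"
    using p(1) by (intro tens_class_closed formals_scale)
  then show "\<exists>y\<in>carrier ?T. y \<oplus>\<^bsub>?T\<^esub> x = \<zero>\<^bsub>?T\<^esub>"
    by (rule rev_bexI) (simp add: z p(2) tens_class_add diff_fscale[symmetric] add.commute[of _ p])
  show "c \<odot>\<^bsub>?T\<^esub> x \<in> carrier ?T" for c
    unfolding p(2) tens_class_smult using p(1) by (intro tens_class_closed formals_scale)
  fix y assume "y \<in> carrier ?T"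
  then obtain q where q: "q \<in> formals" "y = tens_class A B q" by (rule tens_class_cases)
  show "x \<oplus>\<^bsub>?T\<^esub> y \<in> carrier ?T"
    unfolding p(2) q(2) tens_class_add using p(1) q(1) by (intro tens_class_closed formals_add)
  show "x \<oplus>\<^bsub>?T\<^esub> y = y \<oplus>\<^bsub>?T\<^esub> x" by (simp add: p(2) q(2) tens_class_add add.commute)
  fix w assume "w \<in> carrier ?T"
  then obtain r where r: "r \<in> formals" "w = tens_class A B r" by (rule tens_class_cases)
  show "x \<oplus>\<^bsub>?T\<^esub> y \<oplus>\<^bsub>?T\<^esub> w = x \<oplus>\<^bsub>?T\<^esub> (y \<oplus>\<^bsub>?T\<^esub> w)"
    by (simp add: p(2) q(2) r(2) tens_class_add add.assoc)
qed

lemma module_tensor: "Module.module class_ring (A \<otimes>\<^sub>A B)"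
proof (rule moduleI)
  show "cring (class_ring :: complex ring)" by (rule class_cring.cring_axioms)
  show "abelian_group (A \<otimes>\<^sub>A B)" using cspace_tensor by (simp add: cspace_def)
  have f: "fscale (c + d) p = fscale c p + fscale d p" "fscale c (p + q) = fscale c p + fscale c q"
    "fscale (c * d) p = fscale c (fscale d p)" "fscale 1 p = p" for c d and p q :: "('a, 'b) formal"
    by (auto intro!: poly_mapping_eqI simp: lookup_add algebra_simps)
  fix c d x y assume "x \<in> carrier (A \<otimes>\<^sub>A B)"
  then obtain p where p: "p \<in> formals" "x = tens_class A B p" by (rule tens_class_cases)
  show "c \<odot>\<^bsub>A \<otimes>\<^sub>A B\<^esub> x \<in> carrier (A \<otimes>\<^sub>A B)"
    using cspace_tensor p tens_class_closed by (simp add: cspace_def)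
  show "(c \<oplus>\<^bsub>class_ring\<^esub> d) \<odot>\<^bsub>A \<otimes>\<^sub>A B\<^esub> x = c \<odot>\<^bsub>A \<otimes>\<^sub>A B\<^esub> x \<oplus>\<^bsub>A \<otimes>\<^sub>A B\<^esub> d \<odot>\<^bsub>A \<otimes>\<^sub>A B\<^esub> x"
    "(c \<otimes>\<^bsub>class_ring\<^esub> d) \<odot>\<^bsub>A \<otimes>\<^sub>A B\<^esub> x = c \<odot>\<^bsub>A \<otimes>\<^sub>A B\<^esub> (d \<odot>\<^bsub>A \<otimes>\<^sub>A B\<^esub> x)"
    "\<one>\<^bsub>class_ring\<^esub> \<odot>\<^bsub>A \<otimes>\<^sub>A B\<^esub> x = x"
    by (simp_all add: p(2) tens_class_smult tens_class_add f)
  assume "y \<in> carrier (A \<otimes>\<^sub>A B)"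
  then obtain q where q: "q \<in> formals" "y = tens_class A B q" by (rule tens_class_cases)
  show "c \<odot>\<^bsub>A \<otimes>\<^sub>A B\<^esub> (x \<oplus>\<^bsub>A \<otimes>\<^sub>A B\<^esub> y) = c \<odot>\<^bsub>A \<otimes>\<^sub>A B\<^esub> x \<oplus>\<^bsub>A \<otimes>\<^sub>A B\<^esub> c \<odot>\<^bsub>A \<otimes>\<^sub>A B\<^esub> y"
    by (simp add: p(2) q(2) tens_class_smult tens_class_add f)
qed

lemma lform_tev: "bform A B h \<Longrightarrow> lform (A \<otimes>\<^sub>A B) (tev h)"
proof (rule lformI)
  fix x y assume h: "bform A B h" and "x \<in> carrier (A \<otimes>\<^sub>A B)" "y \<in> carrier (A \<otimes>\<^sub>A B)"
  then show "tev h (x \<oplus>\<^bsub>A \<otimes>\<^sub>A B\<^esub> y) = tev h x + tev h y"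
    by (elim tens_class_cases) (simp add: tens_class_add tev_class fev_add)
next
  fix c x assume h: "bform A B h" and "x \<in> carrier (A \<otimes>\<^sub>A B)"
  then show "tev h (c \<odot>\<^bsub>A \<otimes>\<^sub>A B\<^esub> x) = c * tev h x"
    by (elim tens_class_cases) (simp add: tens_class_smult tev_class fev_scale)
qed

lemma tev_ptens: "bform A B h \<Longrightarrow> tev h (ptens A B x y) = h x y"
  by (simp add: ptens_def tev_class)

lemma tev_cong:
  assumes "t \<in> carrier (A \<otimes>\<^sub>A B)" "\<And>x y. x \<in> carrier A \<Longrightarrow> y \<in> carrier B \<Longrightarrow> h x y = h' x y"
  shows "tev h t = tev h' t"
  using rep_formals[OF assms(1)] assms(2) unfolding tev_def fev_def
  by (intro sum.cong) auto

lemma lform_tev_param: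
  assumes "t \<in> carrier (A \<otimes>\<^sub>A B)"
    "\<And>x y. x \<in> carrier A \<Longrightarrow> y \<in> carrier B \<Longrightarrow> lform C (\<lambda>z. h z x y)"
  shows "lform C (\<lambda>z. tev (h z) t)"
  using rep_formals[OF assms(1)] assms(2) unfolding tev_def fev_def
  by (intro lform_sum lform_mult_left) auto

lemma ptens_add_left:
  assumes "x \<in> carrier A" "x' \<in> carrier A" "y \<in> carrier B"
  shows "ptens A B (x \<oplus>\<^bsub>A\<^esub> x') y = ptens A B x y \<oplus>\<^bsub>A \<otimes>\<^sub>A B\<^esub> ptens A B x' y"
  using tens_null.add_left[OF assms]
  unfolding ptens_def tens_class_add by (intro tens_class_eqI) (simp add: algebra_simps)

lemma ptens_add_right:
  assumes "x \<in> carrier A" "y \<in> carrier B" "y' \<in> carrier B"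
  shows "ptens A B x (y \<oplus>\<^bsub>B\<^esub> y') = ptens A B x y \<oplus>\<^bsub>A \<otimes>\<^sub>A B\<^esub> ptens A B x y'"
  using tens_null.add_right[OF assms]
  unfolding ptens_def tens_class_add by (intro tens_class_eqI) (simp add: algebra_simps)

lemma fscale_single: "fscale c (Poly_Mapping.single k d) = Poly_Mapping.single k (c * d)"
  by (rule poly_mapping_eqI) (simp add: lookup_single when_def)

lemma ptens_smult_left:
  assumes "x \<in> carrier A" "y \<in> carrier B"
  shows "ptens A B (c \<odot>\<^bsub>A\<^esub> x) y = c \<odot>\<^bsub>A \<otimes>\<^sub>A B\<^esub> ptens A B x y"
  using tens_null.smult_left[OF assms]
  unfolding ptens_def tens_class_smult by (intro tens_class_eqI) (simp add: fscale_single)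

lemma ptens_smult_right:
  assumes "x \<in> carrier A" "y \<in> carrier B"
  shows "ptens A B x (c \<odot>\<^bsub>B\<^esub> y) = c \<odot>\<^bsub>A \<otimes>\<^sub>A B\<^esub> ptens A B x y"
  using tens_null.smult_right[OF assms]
  unfolding ptens_def tens_class_smult by (intro tens_class_eqI) (simp add: fscale_single)

lemma bform_ptens:
  assumes "lform (A \<otimes>\<^sub>A B) F"
  shows "bform A B (\<lambda>x y. F (ptens A B x y))"
  using assms
  by (auto intro!: bformI lformI simp: ptens_add_left ptens_add_right ptens_smult_left
      ptens_smult_right lform_def)

text \<open>The converse of \<open>lform_tev\<close>: pure tensors span, so a form on the tensor
  product is determined by the bilinear form it induces on pairs. The induction removes one pure
  tensor from the support at a time.\<close>

lemma lform_as_tev: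
  assumes F: "lform (A \<otimes>\<^sub>A B) F" and t: "t \<in> carrier (A \<otimes>\<^sub>A B)"
  shows "F t = tev (\<lambda>x y. F (ptens A B x y)) t"
proof -
  have eq: "tens_class A B p \<in> carrier (A \<otimes>\<^sub>A B) \<and> F (tens_class A B p) = fev (\<lambda>x y. F (ptens A B x y)) p"
    if "p \<in> formals" for p
    using that
  proof (induction "Poly_Mapping.keys p" arbitrary: p rule: infinite_finite_induct)
    case infinite
    then show ?case by simp
  next
    case empty
    then have "p = 0" by (metis keys_eq_empty)
    then show ?case using lform_zero[OF cspace_tensor F] tens_class_closed[of 0] by (simp add: tensor_alg_def)
  next
    case (insert k K)
    let ?c = "Poly_Mapping.lookup p k"
    let ?p' = "p - Poly_Mapping.single k ?c"
    obtain x y where k: "k = (x, y)" "x \<in> carrier A" "y \<in> carrier B" using insert by auto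
    have "Poly_Mapping.keys ?p' = Poly_Mapping.keys p - {k}"
      by (auto simp: in_keys_iff lookup_minus lookup_single when_def split: if_splits)
    then have K: "Poly_Mapping.keys ?p' = K" using insert.hyps by auto
    have p': "?p' \<in> formals" using insert.hyps(4) insert.prems K by auto
    have s: "tens_class A B (Poly_Mapping.single k ?c) = ?c \<odot>\<^bsub>A \<otimes>\<^sub>A B\<^esub> ptens A B x y"
      by (simp add: k ptens_def tens_class_smult fscale_single)
    have "tens_class A B p = tens_class A B ?p' \<oplus>\<^bsub>A \<otimes>\<^sub>A B\<^esub> tens_class A B (Poly_Mapping.single k ?c)"
      by (simp add: tens_class_add)
    moreover have "fev (\<lambda>x y. F (ptens A B x y)) p
        = fev (\<lambda>x y. F (ptens A B x y)) ?p' + fev (\<lambda>x y. F (ptens A B x y)) (Poly_Mapping.single k ?c)"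
      by (simp add: fev_diff)
    moreover have "?c \<odot>\<^bsub>A \<otimes>\<^sub>A B\<^esub> ptens A B x y \<in> carrier (A \<otimes>\<^sub>A B)"
      using cspace_tensor k by (simp add: cspace_def)
    ultimately show ?case
      using insert.hyps(3)[OF K[symmetric] p'] tens_class_closed[OF insert.prems] k s
        lform_add[OF F] lform_smult[OF F]
      by simp
  qed
  show ?thesis using eq[OF rep_formals[OF t]] tens_class_rep[OF t] by (simp add: tev_def)
qed

text \<open>Entry point for every map defined by \<open>tens_lift\<close>: composed with a form on
  the target, it becomes an evaluation by \<open>tev\<close>.\<close>

lemma tens_lift_eval:
  assumes C: "cspace C" and f: "lform C f" and t: "t \<in> carrier (A \<otimes>\<^sub>A B)"
    and h: "\<And>x y. x \<in> carrier A \<Longrightarrow> y \<in> carrier B \<Longrightarrow> h x y \<in> carrier C"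
  shows "f (tens_lift C h t) = tev (\<lambda>x y. f (h x y)) t" "tens_lift C h t \<in> carrier C"
proof -
  interpret C: abelian_group C using C by (simp add: cspace_def)
  have hk: "h (fst k) (snd k) \<in> carrier C" if "k \<in> Poly_Mapping.keys (rep t)" for k
    using rep_formals[OF t] h that by (cases k) auto
  then have c: "(\<lambda>k. Poly_Mapping.lookup (rep t) k \<odot>\<^bsub>C\<^esub> h (fst k) (snd k))
      \<in> Poly_Mapping.keys (rep t) \<rightarrow> carrier C"
    using C by (simp add: cspace_def)
  show "tens_lift C h t \<in> carrier C" unfolding tens_lift_def by (rule C.finsum_closed[OF c])
  show "f (tens_lift C h t) = tev (\<lambda>x y. f (h x y)) t"
    unfolding tens_lift_def tev_def fev_def lform_finsum[OF C f c]
    by (intro sum.cong refl lform_smult[OF f] hk)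
qed

text \<open>Bilinear forms separate tensors: a formal sum outside \<open>tens_null\<close> is detected by a linear
  form vanishing on \<open>tens_null\<close>.\<close>

lemma tens_eqI:
  assumes s: "s \<in> carrier (A \<otimes>\<^sub>A B)" and t: "t \<in> carrier (A \<otimes>\<^sub>A B)"
    and eq: "\<And>h. bform A B h \<Longrightarrow> tev h s = tev h t"
  shows "s = t"
proof (rule ccontr)
  assume "s \<noteq> t"
  let ?q = "rep s - rep t"
  have q: "?q \<notin> tens_null A B"
    using \<open>s \<noteq> t\<close> tens_class_eqI[of "rep s" "rep t"] tens_class_rep s t by auto
  interpret V: vector_space "fscale :: complex \<Rightarrow> ('a, 'b) formal \<Rightarrow> _"
    by unfold_locales (auto intro!: poly_mapping_eqI simp: lookup_add algebra_simps)
  interpret W: vector_space "(*) :: complex \<Rightarrow> complex \<Rightarrow> complex"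
    by unfold_locales (auto simp: algebra_simps)
  interpret P: vector_space_pair "fscale :: complex \<Rightarrow> ('a, 'b) formal \<Rightarrow> _" "(*) :: complex \<Rightarrow> _" ..
  have sub: "V.subspace (tens_null A B)"
    by (auto simp: V.subspace_def intro: tens_null.intros)
  obtain Bs where Bs: "Bs \<subseteq> tens_null A B" "V.independent Bs" "tens_null A B \<subseteq> V.span Bs"
    using V.basis_exists by metis
  have "V.span Bs = tens_null A B" using Bs sub by (simp add: V.span_subspace)
  then have ind: "V.independent (insert ?q Bs)" using q Bs by (simp add: V.independent_insertI)
  \<comment> \<open>The separating form takes the value 1 on \<open>?q\<close> and 0 on a basis of
    the null sums; independence of \<open>insert ?q Bs\<close> permits this choice.\<close>
  obtain F where F: "Vector_Spaces.linear fscale (*) F" "\<forall>x\<in>insert ?q Bs. F x = (if x = ?q then 1 else (0::complex))"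
    using P.linear_independent_extend[OF ind, of "\<lambda>x. if x = ?q then 1 else 0"]
    by (elim exE conjE) (rule that)
  interpret F: Vector_Spaces.linear fscale "(*)" F by (rule F(1))
  have null: "F x = 0" if "x \<in> tens_null A B" for x
  proof -
    have "x \<in> V.span Bs" using that Bs by auto
    moreover have "V.subspace {x. F x = 0}" by (auto simp: V.subspace_def F.add F.scale F.zero)
    moreover have "Bs \<subseteq> {x. F x = 0}" using F(2) Bs(1) q by auto
    ultimately show ?thesis using V.span_minimal by blast
  qed
  let ?h = "\<lambda>x y. F (Poly_Mapping.single (x, y) 1)"
  have sc: "Poly_Mapping.single k c = fscale c (Poly_Mapping.single k 1)" for k c
    by (simp add: fscale_single)
  have h: "bform A B ?h"
  proof (intro bformI lformI)
    fix x x' y y' c assume c: "x \<in> carrier A" "y \<in> carrier B"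
    show "?h (c \<odot>\<^bsub>A\<^esub> x) y = c * ?h x y"
      using null[OF tens_null.smult_left[OF c]] by (simp add: F.diff sc[of "(x, y)" c] F.scale)
    show "?h x (c \<odot>\<^bsub>B\<^esub> y) = c * ?h x y"
      using null[OF tens_null.smult_right[OF c]] by (simp add: F.diff sc[of "(x, y)" c] F.scale)
    show "?h (x \<oplus>\<^bsub>A\<^esub> x') y = ?h x y + ?h x' y" if "x' \<in> carrier A"
      using null[OF tens_null.add_left[OF c(1) that c(2)]] by (simp add: F.diff F.add diff_diff_eq)
    show "?h x (y \<oplus>\<^bsub>B\<^esub> y') = ?h x y + ?h x y'" if "y' \<in> carrier B"
      using null[OF tens_null.add_right[OF c that]] by (simp add: F.diff F.add diff_diff_eq)
  qed
  have "fev ?h p = F p" for p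
  proof -
    have "p = (\<Sum>k\<in>Poly_Mapping.keys p. Poly_Mapping.single k (Poly_Mapping.lookup p k))"
      by (rule poly_mapping_eqI) (auto simp: lookup_sum lookup_single when_def in_keys_iff)
    then have "F p = (\<Sum>k\<in>Poly_Mapping.keys p. F (Poly_Mapping.single k (Poly_Mapping.lookup p k)))"
      by (metis F.sum)
    also have "\<dots> = fev ?h p" unfolding fev_def
      by (intro sum.cong refl) (subst sc, simp add: F.scale)
    finally show ?thesis ..
  qed
  then have "tev ?h s - tev ?h t = F ?q" by (simp add: tev_def F.diff)
  moreover have "F ?q = 1" using F(2) by simp
  ultimately show False using eq[OF h] by simp
qed

end

text \<open>Both sides are one finite double sum over two representatives. This is what allows
  Sweedler sums attached to different elements to be interchanged.\<close>

lemma tev_swap: "tev (\<lambda>x y. tev (\<lambda>a b. k x y a b) s) t = tev (\<lambda>a b. tev (\<lambda>x y. k x y a b) t) s"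
  unfolding tev_def fev_def sum_distrib_left by (subst sum.swap) (simp add: mult.left_commute)

lemma tev_zero [simp]: "tev (\<lambda>x y. 0) t = 0"
  by (simp add: tev_def fev_def)

lemma tev_mult_left: "tev (\<lambda>x y. c * h x y) t = c * tev h t"
  by (simp add: tev_def fev_def sum_distrib_left mult.left_commute)

lemma tev_mult_right: "tev (\<lambda>x y. h x y * c) t = tev h t * c"
  by (simp add: tev_def fev_def sum_distrib_right mult.assoc)

lemma tev_add: "tev (\<lambda>x y. h x y + h' x y) t = tev h t + tev h' t"
  by (simp add: tev_def fev_def sum.distrib algebra_simps)

lemma tev_diff: "tev (\<lambda>x y. h x y - h' x y) t = tev h t - tev h' t"
  by (simp add: tev_def fev_def sum_subtractf algebra_simps)

lemma tev_sum: "tev (\<lambda>x y. \<Sum>k\<in>K. h k x y) t = (\<Sum>k\<in>K. tev (h k) t)"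
  unfolding tev_def fev_def sum_distrib_left by (rule sum.swap)

locale two_algebras =
  fixes A :: "'a calg" and B :: "'b calg"
  assumes alg_A: "complex_algebra A" and alg_B: "complex_algebra B"
begin

sublocale two_spaces A B
  by unfold_locales (auto intro: cspace_complex_algebra alg_A alg_B)

sublocale RA: ring A using alg_A by (simp add: complex_algebra_def)
sublocale RB: ring B using alg_B by (simp add: complex_algebra_def)

lemma formal_mult_formals: "p \<in> formals \<Longrightarrow> q \<in> formals \<Longrightarrow> formal_mult A B p q \<in> formals"
proof -
  assume p: "p \<in> formals" and q: "q \<in> formals"
  have sum: "(\<Sum>k\<in>K. f k) \<in> formals" if "\<And>k. k \<in> K \<Longrightarrow> f k \<in> formals"
    for K :: "'z set" and f :: "'z \<Rightarrow> ('a, 'b) formal"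
    using that by (induction K rule: infinite_finite_induct) (simp_all add: formals_add[simplified])
  show ?thesis unfolding formal_mult_def
  proof (intro sum)
    fix k l assume "k \<in> Poly_Mapping.keys p" "l \<in> Poly_Mapping.keys q"
    then show "Poly_Mapping.single (fst k \<otimes>\<^bsub>A\<^esub> fst l, snd k \<otimes>\<^bsub>B\<^esub> snd l)
        (Poly_Mapping.lookup p k * Poly_Mapping.lookup q l) \<in> formals"
      using p q by (intro formals_single) (cases k; cases l; auto)+
  qed
qed

lemma tensor_mult_closed:
  assumes "s \<in> carrier (A \<otimes>\<^sub>A B)" "t \<in> carrier (A \<otimes>\<^sub>A B)"
  shows "s \<otimes>\<^bsub>A \<otimes>\<^sub>A B\<^esub> t \<in> carrier (A \<otimes>\<^sub>A B)"
  using tens_class_closed[OF formal_mult_formals[OF rep_formals[OF assms(1)] rep_formals[OF assms(2)]]]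
  by (simp add: tensor_alg_def)

lemma tensor_one_closed: "\<one>\<^bsub>A \<otimes>\<^sub>A B\<^esub> \<in> carrier (A \<otimes>\<^sub>A B)"
proof -
  have "\<one>\<^bsub>A \<otimes>\<^sub>A B\<^esub> = ptens A B \<one>\<^bsub>A\<^esub> \<one>\<^bsub>B\<^esub>" by (simp add: tensor_alg_def)
  then show ?thesis by simp
qed

lemma tev_one: "bform A B h \<Longrightarrow> tev h \<one>\<^bsub>A \<otimes>\<^sub>A B\<^esub> = h \<one>\<^bsub>A\<^esub> \<one>\<^bsub>B\<^esub>"
  using tev_ptens[of h "\<one>\<^bsub>A\<^esub>" "\<one>\<^bsub>B\<^esub>"] by (simp add: tensor_alg_def)

lemma tev_mult:
  assumes "bform A B h"
  shows "tev h (s \<otimes>\<^bsub>A \<otimes>\<^sub>A B\<^esub> t)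
    = tev (\<lambda>p q. tev (\<lambda>p' q'. h (p \<otimes>\<^bsub>A\<^esub> p') (q \<otimes>\<^bsub>B\<^esub> q')) t) s"
  using tev_class[OF assms]
  by (simp add: tensor_alg_def formal_mult_def fev_sum tev_def fev_def[of _ "rep s"] fev_def[of _ "rep t"]
      sum_distrib_left mult.assoc)

end

section \<open>Sweedler calculus and the antipode\<close>

section \<open>Hopf algebras through their linear forms\<close>

text \<open>Collects rules about \<open>lform A (\<lambda>x. ...)\<close>,
  \<open>lmap A B (\<lambda>x. ...)\<close> and their multilinear analogues, so that repeated
  introduction decides linearity of a nested Sweedler expression in one variable. Forms local to a
  proof are added where they appear.\<close>

named_theorems lin

lemma lmap_id [lin]: "lmap A A (\<lambda>x. x)"
  by (simp add: lmap_def)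

declare bformI [lin] lform_mult_left [lin] lform_mult_right [lin]

lemma clinear_lmap: "E \<in> clinear A B \<Longrightarrow> lmap A B E"
  by (auto simp: lmap_def LinearCombinations.module_hom_def)

lemma clinear_lform: "f \<in> clinear A Calg \<Longrightarrow> lform A f"
  by (auto simp: lform_def LinearCombinations.module_hom_def Calg_def)

lemma bform_lform1: "bform B C h \<Longrightarrow> y \<in> carrier C \<Longrightarrow> lmap A B E \<Longrightarrow> lform A (\<lambda>x. h (E x) y)"
  by (rule lform_lmap[OF bform1])

lemma bform_lform2: "bform B C h \<Longrightarrow> x \<in> carrier B \<Longrightarrow> lmap A C E \<Longrightarrow> lform A (\<lambda>y. h x (E y))"
  by (rule lform_lmap[OF bform2])

definition tform :: "'a calg \<Rightarrow> 'b calg \<Rightarrow> 'c calg \<Rightarrow> ('a \<Rightarrow> 'b \<Rightarrow> 'c \<Rightarrow> complex) \<Rightarrow> bool" where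
  "tform A B C h \<longleftrightarrow> (\<forall>y\<in>carrier B. \<forall>z\<in>carrier C. lform A (\<lambda>x. h x y z)) \<and>
     (\<forall>x\<in>carrier A. \<forall>z\<in>carrier C. lform B (\<lambda>y. h x y z)) \<and>
     (\<forall>x\<in>carrier A. \<forall>y\<in>carrier B. lform C (\<lambda>z. h x y z))"

lemma tformI [lin]:
  "(\<And>y z. y \<in> carrier B \<Longrightarrow> z \<in> carrier C \<Longrightarrow> lform A (\<lambda>x. h x y z)) \<Longrightarrow>
   (\<And>x z. x \<in> carrier A \<Longrightarrow> z \<in> carrier C \<Longrightarrow> lform B (\<lambda>y. h x y z)) \<Longrightarrow>
   (\<And>x y. x \<in> carrier A \<Longrightarrow> y \<in> carrier B \<Longrightarrow> lform C (\<lambda>z. h x y z)) \<Longrightarrow> tform A B C h"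
  by (simp add: tform_def)

locale calgebra =
  fixes U :: "'u calg" (structure)
  assumes calg: "complex_algebra U"
begin

sublocale ring U using calg by (simp add: complex_algebra_def)
sublocale V: vectorspace class_ring U using calg by (simp add: complex_algebra_def)
sublocale UU: two_algebras U U by unfold_locales (rule calg)+

lemma cspace: "cspace U" using calg by (rule cspace_complex_algebra)

lemma smult_closed [simp]: "x \<in> carrier U \<Longrightarrow> c \<odot> x \<in> carrier U"
  using cspace by (simp add: cspace_def)

lemma smult_mult: "x \<in> carrier U \<Longrightarrow> y \<in> carrier U \<Longrightarrow> (c \<odot> x) \<otimes> y = c \<odot> (x \<otimes> y)"
  and mult_smult: "x \<in> carrier U \<Longrightarrow> y \<in> carrier U \<Longrightarrow> x \<otimes> (c \<odot> y) = c \<odot> (x \<otimes> y)"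
  using calg by (auto simp: complex_algebra_def)

lemma lmap_mult_left [lin]: "c \<in> carrier U \<Longrightarrow> lmap A U E \<Longrightarrow> lmap A U (\<lambda>x. c \<otimes> E x)"
  by (intro lmapI) (auto simp: lmap_closed lmap_add lmap_smult r_distr mult_smult)

lemma lmap_mult_right [lin]: "c \<in> carrier U \<Longrightarrow> lmap A U E \<Longrightarrow> lmap A U (\<lambda>x. E x \<otimes> c)"
  by (intro lmapI) (auto simp: lmap_closed lmap_add lmap_smult l_distr smult_mult)

end

locale hopf = calgebra +
  fixes \<Delta> :: "'a \<Rightarrow> ('a, 'a) tens" and \<epsilon> :: "'a \<Rightarrow> complex" and S :: "'a \<Rightarrow> 'a"
  assumes hopf: "hopf_algebra U \<Delta> \<epsilon> S"
begin

abbreviation "lf \<equiv> lform U"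
abbreviation "bf \<equiv> bform U U"
abbreviation "tf \<equiv> tform U U U"
text \<open>Sweedler notation: h(x_1, x_2), summed over the coproduct of x. Nested uses encode
  iterated coproducts, which \<open>sw_coassoc\<close> regroups.\<close>

abbreviation "sw h x \<equiv> tev h (\<Delta> x)"

lemma cop_closed [simp]: "x \<in> carrier U \<Longrightarrow> \<Delta> x \<in> carrier (U \<otimes>\<^sub>A U)"
  using hopf by (auto simp: hopf_algebra_def alg_hom_def LinearCombinations.module_hom_def)

lemma lmap_cop: "lmap U (U \<otimes>\<^sub>A U) \<Delta>"
  using hopf by (intro clinear_lmap) (auto simp: hopf_algebra_def alg_hom_def)

lemma lf_counit: "lf \<epsilon>"
  using hopf by (intro clinear_lform) (auto simp: hopf_algebra_def alg_hom_def)

lemma lf_counit' [lin]: "lmap A U E \<Longrightarrow> lform A (\<lambda>x. \<epsilon> (E x))"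
  by (rule lform_lmap[OF lf_counit])

lemma counit_mult [simp]: "x \<in> carrier U \<Longrightarrow> y \<in> carrier U \<Longrightarrow> \<epsilon> (x \<otimes> y) = \<epsilon> x * \<epsilon> y"
  and counit_one [simp]: "\<epsilon> \<one> = 1"
  using hopf by (auto simp: hopf_algebra_def alg_hom_def Calg_def Ring.ring_hom_def)

lemma lmap_antipode: "lmap U U S"
  using hopf by (intro clinear_lmap) (auto simp: hopf_algebra_def)

lemma lmap_antipode' [lin]: "lmap A U E \<Longrightarrow> lmap A U (\<lambda>x. S (E x))"
  by (rule lmap_comp[OF lmap_antipode])

lemma antipode_closed [simp]: "x \<in> carrier U \<Longrightarrow> S x \<in> carrier U"
  by (rule lmap_closed[OF lmap_antipode])

lemma lf_sw [lin]: "bf h \<Longrightarrow> lmap A U E \<Longrightarrow> lform A (\<lambda>x. sw h (E x))"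
  using lform_lmap[OF UU.lform_tev] lmap_comp[OF lmap_cop] by blast

lemma lf_sw_param [lin]:
  "x \<in> carrier U \<Longrightarrow> (\<And>p q. p \<in> carrier U \<Longrightarrow> q \<in> carrier U \<Longrightarrow> lform A (\<lambda>z. h z p q)) \<Longrightarrow>
   lform A (\<lambda>z. sw (h z) x)"
  by (rule UU.lform_tev_param) simp_all

lemma sw_cong:
  "x \<in> carrier U \<Longrightarrow> (\<And>p q. p \<in> carrier U \<Longrightarrow> q \<in> carrier U \<Longrightarrow> h p q = h' p q) \<Longrightarrow> sw h x = sw h' x"
  by (rule UU.tev_cong) simp_all

lemma sw_mult:
  assumes "bf h" "x \<in> carrier U" "y \<in> carrier U"
  shows "sw h (x \<otimes> y) = sw (\<lambda>p q. sw (\<lambda>p' q'. h (p \<otimes> p') (q \<otimes> q')) y) x"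
proof -
  have "\<Delta> (x \<otimes> y) = \<Delta> x \<otimes>\<^bsub>U \<otimes>\<^sub>A U\<^esub> \<Delta> y"
    using hopf assms by (auto simp: hopf_algebra_def alg_hom_def Ring.ring_hom_def)
  then show ?thesis by (simp add: UU.tev_mult[OF assms(1)])
qed

lemma sw_one: "bf h \<Longrightarrow> sw h \<one> = h \<one> \<one>"
proof -
  have "\<Delta> \<one> = \<one>\<^bsub>U \<otimes>\<^sub>A U\<^esub>"
    using hopf by (auto simp: hopf_algebra_def alg_hom_def Ring.ring_hom_def)
  then show "bf h \<Longrightarrow> ?thesis" by (simp add: UU.tev_one)
qed

lemma sw_counit_left: "lf f \<Longrightarrow> x \<in> carrier U \<Longrightarrow> sw (\<lambda>p q. \<epsilon> p * f q) x = f x"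
proof -
  assume f: "lf f" and x: "x \<in> carrier U"
  have "f (form_left U \<epsilon> (\<Delta> x)) = f x" using hopf x by (simp add: hopf_algebra_def)
  then show ?thesis
    unfolding form_left_def
    by (subst (asm) UU.tens_lift_eval(1)[OF cspace f cop_closed[OF x]])
      (auto simp: x lform_smult[OF f] cong: sw_cong)
qed

lemma sw_counit_right: "lf f \<Longrightarrow> x \<in> carrier U \<Longrightarrow> sw (\<lambda>p q. f p * \<epsilon> q) x = f x"
proof -
  assume f: "lf f" and x: "x \<in> carrier U"
  have "f (form_right U \<epsilon> (\<Delta> x)) = f x" using hopf x by (simp add: hopf_algebra_def)
  then show ?thesis
    unfolding form_right_def
    by (subst (asm) UU.tens_lift_eval(1)[OF cspace f cop_closed[OF x]])
      (auto simp: x lform_smult[OF f] mult.commute cong: sw_cong)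
qed

lemma sw_antipode_left: "lf f \<Longrightarrow> x \<in> carrier U \<Longrightarrow> sw (\<lambda>p q. f (S p \<otimes> q)) x = \<epsilon> x * f \<one>"
proof -
  assume f: "lf f" and x: "x \<in> carrier U"
  have "f (tens_lift U (\<lambda>x y. S x \<otimes> y) (\<Delta> x)) = f (\<epsilon> x \<odot> \<one>)" using hopf x by (simp add: hopf_algebra_def)
  then show ?thesis
    by (subst (asm) UU.tens_lift_eval(1)[OF cspace f cop_closed[OF x]])
      (auto simp: lform_smult[OF f])
qed

lemma sw_antipode_right: "lf f \<Longrightarrow> x \<in> carrier U \<Longrightarrow> sw (\<lambda>p q. f (p \<otimes> S q)) x = \<epsilon> x * f \<one>"
proof -
  assume f: "lf f" and x: "x \<in> carrier U"
  have "f (tens_lift U (\<lambda>x y. x \<otimes> S y) (\<Delta> x)) = f (\<epsilon> x \<odot> \<one>)" using hopf x by (simp add: hopf_algebra_def)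
  then show ?thesis
    by (subst (asm) UU.tens_lift_eval(1)[OF cspace f cop_closed[OF x]])
      (auto simp: lform_smult[OF f])
qed

text \<open>Both bracketings are values of the single form \<open>?H\<close> on
  \<open>U \<otimes>\<^sub>A (U \<otimes>\<^sub>A U)\<close>, taken at the two sides of the
  coassociativity axiom.\<close>

lemma sw_coassoc:
  assumes h: "tf h" and x: "x \<in> carrier U"
  shows "sw (\<lambda>p q. sw (\<lambda>a b. h a b q) p) x = sw (\<lambda>p q. sw (\<lambda>a b. h p a b) q) x"
proof -
  interpret U12: two_spaces "U \<otimes>\<^sub>A U" U by unfold_locales (rule UU.cspace_tensor, rule cspace)
  interpret U23: two_spaces U "U \<otimes>\<^sub>A U" by unfold_locales (rule cspace, rule UU.cspace_tensor)
  have h1: "bform U U (\<lambda>y z. h x y z)" if "x \<in> carrier U" for x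
    using h that by (auto simp: tform_def bform_def)
  have h2: "bform U (U \<otimes>\<^sub>A U) (\<lambda>x t. tev (h x) t)"
    using h by (intro bformI UU.lform_tev h1 UU.lform_tev_param) (auto simp: tform_def)
  let ?H = "tev (\<lambda>x t. tev (h x) t)"
  have H: "lform (U \<otimes>\<^sub>A (U \<otimes>\<^sub>A U)) ?H" by (rule U23.lform_tev[OF h2])
  have H': "?H (ptens U (U \<otimes>\<^sub>A U) a (ptens U U b c)) = h a b c" if "a \<in> carrier U" for a b c
    using U23.tev_ptens[OF h2] UU.tev_ptens[OF h1[OF that]] by simp
  have h3: "bform (U \<otimes>\<^sub>A U) U (\<lambda>t z. tev (\<lambda>a b. h a b z) t)"
    using h by (intro bformI UU.lform_tev UU.lform_tev_param) (auto simp: tform_def bform_def)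
  have assoc: "tens_assoc U U U (tens_map (U \<otimes>\<^sub>A U) U \<Delta> (\<lambda>x. x) (\<Delta> x))
      = tens_map U (U \<otimes>\<^sub>A U) (\<lambda>x. x) \<Delta> (\<Delta> x)"
    using hopf x by (simp add: hopf_algebra_def)
  have l: "tens_map (U \<otimes>\<^sub>A U) U \<Delta> (\<lambda>x. x) (\<Delta> x) \<in> carrier ((U \<otimes>\<^sub>A U) \<otimes>\<^sub>A U)"
    unfolding tens_map_def using x
    by (intro UU.tens_lift_eval(2)[OF U12.cspace_tensor U12.lform_tev[OF h3]]) auto
  have c1: "tens_lift (U \<otimes>\<^sub>A U \<otimes>\<^sub>A U) (\<lambda>a b. ptens U (U \<otimes>\<^sub>A U) a (ptens U U b z)) t
      \<in> carrier (U \<otimes>\<^sub>A U \<otimes>\<^sub>A U)" if "t \<in> carrier (U \<otimes>\<^sub>A U)" "z \<in> carrier U" for t z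
    using that by (intro UU.tens_lift_eval(2)[OF U23.cspace_tensor H]) auto
  have "?H (tens_assoc U U U (tens_map (U \<otimes>\<^sub>A U) U \<Delta> (\<lambda>x. x) (\<Delta> x)))
      = tev (\<lambda>t z. ?H (tens_lift (U \<otimes>\<^sub>A U \<otimes>\<^sub>A U) (\<lambda>a b. ptens U (U \<otimes>\<^sub>A U) a (ptens U U b z)) t))
          (tens_map (U \<otimes>\<^sub>A U) U \<Delta> (\<lambda>x. x) (\<Delta> x))"
    unfolding tens_assoc_def by (rule U12.tens_lift_eval(1)[OF U23.cspace_tensor H l c1])
  also have "\<dots> = tev (\<lambda>t z. tev (\<lambda>a b. h a b z) t) (tens_map (U \<otimes>\<^sub>A U) U \<Delta> (\<lambda>x. x) (\<Delta> x))"
  proof (rule U12.tev_cong[OF l])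
    fix t z assume t: "t \<in> carrier (U \<otimes>\<^sub>A U)" and z: "z \<in> carrier U"
    have "?H (tens_lift (U \<otimes>\<^sub>A U \<otimes>\<^sub>A U) (\<lambda>a b. ptens U (U \<otimes>\<^sub>A U) a (ptens U U b z)) t)
        = tev (\<lambda>a b. ?H (ptens U (U \<otimes>\<^sub>A U) a (ptens U U b z))) t"
      using z by (intro UU.tens_lift_eval(1)[OF U23.cspace_tensor H t]) auto
    also have "\<dots> = tev (\<lambda>a b. h a b z) t" by (rule UU.tev_cong[OF t H'])
    finally show "?H (tens_lift (U \<otimes>\<^sub>A U \<otimes>\<^sub>A U) (\<lambda>a b. ptens U (U \<otimes>\<^sub>A U) a (ptens U U b z)) t)
        = tev (\<lambda>a b. h a b z) t" .
  qed
  also have "\<dots> = sw (\<lambda>p q. sw (\<lambda>a b. h a b q) p) x"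
    unfolding tens_map_def
    by (subst UU.tens_lift_eval(1)[OF U12.cspace_tensor U12.lform_tev[OF h3] cop_closed[OF x]])
      (auto simp: x U12.tev_ptens[OF h3])
  finally have 1: "?H (tens_assoc U U U (tens_map (U \<otimes>\<^sub>A U) U \<Delta> (\<lambda>x. x) (\<Delta> x)))
      = sw (\<lambda>p q. sw (\<lambda>a b. h a b q) p) x" .
  have "?H (tens_map U (U \<otimes>\<^sub>A U) (\<lambda>x. x) \<Delta> (\<Delta> x)) = sw (\<lambda>p q. sw (\<lambda>a b. h p a b) q) x"
    unfolding tens_map_def
    by (subst UU.tens_lift_eval(1)[OF U23.cspace_tensor H cop_closed[OF x]])
      (auto simp: x U23.tev_ptens[OF h2])
  then show ?thesis using 1 assoc by simp
qed

text \<open>S(xy) and S(y)S(x) are both convolution inverses of the multiplication. Spelled out: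
  insert x_2 S(x_3) and y_2 S(y_3) behind S(x_1 y_1), regroup by coassociativity, and collapse S(x_1
  y_1) x_2 y_2.\<close>

lemma antipode_mult_form:
  assumes f: "lf f" and x: "x \<in> carrier U" and y: "y \<in> carrier U"
  shows "f (S (x \<otimes> y)) = f (S y \<otimes> S x)"
proof -
  note [lin] = lform_lmap[OF f]
  let ?G = "\<lambda>x1 y1 xa ya yb xb. f (S (x1 \<otimes> y1) \<otimes> (xa \<otimes> (ya \<otimes> (S yb \<otimes> S xb))))"
  have "f (S (x \<otimes> y)) = sw (\<lambda>x1 x2. f (S (x1 \<otimes> y)) * \<epsilon> x2) x"
    by (rule sw_counit_right[symmetric]) ((intro lin)?; simp add: x y)+
  also have "\<dots> = sw (\<lambda>x1 x2. sw (\<lambda>y1 y2. f (S (x1 \<otimes> y1)) * \<epsilon> y2) y * \<epsilon> x2) x"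
    by (intro sw_cong[OF x] arg_cong[where f = "\<lambda>t. t * _"] sw_counit_right[symmetric])
      ((intro lin)?; simp add: x y)+
  \<comment> \<open>The counit values are expanded as xa S(xb) and ya S(yb), the y-pair nested
    inside the x-pair; this order makes the two left halves adjacent.\<close>
  also have "\<dots> = sw (\<lambda>x1 x2. sw (\<lambda>y1 y2. sw (\<lambda>xa xb. sw (\<lambda>ya yb. ?G x1 y1 xa ya yb xb) y2) x2) y) x"
  proof (intro sw_cong[OF x])
    fix x1 x2 assume c1: "x1 \<in> carrier U" "x2 \<in> carrier U"
    have "sw (\<lambda>y1 y2. f (S (x1 \<otimes> y1)) * \<epsilon> y2) y * \<epsilon> x2
        = sw (\<lambda>y1 y2. f (S (x1 \<otimes> y1)) * \<epsilon> y2 * \<epsilon> x2) y"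
      by (simp add: tev_mult_right)
    also have "\<dots> = sw (\<lambda>y1 y2. sw (\<lambda>xa xb. sw (\<lambda>ya yb. ?G x1 y1 xa ya yb xb) y2) x2) y"
    proof (intro sw_cong[OF y])
      fix y1 y2 assume c2: "y1 \<in> carrier U" "y2 \<in> carrier U"
      have "sw (\<lambda>xa xb. sw (\<lambda>ya yb. ?G x1 y1 xa ya yb xb) y2) x2
          = sw (\<lambda>xa xb. \<epsilon> y2 * f (S (x1 \<otimes> y1) \<otimes> (xa \<otimes> S xb))) x2"
      proof (intro sw_cong)
        fix xa xb assume c3: "xa \<in> carrier U" "xb \<in> carrier U"
        have l: "lf (\<lambda>w. f (S (x1 \<otimes> y1) \<otimes> (xa \<otimes> (w \<otimes> S xb))))"
          by ((intro lin)?; simp add: c1 c2 c3)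
        show "sw (\<lambda>ya yb. ?G x1 y1 xa ya yb xb) y2 = \<epsilon> y2 * f (S (x1 \<otimes> y1) \<otimes> (xa \<otimes> S xb))"
          using sw_antipode_right[OF l c2(2)] by (simp add: c1 c2 c3 m_assoc cong: sw_cong)
      qed (rule c1)
      also have "\<dots> = \<epsilon> y2 * (\<epsilon> x2 * f (S (x1 \<otimes> y1)))"
      proof -
        have l: "lf (\<lambda>w. f (S (x1 \<otimes> y1) \<otimes> w))" by ((intro lin)?; simp add: c1 c2)
        show ?thesis using sw_antipode_right[OF l c1(2)] by (simp add: tev_mult_left c1 c2)
      qed
      finally show "f (S (x1 \<otimes> y1)) * \<epsilon> y2 * \<epsilon> x2
          = sw (\<lambda>xa xb. sw (\<lambda>ya yb. ?G x1 y1 xa ya yb xb) y2) x2" by simp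
    qed
    finally show "sw (\<lambda>y1 y2. f (S (x1 \<otimes> y1)) * \<epsilon> y2) y * \<epsilon> x2
        = sw (\<lambda>y1 y2. sw (\<lambda>xa xb. sw (\<lambda>ya yb. ?G x1 y1 xa ya yb xb) y2) x2) y" .
  qed
  also have "\<dots> = sw (\<lambda>x1 x2. sw (\<lambda>xa xb. sw (\<lambda>y1 y2. sw (\<lambda>ya yb. ?G x1 y1 xa ya yb xb) y2) y) x2) x"
    by (intro sw_cong[OF x] tev_swap)
  also have "\<dots> = sw (\<lambda>x1 xb. sw (\<lambda>x1 xa. sw (\<lambda>y1 y2. sw (\<lambda>ya yb. ?G x1 y1 xa ya yb xb) y2) y) x1) x"
    by (rule sw_coassoc[symmetric]) ((intro lin)?; simp add: x y)+
  also have "\<dots> = sw (\<lambda>x1 xb. sw (\<lambda>x1 xa. sw (\<lambda>y1 yb. sw (\<lambda>y1 ya. ?G x1 y1 xa ya yb xb) y1) y) x1) x"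
    by (intro sw_cong[OF x] sw_cong sw_coassoc[symmetric]) (assumption | (intro lin)?; simp add: x y)+
  also have "\<dots> = sw (\<lambda>x1 xb. sw (\<lambda>y1 yb. sw (\<lambda>x1 xa. sw (\<lambda>y1 ya. ?G x1 y1 xa ya yb xb) y1) x1) y) x"
    by (intro sw_cong[OF x] tev_swap)
  \<comment> \<open>After regrouping, S(x1 y1) xa ya is S(u_1) u_2 for u the product of the outer
    \<open>x1\<close> and \<open>y1\<close>.\<close>
  also have "\<dots> = sw (\<lambda>x1 xb. sw (\<lambda>y1 yb. \<epsilon> x1 * (\<epsilon> y1 * f (S yb \<otimes> S xb))) y) x"
  proof (intro sw_cong[OF x] sw_cong[OF y])
    fix x1 xb y1 yb assume c: "x1 \<in> carrier U" "xb \<in> carrier U" "y1 \<in> carrier U" "yb \<in> carrier U"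
    let ?h = "\<lambda>a b. f (S a \<otimes> b \<otimes> (S yb \<otimes> S xb))"
    have "bf ?h" by ((intro lin)?; simp add: c)
    from sw_mult[OF this c(1,3)]
    have "sw (\<lambda>x1 xa. sw (\<lambda>y1 ya. ?G x1 y1 xa ya yb xb) y1) x1 = sw ?h (x1 \<otimes> y1)"
      by (simp add: c m_assoc cong: sw_cong)
    also have "\<dots> = \<epsilon> (x1 \<otimes> y1) * f (\<one> \<otimes> (S yb \<otimes> S xb))"
      by (rule sw_antipode_left) ((intro lin)?; simp add: c)+
    finally show "sw (\<lambda>x1 xa. sw (\<lambda>y1 ya. ?G x1 y1 xa ya yb xb) y1) x1
        = \<epsilon> x1 * (\<epsilon> y1 * f (S yb \<otimes> S xb))" by (simp add: c)
  qed
  also have "\<dots> = sw (\<lambda>x1 xb. \<epsilon> x1 * f (S y \<otimes> S xb)) x"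
  proof (intro sw_cong[OF x])
    fix x1 xb assume c: "x1 \<in> carrier U" "xb \<in> carrier U"
    have l: "lf (\<lambda>w. f (S w \<otimes> S xb))" by ((intro lin)?; simp add: c)
    show "sw (\<lambda>y1 yb. \<epsilon> x1 * (\<epsilon> y1 * f (S yb \<otimes> S xb))) y = \<epsilon> x1 * f (S y \<otimes> S xb)"
      using sw_counit_left[OF l y] by (simp add: tev_mult_left)
  qed
  also have "\<dots> = f (S y \<otimes> S x)"
    by (rule sw_counit_left) ((intro lin)?; simp add: x y)+
  finally show ?thesis .
qed

text \<open>Linear forms separate points, because \<open>x\<close> can be recovered from \<open>\<Delta> x\<close> and bilinear forms
  separate tensors.\<close>

lemma lf_eqI:
  assumes x: "x \<in> carrier U" and y: "y \<in> carrier U" and eq: "\<And>f. lf f \<Longrightarrow> f x = f y"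
  shows "x = y"
proof -
  have "\<Delta> x = \<Delta> y"
    using x y eq[OF lf_sw[OF _ lmap_id]] by (intro UU.tens_eqI) auto
  then have "form_left U \<epsilon> (\<Delta> x) = form_left U \<epsilon> (\<Delta> y)" by simp
  then show ?thesis using hopf x y by (simp add: hopf_algebra_def)
qed

lemma antipode_mult [simp]: "x \<in> carrier U \<Longrightarrow> y \<in> carrier U \<Longrightarrow> S (x \<otimes> y) = S y \<otimes> S x"
  by (rule lf_eqI) (auto intro: antipode_mult_form)

lemma antipode_one [simp]: "S \<one> = \<one>"
proof (rule lf_eqI)
  fix f assume f: "lf f"
  have "bf (\<lambda>p q. f (S p \<otimes> q))" by ((intro lin lform_lmap[OF f])?; simp)+
  then show "f (S \<one>) = f \<one>" using sw_antipode_left[OF f, of \<one>] by (simp add: sw_one)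
qed simp_all

lemma counit_antipode [simp]: "x \<in> carrier U \<Longrightarrow> \<epsilon> (S x) = \<epsilon> x"
proof -
  assume x: "x \<in> carrier U"
  have "\<epsilon> x = sw (\<lambda>p q. \<epsilon> (S p \<otimes> q)) x" using sw_antipode_left[OF lf_counit x] by simp
  also have "\<dots> = sw (\<lambda>p q. \<epsilon> (S p) * \<epsilon> q) x" by (rule sw_cong[OF x]) simp
  also have "\<dots> = \<epsilon> (S x)" by (rule sw_counit_right[OF _ x]) ((intro lin)?; simp)
  finally show ?thesis by simp
qed

text \<open>The coproduct has two convolution inverses, its composite with S and the flipped image
  of S \<otimes> S, which therefore agree. \<open>expand\<close> is the identity making the second
  one an inverse; it is inserted behind the coproduct of S(x_1).\<close>

lemma sw_antipode:
  assumes h: "bf h" and x: "x \<in> carrier U"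
  shows "sw h (S x) = sw (\<lambda>p q. h (S q) (S p)) x"
proof -
  note [lin] = bform_lform1[OF h] bform_lform2[OF h]
  have expand: "sw (\<lambda>p q. sw (\<lambda>p1 p2. sw (\<lambda>q1 q2. h (a \<otimes> p1 \<otimes> S q2) (b \<otimes> p2 \<otimes> S q1)) q) p) u = \<epsilon> u * h a b"
    if c: "a \<in> carrier U" "b \<in> carrier U" and u: "u \<in> carrier U" for a b u
  proof -
    have "sw (\<lambda>p q. sw (\<lambda>p1 p2. sw (\<lambda>q1 q2. h (a \<otimes> p1 \<otimes> S q2) (b \<otimes> p2 \<otimes> S q1)) q) p) u
        = sw (\<lambda>p1 r. sw (\<lambda>p2 q. sw (\<lambda>q1 q2. h (a \<otimes> p1 \<otimes> S q2) (b \<otimes> p2 \<otimes> S q1)) q) r) u"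
      by (rule sw_coassoc) ((intro lin)?; simp add: c u)+
    also have "\<dots> = sw (\<lambda>p1 r. sw (\<lambda>w q2. sw (\<lambda>p2 q1. h (a \<otimes> p1 \<otimes> S q2) (b \<otimes> p2 \<otimes> S q1)) w) r) u"
      by (intro sw_cong[OF u] sw_coassoc[symmetric]) ((intro lin)?; simp add: c u)+
    also have "\<dots> = sw (\<lambda>p1 r. sw (\<lambda>w q2. \<epsilon> w * h (a \<otimes> p1 \<otimes> S q2) b) r) u"
    proof (intro sw_cong[OF u] sw_cong)
      fix p1 r w q2 assume c': "p1 \<in> carrier U" "r \<in> carrier U" "w \<in> carrier U" "q2 \<in> carrier U"
      have l: "lf (\<lambda>z. h (a \<otimes> p1 \<otimes> S q2) (b \<otimes> z))" by ((intro lin)?; simp add: c c')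
      show "sw (\<lambda>p2 q1. h (a \<otimes> p1 \<otimes> S q2) (b \<otimes> p2 \<otimes> S q1)) w = \<epsilon> w * h (a \<otimes> p1 \<otimes> S q2) b"
        using sw_antipode_right[OF l c'(3)] by (simp add: c c' m_assoc cong: sw_cong)
    qed
    also have "\<dots> = sw (\<lambda>p1 r. h (a \<otimes> (p1 \<otimes> S r)) b) u"
      by (intro sw_cong[OF u], subst sw_counit_left) ((intro lin)?; simp add: c u m_assoc)+
    also have "\<dots> = \<epsilon> u * h (a \<otimes> \<one>) b"
      by (rule sw_antipode_right) ((intro lin)?; simp add: c u)+
    finally show ?thesis using c by simp
  qed
  have lh: "lf (\<lambda>x. sw h (S x))" by ((intro lin h)?; simp)
  have "sw h (S x) = sw (\<lambda>x1 x2. sw h (S x1) * \<epsilon> x2) x"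
    by (rule sw_counit_right[OF lh x, symmetric])
  also have "\<dots> = sw (\<lambda>x1 x2. sw (\<lambda>a b. sw (\<lambda>p q. sw (\<lambda>p1 p2. sw (\<lambda>q1 q2.
      h (a \<otimes> p1 \<otimes> S q2) (b \<otimes> p2 \<otimes> S q1)) q) p) x2) (S x1)) x"
    by (intro sw_cong[OF x]) (simp add: tev_mult_left expand mult.commute cong: sw_cong)
  also have "\<dots> = sw (\<lambda>x1 x2. sw (\<lambda>p q. sw (\<lambda>a b. sw (\<lambda>p1 p2. sw (\<lambda>q1 q2.
      h (a \<otimes> p1 \<otimes> S q2) (b \<otimes> p2 \<otimes> S q1)) q) p) (S x1)) x2) x"
    by (intro sw_cong[OF x] tev_swap)
  also have "\<dots> = sw (\<lambda>w q. sw (\<lambda>x1 p. sw (\<lambda>a b. sw (\<lambda>p1 p2. sw (\<lambda>q1 q2.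
      h (a \<otimes> p1 \<otimes> S q2) (b \<otimes> p2 \<otimes> S q1)) q) p) (S x1)) w) x"
    by (rule sw_coassoc[symmetric]) ((intro lin)?; simp add: x)+
  also have "\<dots> = sw (\<lambda>w q. \<epsilon> w * sw (\<lambda>q1 q2. h (S q2) (S q1)) q) x"
  proof (intro sw_cong[OF x])
    fix w q assume c: "w \<in> carrier U" "q \<in> carrier U"
    let ?k = "\<lambda>a b. sw (\<lambda>q1 q2. h (a \<otimes> S q2) (b \<otimes> S q1)) q"
    have k: "bf ?k" by ((intro lin)?; simp add: c)
    have "sw (\<lambda>x1 p. sw (\<lambda>a b. sw (\<lambda>p1 p2. sw (\<lambda>q1 q2.
        h (a \<otimes> p1 \<otimes> S q2) (b \<otimes> p2 \<otimes> S q1)) q) p) (S x1)) w = sw (\<lambda>x1 p. sw ?k (S x1 \<otimes> p)) w"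
      by (intro sw_cong c) (simp add: sw_mult[OF k])
    also have "\<dots> = \<epsilon> w * sw ?k \<one>"
      by (rule sw_antipode_left) ((intro lin k)?; simp add: c)+
    also have "\<dots> = \<epsilon> w * sw (\<lambda>q1 q2. h (S q2) (S q1)) q"
      by (simp add: sw_one[OF k] c cong: sw_cong)
    finally show "sw (\<lambda>x1 p. sw (\<lambda>a b. sw (\<lambda>p1 p2. sw (\<lambda>q1 q2.
        h (a \<otimes> p1 \<otimes> S q2) (b \<otimes> p2 \<otimes> S q1)) q) p) (S x1)) w = \<epsilon> w * sw (\<lambda>q1 q2. h (S q2) (S q1)) q" .
  qed
  also have "\<dots> = sw (\<lambda>q1 q2. h (S q2) (S q1)) x"
    by (rule sw_counit_left) ((intro lin)?; simp add: x)+
  finally show ?thesis .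
qed

end

section \<open>Pivotal structure and the inverse of the antipode\<close>

locale pivotal_hopf = hopf +
  fixes g :: 'a
  assumes pivot_closed [simp]: "g \<in> carrier U" and counit_pivot [simp]: "\<epsilon> g = 1"
    and cop_pivot: "\<Delta> g = ptens U U g g"
    and antipode_square: "\<And>x. x \<in> carrier U \<Longrightarrow> S (S x) = g \<otimes> x \<otimes> inv g"
begin

lemma sw_pivot: "bf h \<Longrightarrow> sw h g = h g g"
  by (simp add: cop_pivot UU.tev_ptens)

text \<open>The locale writes \<open>inv g\<close> without assuming that g is a unit. Being
  grouplike with counit 1 turns the two antipode laws at g into the two inverse laws.\<close>

lemma antipode_pivot: "S g \<otimes> g = \<one>" "g \<otimes> S g = \<one>"
proof -
  have "f (S g \<otimes> g) = f \<one>" "f (g \<otimes> S g) = f \<one>" if f: "lf f" for f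
  proof -
    have "bf (\<lambda>p q. f (S p \<otimes> q))" "bf (\<lambda>p q. f (p \<otimes> S q))" by ((intro lin lform_lmap[OF f])?; simp)+
    then show "f (S g \<otimes> g) = f \<one>" "f (g \<otimes> S g) = f \<one>"
      using sw_antipode_left[OF f pivot_closed] sw_antipode_right[OF f pivot_closed] by (simp_all add: sw_pivot)
  qed
  then show "S g \<otimes> g = \<one>" "g \<otimes> S g = \<one>" by (auto intro!: lf_eqI)
qed

lemma pivot_Units: "g \<in> Units U"
  using antipode_pivot by (auto simp: Units_def intro!: bexI[of _ "S g"])

abbreviation gi :: 'a where "gi \<equiv> inv g"

lemma gi_closed [simp]: "gi \<in> carrier U"
  and gi_pivot [simp]: "gi \<otimes> g = \<one>" "g \<otimes> gi = \<one>"
  using pivot_Units by auto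

lemma gi_pivot_assoc [simp]: "x \<in> carrier U \<Longrightarrow> gi \<otimes> (g \<otimes> x) = x" "x \<in> carrier U \<Longrightarrow> g \<otimes> (gi \<otimes> x) = x"
  by (simp_all flip: m_assoc)

lemma antipode_pivot_eq [simp]: "S g = gi" "S gi = g"
proof -
  show 1: "S g = gi" using antipode_pivot by (intro inv_unique') simp_all
  have "S (S g) = g" by (subst antipode_square) (simp_all add: m_assoc)
  then show "S gi = g" by (simp add: 1)
qed

lemma counit_gi [simp]: "\<epsilon> gi = 1"
  using counit_antipode[OF pivot_closed] by simp

lemma sw_pivot_mult:
  assumes h: "bf h" and x: "x \<in> carrier U"
  shows "sw h (g \<otimes> x) = sw (\<lambda>p q. h (g \<otimes> p) (g \<otimes> q)) x"
proof -
  note [lin] = bform_lform1[OF h] bform_lform2[OF h]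
  have "sw h (g \<otimes> x) = sw (\<lambda>p q. sw (\<lambda>p' q'. h (p \<otimes> p') (q \<otimes> q')) x) g"
    by (rule sw_mult[OF h]) (simp_all add: x)
  also have "\<dots> = sw (\<lambda>p q. h (g \<otimes> p) (g \<otimes> q)) x"
    by (rule sw_pivot) ((intro lin)?; simp add: x)
  finally show ?thesis .
qed

lemma sw_gi_mult:
  assumes h: "bf h" and x: "x \<in> carrier U"
  shows "sw h (gi \<otimes> x) = sw (\<lambda>p q. h (gi \<otimes> p) (gi \<otimes> q)) x"
proof -
  note [lin] = bform_lform1[OF h] bform_lform2[OF h]
  have "bf (\<lambda>p q. h (gi \<otimes> p) (gi \<otimes> q))" by ((intro lin)?; simp add: x)
  from sw_pivot_mult[OF this, of "gi \<otimes> x", unfolded gi_pivot_assoc(2)[OF x]] show ?thesis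
    by (simp add: x cong: sw_cong)
qed

text \<open>The inverse of the antipode: since S^2 is conjugation by g, composing S with conjugation
  by \<open>gi\<close> undoes S.\<close>

definition Si :: "'a \<Rightarrow> 'a" where
  "Si x = gi \<otimes> S x \<otimes> g"

lemma Si_closed [simp]: "x \<in> carrier U \<Longrightarrow> Si x \<in> carrier U"
  by (simp add: Si_def)

lemma lmap_Si [lin]: "lmap A U E \<Longrightarrow> lmap A U (\<lambda>x. Si (E x))"
  unfolding Si_def by ((intro lin)?; simp)

lemma S_Si [simp]: "x \<in> carrier U \<Longrightarrow> S (Si x) = x"
  by (simp add: Si_def antipode_square m_assoc)

lemma Si_S [simp]: "x \<in> carrier U \<Longrightarrow> Si (S x) = x"
  by (simp add: Si_def antipode_square m_assoc)

lemma Si_mult [simp]: "x \<in> carrier U \<Longrightarrow> y \<in> carrier U \<Longrightarrow> Si (x \<otimes> y) = Si y \<otimes> Si x"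
  by (simp add: Si_def m_assoc)

lemma Si_one [simp]: "Si \<one> = \<one>" and Si_pivot [simp]: "Si g = gi" and Si_gi [simp]: "Si gi = g"
  by (simp_all add: Si_def m_assoc)

lemma Si_Si: "x \<in> carrier U \<Longrightarrow> Si (Si x) = gi \<otimes> x \<otimes> g"
  by (subst Si_def) (simp add: m_assoc)

text \<open>The law x_1 S(x_2) = \<epsilon>(x) read through \<open>Si\<close>, which reverses
  products and so returns the factors in the other order.\<close>

lemma sw_Si_right:
  assumes f: "lf f" and x: "x \<in> carrier U" shows "sw (\<lambda>p q. f (q \<otimes> Si p)) x = \<epsilon> x * f \<one>"
proof -
  have "lf (\<lambda>z. f (Si z))" by ((intro lin lform_lmap[OF f])?; simp)
  from sw_antipode_right[OF this x] show ?thesis by (simp add: x cong: sw_cong)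
qed

lemma sw_Si_left:
  assumes f: "lf f" and x: "x \<in> carrier U" shows "sw (\<lambda>p q. f (Si q \<otimes> p)) x = \<epsilon> x * f \<one>"
proof -
  have "lf (\<lambda>z. f (Si z))" by ((intro lin lform_lmap[OF f])?; simp)
  from sw_antipode_left[OF this x] show ?thesis by (simp add: x cong: sw_cong)
qed

end

section \<open>Quotients as vanishing conditions on forms\<close>

section \<open>Hopf group-coalgebras\<close>

text \<open>\<open>I_cop\<close> dualises the inclusion of the coproduct of I(\<alpha> + \<beta>) in
  I(\<alpha>) \<otimes> U + U \<otimes> I(\<beta>): a bilinear form killing both summands kills the
  coproduct. In this shape no tensor product of quotients has to be formed.\<close>

locale hopf_gcoalgebra = pivotal_hopf +
  fixes I :: "'g::ab_group_add \<Rightarrow> 'a set"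
  assumes I_closed: "x \<in> I \<gamma> \<Longrightarrow> x \<in> carrier U"
    and I_mult_left: "x \<in> I \<gamma> \<Longrightarrow> y \<in> carrier U \<Longrightarrow> y \<otimes> x \<in> I \<gamma>"
    and I_mult_right: "x \<in> I \<gamma> \<Longrightarrow> y \<in> carrier U \<Longrightarrow> x \<otimes> y \<in> I \<gamma>"
    and I_antipode: "x \<in> I \<gamma> \<Longrightarrow> S x \<in> I (- \<gamma>)"
    and I_counit: "x \<in> I 0 \<Longrightarrow> \<epsilon> x = 0"
    and I_cop: "bform U U h \<Longrightarrow> (\<And>x y. x \<in> I \<alpha> \<Longrightarrow> y \<in> carrier U \<Longrightarrow> h x y = 0) \<Longrightarrow>
      (\<And>x y. x \<in> carrier U \<Longrightarrow> y \<in> I \<beta> \<Longrightarrow> h x y = 0) \<Longrightarrow> x \<in> I (\<alpha> + \<beta>) \<Longrightarrow> tev h (\<Delta> x) = 0"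
begin

text \<open>A linear form on the quotient by I(\<gamma>), kept as a form on U. Likewise
  \<open>bmf\<close> stands for a bilinear form on two quotients and \<open>lmod\<close> for a map
  that induces one between quotients.\<close>

definition mf :: "'g \<Rightarrow> ('a \<Rightarrow> complex) \<Rightarrow> bool" where
  "mf \<gamma> f \<longleftrightarrow> lf f \<and> (\<forall>x\<in>I \<gamma>. f x = 0)"

definition bmf :: "'g \<Rightarrow> 'g \<Rightarrow> ('a \<Rightarrow> 'a \<Rightarrow> complex) \<Rightarrow> bool" where
  "bmf \<alpha> \<beta> h \<longleftrightarrow> (\<forall>y\<in>carrier U. mf \<alpha> (\<lambda>x. h x y)) \<and> (\<forall>x\<in>carrier U. mf \<beta> (h x))"

definition lmod :: "'g \<Rightarrow> 'g \<Rightarrow> ('a \<Rightarrow> 'a) \<Rightarrow> bool" where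
  "lmod \<gamma> \<delta> E \<longleftrightarrow> lmap U U E \<and> (\<forall>x\<in>I \<gamma>. E x \<in> I \<delta>)"

lemma mf_lf [lin]: "mf \<gamma> f \<Longrightarrow> lf f" by (simp add: mf_def)

lemma mf_lmod: "mf \<delta> f \<Longrightarrow> lmod \<gamma> \<delta> E \<Longrightarrow> mf \<gamma> (\<lambda>x. f (E x))"
  by (auto simp: mf_def lmod_def intro: lform_lmap)

named_theorems modlin

lemma lmod_id [modlin]: "\<gamma> = \<delta> \<Longrightarrow> lmod \<gamma> \<delta> (\<lambda>x. x)"
  by (simp add: lmod_def lmap_id)

lemma lmod_mult_left [modlin]: "c \<in> carrier U \<Longrightarrow> lmod \<gamma> \<delta> E \<Longrightarrow> lmod \<gamma> \<delta> (\<lambda>x. c \<otimes> E x)"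
  by (auto simp: lmod_def I_mult_left intro: lin)

lemma lmod_mult_right [modlin]: "c \<in> carrier U \<Longrightarrow> lmod \<gamma> \<delta> E \<Longrightarrow> lmod \<gamma> \<delta> (\<lambda>x. E x \<otimes> c)"
  by (auto simp: lmod_def I_mult_right intro: lin)

lemma lmod_antipode [modlin]: "lmod \<gamma> (- \<delta>) E \<Longrightarrow> lmod \<gamma> \<delta> (\<lambda>x. S (E x))"
  using I_antipode[of _ "- \<delta>"] by (auto simp: lmod_def intro: lin)

lemma lmod_Si [modlin]: "lmod \<gamma> (- \<delta>) E \<Longrightarrow> lmod \<gamma> \<delta> (\<lambda>x. Si (E x))"
  unfolding Si_def by (intro modlin) simp_all

lemma mf_mult_left [modlin]: "mf \<gamma> f \<Longrightarrow> mf \<gamma> (\<lambda>x. c * f x)"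
  and mf_mult_right [modlin]: "mf \<gamma> f \<Longrightarrow> mf \<gamma> (\<lambda>x. f x * c)"
  by (auto simp: mf_def intro: lform_mult_left lform_mult_right)

lemma mf_minus: "mf \<gamma> f \<Longrightarrow> mf \<gamma> f' \<Longrightarrow> mf \<gamma> (\<lambda>x. f x - f' x)"
  by (auto simp: mf_def intro: lform_minus)

lemma mf_counit: "mf 0 \<epsilon>"
  by (simp add: mf_def lf_counit I_counit)

lemma bmfI [modlin]:
  "(\<And>y. y \<in> carrier U \<Longrightarrow> mf \<alpha> (\<lambda>x. h x y)) \<Longrightarrow> (\<And>x. x \<in> carrier U \<Longrightarrow> mf \<beta> (\<lambda>y. h x y)) \<Longrightarrow> bmf \<alpha> \<beta> h"
  by (simp add: bmf_def)

lemma bmf1: "bmf \<alpha> \<beta> h \<Longrightarrow> y \<in> carrier U \<Longrightarrow> mf \<alpha> (\<lambda>x. h x y)"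
  and bmf2: "bmf \<alpha> \<beta> h \<Longrightarrow> x \<in> carrier U \<Longrightarrow> mf \<beta> (\<lambda>y. h x y)"
  by (simp_all add: bmf_def)

lemma bmf_mf1: "bmf \<alpha> \<beta> h \<Longrightarrow> y \<in> carrier U \<Longrightarrow> lmod \<gamma> \<alpha> E \<Longrightarrow> mf \<gamma> (\<lambda>x. h (E x) y)"
  by (rule mf_lmod[OF bmf1])

lemma bmf_mf2: "bmf \<alpha> \<beta> h \<Longrightarrow> x \<in> carrier U \<Longrightarrow> lmod \<gamma> \<beta> E \<Longrightarrow> mf \<gamma> (\<lambda>y. h x (E y))"
  by (rule mf_lmod[OF bmf2])

lemma bmf_bf [lin]: "bmf \<alpha> \<beta> h \<Longrightarrow> bf h"
  by (auto simp: bmf_def bform_def mf_def)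

lemma mf_sw: "bmf \<alpha> \<beta> h \<Longrightarrow> lmod \<gamma> (\<alpha> + \<beta>) E \<Longrightarrow> mf \<gamma> (\<lambda>x. sw h (E x))"
proof (rule mf_lmod[of "\<alpha> + \<beta>"])
  assume h: "bmf \<alpha> \<beta> h"
  show "mf (\<alpha> + \<beta>) (sw h)" unfolding mf_def
  proof (intro conjI ballI)
    show "lf (sw h)" using h by (intro lin)
    fix x assume "x \<in> I (\<alpha> + \<beta>)"
    with h show "sw h x = 0"
      by (intro I_cop[of h \<alpha> \<beta>] lin) (auto simp: bmf_def mf_def)
  qed
qed

lemma mf_sw_param [modlin]:
  "x \<in> carrier U \<Longrightarrow> (\<And>p q. p \<in> carrier U \<Longrightarrow> q \<in> carrier U \<Longrightarrow> mf \<gamma> (\<lambda>z. h z p q)) \<Longrightarrow>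
   mf \<gamma> (\<lambda>z. sw (h z) x)"
proof -
  assume x: "x \<in> carrier U" and h: "\<And>p q. p \<in> carrier U \<Longrightarrow> q \<in> carrier U \<Longrightarrow> mf \<gamma> (\<lambda>z. h z p q)"
  have "lf (\<lambda>z. sw (h z) x)" by (intro lf_sw_param x mf_lf[OF h])
  moreover have "sw (h z) x = 0" if "z \<in> I \<gamma>" for z
  proof -
    have "sw (h z) x = sw (\<lambda>p q. 0) x" using h that by (intro sw_cong[OF x]) (simp add: mf_def)
    then show ?thesis by simp
  qed
  ultimately show ?thesis by (simp add: mf_def)
qed

end

text \<open>\<open>Y\<close> lifts a two-sided cointegral of the quotient by \<open>I 0\<close>: it
  absorbs elements through the counit only when tested by forms on that quotient.\<close>

locale gcoalgebra_integral = hopf_gcoalgebra U \<Delta> \<epsilon> S g I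
  for U :: "'a calg" (structure) and \<Delta> \<epsilon> S g and I :: "'g::ab_group_add \<Rightarrow> 'a set" +
  fixes L :: "'g::ab_group_add \<Rightarrow> 'a \<Rightarrow> complex" and Y :: 'a
  assumes mf_L: "mf \<gamma> (L \<gamma>)"
    and right_integral: "mf \<beta> f \<Longrightarrow> x \<in> carrier U \<Longrightarrow>
      tev (\<lambda>p q. L \<alpha> p * f q) (\<Delta> x) = L (\<alpha> + \<beta>) x * f \<one>"
    and Y_closed [simp]: "Y \<in> carrier U"
    and Y_left: "mf 0 f \<Longrightarrow> x \<in> carrier U \<Longrightarrow> f (x \<otimes> Y) = \<epsilon> x * f Y"
    and Y_right: "mf 0 f \<Longrightarrow> x \<in> carrier U \<Longrightarrow> f (Y \<otimes> x) = \<epsilon> x * f Y"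
    and L_Y: "L 0 Y = 1"
begin

section \<open>Nondegeneracy of the cointegral and its consequences\<close>

lemmas mf_L' [modlin] = mf_lmod[OF mf_L]
lemmas lf_L [lin] = lform_lmap[OF mf_lf[OF mf_L]]

text \<open>Y_1 x \<otimes> Y_2 equals (Y x_1)_1 \<otimes> (Y x_1)_2 S(x_2), and Y absorbs x_1. The
  indices \<gamma> and -\<gamma> add up to 0, where absorption is available.\<close>

lemma Y_move_right:
  assumes h: "bmf \<gamma> (- \<gamma>) h" and x: "x \<in> carrier U"
  shows "sw (\<lambda>p q. h (p \<otimes> x) q) Y = sw (\<lambda>p q. h p (q \<otimes> S x)) Y"
proof -
  note [lin] = bform_lform1[OF bmf_bf[OF h]] bform_lform2[OF bmf_bf[OF h]]
  note [modlin] = bmf_mf1[OF h] bmf_mf2[OF h]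
  have "sw (\<lambda>p q. h (p \<otimes> x) q) Y = sw (\<lambda>x1 x2. sw (\<lambda>p q. h (p \<otimes> x1) q) Y * \<epsilon> x2) x"
    by (rule sw_counit_right[symmetric]) ((intro lin)?; simp add: x)+
  also have "\<dots> = sw (\<lambda>x1 x2. sw (\<lambda>a b. sw (\<lambda>p q. h (p \<otimes> x1) (q \<otimes> a \<otimes> S b)) Y) x2) x"
  proof (intro sw_cong[OF x])
    fix x1 x2 assume c: "x1 \<in> carrier U" "x2 \<in> carrier U"
    have l: "lf (\<lambda>z. sw (\<lambda>p q. h (p \<otimes> x1) (q \<otimes> z)) Y)" by ((intro lin)?; simp add: c)
    show "sw (\<lambda>p q. h (p \<otimes> x1) q) Y * \<epsilon> x2
        = sw (\<lambda>a b. sw (\<lambda>p q. h (p \<otimes> x1) (q \<otimes> a \<otimes> S b)) Y) x2"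
      using sw_antipode_right[OF l c(2)] by (simp add: c m_assoc mult.commute cong: sw_cong)
  qed
  also have "\<dots> = sw (\<lambda>w b. sw (\<lambda>x1 a. sw (\<lambda>p q. h (p \<otimes> x1) (q \<otimes> a \<otimes> S b)) Y) w) x"
    by (rule sw_coassoc[symmetric]) ((intro lin)?; simp add: x)+
  also have "\<dots> = sw (\<lambda>w b. \<epsilon> w * sw (\<lambda>p q. h p (q \<otimes> S b)) Y) x"
  proof (intro sw_cong[OF x])
    fix w b assume c: "w \<in> carrier U" "b \<in> carrier U"
    have b: "bmf \<gamma> (- \<gamma>) (\<lambda>p q. h p (q \<otimes> S b))" by (intro modlin) (simp_all add: c)
    have "sw (\<lambda>x1 a. sw (\<lambda>p q. h (p \<otimes> x1) (q \<otimes> a \<otimes> S b)) Y) w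
        = sw (\<lambda>p q. sw (\<lambda>x1 a. h (p \<otimes> x1) (q \<otimes> a \<otimes> S b)) w) Y"
      by (rule tev_swap)
    also have "\<dots> = sw (\<lambda>p q. h p (q \<otimes> S b)) (Y \<otimes> w)"
      using sw_mult[OF bmf_bf[OF b] Y_closed c(1)] by simp
    also have "\<dots> = \<epsilon> w * sw (\<lambda>p q. h p (q \<otimes> S b)) Y"
      by (rule Y_right) (rule mf_sw[OF b], simp add: lmod_id, rule c)
    finally show "sw (\<lambda>x1 a. sw (\<lambda>p q. h (p \<otimes> x1) (q \<otimes> a \<otimes> S b)) Y) w
        = \<epsilon> w * sw (\<lambda>p q. h p (q \<otimes> S b)) Y" .
  qed
  also have "\<dots> = sw (\<lambda>p q. h p (q \<otimes> S x)) Y"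
    by (rule sw_counit_left) ((intro lin)?; simp add: x)+
  finally show ?thesis .
qed

lemma Y_move_left:
  assumes h: "bmf \<gamma> (- \<gamma>) h" and x: "x \<in> carrier U"
  shows "sw (\<lambda>p q. h p (x \<otimes> q)) Y = sw (\<lambda>p q. h (S x \<otimes> p) q) Y"
proof -
  note [lin] = bform_lform1[OF bmf_bf[OF h]] bform_lform2[OF bmf_bf[OF h]]
  note [modlin] = bmf_mf1[OF h] bmf_mf2[OF h]
  have "sw (\<lambda>p q. h p (x \<otimes> q)) Y = sw (\<lambda>x1 x2. \<epsilon> x1 * sw (\<lambda>p q. h p (x2 \<otimes> q)) Y) x"
    by (rule sw_counit_left[symmetric]) ((intro lin)?; simp add: x)+
  also have "\<dots> = sw (\<lambda>x1 x2. sw (\<lambda>a b. sw (\<lambda>p q. h (S a \<otimes> (b \<otimes> p)) (x2 \<otimes> q)) Y) x1) x"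
  proof (intro sw_cong[OF x])
    fix x1 x2 assume c: "x1 \<in> carrier U" "x2 \<in> carrier U"
    have l: "lf (\<lambda>z. sw (\<lambda>p q. h (z \<otimes> p) (x2 \<otimes> q)) Y)" by ((intro lin)?; simp add: c)
    show "\<epsilon> x1 * sw (\<lambda>p q. h p (x2 \<otimes> q)) Y
        = sw (\<lambda>a b. sw (\<lambda>p q. h (S a \<otimes> (b \<otimes> p)) (x2 \<otimes> q)) Y) x1"
      using sw_antipode_left[OF l c(1)] by (simp add: c m_assoc cong: sw_cong)
  qed
  also have "\<dots> = sw (\<lambda>a r. sw (\<lambda>b x2. sw (\<lambda>p q. h (S a \<otimes> (b \<otimes> p)) (x2 \<otimes> q)) Y) r) x"
    by (rule sw_coassoc) ((intro lin)?; simp add: x)+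
  also have "\<dots> = sw (\<lambda>a r. sw (\<lambda>p q. h (S a \<otimes> p) q) Y * \<epsilon> r) x"
  proof (intro sw_cong[OF x])
    fix a r assume c: "a \<in> carrier U" "r \<in> carrier U"
    have b: "bmf \<gamma> (- \<gamma>) (\<lambda>p q. h (S a \<otimes> p) q)" by (intro modlin) (simp_all add: c)
    have "sw (\<lambda>b x2. sw (\<lambda>p q. h (S a \<otimes> (b \<otimes> p)) (x2 \<otimes> q)) Y) r
        = sw (\<lambda>p q. h (S a \<otimes> p) q) (r \<otimes> Y)"
      using sw_mult[OF bmf_bf[OF b] c(2) Y_closed] by simp
    also have "\<dots> = \<epsilon> r * sw (\<lambda>p q. h (S a \<otimes> p) q) Y"
      by (rule Y_left) (rule mf_sw[OF b], simp add: lmod_id, rule c)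
    finally show "sw (\<lambda>b x2. sw (\<lambda>p q. h (S a \<otimes> (b \<otimes> p)) (x2 \<otimes> q)) Y) r
        = sw (\<lambda>p q. h (S a \<otimes> p) q) Y * \<epsilon> r" by simp
  qed
  also have "\<dots> = sw (\<lambda>p q. h (S x \<otimes> p) q) Y"
    by (rule sw_counit_right) ((intro lin)?; simp add: x)+
  finally show ?thesis .
qed

lemma integral_Y: "mf (- \<gamma>) f \<Longrightarrow> sw (\<lambda>p q. L \<gamma> p * f q) Y = f \<one>"
  using right_integral[of "- \<gamma>" f Y \<gamma>] by (simp add: L_Y)

text \<open>S reverses the coproduct, and \<open>Si\<close> compensates for it in the argument of f;
  so the composite of the integral with S inherits the mirrored property and is a left
  integral.\<close>

lemma antipode_integral:
  assumes f: "mf \<alpha> f" and x: "x \<in> carrier U"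
  shows "sw (\<lambda>p q. f p * L (- \<beta>) (S q)) x = f \<one> * L (- (\<alpha> + \<beta>)) (S x)"
proof -
  have E: "mf (- \<alpha>) (\<lambda>z. f (Si z))" by (intro mf_lmod[OF f] modlin) simp
  have h: "bf (\<lambda>a b. L (- \<beta>) a * f (Si b))"
    by (intro bform_prod mf_lf[OF E] mf_lf[OF mf_L])
  have "sw (\<lambda>p q. f p * L (- \<beta>) (S q)) x = sw (\<lambda>p q. L (- \<beta>) (S q) * f (Si (S p))) x"
    by (intro sw_cong[OF x]) simp
  also have "\<dots> = sw (\<lambda>a b. L (- \<beta>) a * f (Si b)) (S x)"
    by (rule sw_antipode[OF h x, symmetric])
  also have "\<dots> = L (- (\<alpha> + \<beta>)) (S x) * f \<one>"
    using right_integral[OF E, of "S x" "- \<beta>"] x by (simp add: minus_diff_commute)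
  finally show ?thesis by simp
qed

text \<open>The number \<lambda>(Y_1) \<lambda>(Y Y_2) is computed twice. The integral property
  gives \<lambda>(Y) = 1. Moving the inner Y to the left leg gives \<lambda>(S(Y)) \<lambda>(Y),
  because S(Y) absorbs elements on its right.\<close>

lemma L_antipode_Y: "L 0 (S Y) = 1"
proof -
  have int: "f (S Y \<otimes> x) = \<epsilon> x * f (S Y)" if f: "mf 0 f" and x: "x \<in> carrier U" for f x
  proof -
    have "mf 0 (\<lambda>z. f (S z))" by (intro mf_lmod[OF f] modlin) simp
    from Y_left[OF this, of "Si x"] x show ?thesis
      using counit_antipode[of "Si x"] by simp
  qed
  have b: "bmf 0 (- 0) (\<lambda>p q. L 0 p * L 0 q)" by (intro modlin) simp_all
  have "1 = sw (\<lambda>p q. L 0 p * L 0 (Y \<otimes> q)) Y"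
    using integral_Y[OF mf_lmod[OF mf_L lmod_mult_left[OF Y_closed lmod_id]], of 0 0] by (simp add: L_Y)
  also have "\<dots> = sw (\<lambda>p q. L 0 (S Y \<otimes> p) * L 0 q) Y"
    by (rule Y_move_left[OF b Y_closed])
  also have "\<dots> = sw (\<lambda>p q. L 0 (S Y) * (\<epsilon> p * L 0 q)) Y"
    by (intro sw_cong) (simp_all add: int[OF mf_L])
  also have "\<dots> = L 0 (S Y) * L 0 Y"
    using sw_counit_left[OF mf_lf[OF mf_L] Y_closed] by (simp add: tev_mult_left)
  finally show ?thesis by (simp add: L_Y)
qed

text \<open>The coproduct of Y is a nondegenerate tensor: D(v) = D(Y_1 v) \<lambda>(S(Y_2)), and
  moving v across turns this into D(Y_1) f(Y_2) with f(q) = \<lambda>(S(q S(v))).\<close>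

lemma mf_zero_left:
  assumes D: "mf \<gamma> D" and z: "\<And>f. mf (- \<gamma>) f \<Longrightarrow> sw (\<lambda>p q. D p * f q) Y = 0" and v: "v \<in> carrier U"
  shows "D v = 0"
proof -
  let ?f = "\<lambda>q. L (- (- \<gamma>)) (S q)"
  have f: "mf (- \<gamma>) ?f" by (intro modlin) simp
  have Dv: "mf \<gamma> (\<lambda>p. D (p \<otimes> v))" by (intro mf_lmod[OF D] modlin v refl)
  have b: "bmf \<gamma> (- \<gamma>) (\<lambda>p q. D p * ?f q)"
    by (intro bmfI mf_mult_left mf_mult_right D f)
  have "D v = sw (\<lambda>p q. D (p \<otimes> v) * ?f q) Y"
    using antipode_integral[OF Dv Y_closed, of "- \<gamma>"] v by (simp add: L_antipode_Y)
  also have "\<dots> = sw (\<lambda>p q. D p * ?f (q \<otimes> S v)) Y"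
    by (rule Y_move_right[OF b v])
  also have "\<dots> = 0" by (intro z mf_lmod[OF f] modlin) (simp_all add: v)
  finally show ?thesis .
qed

lemma mf_zero_right:
  assumes D: "mf (- \<gamma>) D" and z: "\<And>f. mf \<gamma> f \<Longrightarrow> sw (\<lambda>p q. f p * D q) Y = 0" and v: "v \<in> carrier U"
  shows "D v = 0"
proof -
  have Dv: "mf (- \<gamma>) (\<lambda>p. D (p \<otimes> v))" by (intro mf_lmod[OF D] modlin v refl)
  have b: "bmf \<gamma> (- \<gamma>) (\<lambda>p q. L \<gamma> p * D q)"
    by (intro bmfI mf_mult_left mf_mult_right D mf_L)
  have "D v = sw (\<lambda>p q. L \<gamma> p * D (q \<otimes> v)) Y"
    using integral_Y[OF Dv] v by simp
  also have "\<dots> = sw (\<lambda>p q. L \<gamma> (p \<otimes> Si v) * D q) Y"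
    using Y_move_right[OF b, of "Si v"] v by simp
  also have "\<dots> = 0" by (intro z mf_lmod[OF mf_L] modlin) (simp_all add: v)
  finally show ?thesis .
qed

text \<open>The Nakayama automorphism of the integral is S^2. Contracted with Y, both forms of y
  send f to f(S(x)), each by moving the factor to the other leg and integrating.\<close>

lemma L_commute:
  assumes x: "x \<in> carrier U" and y: "y \<in> carrier U"
  shows "L \<gamma> (y \<otimes> x) = L \<gamma> (S (S x) \<otimes> y)"
proof -
  let ?D = "\<lambda>y. L \<gamma> (y \<otimes> x) - L \<gamma> (S (S x) \<otimes> y)"
  have "?D y = 0"
  proof (rule mf_zero_left[OF _ _ y])
    show "mf \<gamma> ?D" by (intro mf_minus modlin) (simp_all add: x)
    fix f assume f: "mf (- \<gamma>) f"
    have b: "bmf \<gamma> (- \<gamma>) (\<lambda>p q. L \<gamma> p * f q)"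
      by (intro bmfI mf_mult_left mf_mult_right f mf_L)
    have "sw (\<lambda>p q. L \<gamma> (p \<otimes> x) * f q) Y = f (S x)"
      using Y_move_right[OF b x] integral_Y[OF mf_lmod[OF f lmod_mult_right[OF antipode_closed[OF x] lmod_id[OF refl]]]]
      by (simp add: x)
    moreover have "sw (\<lambda>p q. L \<gamma> (S (S x) \<otimes> p) * f q) Y = f (S x)"
      using Y_move_left[OF b antipode_closed[OF x]]
        integral_Y[OF mf_lmod[OF f lmod_mult_left[OF antipode_closed[OF x] lmod_id[OF refl]]]]
      by (simp add: x)
    ultimately show "sw (\<lambda>p q. ?D p * f q) Y = 0"
      by (simp add: left_diff_distrib tev_diff)
  qed
  then show ?thesis by simp
qed

text \<open>Both sides, as forms in x, have the same contraction with Y, and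
  \<open>mf_zero_left\<close> identifies them.\<close>

lemma integral_unique:
  assumes L': "\<And>\<gamma>. mf \<gamma> (L' \<gamma>)"
    and int: "\<And>\<alpha> \<beta> f x. mf \<beta> f \<Longrightarrow> x \<in> carrier U \<Longrightarrow>
      tev (\<lambda>p q. L' \<alpha> p * f q) (\<Delta> x) = L' (\<alpha> + \<beta>) x * f \<one>"
    and x: "x \<in> carrier U"
  shows "L' \<gamma> x = L' 0 Y * L \<gamma> x"
proof -
  let ?D = "\<lambda>y. L' \<gamma> y - L' 0 Y * L \<gamma> y"
  have "?D x = 0"
  proof (rule mf_zero_left[OF _ _ x])
    show "mf \<gamma> ?D" by (intro mf_minus L' mf_mult_left mf_L)
    fix f assume f: "mf (- \<gamma>) f"
    show "sw (\<lambda>p q. ?D p * f q) Y = 0"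
      using int[OF f Y_closed, of \<gamma>] integral_Y[OF f]
      by (simp add: left_diff_distrib tev_diff mult.assoc tev_mult_left)
  qed
  then show ?thesis by simp
qed

section \<open>The symmetrised integral and partial traces\<close>

definition mu :: "'g \<Rightarrow> 'a \<Rightarrow> complex" where
  "mu \<gamma> x = L \<gamma> (g \<otimes> x)"

lemma mf_mu: "mf \<gamma> (mu \<gamma>)"
  unfolding mu_def by (intro modlin) simp_all

lemmas mf_mu' [modlin] = mf_lmod[OF mf_mu]
lemmas lf_mu [lin] = lform_lmap[OF mf_lf[OF mf_mu]]

text \<open>The conjugation by g hidden in S^2 cancels against the g built into
  \<open>mu\<close>.\<close>

lemma mu_commute: "x \<in> carrier U \<Longrightarrow> y \<in> carrier U \<Longrightarrow> mu \<gamma> (x \<otimes> y) = mu \<gamma> (y \<otimes> x)"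
  unfolding mu_def
  using L_commute[of y "g \<otimes> x" \<gamma>] by (simp add: antipode_square m_assoc)

text \<open>The hypothesis says that the distinguished element is g^2. Under it both forms of x,
  placed on the second leg of the coproduct of Y against any f on the first, give f(1).\<close>

lemma antipode_L_if:
  assumes A: "\<And>\<gamma> f. mf \<gamma> f \<Longrightarrow> sw (\<lambda>p q. f p * L (- \<gamma>) q) Y = f (g \<otimes> g)" and x: "x \<in> carrier U"
  shows "L \<gamma> (g \<otimes> (g \<otimes> x)) = L (- \<gamma>) (S x)"
proof -
  let ?D = "\<lambda>x. L \<gamma> (g \<otimes> (g \<otimes> x)) - L (- \<gamma>) (S x)"
  have "?D x = 0"
  proof (rule mf_zero_right[of "- \<gamma>", OF _ _ x])
    show "mf (- (- \<gamma>)) ?D" by (intro mf_minus modlin) simp_all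
    fix f assume f: "mf (- \<gamma>) f"
    have b: "bmf (- \<gamma>) (- (- \<gamma>)) (\<lambda>p q. f p * L \<gamma> q)"
      using mf_L[of \<gamma>] by (intro bmfI mf_mult_left mf_mult_right f) simp
    have "sw (\<lambda>p q. f p * L \<gamma> (g \<otimes> (g \<otimes> q))) Y = sw (\<lambda>p q. f p * L \<gamma> (g \<otimes> g \<otimes> q)) Y"
      by (intro sw_cong) (simp_all add: m_assoc)
    also have "\<dots> = sw (\<lambda>p q. f (S (g \<otimes> g) \<otimes> p) * L \<gamma> q) Y"
      by (rule Y_move_left[OF b]) simp
    also have "\<dots> = f \<one>"
      using A[OF mf_lmod[OF f lmod_mult_left[OF _ lmod_id[OF refl]]], of "S (g \<otimes> g)"]
      by (simp add: m_assoc)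
    finally show "sw (\<lambda>p q. f p * ?D q) Y = 0"
      using antipode_integral[OF f Y_closed, of \<gamma>]
      by (simp add: right_diff_distrib tev_diff L_antipode_Y)
  qed
  then show ?thesis by simp
qed

context
  assumes L_antipode: "\<And>\<gamma> x. x \<in> carrier U \<Longrightarrow> L \<gamma> (g \<otimes> (g \<otimes> x)) = L (- \<gamma>) (S x)"
begin

lemma left_integral:
  assumes f: "mf \<alpha> f" and x: "x \<in> carrier U"
  shows "sw (\<lambda>p q. f p * L \<beta> (g \<otimes> (g \<otimes> q))) x = f \<one> * L (\<alpha> + \<beta>) (g \<otimes> (g \<otimes> x))"
  using antipode_integral[OF f x, of \<beta>] by (simp add: L_antipode x cong: sw_cong)

text \<open>The right integral property at g p: the g in front of p_1 is absorbed into
  \<open>mu\<close>, and S(g p_2) = S(p_2) \<open>gi\<close> cancels the g in front of q.\<close>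

lemma mu_right:
  assumes F: "mf \<beta> F" and c: "p \<in> carrier U" "q \<in> carrier U"
  shows "sw (\<lambda>p1 p2. mu (\<alpha> + \<beta>) p1 * F (S p2 \<otimes> q)) p = mu \<alpha> p * F (g \<otimes> q)"
proof -
  have f: "mf (- \<beta>) (\<lambda>b. F (S b \<otimes> (g \<otimes> q)))" by (intro mf_lmod[OF F] modlin) (simp_all add: c)
  have "mu \<alpha> p * F (g \<otimes> q) = sw (\<lambda>a b. L (\<alpha> + \<beta>) a * F (S b \<otimes> (g \<otimes> q))) (g \<otimes> p)"
    using right_integral[OF f, of "g \<otimes> p" "\<alpha> + \<beta>"] c by (simp add: mu_def)
  also have "\<dots> = sw (\<lambda>p1 p2. L (\<alpha> + \<beta>) (g \<otimes> p1) * F (S (g \<otimes> p2) \<otimes> (g \<otimes> q))) p"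
    by (rule sw_pivot_mult) (intro bform_prod mf_lf[OF f] mf_lf[OF mf_L], rule c)
  also have "\<dots> = sw (\<lambda>p1 p2. mu (\<alpha> + \<beta>) p1 * F (S p2 \<otimes> q)) p"
    by (intro sw_cong) (simp_all add: c mu_def m_assoc)
  finally show ?thesis ..
qed

text \<open>The left integral property at \<open>gi\<close> q: g^2 times \<open>gi\<close> leaves
  the g of \<open>mu\<close>, and \<open>Si\<close> of \<open>gi\<close> q_1 contributes a g that
  cancels the \<open>gi\<close> in front of p.\<close>

lemma mu_left:
  assumes F: "mf \<alpha> F" and c: "p \<in> carrier U" "q \<in> carrier U"
  shows "sw (\<lambda>q1 q2. F (Si q1 \<otimes> p) * mu (\<alpha> + \<beta>) q2) q = F (gi \<otimes> p) * mu \<beta> q"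
proof -
  have f: "mf (- \<alpha>) (\<lambda>a. F (Si a \<otimes> (gi \<otimes> p)))" by (intro mf_lmod[OF F] modlin) (simp_all add: c)
  have "F (gi \<otimes> p) * mu \<beta> q
      = sw (\<lambda>a b. F (Si a \<otimes> (gi \<otimes> p)) * L (\<alpha> + \<beta>) (g \<otimes> (g \<otimes> b))) (gi \<otimes> q)"
    using left_integral[OF f, of "gi \<otimes> q" "\<alpha> + \<beta>"] c by (simp add: mu_def)
  also have "\<dots> = sw (\<lambda>a b. F (Si (gi \<otimes> a) \<otimes> (gi \<otimes> p)) * L (\<alpha> + \<beta>) (g \<otimes> (g \<otimes> (gi \<otimes> b)))) q"
    by (rule sw_gi_mult) (intro bform_prod mf_lf[OF f] lin c; simp)+
  also have "\<dots> = sw (\<lambda>q1 q2. F (Si q1 \<otimes> p) * mu (\<alpha> + \<beta>) q2) q"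
    by (intro sw_cong) (simp_all add: c mu_def m_assoc)
  finally show ?thesis ..
qed

text \<open>The \<open>U\<close>-module \<open>U\<^sub>\<alpha> \<otimes> U\<^sub>\<beta>\<close> is free over \<open>U\<^sub>\<alpha>\<^sub>+\<^sub>\<beta>\<close> both on \<open>1 \<otimes> U\<^sub>\<beta>\<close> and on
  \<open>U\<^sub>\<alpha> \<otimes> 1\<close>. The two sides are the trace, weighted by \<open>mu\<close>, of the module endomorphism
  \<open>\<Sum> p k \<otimes> q k\<close> computed in these two bases.\<close>

theorem partial_traces_agree:
  assumes pq: "\<And>k. k \<in> K \<Longrightarrow> p k \<in> carrier U" "\<And>k. k \<in> K \<Longrightarrow> q k \<in> carrier U"
    and cen: "\<And>h c. bmf \<alpha> \<beta> h \<Longrightarrow> c \<in> carrier U \<Longrightarrow>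
      (\<Sum>k\<in>K. sw (\<lambda>c1 c2. h (p k \<otimes> c1) (q k \<otimes> c2)) c) = (\<Sum>k\<in>K. sw (\<lambda>c1 c2. h (c1 \<otimes> p k) (c2 \<otimes> q k)) c)"
    and x: "\<And>i. i \<in> A \<Longrightarrow> x i \<in> carrier U" "\<And>i. i \<in> A \<Longrightarrow> mf \<alpha> (xf i)"
      "\<And>f u. mf \<alpha> f \<Longrightarrow> u \<in> carrier U \<Longrightarrow> (\<Sum>i\<in>A. xf i u * f (x i)) = f u"
    and y: "\<And>j. j \<in> B \<Longrightarrow> y j \<in> carrier U" "\<And>j. j \<in> B \<Longrightarrow> mf \<beta> (yf j)"
      "\<And>f u. mf \<beta> f \<Longrightarrow> u \<in> carrier U \<Longrightarrow> (\<Sum>j\<in>B. yf j u * f (y j)) = f u"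
  shows "(\<Sum>k\<in>K. mu \<alpha> (p k) * (\<Sum>j\<in>B. yf j (g \<otimes> (q k \<otimes> y j))))
    = (\<Sum>k\<in>K. (\<Sum>i\<in>A. xf i (gi \<otimes> (p k \<otimes> x i))) * mu \<beta> (q k))"
proof -
  \<comment> \<open>P \<otimes> Q is the image of P_1 \<otimes> S(P_2) Q under u \<otimes> y ->
    \<Delta>(u)(1 \<otimes> y). So \<Phi> j is \<open>mu\<close> of the coefficient of P \<otimes> Q
    at the basis element 1 \<otimes> y j.\<close>
  define \<Phi> where "\<Phi> j P Q = sw (\<lambda>p1 p2. mu (\<alpha> + \<beta>) p1 * yf j (S p2 \<otimes> Q)) P" for j P Q
  note xl = mf_lmod[OF x(2)] and yl = mf_lmod[OF y(2)]
  have \<Phi>: "bmf \<alpha> \<beta> (\<Phi> j)" if j: "j \<in> B" for j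
  proof (rule bmfI)
    fix Q assume Q: "Q \<in> carrier U"
    have "bmf (\<alpha> + \<beta>) (- \<beta>) (\<lambda>p1 p2. mu (\<alpha> + \<beta>) p1 * yf j (S p2 \<otimes> Q))"
      by (intro modlin yl[OF j]) (simp_all add: Q)
    then show "mf \<alpha> (\<lambda>P. \<Phi> j P Q)" unfolding \<Phi>_def by (rule mf_sw) (simp add: lmod_id)
  next
    fix P assume P: "P \<in> carrier U"
    show "mf \<beta> (\<lambda>Q. \<Phi> j P Q)" unfolding \<Phi>_def
      by (intro modlin yl[OF j] P) simp_all
  qed
  \<comment> \<open>Change of basis: 1 \<otimes> Y = \<Delta>(Y_2)(Si(Y_1) \<otimes> 1), since Y_2
    Si(Y_1) collapses, and Si(Y_1) is then expanded in the x i.\<close>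
  have step1: "h P (Q \<otimes> Y) = (\<Sum>i\<in>A. sw (\<lambda>a r. xf i (Si a) * sw (\<lambda>b c. h (P \<otimes> b \<otimes> x i) (Q \<otimes> c)) r) Y)"
    if h: "bmf \<alpha> \<beta> h" and c: "P \<in> carrier U" "Q \<in> carrier U" "Y \<in> carrier U" for h P Q Y
  proof -
    note [lin] = bform_lform1[OF bmf_bf[OF h]] bform_lform2[OF bmf_bf[OF h]]
    have "(\<Sum>i\<in>A. sw (\<lambda>a r. xf i (Si a) * sw (\<lambda>b c. h (P \<otimes> b \<otimes> x i) (Q \<otimes> c)) r) Y)
        = sw (\<lambda>a r. sw (\<lambda>b c. \<Sum>i\<in>A. xf i (Si a) * h (P \<otimes> b \<otimes> x i) (Q \<otimes> c)) r) Y"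
      by (simp add: tev_sum tev_mult_left)
    also have "\<dots> = sw (\<lambda>a r. sw (\<lambda>b d. h (P \<otimes> b \<otimes> Si a) (Q \<otimes> d)) r) Y"
    proof (intro sw_cong c)
      fix a r b d assume c': "a \<in> carrier U" "r \<in> carrier U" "b \<in> carrier U" "d \<in> carrier U"
      show "(\<Sum>i\<in>A. xf i (Si a) * h (P \<otimes> b \<otimes> x i) (Q \<otimes> d)) = h (P \<otimes> b \<otimes> Si a) (Q \<otimes> d)"
        by (rule x(3)[of "\<lambda>u. h (P \<otimes> b \<otimes> u) (Q \<otimes> d)"])
          ((intro bmf_mf1[OF h] modlin)?; simp add: c c')+
    qed
    also have "\<dots> = sw (\<lambda>w d. sw (\<lambda>a b. h (P \<otimes> b \<otimes> Si a) (Q \<otimes> d)) w) Y"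
      by (rule sw_coassoc[symmetric]) ((intro lin)?; simp add: c)+
    also have "\<dots> = sw (\<lambda>w d. \<epsilon> w * h P (Q \<otimes> d)) Y"
    proof (intro sw_cong c)
      fix w d assume c': "w \<in> carrier U" "d \<in> carrier U"
      have "lf (\<lambda>z. h (P \<otimes> z) (Q \<otimes> d))" by ((intro lin)?; simp add: c c')
      from sw_Si_right[OF this c'(1)]
      show "sw (\<lambda>a b. h (P \<otimes> b \<otimes> Si a) (Q \<otimes> d)) w = \<epsilon> w * h P (Q \<otimes> d)"
        by (simp add: c c' m_assoc cong: sw_cong)
    qed
    also have "\<dots> = h P (Q \<otimes> Y)"
      by (rule sw_counit_left) ((intro lin)?; simp add: c)+
    finally show ?thesis ..
  qed
  \<comment> \<open>Coefficients are linear over the coproduct: acting by \<Delta>(r) multiplies the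
    first factor by r, because S(r_2) r_3 cancels in the second.\<close>
  have step2: "sw (\<lambda>b c. \<Phi> j (b \<otimes> P) (c \<otimes> Q)) r = sw (\<lambda>P1 P2. mu (\<alpha> + \<beta>) (r \<otimes> P1) * yf j (S P2 \<otimes> Q)) P"
    if j: "j \<in> B" and c: "P \<in> carrier U" "Q \<in> carrier U" "r \<in> carrier U" for j P Q r
  proof -
    note [lin] = lform_lmap[OF mf_lf[OF y(2)[OF j]]]
    have "sw (\<lambda>b d. \<Phi> j (b \<otimes> P) (d \<otimes> Q)) r
        = sw (\<lambda>b d. sw (\<lambda>b1 b2. sw (\<lambda>P1 P2. mu (\<alpha> + \<beta>) (b1 \<otimes> P1) * yf j (S (b2 \<otimes> P2) \<otimes> (d \<otimes> Q))) P) b) r"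
    proof (intro sw_cong c)
      fix b d assume c': "b \<in> carrier U" "d \<in> carrier U"
      show "\<Phi> j (b \<otimes> P) (d \<otimes> Q)
        = sw (\<lambda>b1 b2. sw (\<lambda>P1 P2. mu (\<alpha> + \<beta>) (b1 \<otimes> P1) * yf j (S (b2 \<otimes> P2) \<otimes> (d \<otimes> Q))) P) b"
        unfolding \<Phi>_def by (rule sw_mult) ((intro lin)?; simp add: c c')+
    qed
    also have "\<dots> = sw (\<lambda>b1 s. sw (\<lambda>b2 d. sw (\<lambda>P1 P2. mu (\<alpha> + \<beta>) (b1 \<otimes> P1) * yf j (S (b2 \<otimes> P2) \<otimes> (d \<otimes> Q))) P) s) r"
      by (rule sw_coassoc) ((intro lin)?; simp add: c)+
    also have "\<dots> = sw (\<lambda>b1 s. sw (\<lambda>P1 P2. mu (\<alpha> + \<beta>) (b1 \<otimes> P1) * yf j (S P2 \<otimes> Q)) P * \<epsilon> s) r"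
    proof (intro sw_cong c)
      fix b1 s assume c': "b1 \<in> carrier U" "s \<in> carrier U"
      have l: "lf (\<lambda>z. sw (\<lambda>P1 P2. mu (\<alpha> + \<beta>) (b1 \<otimes> P1) * yf j (S P2 \<otimes> z \<otimes> Q)) P)"
        by ((intro lin)?; simp add: c c')
      show "sw (\<lambda>b2 d. sw (\<lambda>P1 P2. mu (\<alpha> + \<beta>) (b1 \<otimes> P1) * yf j (S (b2 \<otimes> P2) \<otimes> (d \<otimes> Q))) P) s
        = sw (\<lambda>P1 P2. mu (\<alpha> + \<beta>) (b1 \<otimes> P1) * yf j (S P2 \<otimes> Q)) P * \<epsilon> s"
        using sw_antipode_left[OF l c'(2)] by (simp add: c c' m_assoc mult.commute cong: sw_cong)
    qed
    also have "\<dots> = sw (\<lambda>P1 P2. mu (\<alpha> + \<beta>) (r \<otimes> P1) * yf j (S P2 \<otimes> Q)) P"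
      by (rule sw_counit_right) ((intro lin)?; simp add: c)+
    finally show ?thesis .
  qed
  \<comment> \<open>Summing over j undoes the expansion in the y j. What remains is
    \<open>mu\<close> of the coefficient of P \<otimes> Q at x i \<otimes> 1; the trace property of
    \<open>mu\<close> is needed to bring P_1 next to S(P_2).\<close>
  have step3: "(\<Sum>j\<in>B. sw (\<lambda>a r. xf i (Si a) * sw (\<lambda>P1 P2. mu (\<alpha> + \<beta>) (r \<otimes> P1) * yf j (S P2 \<otimes> Q)) P) (y j))
      = sw (\<lambda>q1 q2. xf i (Si q1 \<otimes> P) * mu (\<alpha> + \<beta>) q2) Q"
    if i: "i \<in> A" and c: "P \<in> carrier U" "Q \<in> carrier U" for i P Q
  proof -
    note [lin] = lform_lmap[OF mf_lf[OF x(2)[OF i]]]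
    have "(\<Sum>j\<in>B. sw (\<lambda>a r. xf i (Si a) * sw (\<lambda>P1 P2. mu (\<alpha> + \<beta>) (r \<otimes> P1) * yf j (S P2 \<otimes> Q)) P) (y j))
        = (\<Sum>j\<in>B. sw (\<lambda>P1 P2. yf j (S P2 \<otimes> Q) * sw (\<lambda>a r. xf i (Si a) * mu (\<alpha> + \<beta>) (r \<otimes> P1)) (y j)) P)"
      by (intro sum.cong refl)
        (simp add: tev_mult_left[symmetric], subst tev_swap, simp add: mult_ac)
    also have "\<dots> = sw (\<lambda>P1 P2. sw (\<lambda>a r. xf i (Si a) * mu (\<alpha> + \<beta>) (r \<otimes> P1)) (S P2 \<otimes> Q)) P"
      unfolding tev_sum[symmetric]
    proof (intro sw_cong c)
      fix P1 P2 assume c': "P1 \<in> carrier U" "P2 \<in> carrier U"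
      have "bmf (- \<alpha>) (\<alpha> + \<beta>) (\<lambda>a r. xf i (Si a) * mu (\<alpha> + \<beta>) (r \<otimes> P1))"
        by (intro modlin xl[OF i]) (simp_all add: c c')
      from mf_sw[OF this, of \<beta> "\<lambda>x. x"]
      have "mf \<beta> (\<lambda>Y. sw (\<lambda>a r. xf i (Si a) * mu (\<alpha> + \<beta>) (r \<otimes> P1)) Y)" by (simp add: lmod_id)
      then show "(\<Sum>j\<in>B. yf j (S P2 \<otimes> Q) * sw (\<lambda>a r. xf i (Si a) * mu (\<alpha> + \<beta>) (r \<otimes> P1)) (y j))
          = sw (\<lambda>a r. xf i (Si a) * mu (\<alpha> + \<beta>) (r \<otimes> P1)) (S P2 \<otimes> Q)"
        by (rule y(3)) (simp add: c c')
    qed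
    also have "\<dots> = sw (\<lambda>P1 P2. sw (\<lambda>u v. sw (\<lambda>q1 q2. xf i (Si q1 \<otimes> v) * mu (\<alpha> + \<beta>) (P1 \<otimes> S u \<otimes> q2)) Q) P2) P"
    proof (intro sw_cong c)
      fix P1 P2 assume c': "P1 \<in> carrier U" "P2 \<in> carrier U"
      have b: "bf (\<lambda>a r. xf i (Si a) * mu (\<alpha> + \<beta>) (r \<otimes> P1))"
        by ((intro lin)?; simp add: c c')
      have "sw (\<lambda>a r. xf i (Si a) * mu (\<alpha> + \<beta>) (r \<otimes> P1)) (S P2 \<otimes> Q)
          = sw (\<lambda>a r. sw (\<lambda>q1 q2. xf i (Si (a \<otimes> q1)) * mu (\<alpha> + \<beta>) (r \<otimes> q2 \<otimes> P1)) Q) (S P2)"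
        by (rule sw_mult[OF b]) (simp_all add: c c')
      also have "\<dots> = sw (\<lambda>u v. sw (\<lambda>q1 q2. xf i (Si (S v \<otimes> q1)) * mu (\<alpha> + \<beta>) (S u \<otimes> q2 \<otimes> P1)) Q) P2"
        by (rule sw_antipode) ((intro lin)?; simp add: c c')+
      also have "\<dots> = sw (\<lambda>u v. sw (\<lambda>q1 q2. xf i (Si q1 \<otimes> v) * mu (\<alpha> + \<beta>) (P1 \<otimes> S u \<otimes> q2)) Q) P2"
      proof (intro sw_cong c c')
        fix u v q1 q2 assume c'': "u \<in> carrier U" "v \<in> carrier U" "q1 \<in> carrier U" "q2 \<in> carrier U"
        have "mu (\<alpha> + \<beta>) (S u \<otimes> q2 \<otimes> P1) = mu (\<alpha> + \<beta>) (P1 \<otimes> (S u \<otimes> q2))"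
          by (rule mu_commute) (simp_all add: c' c'')
        then show "xf i (Si (S v \<otimes> q1)) * mu (\<alpha> + \<beta>) (S u \<otimes> q2 \<otimes> P1)
            = xf i (Si q1 \<otimes> v) * mu (\<alpha> + \<beta>) (P1 \<otimes> S u \<otimes> q2)"
          by (simp add: c' c'' m_assoc)
      qed
      finally show "sw (\<lambda>a r. xf i (Si a) * mu (\<alpha> + \<beta>) (r \<otimes> P1)) (S P2 \<otimes> Q)
          = sw (\<lambda>u v. sw (\<lambda>q1 q2. xf i (Si q1 \<otimes> v) * mu (\<alpha> + \<beta>) (P1 \<otimes> S u \<otimes> q2)) Q) P2" .
    qed
    also have "\<dots> = sw (\<lambda>w v. sw (\<lambda>P1 u. sw (\<lambda>q1 q2. xf i (Si q1 \<otimes> v) * mu (\<alpha> + \<beta>) (P1 \<otimes> S u \<otimes> q2)) Q) w) P"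
      by (rule sw_coassoc[symmetric]) ((intro lin)?; simp add: c)+
    also have "\<dots> = sw (\<lambda>w v. \<epsilon> w * sw (\<lambda>q1 q2. xf i (Si q1 \<otimes> v) * mu (\<alpha> + \<beta>) q2) Q) P"
    proof (intro sw_cong c)
      fix w v assume c': "w \<in> carrier U" "v \<in> carrier U"
      have l: "lf (\<lambda>z. sw (\<lambda>q1 q2. xf i (Si q1 \<otimes> v) * mu (\<alpha> + \<beta>) (z \<otimes> q2)) Q)"
        by ((intro lin)?; simp add: c c')
      show "sw (\<lambda>P1 u. sw (\<lambda>q1 q2. xf i (Si q1 \<otimes> v) * mu (\<alpha> + \<beta>) (P1 \<otimes> S u \<otimes> q2)) Q) w
          = \<epsilon> w * sw (\<lambda>q1 q2. xf i (Si q1 \<otimes> v) * mu (\<alpha> + \<beta>) q2) Q"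
        using sw_antipode_right[OF l c'(1)] by (simp add: c c' cong: sw_cong)
    qed
    also have "\<dots> = sw (\<lambda>q1 q2. xf i (Si q1 \<otimes> P) * mu (\<alpha> + \<beta>) q2) Q"
      by (rule sw_counit_left) ((intro lin)?; simp add: c)+
    finally show ?thesis .
  qed
  \<comment> \<open>The only use of \<open>cen\<close>: the endomorphism is carried past
    \<Delta>(r), which turns it into a statement covered by \<open>step2\<close>.\<close>
  have central: "(\<Sum>k\<in>K. sw (\<lambda>b c. \<Phi> j (p k \<otimes> b \<otimes> x i) (q k \<otimes> c)) r)
      = (\<Sum>k\<in>K. sw (\<lambda>P1 P2. mu (\<alpha> + \<beta>) (r \<otimes> P1) * yf j (S P2 \<otimes> q k)) (p k \<otimes> x i))"
    if ji: "j \<in> B" "i \<in> A" and r: "r \<in> carrier U" for j i r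
  proof -
    have "bmf \<alpha> \<beta> (\<lambda>P Q. \<Phi> j (P \<otimes> x i) Q)"
      by (intro bmfI bmf_mf1[OF \<Phi>[OF ji(1)]] bmf_mf2[OF \<Phi>[OF ji(1)]] modlin) (simp_all add: ji x)
    from cen[OF this r]
    have "(\<Sum>k\<in>K. sw (\<lambda>b c. \<Phi> j (p k \<otimes> b \<otimes> x i) (q k \<otimes> c)) r)
        = (\<Sum>k\<in>K. sw (\<lambda>b c. \<Phi> j (b \<otimes> p k \<otimes> x i) (c \<otimes> q k)) r)" .
    also have "\<dots> = (\<Sum>k\<in>K. sw (\<lambda>b c. \<Phi> j (b \<otimes> (p k \<otimes> x i)) (c \<otimes> q k)) r)"
      by (intro sum.cong refl sw_cong r) (simp add: pq x(1)[OF ji(2)] m_assoc)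
    also have "\<dots> = (\<Sum>k\<in>K. sw (\<lambda>P1 P2. mu (\<alpha> + \<beta>) (r \<otimes> P1) * yf j (S P2 \<otimes> q k)) (p k \<otimes> x i))"
      by (intro sum.cong refl step2 ji r) (simp_all add: pq x(1)[OF ji(2)])
    finally show ?thesis .
  qed
  \<comment> \<open>\<open>mu_right\<close> recognises the left side as the sum of diagonal
    coefficients in the basis 1 \<otimes> y j.\<close>
  have "(\<Sum>k\<in>K. mu \<alpha> (p k) * (\<Sum>j\<in>B. yf j (g \<otimes> (q k \<otimes> y j)))) = (\<Sum>k\<in>K. \<Sum>j\<in>B. \<Phi> j (p k) (q k \<otimes> y j))"
    unfolding sum_distrib_left \<Phi>_def
    by (intro sum.cong refl mu_right[symmetric]) (simp_all add: pq y)
  also have "\<dots> = (\<Sum>k\<in>K. \<Sum>j\<in>B. \<Sum>i\<in>A. sw (\<lambda>a r. xf i (Si a) * sw (\<lambda>b c. \<Phi> j (p k \<otimes> b \<otimes> x i) (q k \<otimes> c)) r) (y j))"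
    by (intro sum.cong refl step1) (simp_all add: pq y \<Phi>)
  also have "\<dots> = (\<Sum>j\<in>B. \<Sum>i\<in>A. \<Sum>k\<in>K. sw (\<lambda>a r. xf i (Si a) * sw (\<lambda>b c. \<Phi> j (p k \<otimes> b \<otimes> x i) (q k \<otimes> c)) r) (y j))"
    by (subst sum.swap, rule sum.cong[OF refl], rule sum.swap)
  also have "\<dots> = (\<Sum>j\<in>B. \<Sum>i\<in>A. sw (\<lambda>a r. xf i (Si a) * (\<Sum>k\<in>K. sw (\<lambda>b c. \<Phi> j (p k \<otimes> b \<otimes> x i) (q k \<otimes> c)) r)) (y j))"
    by (simp only: tev_sum sum_distrib_left)
  also have "\<dots> = (\<Sum>j\<in>B. \<Sum>i\<in>A. sw (\<lambda>a r. xf i (Si a) * (\<Sum>k\<in>K.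
      sw (\<lambda>P1 P2. mu (\<alpha> + \<beta>) (r \<otimes> P1) * yf j (S P2 \<otimes> q k)) (p k \<otimes> x i))) (y j))"
    by (intro sum.cong refl sw_cong y(1)) (simp_all only: central)
  also have "\<dots> = (\<Sum>j\<in>B. \<Sum>i\<in>A. \<Sum>k\<in>K. sw (\<lambda>a r. xf i (Si a) *
      sw (\<lambda>P1 P2. mu (\<alpha> + \<beta>) (r \<otimes> P1) * yf j (S P2 \<otimes> q k)) (p k \<otimes> x i)) (y j))"
    by (simp only: tev_sum sum_distrib_left)
  also have "\<dots> = (\<Sum>k\<in>K. \<Sum>i\<in>A. \<Sum>j\<in>B. sw (\<lambda>a r. xf i (Si a) *
      sw (\<lambda>P1 P2. mu (\<alpha> + \<beta>) (r \<otimes> P1) * yf j (S P2 \<otimes> q k)) (p k \<otimes> x i)) (y j))"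
    by (rule trans[OF sum.cong[OF refl sum.swap] trans[OF sum.swap sum.cong[OF refl sum.swap]]])
  also have "\<dots> = (\<Sum>k\<in>K. \<Sum>i\<in>A. sw (\<lambda>q1 q2. xf i (Si q1 \<otimes> (p k \<otimes> x i)) * mu (\<alpha> + \<beta>) q2) (q k))"
    by (intro sum.cong refl step3) (simp_all add: pq x)
  \<comment> \<open>\<open>mu_left\<close> does the same for the basis x i \<otimes> 1.\<close>
  also have "\<dots> = (\<Sum>k\<in>K. (\<Sum>i\<in>A. xf i (gi \<otimes> (p k \<otimes> x i))) * mu \<beta> (q k))"
    unfolding sum_distrib_right by (intro sum.cong refl mu_left) (simp_all add: pq x)
  finally show ?thesis .
qed

end

end

section \<open>Coordinates in possibly infinite direct sums\<close>

section \<open>Components of a direct sum\<close>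

definition linear_subset :: "'a calg \<Rightarrow> 'a set \<Rightarrow> bool" where
  "linear_subset A D \<longleftrightarrow> D \<subseteq> carrier A \<and> \<zero>\<^bsub>A\<^esub> \<in> D \<and> (\<forall>x\<in>D. \<forall>y\<in>D. x \<oplus>\<^bsub>A\<^esub> y \<in> D) \<and>
     (\<forall>c. \<forall>x\<in>D. c \<odot>\<^bsub>A\<^esub> x \<in> D)"

lemma linear_subset_subspace: "VectorSpace.subspace class_ring D A \<Longrightarrow> linear_subset A D"
  using submodule.subset submodule.zero_closed submodule.m_closed submodule.smult_closed
  unfolding VectorSpace.subspace_def linear_subset_def by fastforce

lemma linear_subset_carrier: "cspace A \<Longrightarrow> linear_subset A (carrier A)"
proof -
  assume A: "cspace A"
  then interpret abelian_group A by (simp add: cspace_def)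
  show ?thesis using A by (auto simp: linear_subset_def cspace_def)
qed

definition ds_comp ::
  "'b calg \<Rightarrow> 'a calg \<Rightarrow> 'j set \<Rightarrow> ('j \<Rightarrow> 'b set) \<Rightarrow> ('j \<Rightarrow> 'b \<Rightarrow> 'a) \<Rightarrow> 'a \<Rightarrow> 'j \<Rightarrow> 'b" where
  "ds_comp B A J D \<phi> v = (THE f. f \<in> (\<Pi>\<^sub>E j\<in>J. D j) \<and> finite {j\<in>J. f j \<noteq> \<zero>\<^bsub>B\<^esub>} \<and>
     v = (\<Oplus>\<^bsub>A\<^esub> j\<in>{j\<in>J. f j \<noteq> \<zero>\<^bsub>B\<^esub>}. \<phi> j (f j)))"

text \<open>\<open>cspace\<close> contains no module laws, so the two scalar identities enter as
  assumptions; the interpretations below supply them from an algebra.\<close>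

locale direct_sum_decomposition =
  fixes B :: "'b calg" and A :: "'a calg" and T :: "'a set" and J :: "'j set"
    and D :: "'j \<Rightarrow> 'b set" and \<phi> :: "'j \<Rightarrow> 'b \<Rightarrow> 'a"
  assumes B: "cspace B" and A: "cspace A" and ds: "direct_sum B A T J D \<phi>"
    and D: "\<And>j. j \<in> J \<Longrightarrow> linear_subset B (D j)" and T: "linear_subset A T"
    and \<phi>_add: "\<And>j x y. j \<in> J \<Longrightarrow> x \<in> D j \<Longrightarrow> y \<in> D j \<Longrightarrow> \<phi> j (x \<oplus>\<^bsub>B\<^esub> y) = \<phi> j x \<oplus>\<^bsub>A\<^esub> \<phi> j y"
    and \<phi>_smult: "\<And>j x c. j \<in> J \<Longrightarrow> x \<in> D j \<Longrightarrow> \<phi> j (c \<odot>\<^bsub>B\<^esub> x) = c \<odot>\<^bsub>A\<^esub> \<phi> j x"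
    and smult_finsum: "\<And>c (F :: 'j set) h. h \<in> F \<rightarrow> carrier A \<Longrightarrow>
      c \<odot>\<^bsub>A\<^esub> (\<Oplus>\<^bsub>A\<^esub>j\<in>F. h j) = (\<Oplus>\<^bsub>A\<^esub>j\<in>F. c \<odot>\<^bsub>A\<^esub> h j)"
    and smult_zero: "\<And>c. c \<odot>\<^bsub>B\<^esub> \<zero>\<^bsub>B\<^esub> = \<zero>\<^bsub>B\<^esub>"
begin

sublocale A: abelian_group A using A by (simp add: cspace_def)
sublocale B: abelian_group B using B by (simp add: cspace_def)

lemma D_carrier: "j \<in> J \<Longrightarrow> x \<in> D j \<Longrightarrow> x \<in> carrier B"
  using D[of j] by (auto simp: linear_subset_def)

lemma \<phi>_closed: "j \<in> J \<Longrightarrow> x \<in> D j \<Longrightarrow> \<phi> j x \<in> carrier A"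
  using ds T by (auto simp: direct_sum_def linear_subset_def)

lemma \<phi>_zero: "j \<in> J \<Longrightarrow> \<phi> j \<zero>\<^bsub>B\<^esub> = \<zero>\<^bsub>A\<^esub>"
  using \<phi>_add[of j "\<zero>\<^bsub>B\<^esub>" "\<zero>\<^bsub>B\<^esub>"] \<phi>_closed[of j "\<zero>\<^bsub>B\<^esub>"] D[of j]
  by (simp add: linear_subset_def A.add.l_cancel_one')

abbreviation comp :: "'j \<Rightarrow> 'a \<Rightarrow> 'b" where "comp j v \<equiv> ds_comp B A J D \<phi> v j"

lemma comp_props:
  assumes v: "v \<in> T"
  shows "(\<lambda>j. comp j v) \<in> (\<Pi>\<^sub>E j\<in>J. D j)" "finite {j\<in>J. comp j v \<noteq> \<zero>\<^bsub>B\<^esub>}"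
    "v = (\<Oplus>\<^bsub>A\<^esub> j\<in>{j\<in>J. comp j v \<noteq> \<zero>\<^bsub>B\<^esub>}. \<phi> j (comp j v))"
proof -
  have "\<exists>!f. f \<in> (\<Pi>\<^sub>E j\<in>J. D j) \<and> finite {j\<in>J. f j \<noteq> \<zero>\<^bsub>B\<^esub>} \<and>
     v = (\<Oplus>\<^bsub>A\<^esub> j\<in>{j\<in>J. f j \<noteq> \<zero>\<^bsub>B\<^esub>}. \<phi> j (f j))"
    using ds v by (simp add: direct_sum_def)
  from theI'[OF this] show "(\<lambda>j. comp j v) \<in> (\<Pi>\<^sub>E j\<in>J. D j)" "finite {j\<in>J. comp j v \<noteq> \<zero>\<^bsub>B\<^esub>}"
    "v = (\<Oplus>\<^bsub>A\<^esub> j\<in>{j\<in>J. comp j v \<noteq> \<zero>\<^bsub>B\<^esub>}. \<phi> j (comp j v))"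
    unfolding ds_comp_def by simp_all
qed

lemma comp_in: "v \<in> T \<Longrightarrow> j \<in> J \<Longrightarrow> comp j v \<in> D j"
  using comp_props(1) by auto

lemma finsum_support:
  assumes f: "\<And>j. j \<in> J \<Longrightarrow> f j \<in> D j" and F: "finite F" "F \<subseteq> J" "{j\<in>J. f j \<noteq> \<zero>\<^bsub>B\<^esub>} \<subseteq> F"
  shows "(\<Oplus>\<^bsub>A\<^esub> j\<in>{j\<in>J. f j \<noteq> \<zero>\<^bsub>B\<^esub>}. \<phi> j (f j)) = (\<Oplus>\<^bsub>A\<^esub>j\<in>F. \<phi> j (f j))"
proof (rule A.add.finprod_mono_neutral_cong_left)
  show "\<phi> i (f i) = \<zero>\<^bsub>A\<^esub>" if "i \<in> F - {j\<in>J. f j \<noteq> \<zero>\<^bsub>B\<^esub>}" for i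
    using that F \<phi>_zero[of i] by auto
qed (use F f \<phi>_closed in auto)

text \<open>\<open>direct_sum\<close> sums over the exact support. Here any finite set containing
  the support may be used, so supports of different vectors can be merged.\<close>

lemma comp_unique:
  assumes v: "v \<in> T" and f: "\<And>j. j \<in> J \<Longrightarrow> f j \<in> D j"
    and F: "finite F" "F \<subseteq> J" "\<And>j. j \<in> J - F \<Longrightarrow> f j = \<zero>\<^bsub>B\<^esub>"
    and eq: "v = (\<Oplus>\<^bsub>A\<^esub>j\<in>F. \<phi> j (f j))" and j: "j \<in> J"
  shows "comp j v = f j"
proof -
  let ?P = "\<lambda>f. f \<in> (\<Pi>\<^sub>E j\<in>J. D j) \<and> finite {j\<in>J. f j \<noteq> \<zero>\<^bsub>B\<^esub>} \<and>
     v = (\<Oplus>\<^bsub>A\<^esub> j\<in>{j\<in>J. f j \<noteq> \<zero>\<^bsub>B\<^esub>}. \<phi> j (f j))"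
  let ?f = "restrict f J"
  have s: "{j\<in>J. ?f j \<noteq> \<zero>\<^bsub>B\<^esub>} \<subseteq> F" using F by auto
  have "(\<Oplus>\<^bsub>A\<^esub> j\<in>{j\<in>J. ?f j \<noteq> \<zero>\<^bsub>B\<^esub>}. \<phi> j (?f j)) = (\<Oplus>\<^bsub>A\<^esub>j\<in>F. \<phi> j (?f j))"
    by (rule finsum_support[OF _ F(1,2) s]) (use f in auto)
  also have "\<dots> = v" unfolding eq
    by (rule A.finsum_cong') (use F f \<phi>_closed in auto)
  finally have "?P ?f" using f finite_subset[OF s F(1)] by auto
  moreover have "\<exists>!f. ?P f" using ds v by (simp add: direct_sum_def)
  ultimately have "ds_comp B A J D \<phi> v = ?f" unfolding ds_comp_def by (intro the1_equality)
  then show ?thesis using j by simp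
qed

lemma comp_sum:
  assumes v: "v \<in> T" and F: "finite F" "F \<subseteq> J" "{j\<in>J. comp j v \<noteq> \<zero>\<^bsub>B\<^esub>} \<subseteq> F"
  shows "v = (\<Oplus>\<^bsub>A\<^esub>j\<in>F. \<phi> j (comp j v))"
  using comp_props(3)[OF v] finsum_support[OF comp_in[OF v] F] by simp

lemma comp_add:
  assumes v: "v \<in> T" and w: "w \<in> T" and j: "j \<in> J"
  shows "comp j (v \<oplus>\<^bsub>A\<^esub> w) = comp j v \<oplus>\<^bsub>B\<^esub> comp j w"
proof (rule comp_unique[OF _ _ _ _ _ _ j])
  let ?F = "{j\<in>J. comp j v \<noteq> \<zero>\<^bsub>B\<^esub>} \<union> {j\<in>J. comp j w \<noteq> \<zero>\<^bsub>B\<^esub>}"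
  show F: "finite ?F" using comp_props(2) v w by blast
  show "?F \<subseteq> J" by auto
  have "v \<oplus>\<^bsub>A\<^esub> w = (\<Oplus>\<^bsub>A\<^esub>j\<in>?F. \<phi> j (comp j v)) \<oplus>\<^bsub>A\<^esub> (\<Oplus>\<^bsub>A\<^esub>j\<in>?F. \<phi> j (comp j w))"
    using comp_sum[OF v F] comp_sum[OF w F] by auto
  also have "\<dots> = (\<Oplus>\<^bsub>A\<^esub>j\<in>?F. \<phi> j (comp j v) \<oplus>\<^bsub>A\<^esub> \<phi> j (comp j w))"
    by (intro A.finsum_addf[symmetric]) (auto intro: \<phi>_closed comp_in v w)
  also have "\<dots> = (\<Oplus>\<^bsub>A\<^esub>j\<in>?F. \<phi> j (comp j v \<oplus>\<^bsub>B\<^esub> comp j w))"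
    using \<phi>_add comp_in[OF v] comp_in[OF w] D
    by (intro A.finsum_cong') (auto simp: linear_subset_def intro!: \<phi>_closed)
  finally show "v \<oplus>\<^bsub>A\<^esub> w = (\<Oplus>\<^bsub>A\<^esub>j\<in>?F. \<phi> j (comp j v \<oplus>\<^bsub>B\<^esub> comp j w))" .
qed (use T v w D comp_in in \<open>auto simp: linear_subset_def\<close>)

lemma comp_smult:
  assumes v: "v \<in> T" and j: "j \<in> J"
  shows "comp j (c \<odot>\<^bsub>A\<^esub> v) = c \<odot>\<^bsub>B\<^esub> comp j v"
proof (rule comp_unique[OF _ _ _ _ _ _ j])
  let ?F = "{j\<in>J. comp j v \<noteq> \<zero>\<^bsub>B\<^esub>}"
  show F: "finite ?F" using comp_props(2) v by blast
  show "?F \<subseteq> J" by auto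
  have "c \<odot>\<^bsub>A\<^esub> v = c \<odot>\<^bsub>A\<^esub> (\<Oplus>\<^bsub>A\<^esub>j\<in>?F. \<phi> j (comp j v))"
    using comp_sum[OF v F] by auto
  also have "\<dots> = (\<Oplus>\<^bsub>A\<^esub>j\<in>?F. c \<odot>\<^bsub>A\<^esub> \<phi> j (comp j v))"
    by (intro smult_finsum) (auto intro: \<phi>_closed comp_in v)
  also have "\<dots> = (\<Oplus>\<^bsub>A\<^esub>j\<in>?F. \<phi> j (c \<odot>\<^bsub>B\<^esub> comp j v))"
    using \<phi>_smult comp_in[OF v] D
    by (intro A.finsum_cong') (auto simp: linear_subset_def intro!: \<phi>_closed)
  finally show "c \<odot>\<^bsub>A\<^esub> v = (\<Oplus>\<^bsub>A\<^esub>j\<in>?F. \<phi> j (c \<odot>\<^bsub>B\<^esub> comp j v))" .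
qed (use T v D comp_in in \<open>auto simp: linear_subset_def smult_zero\<close>)

lemma comp_\<phi>:
  assumes i: "i \<in> J" and d: "d \<in> D i" and j: "j \<in> J"
  shows "comp j (\<phi> i d) = (if j = i then d else \<zero>\<^bsub>B\<^esub>)"
proof (rule comp_unique[where F = "{i}", OF _ _ _ _ _ _ j])
  show "\<phi> i d = (\<Oplus>\<^bsub>A\<^esub>j\<in>{i}. \<phi> j (if j = i then d else \<zero>\<^bsub>B\<^esub>))"
    using \<phi>_closed[OF i d] by simp
  show "(if j = i then d else \<zero>\<^bsub>B\<^esub>) \<in> D j" if "j \<in> J" for j
    using D[OF that] d by (simp add: linear_subset_def)
qed (use i d ds in \<open>auto simp: direct_sum_def\<close>)

lemma lform_comp_sum:
  assumes f: "lform A f" and v: "v \<in> T" and F: "finite F" "F \<subseteq> J" "{j\<in>J. comp j v \<noteq> \<zero>\<^bsub>B\<^esub>} \<subseteq> F"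
  shows "f v = (\<Sum>j\<in>F. f (\<phi> j (comp j v)))"
proof -
  have "f v = f (\<Oplus>\<^bsub>A\<^esub>j\<in>F. \<phi> j (comp j v))" using comp_sum[OF v F] by simp
  also have "\<dots> = (\<Sum>j\<in>F. f (\<phi> j (comp j v)))"
    by (rule lform_finsum[OF A f]) (use F in \<open>auto intro!: \<phi>_closed comp_in v\<close>)
  finally show ?thesis .
qed

lemma lform_eqI:
  assumes "lform A f" "lform A f'" "\<And>j d. j \<in> J \<Longrightarrow> d \<in> D j \<Longrightarrow> f (\<phi> j d) = f' (\<phi> j d)" "v \<in> T"
  shows "f v = f' v"
proof -
  note F = comp_props(2)[OF assms(4)]
  have "f v = (\<Sum>j\<in>{j\<in>J. comp j v \<noteq> \<zero>\<^bsub>B\<^esub>}. f (\<phi> j (comp j v)))"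
    by (rule lform_comp_sum[OF assms(1,4) F]) auto
  also have "\<dots> = (\<Sum>j\<in>{j\<in>J. comp j v \<noteq> \<zero>\<^bsub>B\<^esub>}. f' (\<phi> j (comp j v)))"
    by (intro sum.cong refl assms(3) comp_in assms(4)) auto
  also have "\<dots> = f' v"
    by (rule lform_comp_sum[OF assms(2,4) F, symmetric]) auto
  finally show ?thesis .
qed

end

lemma (in calgebra) smult_finsum':
  "h \<in> F \<rightarrow> carrier U \<Longrightarrow> c \<odot> (\<Oplus>j\<in>F. h j) = (\<Oplus>j\<in>F. c \<odot> h j)"
  by (induction F rule: infinite_finite_induct) (auto simp: V.smult_r_distr Pi_iff)

lemma (in calgebra) smult_zero': "c \<odot> \<zero> = \<zero>"
  using smult_finsum'[of _ "{}" c] by simp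

lemma (in calgebra) smult_one' [simp]: "x \<in> carrier U \<Longrightarrow> 1 \<odot> x = x"
  using V.smult_one by simp

lemma (in calgebra) smult_l_null' [simp]: "x \<in> carrier U \<Longrightarrow> 0 \<odot> x = \<zero>"
  using V.smult_l_null by simp

lemma cspan_lform_eqI:
  assumes A: "cspace A" "Module.module class_ring A" and f: "lform A f" "lform A f'" and S: "S \<subseteq> carrier A"
    and eq: "\<And>x. x \<in> S \<Longrightarrow> f x = f' x" and x: "x \<in> cspan A S"
  shows "f x = f' x"
proof -
  interpret M: Module.module class_ring A by (rule A)
  obtain a F where F: "finite F" "F \<subseteq> S" "x = M.lincomb a F" using x by (auto simp: M.span_def)
  have c: "(\<lambda>v. a v \<odot>\<^bsub>A\<^esub> v) \<in> F \<rightarrow> carrier A" using F S A(1) by (auto simp: cspace_def)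
  show ?thesis unfolding F(3) M.lincomb_def lform_finsum[OF A(1) f(1) c] lform_finsum[OF A(1) f(2) c]
    using F S eq by (intro sum.cong refl) (auto simp: lform_smult[OF f(1)] lform_smult[OF f(2)] subset_iff)
qed

section \<open>The weight lattice\<close>

lemma lookup_lat: "m \<in> lat r \<Longrightarrow> Poly_Mapping.lookup m i \<in> \<int>"
  by (simp add: lat_def)

lemma lat_zero [simp]: "0 \<in> lat r"
  by (simp add: lat_def wspace_def)

lemma wspace_add: "a \<in> wspace r \<Longrightarrow> b \<in> wspace r \<Longrightarrow> a + b \<in> wspace r"
  using keys_add[of a b] by (auto simp: wspace_def)

lemma wspace_diff: "a \<in> wspace r \<Longrightarrow> b \<in> wspace r \<Longrightarrow> a - b \<in> wspace r"
  using keys_minus[of a b] by (auto simp: wspace_def)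

lemma lat_add [simp]: "a \<in> lat r \<Longrightarrow> b \<in> lat r \<Longrightarrow> a + b \<in> lat r"
  by (auto simp: lat_def wspace_add lookup_add)

lemma lat_diff [simp]: "a \<in> lat r \<Longrightarrow> b \<in> lat r \<Longrightarrow> a - b \<in> lat r"
  by (auto simp: lat_def wspace_diff lookup_minus)

lemma lat_uminus [simp]: "a \<in> lat r \<Longrightarrow> - a \<in> lat r"
  using lat_diff[of 0 r a] by simp

lemma lat_fscale [simp]: "a \<in> lat r \<Longrightarrow> fscale (of_nat n) a \<in> lat r"
  using keys_fscale[of "of_nat n" a] by (auto simp: lat_def wspace_def)

lemma lat_wspace: "a \<in> lat r \<Longrightarrow> a \<in> wspace r"
  by (simp add: lat_def)

lemma pairing_add_right: "pairing r a (v + w) = pairing r a v + pairing r a w"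
  and pairing_add_left: "pairing r (a + b) v = pairing r a v + pairing r b v"
  and pairing_uminus_right: "pairing r a (- v) = - pairing r a v"
  and pairing_uminus_left: "pairing r (- a) v = - pairing r a v"
  and pairing_zero_right: "pairing r a 0 = 0"
  and pairing_zero_left: "pairing r 0 v = 0"
  and pairing_fscale_left: "pairing r (fscale c a) v = c * pairing r a v"
  by (simp_all add: pairing_def lookup_add sum.distrib algebra_simps sum_negf sum_distrib_left)

lemma pairing_lat: "a \<in> lat r \<Longrightarrow> m \<in> lat r \<Longrightarrow> pairing r a m \<in> \<int>"
  unfolding pairing_def by (intro Ints_sum Ints_mult lookup_lat)

lemma xi_add: "xi l (x + y) = xi l x * xi l y"
  by (simp add: xi_def algebra_simps add_divide_distrib exp_add)

lemma xi_zero [simp]: "xi l 0 = 1"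
  by (simp add: xi_def)

lemma xi_nonzero [simp]: "xi l x \<noteq> 0"
  by (simp add: xi_def)

lemma xi_uminus: "xi l (- x) = inverse (xi l x)"
  by (simp add: xi_def exp_minus)

lemma xi_int: "n \<in> \<int> \<Longrightarrow> l \<ge> 1 \<Longrightarrow> xi l (of_nat l * n) = 1"
proof -
  assume n: "n \<in> \<int>" and l: "l \<ge> 1"
  obtain k where k: "n = of_int k" using n by (elim Ints_cases)
  have "xi l (of_nat l * n) = cis (2 * pi * of_int k)"
    using l by (simp add: xi_def k cis_conv_exp mult_ac)
  then show ?thesis by simp
qed

section \<open>Degree projections and commutation with the elements K\<close>

section \<open>Graded Hopf algebras with a lattice of grouplike elements\<close>

text \<open>The same space as \<open>Udeg\<close>, with explicit parameters so that the grading can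
  be studied apart from the data record.\<close>

definition hdeg :: "'u calg \<Rightarrow> nat \<Rightarrow> (cvec \<Rightarrow> 'u set) \<Rightarrow> (cvec \<Rightarrow> 'u) \<Rightarrow> cvec \<Rightarrow> 'u set" where
  "hdeg U r Wd K m = cspan U {w \<otimes>\<^bsub>U\<^esub> K a | w a. w \<in> Wd m \<and> a \<in> lat r}"

locale graded_hopf = pivotal_hopf U \<Delta> \<epsilon> S g
  for U :: "'a calg" (structure) and \<Delta> \<epsilon> S g +
  fixes r l :: nat and W :: "'a set" and Wd :: "cvec \<Rightarrow> 'a set" and K :: "cvec \<Rightarrow> 'a"
  assumes l_pos: "l \<ge> 1"
    and W_sub: "linear_subset U W" and Wd_sub: "\<And>m. m \<in> lat r \<Longrightarrow> linear_subset U (Wd m)"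
    and W_ds: "direct_sum U U W (lat r) Wd (\<lambda>m w. w)"
    and one_Wd: "\<one> \<in> Wd 0" and K_zero: "K 0 = \<one>"
    and K_closed [simp]: "\<And>a. a \<in> lat r \<Longrightarrow> K a \<in> carrier U"
    and cop_K: "\<And>a. a \<in> lat r \<Longrightarrow> \<Delta> (K a) = ptens U U (K a) (K a)"
    and K_add: "\<And>a b. a \<in> lat r \<Longrightarrow> b \<in> lat r \<Longrightarrow> K (a + b) = K a \<otimes> K b"
    and U_ds: "direct_sum U U (carrier U) (lat r) (\<lambda>a. W) (\<lambda>a w. w \<otimes> K a)"
    and hdeg_mult: "\<And>m n x y. m \<in> lat r \<Longrightarrow> n \<in> lat r \<Longrightarrow> x \<in> hdeg U r Wd K m \<Longrightarrow>
      y \<in> hdeg U r Wd K n \<Longrightarrow> x \<otimes> y \<in> hdeg U r Wd K (m + n)"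
    and hdeg_cop: "\<And>m x. m \<in> lat r \<Longrightarrow> x \<in> hdeg U r Wd K m \<Longrightarrow>
      \<Delta> x \<in> cspan (U \<otimes>\<^sub>A U) {ptens U U y z | y z p q. p \<in> lat r \<and> q \<in> lat r \<and> p + q = m \<and>
        y \<in> hdeg U r Wd K p \<and> z \<in> hdeg U r Wd K q}"
    and hdeg_counit: "\<And>m x. m \<in> lat r \<Longrightarrow> x \<in> hdeg U r Wd K m \<Longrightarrow> m \<noteq> 0 \<Longrightarrow> \<epsilon> x = 0"
    and hdeg_antipode: "\<And>m x. m \<in> lat r \<Longrightarrow> x \<in> hdeg U r Wd K m \<Longrightarrow> S x \<in> hdeg U r Wd K m"
    and K_Wd: "\<And>a m x. a \<in> lat r \<Longrightarrow> m \<in> lat r \<Longrightarrow> x \<in> Wd m \<Longrightarrow>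
      K a \<otimes> x \<otimes> K (- a) = xi l (pairing r a m) \<odot> x"
begin

abbreviation "Udg m \<equiv> hdeg U r Wd K m"

sublocale WD: direct_sum_decomposition U U W "lat r" Wd "\<lambda>m w. w"
  by unfold_locales (auto simp: cspace W_ds Wd_sub W_sub smult_finsum' smult_zero')

lemma W_closed: "w \<in> W \<Longrightarrow> w \<in> carrier U"
  using W_sub by (auto simp: linear_subset_def)

lemma Wd_closed: "m \<in> lat r \<Longrightarrow> w \<in> Wd m \<Longrightarrow> w \<in> carrier U"
  using Wd_sub[of m] by (auto simp: linear_subset_def)

lemma Wd_W: "m \<in> lat r \<Longrightarrow> w \<in> Wd m \<Longrightarrow> w \<in> W"
  using W_ds by (auto simp: direct_sum_def)

sublocale UD: direct_sum_decomposition U U "carrier U" "lat r" "\<lambda>a. W" "\<lambda>a w. w \<otimes> K a"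
  by unfold_locales
    (auto simp: cspace U_ds W_sub linear_subset_carrier smult_finsum' smult_zero' W_closed l_distr smult_mult)

abbreviation "cf \<equiv> UD.comp"
abbreviation "wc \<equiv> WD.comp"

lemma gens_closed: "m \<in> lat r \<Longrightarrow> {w \<otimes> K a | w a. w \<in> Wd m \<and> a \<in> lat r} \<subseteq> carrier U"
  by (auto simp: Wd_closed)

lemma linear_subset_Udg: "m \<in> lat r \<Longrightarrow> linear_subset U (Udg m)"
  unfolding hdeg_def by (intro linear_subset_subspace V.span_is_subspace gens_closed)

lemma Udg_closed: "m \<in> lat r \<Longrightarrow> x \<in> Udg m \<Longrightarrow> x \<in> carrier U"
  using linear_subset_Udg[of m] by (auto simp: linear_subset_def)

lemma Udg_gen: "m \<in> lat r \<Longrightarrow> w \<in> Wd m \<Longrightarrow> a \<in> lat r \<Longrightarrow> w \<otimes> K a \<in> Udg m"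
  unfolding hdeg_def by (rule subsetD[OF V.in_own_span[OF gens_closed]]) auto

lemma Udg_lform_eqI:
  assumes "m \<in> lat r" "lform U f" "lform U f'"
    and "\<And>w a. w \<in> Wd m \<Longrightarrow> a \<in> lat r \<Longrightarrow> f (w \<otimes> K a) = f' (w \<otimes> K a)" and "x \<in> Udg m"
  shows "f x = f' x"
proof (rule cspan_lform_eqI[OF cspace V.module_axioms assms(2,3) gens_closed[OF assms(1)]])
  show "f y = f' y" if "y \<in> {w \<otimes> K a |w a. w \<in> Wd m \<and> a \<in> lat r}" for y
    using that assms(4) by blast
  show "x \<in> cspan U {w \<otimes> K a |w a. w \<in> Wd m \<and> a \<in> lat r}" using assms(5) unfolding hdeg_def .
qed

lemma K_Udg: "a \<in> lat r \<Longrightarrow> K a \<in> Udg 0"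
  using Udg_gen[OF lat_zero one_Wd, of a] by simp

lemma one_Udg: "\<one> \<in> Udg 0"
  using K_Udg[of 0] by (simp add: K_zero)

text \<open>The projection to degree m, assembled from the splitting of U into pieces W K^a and of W
  into its graded pieces. The value zero outside the lattice keeps \<open>gr_mult_left\<close> and
  \<open>gr_mult_right\<close> free of conditions on m.\<close>

definition gr :: "cvec \<Rightarrow> 'a \<Rightarrow> 'a" where
  "gr m u = (if m \<in> lat r then \<Oplus>a\<in>{a\<in>lat r. cf a u \<noteq> \<zero>}. wc m (cf a u) \<otimes> K a else \<zero>)"

lemma cf_W [simp]: "u \<in> carrier U \<Longrightarrow> a \<in> lat r \<Longrightarrow> cf a u \<in> W"
  by (rule UD.comp_in)

lemma wc_Wd [simp]: "w \<in> W \<Longrightarrow> m \<in> lat r \<Longrightarrow> wc m w \<in> Wd m"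
  using WD.comp_in by blast

lemma wc_closed [simp]: "w \<in> W \<Longrightarrow> m \<in> lat r \<Longrightarrow> wc m w \<in> carrier U"
  using Wd_closed[OF _ wc_Wd] by blast

lemma wc_zero: "m \<in> lat r \<Longrightarrow> wc m \<zero> = \<zero>"
  using WD.comp_\<phi>[of m \<zero> m] Wd_sub[of m] by (simp add: linear_subset_def)

lemma gr_closed [simp]: "u \<in> carrier U \<Longrightarrow> gr m u \<in> carrier U"
  unfolding gr_def by (auto intro!: finsum_closed)

lemma gr_Udg: "u \<in> carrier U \<Longrightarrow> m \<in> lat r \<Longrightarrow> gr m u \<in> Udg m"
proof -
  assume u: "u \<in> carrier U" and m: "m \<in> lat r"
  have "(\<Oplus>a\<in>F. wc m (cf a u) \<otimes> K a) \<in> Udg m" if "F \<subseteq> lat r" for F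
    using that linear_subset_Udg[OF m] Udg_gen[OF m wc_Wd[OF cf_W[OF u] m]] u m
    by (induction F rule: infinite_finite_induct)
      (auto simp: linear_subset_def Pi_iff subset_iff)
  then show ?thesis using m by (auto simp: gr_def)
qed

lemma lf_gr_sum:
  assumes f: "lf f" and u: "u \<in> carrier U" and m: "m \<in> lat r"
    and F: "finite F" "F \<subseteq> lat r" "{a\<in>lat r. cf a u \<noteq> \<zero>} \<subseteq> F"
  shows "f (gr m u) = (\<Sum>a\<in>F. f (wc m (cf a u) \<otimes> K a))"
proof -
  have "f (gr m u) = (\<Sum>a\<in>{a\<in>lat r. cf a u \<noteq> \<zero>}. f (wc m (cf a u) \<otimes> K a))"
    unfolding gr_def using m u by (simp, subst lform_finsum[OF cspace f]) auto
  also have "\<dots> = (\<Sum>a\<in>F. f (wc m (cf a u) \<otimes> K a))"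
    using F by (intro sum.mono_neutral_left) (auto simp: wc_zero m lform_zero[OF cspace f])
  finally show ?thesis .
qed

lemma cf_finite: "u \<in> carrier U \<Longrightarrow> finite {a\<in>lat r. cf a u \<noteq> \<zero>}"
  by (rule UD.comp_props(2))

lemma lmap_gr: "lmap U U (gr m)"
proof (cases "m \<in> lat r")
  case m: True
  show ?thesis
  proof (rule lmapI)
    fix u v assume c: "u \<in> carrier U" "v \<in> carrier U"
    show "gr m (u \<oplus> v) = gr m u \<oplus> gr m v"
    proof (rule lf_eqI)
      fix f assume f: "lf f"
      let ?F = "{a\<in>lat r. cf a u \<noteq> \<zero>} \<union> {a\<in>lat r. cf a v \<noteq> \<zero>} \<union> {a\<in>lat r. cf a (u \<oplus> v) \<noteq> \<zero>}"
      have F: "finite ?F" using cf_finite c by auto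
      have "f (gr m (u \<oplus> v)) = (\<Sum>a\<in>?F. f (wc m (cf a (u \<oplus> v)) \<otimes> K a))"
        by (rule lf_gr_sum[OF f _ m F]) (use c in auto)
      also have "\<dots> = (\<Sum>a\<in>?F. f (wc m (cf a u) \<otimes> K a) + f (wc m (cf a v) \<otimes> K a))"
        using c m by (intro sum.cong) (auto simp: UD.comp_add WD.comp_add l_distr lform_add[OF f])
      also have "\<dots> = f (gr m u) + f (gr m v)"
        unfolding sum.distrib by (intro arg_cong2[where f = "(+)"] lf_gr_sum[OF f _ m F, symmetric]) (use c in auto)
      finally show "f (gr m (u \<oplus> v)) = f (gr m u \<oplus> gr m v)" using c by (simp add: lform_add[OF f])
    qed (use c in simp_all)
  next
    fix k u assume c: "u \<in> carrier U"
    show "gr m (k \<odot> u) = k \<odot> gr m u"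
    proof (rule lf_eqI)
      fix f assume f: "lf f"
      let ?F = "{a\<in>lat r. cf a u \<noteq> \<zero>} \<union> {a\<in>lat r. cf a (k \<odot> u) \<noteq> \<zero>}"
      have F: "finite ?F" using cf_finite c by auto
      have "f (gr m (k \<odot> u)) = (\<Sum>a\<in>?F. f (wc m (cf a (k \<odot> u)) \<otimes> K a))"
        by (rule lf_gr_sum[OF f _ m F]) (use c in auto)
      also have "\<dots> = (\<Sum>a\<in>?F. k * f (wc m (cf a u) \<otimes> K a))"
        using c m by (intro sum.cong) (auto simp: UD.comp_smult WD.comp_smult smult_mult lform_smult[OF f])
      also have "\<dots> = k * f (gr m u)"
        unfolding sum_distrib_left[symmetric] by (subst lf_gr_sum[OF f _ m F]) (use c in auto)
      finally show "f (gr m (k \<odot> u)) = f (k \<odot> gr m u)" using c by (simp add: lform_smult[OF f])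
    qed (use c in simp_all)
  qed simp
next
  case False
  then show ?thesis by (auto intro!: lmapI simp: gr_def smult_zero')
qed

lemma lmap_gr' [lin]: "lmap A U E \<Longrightarrow> lmap A U (\<lambda>x. gr m (E x))"
  by (rule lmap_comp[OF lmap_gr])

lemma gr_gen:
  assumes n: "n \<in> lat r" and w: "w \<in> Wd n" and a: "a \<in> lat r"
  shows "gr m (w \<otimes> K a) = (if m = n then w \<otimes> K a else \<zero>)"
proof (cases "m \<in> lat r")
  case m: True
  have cf: "cf b (w \<otimes> K a) = (if b = a then w else \<zero>)" if "b \<in> lat r" for b
    using UD.comp_\<phi>[OF a Wd_W[OF n w] that] .
  have c: "w \<otimes> K a \<in> carrier U" using w n a Wd_closed by simp
  show ?thesis
  proof (rule lf_eqI)
    fix f assume f: "lf f"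
    have "f (gr m (w \<otimes> K a)) = (\<Sum>b\<in>{a}. f (wc m (cf b (w \<otimes> K a)) \<otimes> K b))"
      by (rule lf_gr_sum[OF f c m]) (auto simp: a cf split: if_splits)
    then show "f (gr m (w \<otimes> K a)) = f (if m = n then w \<otimes> K a else \<zero>)"
      using WD.comp_\<phi>[OF n w m] a by (simp add: cf)
  qed (use c in auto)
next
  case False
  then show ?thesis using n by (auto simp: gr_def)
qed

lemma gr_Udg_eq:
  assumes n: "n \<in> lat r" and u: "u \<in> Udg n"
  shows "gr m u = (if m = n then u else \<zero>)"
proof (rule lf_eqI)
  note c = Udg_closed[OF n u]
  show "gr m u \<in> carrier U" "(if m = n then u else \<zero>) \<in> carrier U" using c by auto
  fix f assume f: "lf f"
  have l1: "lf (\<lambda>u. f (gr m u))" by ((intro lin lform_lmap[OF f])?; simp)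
  have l2: "lf (\<lambda>u. if m = n then f u else 0)" using f by (auto simp: lform_def)
  show "f (gr m u) = f (if m = n then u else \<zero>)"
    using Udg_lform_eqI[OF n l1 l2 _ u] gr_gen[OF n] by (simp add: lform_zero[OF cspace f])
qed

lemma Udg_K: "a \<in> lat r \<Longrightarrow> m \<in> lat r \<Longrightarrow> x \<in> Udg m \<Longrightarrow> x \<otimes> K a \<in> Udg m"
  using hdeg_mult[OF _ lat_zero _ K_Udg, of m x a] by simp

lemma Udg_K_left: "a \<in> lat r \<Longrightarrow> m \<in> lat r \<Longrightarrow> x \<in> Udg m \<Longrightarrow> K a \<otimes> x \<in> Udg m"
  using hdeg_mult[OF lat_zero _ K_Udg, of m a x] by simp

lemma gr_decomp:
  assumes u: "u \<in> carrier U"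
  obtains F where "finite F" "F \<subseteq> lat r" "\<And>m. m \<notin> F \<Longrightarrow> gr m u = \<zero>"
    "\<And>f. lf f \<Longrightarrow> f u = (\<Sum>m\<in>F. f (gr m u))"
proof -
  let ?A = "{a\<in>lat r. cf a u \<noteq> \<zero>}"
  let ?F = "\<Union>a\<in>?A. {m\<in>lat r. wc m (cf a u) \<noteq> \<zero>}"
  have F: "finite ?F" using cf_finite[OF u] WD.comp_props(2) u by auto
  have sub: "{m\<in>lat r. wc m (cf a u) \<noteq> \<zero>} \<subseteq> ?F" if "a \<in> ?A" for a using that by auto
  have dec: "f u = (\<Sum>m\<in>?F. f (gr m u))" if f: "lf f" for f
  proof -
    have "f u = (\<Sum>a\<in>?A. f (cf a u \<otimes> K a))"
      by (rule UD.lform_comp_sum[OF f u cf_finite[OF u]]) auto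
    also have "\<dots> = (\<Sum>a\<in>?A. \<Sum>m\<in>?F. f (wc m (cf a u) \<otimes> K a))"
    proof (intro sum.cong refl)
      fix a assume a: "a \<in> ?A"
      have "lf (\<lambda>w. f (w \<otimes> K a))" using a by ((intro lin lform_lmap[OF f])?; simp)
      from WD.lform_comp_sum[OF this cf_W[OF u] F _ sub[OF a]] a
      show "f (cf a u \<otimes> K a) = (\<Sum>m\<in>?F. f (wc m (cf a u) \<otimes> K a))" by auto
    qed
    also have "\<dots> = (\<Sum>m\<in>?F. \<Sum>a\<in>?A. f (wc m (cf a u) \<otimes> K a))" by (rule sum.swap)
    also have "\<dots> = (\<Sum>m\<in>?F. f (gr m u))"
      by (intro sum.cong refl lf_gr_sum[OF f u, symmetric] cf_finite u) auto
    finally show ?thesis .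
  qed
  have zero: "gr m u = \<zero>" if "m \<notin> ?F" for m
  proof (cases "m \<in> lat r")
    case m: True
    have "f (gr m u) = f \<zero>" if f: "lf f" for f
    proof -
      have "wc m (cf a u) = \<zero>" if "a \<in> ?A" for a using that m \<open>m \<notin> ?F\<close> by auto
      then show ?thesis
        by (subst lf_gr_sum[OF f u m cf_finite[OF u]]) (auto simp: lform_zero[OF cspace f] intro!: sum.neutral)
    qed
    then show ?thesis using u by (intro lf_eqI) auto
  qed (simp add: gr_def)
  show ?thesis by (rule that[OF F _ zero dec]) auto
qed

lemma gr_decomp_ex:
  "u \<in> carrier U \<Longrightarrow> \<exists>F. finite F \<and> F \<subseteq> lat r \<and> (\<forall>f. lf f \<longrightarrow> f u = (\<Sum>m\<in>F. f (gr m u)))"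
  by (rule gr_decomp) blast+

lemma gr_lf_eqI:
  assumes "lf f" "lf f'" "\<And>m x. m \<in> lat r \<Longrightarrow> x \<in> Udg m \<Longrightarrow> f x = f' x" "u \<in> carrier U"
  shows "f u = f' u"
proof -
  obtain F where F: "finite F" "F \<subseteq> lat r" "\<And>m. m \<notin> F \<Longrightarrow> gr m u = \<zero>"
    "\<And>f. lf f \<Longrightarrow> f u = (\<Sum>m\<in>F. f (gr m u))" using gr_decomp[OF assms(4)] by blast
  show ?thesis unfolding F(4)[OF assms(1)] F(4)[OF assms(2)]
  proof (rule sum.cong[OF refl])
    fix m assume "m \<in> F"
    then have m: "m \<in> lat r" using F(2) by auto
    show "f (gr m u) = f' (gr m u)" by (rule assms(3)[OF m gr_Udg[OF assms(4) m]])
  qed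
qed

lemma gr_notin: "m \<notin> lat r \<Longrightarrow> gr m u = \<zero>"
  by (simp add: gr_def)

lemma gr_mult_left:
  assumes n: "n \<in> lat r" and x: "x \<in> Udg n" and u: "u \<in> carrier U"
  shows "gr m (x \<otimes> u) = x \<otimes> gr (m - n) u"
proof (rule lf_eqI)
  note xc = Udg_closed[OF n x]
  fix f assume f: "lf f"
  note [lin] = lform_lmap[OF f]
  show "f (gr m (x \<otimes> u)) = f (x \<otimes> gr (m - n) u)"
  proof (rule gr_lf_eqI[of "\<lambda>u. f (gr m (x \<otimes> u))" "\<lambda>u. f (x \<otimes> gr (m - n) u)", OF _ _ _ u])
    fix k y assume k: "k \<in> lat r" and y: "y \<in> Udg k"
    show "f (gr m (x \<otimes> y)) = f (x \<otimes> gr (m - n) y)"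
      using gr_Udg_eq[OF _ hdeg_mult[OF n k x y], of m] gr_Udg_eq[OF k y, of "m - n"] n k xc
      by (auto simp: algebra_simps)
  qed ((intro lin)?; simp add: xc)+
qed (use Udg_closed[OF n x] u in simp_all)

lemma gr_mult_right:
  assumes n: "n \<in> lat r" and x: "x \<in> Udg n" and u: "u \<in> carrier U"
  shows "gr m (u \<otimes> x) = gr (m - n) u \<otimes> x"
proof (rule lf_eqI)
  note xc = Udg_closed[OF n x]
  fix f assume f: "lf f"
  note [lin] = lform_lmap[OF f]
  show "f (gr m (u \<otimes> x)) = f (gr (m - n) u \<otimes> x)"
  proof (rule gr_lf_eqI[of "\<lambda>u. f (gr m (u \<otimes> x))" "\<lambda>u. f (gr (m - n) u \<otimes> x)", OF _ _ _ u])
    fix k y assume k: "k \<in> lat r" and y: "y \<in> Udg k"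
    show "f (gr m (y \<otimes> x)) = f (gr (m - n) y \<otimes> x)"
      using gr_Udg_eq[OF _ hdeg_mult[OF k n y x], of m] gr_Udg_eq[OF k y, of "m - n"] n k xc
      by (auto simp: algebra_simps)
  qed ((intro lin)?; simp add: xc)+
qed (use Udg_closed[OF n x] u in simp_all)

lemma gr_zero [simp]: "gr m \<zero> = \<zero>"
  using lmap_smult[OF lmap_gr zero_closed, of m 0] by simp

lemma gr_gr: "u \<in> carrier U \<Longrightarrow> gr m (gr n u) = (if m = n then gr n u else \<zero>)"
  by (cases "n \<in> lat r")
    (auto simp: gr_Udg_eq[OF _ gr_Udg] gr_notin)

text \<open>The coproduct of an element of degree n is spanned by bidegrees with sum n, so
  projecting one leg already projects the other.\<close>

lemma sw_gr:
  assumes n: "n \<in> lat r" and x: "x \<in> Udg n" and h: "bf h"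
  shows "sw (\<lambda>p q. h (gr m p) q) x = sw (\<lambda>p q. h (gr m p) (gr (n - m) q)) x"
    "sw (\<lambda>p q. h p (gr m q)) x = sw (\<lambda>p q. h (gr (n - m) p) (gr m q)) x"
proof -
  note [lin] = bform_lform1[OF h] bform_lform2[OF h]
  let ?S = "{ptens U U y z | y z p q. p \<in> lat r \<and> q \<in> lat r \<and> p + q = n \<and> y \<in> Udg p \<and> z \<in> Udg q}"
  note M = UU.module_tensor
  have S: "?S \<subseteq> carrier (U \<otimes>\<^sub>A U)" using Udg_closed by auto
  have z: "h \<zero> v = 0" "h v \<zero> = 0" if "v \<in> carrier U" for v
    using lform_zero[OF cspace bform1[OF h that]] lform_zero[OF cspace bform2[OF h that]] by auto
  have b: "bf (\<lambda>p q. h (gr m p) q)" "bf (\<lambda>p q. h (gr m p) (gr (n - m) q))" 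
    "bf (\<lambda>p q. h p (gr m q))" "bf (\<lambda>p q. h (gr (n - m) p) (gr m q))"
    by ((intro lin)?; simp)+
  show "sw (\<lambda>p q. h (gr m p) q) x = sw (\<lambda>p q. h (gr m p) (gr (n - m) q)) x"
  proof (rule cspan_lform_eqI[OF UU.cspace_tensor M UU.lform_tev[OF b(1)] UU.lform_tev[OF b(2)] S _ hdeg_cop[OF n x]])
    fix t assume "t \<in> ?S"
    then obtain y w p q where t: "t = ptens U U y w" "p \<in> lat r" "q \<in> lat r" "p + q = n" "y \<in> Udg p" "w \<in> Udg q"
      by auto
    then show "tev (\<lambda>p q. h (gr m p) q) t = tev (\<lambda>p q. h (gr m p) (gr (n - m) q)) t"
      using Udg_closed by (auto simp: UU.tev_ptens[OF b(1)] UU.tev_ptens[OF b(2)] gr_Udg_eq[of p] gr_Udg_eq[of q] z)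
  qed
  show "sw (\<lambda>p q. h p (gr m q)) x = sw (\<lambda>p q. h (gr (n - m) p) (gr m q)) x"
  proof (rule cspan_lform_eqI[OF UU.cspace_tensor M UU.lform_tev[OF b(3)] UU.lform_tev[OF b(4)] S _ hdeg_cop[OF n x]])
    fix t assume "t \<in> ?S"
    then obtain y w p q where t: "t = ptens U U y w" "p \<in> lat r" "q \<in> lat r" "p + q = n" "y \<in> Udg p" "w \<in> Udg q"
      by auto
    then show "tev (\<lambda>p q. h p (gr m q)) t = tev (\<lambda>p q. h (gr (n - m) p) (gr m q)) t"
      using Udg_closed by (auto simp: UU.tev_ptens[OF b(3)] UU.tev_ptens[OF b(4)] gr_Udg_eq[of p] gr_Udg_eq[of q] z)
  qed
qed

lemma K_inverse: "a \<in> lat r \<Longrightarrow> K a \<otimes> K (- a) = \<one>" "a \<in> lat r \<Longrightarrow> K (- a) \<otimes> K a = \<one>"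
  using K_add[of a "- a"] K_add[of "- a" a] by (simp_all add: K_zero)

text \<open>The axiom covers W; since the elements K commute among themselves, the scalar is
  unchanged on products w K^b.\<close>

lemma K_commute:
  assumes a: "a \<in> lat r" and m: "m \<in> lat r" and x: "x \<in> Udg m"
  shows "K a \<otimes> x = xi l (pairing r a m) \<odot> (x \<otimes> K a)"
proof (rule lf_eqI)
  fix f assume f: "lf f"
  have l1: "lf (\<lambda>x. f (K a \<otimes> x))" using a by ((intro lin lform_lmap[OF f])?; simp)
  have l2: "lf (\<lambda>x. xi l (pairing r a m) * f (x \<otimes> K a))" using a by ((intro lin lform_lmap[OF f])?; simp)
  have "f (K a \<otimes> x) = xi l (pairing r a m) * f (x \<otimes> K a)"
  proof (rule Udg_lform_eqI[OF m l1 l2 _ x])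
    fix w b assume w: "w \<in> Wd m" and b: "b \<in> lat r"
    note wc = Wd_closed[OF m w]
    have "K a \<otimes> w = K a \<otimes> w \<otimes> K (- a) \<otimes> K a"
      using a wc by (simp add: m_assoc K_inverse)
    also have "\<dots> = xi l (pairing r a m) \<odot> (w \<otimes> K a)"
      using K_Wd[OF a m w] a wc by (simp add: smult_mult)
    finally have "K a \<otimes> (w \<otimes> K b) = xi l (pairing r a m) \<odot> (w \<otimes> K a \<otimes> K b)"
      using a b wc by (simp add: m_assoc[symmetric] smult_mult)
    moreover have "K a \<otimes> K b = K b \<otimes> K a"
      using K_add[OF a b] K_add[OF b a] by (simp add: add.commute)
    ultimately show "f (K a \<otimes> (w \<otimes> K b)) = xi l (pairing r a m) * f (w \<otimes> K b \<otimes> K a)"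
      using a b wc by (simp add: m_assoc lform_smult[OF f])
  qed
  then show "f (K a \<otimes> x) = f (xi l (pairing r a m) \<odot> (x \<otimes> K a))"
    using a Udg_closed[OF m x] by (simp add: lform_smult[OF f])
qed (use a Udg_closed[OF m x] in simp_all)

lemma antipode_K [simp]: "a \<in> lat r \<Longrightarrow> S (K a) = K (- a)"
proof -
  assume a: "a \<in> lat r"
  have e: "\<epsilon> (K a) * \<epsilon> (K (- a)) = 1" using K_inverse(1)[OF a] a by (metis K_closed counit_mult counit_one lat_uminus)
  have "f (S (K a) \<otimes> K a) = \<epsilon> (K a) * f \<one>" if f: "lf f" for f
  proof -
    have b: "bf (\<lambda>p q. f (S p \<otimes> q))" by ((intro lin lform_lmap[OF f])?; simp)
    show ?thesis using sw_antipode_left[OF f K_closed[OF a]] UU.tev_ptens[OF b] by (simp add: cop_K[OF a])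
  qed
  then have "S (K a) \<otimes> K a = \<epsilon> (K a) \<odot> \<one>" using a by (intro lf_eqI) (auto simp: lform_smult)
  moreover have "\<epsilon> (K a) = 1"
  proof -
    have b: "bf (\<lambda>p q. \<epsilon> p * \<epsilon> q)" by (intro lin; simp)
    have "\<epsilon> (K a) * \<epsilon> (K a) = \<epsilon> (K a)"
      using sw_counit_left[OF lf_counit K_closed[OF a]] UU.tev_ptens[OF b] by (simp add: cop_K[OF a])
    then show ?thesis using e by auto
  qed
  ultimately have "S (K a) \<otimes> K a \<otimes> K (- a) = K (- a)" using a by (simp add: smult_mult)
  then show ?thesis using a by (simp add: m_assoc K_inverse)
qed

lemma counit_K [simp]: "a \<in> lat r \<Longrightarrow> \<epsilon> (K a) = 1"
proof -
  assume a: "a \<in> lat r"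
  have b: "bf (\<lambda>p q. \<epsilon> p * \<epsilon> q)" by (intro lin; simp)
  have "\<epsilon> (K a) * \<epsilon> (K a) = \<epsilon> (K a)"
    using sw_counit_left[OF lf_counit K_closed[OF a]] UU.tev_ptens[OF b] by (simp add: cop_K[OF a])
  moreover have "\<epsilon> (K a) * \<epsilon> (K (- a)) = 1" using K_inverse(1)[OF a] a by (metis K_closed counit_mult counit_one lat_uminus)
  ultimately show ?thesis by auto
qed

lemma pivot_K: "a \<in> lat r \<Longrightarrow> g \<otimes> K a = K a \<otimes> g"
proof -
  assume a: "a \<in> lat r"
  then have "K a = g \<otimes> K a \<otimes> gi" using antipode_square[of "K a"] by simp
  then have "K a \<otimes> g = g \<otimes> K a \<otimes> gi \<otimes> g" by simp
  then show ?thesis using a by (simp add: m_assoc)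
qed

section \<open>The ideals attached to vectors v, and forms compatible with them\<close>

subsection \<open>The central quotients\<close>

text \<open>The scalar by which the central element \<open>Kl a\<close> acts on the quotient at
  v.\<close>

definition chi :: "cvec \<Rightarrow> cvec \<Rightarrow> complex" where
  "chi v a = xi l (of_nat l * pairing r a v)"

abbreviation Kl :: "cvec \<Rightarrow> 'a" where
  "Kl a \<equiv> K (fscale (of_nat l) a)"

definition qideal :: "cvec \<Rightarrow> 'a set" where
  "qideal v = Idl {Kl a \<ominus> chi v a \<odot> \<one> | a. a \<in> lat r}"

lemma chi_add: "chi (v + w) a = chi v a * chi w a"
  by (simp add: chi_def pairing_add_right distrib_left xi_add)

lemma chi_zero: "chi 0 a = 1"
  by (simp add: chi_def pairing_zero_right)

lemma chi_uminus: "chi (- v) (- a) = chi v a"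
  by (simp add: chi_def pairing_uminus_right pairing_uminus_left)

lemma gens_carrier: "{Kl a \<ominus> chi v a \<odot> \<one> | a. a \<in> lat r} \<subseteq> carrier U"
  by auto

lemma qideal_ideal: "ideal (qideal v) U"
  unfolding qideal_def by (rule genideal_ideal[OF gens_carrier])

lemma qideal_gen: "a \<in> lat r \<Longrightarrow> Kl a \<ominus> chi v a \<odot> \<one> \<in> qideal v"
  unfolding qideal_def using genideal_self[OF gens_carrier] by blast

text \<open>Minimality of the generated ideal: the elements satisfying P form an ideal, negatives
  being obtained as products with -1.\<close>

lemma qideal_induct [consumes 1, case_names gen add left right]:
  assumes x: "x \<in> qideal v"
    and gen: "\<And>a. a \<in> lat r \<Longrightarrow> P (Kl a \<ominus> chi v a \<odot> \<one>)"
    and add: "\<And>x y. x \<in> carrier U \<Longrightarrow> y \<in> carrier U \<Longrightarrow> P x \<Longrightarrow> P y \<Longrightarrow> P (x \<oplus> y)"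
    and left: "\<And>c x. c \<in> carrier U \<Longrightarrow> x \<in> carrier U \<Longrightarrow> P x \<Longrightarrow> P (c \<otimes> x)"
    and right: "\<And>c x. c \<in> carrier U \<Longrightarrow> x \<in> carrier U \<Longrightarrow> P x \<Longrightarrow> P (x \<otimes> c)"
  shows "P x"
proof -
  let ?J = "{x \<in> carrier U. P x}"
  have zero: "P \<zero>" using left[OF zero_closed _ gen[OF lat_zero]] by simp
  have "ideal ?J U"
  proof (rule idealI[OF ring_axioms])
    show "subgroup ?J (add_monoid U)"
    proof (rule add.subgroupI)
      show "\<ominus> x \<in> ?J" if "x \<in> ?J" for x
        using left[of "\<ominus> \<one>" x] that by (simp add: l_minus)
    qed (use zero add in auto)
  qed (use left right in auto)
  then have "qideal v \<subseteq> ?J"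
    unfolding qideal_def by (rule genideal_minimal) (use gen in auto)
  then show ?thesis using x by auto
qed

lemma qideal_closed: "x \<in> qideal v \<Longrightarrow> x \<in> carrier U"
  using ideal.Icarr[OF qideal_ideal] .

lemma K_l_commute:
  assumes a: "a \<in> lat r" and u: "u \<in> carrier U"
  shows "Kl a \<otimes> u = u \<otimes> Kl a"
proof (rule lf_eqI)
  fix f assume f: "lf f"
  show "f (Kl a \<otimes> u) = f (u \<otimes> Kl a)"
  proof (rule gr_lf_eqI[of "\<lambda>u. f (Kl a \<otimes> u)" "\<lambda>u. f (u \<otimes> Kl a)", OF _ _ _ u])
    fix m x assume m: "m \<in> lat r" and x: "x \<in> Udg m"
    have "xi l (pairing r (fscale (of_nat l) a) m) = 1"
      unfolding pairing_fscale_left by (rule xi_int[OF pairing_lat[OF a m] l_pos])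
    then show "f (Kl a \<otimes> x) = f (x \<otimes> Kl a)"
      using K_commute[OF lat_fscale[OF a] m x] Udg_closed[OF m x] a by simp
  qed ((intro lin lform_lmap[OF f])?; simp add: a)+
qed (use a u in simp_all)

lemma qideal_vanish_gen:
  assumes "lf f" "\<And>x. x \<in> qideal v \<Longrightarrow> f x = 0" "a \<in> lat r"
  shows "f (Kl a) = chi v a * f \<one>"
  using assms(2)[OF qideal_gen[OF assms(3)]] assms(3)
  by (simp add: lform_a_minus[OF cspace assms(1)] lform_smult[OF assms(1)])

text \<open>On generators this is multiplicativity of \<open>chi\<close> in v, since
  \<open>Kl a\<close> is grouplike. Multiplication by c replaces h by a translate with the same
  vanishing, hence the induction over all h.\<close>

lemma qideal_cop:
  assumes "bf h" "\<And>x y. x \<in> qideal v \<Longrightarrow> y \<in> carrier U \<Longrightarrow> h x y = 0"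
    "\<And>x y. x \<in> carrier U \<Longrightarrow> y \<in> qideal w \<Longrightarrow> h x y = 0" and x: "x \<in> qideal (v + w)"
  shows "sw h x = 0"
  using x assms(1-3)
proof (induction x arbitrary: h rule: qideal_induct)
  case (gen a)
  have "sw h (Kl a \<ominus> chi (v + w) a \<odot> \<one>) = sw h (Kl a) - chi (v + w) a * sw h \<one>"
    using gen by (simp add: lform_a_minus[OF cspace lf_sw[OF gen(2) lmap_id]] lform_smult[OF lf_sw[OF gen(2) lmap_id]])
  also have "\<dots> = h (Kl a) (Kl a) - chi (v + w) a * h \<one> \<one>"
    using gen(1) by (simp add: cop_K UU.tev_ptens[OF gen(2)] sw_one[OF gen(2)])
  also have "h (Kl a) (Kl a) = chi v a * h \<one> (Kl a)"
    by (rule qideal_vanish_gen[OF bform1[OF gen(2)] gen(3) gen(1)]) (use gen(1) in simp_all)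
  also have "h \<one> (Kl a) = chi w a * h \<one> \<one>"
    by (rule qideal_vanish_gen[OF bform2[OF gen(2)] gen(4) gen(1)]) simp_all
  finally show ?case by (simp add: chi_add)
next
  case (add x y)
  then show ?case by (simp add: lform_add[OF lf_sw[OF _ lmap_id]])
next
  case (left c x)
  note [lin] = bform_lform1[OF left(4)] bform_lform2[OF left(4)]
  have "sw h (c \<otimes> x) = sw (\<lambda>p q. sw (\<lambda>p' q'. h (p \<otimes> p') (q \<otimes> q')) x) c"
    by (rule sw_mult) (use left in auto)
  also have "\<dots> = sw (\<lambda>p q. 0) c"
  proof (rule sw_cong[OF left(1)])
    fix p q assume "p \<in> carrier U" "q \<in> carrier U"
    then show "sw (\<lambda>p' q'. h (p \<otimes> p') (q \<otimes> q')) x = 0"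
      using left(5,6) ideal.I_l_closed[OF qideal_ideal] qideal_closed
      by (intro left(3)) ((intro lin)?; simp)+
  qed
  finally show ?case by simp
next
  case (right c x)
  note [lin] = bform_lform1[OF right(4)] bform_lform2[OF right(4)]
  have z: "sw k c = 0" if "\<And>p q. p \<in> carrier U \<Longrightarrow> q \<in> carrier U \<Longrightarrow> k p q = 0" for k
    using sw_cong[OF right(1), of k "\<lambda>p q. 0"] that by simp
  have "sw h (x \<otimes> c) = sw (\<lambda>p q. sw (\<lambda>p' q'. h (p \<otimes> p') (q \<otimes> q')) c) x"
    by (rule sw_mult) (use right in auto)
  also have "\<dots> = 0"
  proof (rule right(3))
    show "bf (\<lambda>p q. sw (\<lambda>p' q'. h (p \<otimes> p') (q \<otimes> q')) c)" by ((intro lin)?; simp add: right(1))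
    show "sw (\<lambda>p' q'. h (p \<otimes> p') (q \<otimes> q')) c = 0" if "p \<in> qideal v" "q \<in> carrier U" for p q
      using that by (intro z right(5) ideal.I_r_closed[OF qideal_ideal] m_closed)
    show "sw (\<lambda>p' q'. h (p \<otimes> p') (q \<otimes> q')) c = 0" if "p \<in> carrier U" "q \<in> qideal w" for p q
      using that by (intro z right(6) ideal.I_r_closed[OF qideal_ideal] m_closed)
  qed
  finally show ?case .
qed

lemma qideal_antipode: "x \<in> qideal v \<Longrightarrow> S x \<in> qideal (- v)"
proof (induction x rule: qideal_induct)
  case (gen a)
  have "- fscale (of_nat l) a = fscale (of_nat l) (- a)"
    by (rule poly_mapping_eqI) simp
  then have "S (Kl a \<ominus> chi v a \<odot> \<one>) = Kl (- a) \<ominus> chi (- v) (- a) \<odot> \<one>"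
    using gen
    by (intro lf_eqI) (auto simp: chi_uminus lform_a_minus[OF cspace] lform_smult
        lform_a_minus[OF cspace lform_lmap[OF _ lmap_antipode]] lform_smult[OF lform_lmap[OF _ lmap_antipode]])
  then show ?case using qideal_gen[of "- a" "- v"] gen by simp
next
  case (add x y)
  then show ?case
    using additive_subgroup.a_closed[OF ideal.axioms(1)[OF qideal_ideal]] by (simp add: lmap_add[OF lmap_antipode])
qed (simp_all add: ideal.I_l_closed[OF qideal_ideal] ideal.I_r_closed[OF qideal_ideal])

lemma qideal_counit: "x \<in> qideal 0 \<Longrightarrow> \<epsilon> x = 0"
  by (induction x rule: qideal_induct)
    (auto simp: lform_a_minus[OF cspace lf_counit] lform_smult[OF lf_counit] chi_zero lform_add[OF lf_counit])

sublocale hopf_gcoalgebra U \<Delta> \<epsilon> S g qideal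
  by (unfold_locales; fact qideal_closed ideal.I_l_closed[OF qideal_ideal]
      ideal.I_r_closed[OF qideal_ideal] qideal_antipode qideal_counit qideal_cop)

text \<open>The ideal is generated in degree 0, hence homogeneous, so degree projections descend to
  the quotient. Multipliers c in the induction are split into homogeneous parts, which only shift
  the degree.\<close>

lemma mf_gr: "mf v f \<Longrightarrow> mf v (\<lambda>x. f (gr m x))"
proof -
  assume f: "mf v f"
  have "f (gr m x) = 0" if "x \<in> qideal v" for x
    using that f
  proof (induction x arbitrary: m f rule: qideal_induct)
    case (gen a)
    note l = lform_lmap[OF mf_lf[OF gen(2)] lmap_gr, of m]
    have "f (gr m (Kl a \<ominus> chi v a \<odot> \<one>)) = (if m = 0 then f (Kl a) - chi v a * f \<one> else 0)"
      using gen(1) by (simp add: lform_a_minus[OF cspace l] lform_smult[OF l] gr_Udg_eq[OF lat_zero K_Udg]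
          gr_Udg_eq[OF lat_zero one_Udg] lform_zero[OF cspace mf_lf[OF gen(2)]])
    also have "f (Kl a) = chi v a * f \<one>"
      by (rule qideal_vanish_gen[OF mf_lf[OF gen(2)] _ gen(1)]) (use gen(2) in \<open>simp add: mf_def\<close>)
    finally show ?case by simp
  next
    case (add x y)
    show ?case using add(3)[OF add(5)] add(4)[OF add(5)] add(1,2)
      by (simp add: lmap_add[OF lmap_gr] lform_add[OF mf_lf[OF add(5)]])
  next
    case (left c x)
    note [lin] = lform_lmap[OF mf_lf[OF left(4)]]
    obtain F where "finite F" and F: "F \<subseteq> lat r" and decomp: "\<forall>f. lf f \<longrightarrow> f c = (\<Sum>m\<in>F. f (gr m c))"
      using gr_decomp_ex[OF left(1)] by (elim exE conjE) (rule that)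
    have "f (gr m (c \<otimes> x)) = (\<Sum>n\<in>F. f (gr m (gr n c \<otimes> x)))"
      by (rule decomp[rule_format, of "\<lambda>c. f (gr m (c \<otimes> x))"]) ((intro lin)?; simp add: left)
    also have "\<dots> = 0"
    proof (intro sum.neutral ballI)
      fix n assume "n \<in> F"
      then have n: "n \<in> lat r" using F by auto
      show "f (gr m (gr n c \<otimes> x)) = 0"
        using left(3)[OF mf_lmod[OF left(4) lmod_mult_left[OF gr_closed[OF left(1)] lmod_id[OF refl]]]]
        by (simp add: gr_mult_left[OF n gr_Udg[OF left(1) n] left(2)])
    qed
    finally show ?case .
  next
    case (right c x)
    note [lin] = lform_lmap[OF mf_lf[OF right(4)]]
    obtain F where "finite F" and F: "F \<subseteq> lat r" and decomp: "\<forall>f. lf f \<longrightarrow> f c = (\<Sum>m\<in>F. f (gr m c))"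
      using gr_decomp_ex[OF right(1)] by (elim exE conjE) (rule that)
    have "f (gr m (x \<otimes> c)) = (\<Sum>n\<in>F. f (gr m (x \<otimes> gr n c)))"
      by (rule decomp[rule_format, of "\<lambda>c. f (gr m (x \<otimes> c))"]) ((intro lin)?; simp add: right)
    also have "\<dots> = 0"
    proof (intro sum.neutral ballI)
      fix n assume "n \<in> F"
      then have n: "n \<in> lat r" using F by auto
      show "f (gr m (x \<otimes> gr n c)) = 0"
        using right(3)[OF mf_lmod[OF right(4) lmod_mult_right[OF gr_closed[OF right(1)] lmod_id[OF refl]]]]
        by (simp add: gr_mult_right[OF n gr_Udg[OF right(1) n] right(2)])
    qed
    finally show ?case .
  qed
  then show ?thesis unfolding mf_def using lform_lmap[OF mf_lf[OF f] lmap_gr] by simp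
qed

text \<open>The counit on W tensored with the character K^a -> \<xi>^(a(v)). It is the tool that
  detects which element K^a has been produced, simultaneously in the quotients at all v.\<close>

definition phi :: "cvec \<Rightarrow> 'a \<Rightarrow> complex" where
  "phi v u = (\<Sum>a\<in>{a\<in>lat r. cf a u \<noteq> \<zero>}. \<epsilon> (cf a u) * xi l (pairing r a v))"

lemma phi_sum:
  assumes F: "finite F" "F \<subseteq> lat r" "{a\<in>lat r. cf a u \<noteq> \<zero>} \<subseteq> F"
  shows "phi v u = (\<Sum>a\<in>F. \<epsilon> (cf a u) * xi l (pairing r a v))"
  unfolding phi_def using F
  by (intro sum.mono_neutral_left) (auto simp: lform_zero[OF cspace lf_counit])

lemma lf_phi: "lf (phi v)"
proof (rule lformI)
  fix x y assume c: "x \<in> carrier U" "y \<in> carrier U"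
  let ?F = "{a\<in>lat r. cf a x \<noteq> \<zero>} \<union> {a\<in>lat r. cf a y \<noteq> \<zero>} \<union> {a\<in>lat r. cf a (x \<oplus> y) \<noteq> \<zero>}"
  have F: "finite ?F" "?F \<subseteq> lat r" using cf_finite c by auto
  have "phi v (x \<oplus> y) = (\<Sum>a\<in>?F. \<epsilon> (cf a (x \<oplus> y)) * xi l (pairing r a v))"
    by (rule phi_sum[OF F]) auto
  also have "\<dots> = (\<Sum>a\<in>?F. \<epsilon> (cf a x) * xi l (pairing r a v) + \<epsilon> (cf a y) * xi l (pairing r a v))"
    using c by (intro sum.cong refl) (auto simp: UD.comp_add W_closed lform_add[OF lf_counit] distrib_right)
  also have "\<dots> = phi v x + phi v y"
    unfolding sum.distrib by (intro arg_cong2[where f = "(+)"] phi_sum[OF F, symmetric]) auto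
  finally show "phi v (x \<oplus> y) = phi v x + phi v y" .
next
  fix k x assume c: "x \<in> carrier U"
  let ?F = "{a\<in>lat r. cf a x \<noteq> \<zero>} \<union> {a\<in>lat r. cf a (k \<odot> x) \<noteq> \<zero>}"
  have F: "finite ?F" "?F \<subseteq> lat r" using cf_finite c by auto
  have "phi v (k \<odot> x) = (\<Sum>a\<in>?F. \<epsilon> (cf a (k \<odot> x)) * xi l (pairing r a v))"
    by (rule phi_sum[OF F]) auto
  also have "\<dots> = (\<Sum>a\<in>?F. k * (\<epsilon> (cf a x) * xi l (pairing r a v)))"
    using c by (intro sum.cong refl) (auto simp: UD.comp_smult W_closed lform_smult[OF lf_counit])
  also have "\<dots> = k * phi v x"
    unfolding sum_distrib_left[symmetric] by (intro arg_cong2[where f = "(*)"] phi_sum[OF F, symmetric]) auto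
  finally show "phi v (k \<odot> x) = k * phi v x" .
qed

lemma phi_W: "w \<in> W \<Longrightarrow> a \<in> lat r \<Longrightarrow> phi v (w \<otimes> K a) = \<epsilon> w * xi l (pairing r a v)"
  using UD.comp_\<phi>[of a w] by (subst phi_sum[of "{a}"]) (auto split: if_splits)

lemma phi_K: "a \<in> lat r \<Longrightarrow> phi v (K a) = xi l (pairing r a v)"
  using phi_W[of \<one> a v] Wd_W[OF lat_zero one_Wd] by simp

lemma phi_Kl: "a \<in> lat r \<Longrightarrow> u \<in> carrier U \<Longrightarrow> phi v (u \<otimes> Kl a) = chi v a * phi v u"
proof -
  assume a: "a \<in> lat r" and u: "u \<in> carrier U"
  note [lin] = lform_lmap[OF lf_phi]
  show ?thesis
  proof (rule UD.lform_eqI[of "\<lambda>u. phi v (u \<otimes> Kl a)" "\<lambda>u. chi v a * phi v u", OF _ _ _ u])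
    fix b w assume b: "b \<in> lat r" and w: "w \<in> W"
    have "w \<otimes> K b \<otimes> Kl a = w \<otimes> K (b + fscale (of_nat l) a)"
      using a b w W_closed by (simp add: K_add m_assoc)
    then show "phi v (w \<otimes> K b \<otimes> Kl a) = chi v a * phi v (w \<otimes> K b)"
      using a b w by (simp add: phi_W pairing_add_left xi_add chi_def pairing_fscale_left)
  qed ((intro lin)?; simp add: a)+
qed

text \<open>\<open>phi\<close> has not been shown to be multiplicative, so vanishing is proved for c
  x d with arbitrary c and d. On a generator, \<open>Kl a\<close> is central and leaves through
  \<open>phi_Kl\<close>.\<close>

lemma mf_phi: "mf v (phi v)"
proof -
  note [lin] = lform_lmap[OF lf_phi]
  have "phi v (c \<otimes> x \<otimes> d) = 0" if "x \<in> qideal v" "c \<in> carrier U" "d \<in> carrier U" for x c d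
    using that
  proof (induction x arbitrary: c d rule: qideal_induct)
    case (gen a)
    have l: "lf (\<lambda>x. phi v (c \<otimes> x \<otimes> d))" by ((intro lin)?; simp add: gen)
    have "phi v (c \<otimes> (Kl a \<ominus> chi v a \<odot> \<one>) \<otimes> d) = phi v (c \<otimes> Kl a \<otimes> d) - chi v a * phi v (c \<otimes> d)"
      using lform_a_minus[OF cspace l] lform_smult[OF l] gen by simp
    also have "c \<otimes> Kl a \<otimes> d = c \<otimes> d \<otimes> Kl a"
      using K_l_commute[OF gen(1) gen(3)] gen by (simp add: m_assoc)
    finally show ?case using gen by (simp add: phi_Kl)
  next
    case (add x y)
    then show ?case by (simp add: l_distr r_distr lform_add[OF lf_phi])
  next
    case (left b x)
    then show ?case using left(3)[of "c \<otimes> b" d] by (simp add: m_assoc)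
  next
    case (right b x)
    then show ?case using right(3)[of c "b \<otimes> d"] by (simp add: m_assoc)
  qed
  from this[of _ \<one> \<one>] show ?thesis by (auto simp: mf_def lf_phi qideal_closed)
qed

end

section \<open>Homogeneity of the integral; one-sided inverse of the distinguished element\<close>

section \<open>The distinguished grouplike element\<close>

locale graded_integral = graded_hopf U \<Delta> \<epsilon> S g r l W Wd K
    + gcoalgebra_integral U \<Delta> \<epsilon> S g "graded_hopf.qideal U r l K" L Y
  for U :: "'a calg" (structure) and \<Delta> \<epsilon> S g r l W Wd K L Y
begin

text \<open>The integral is concentrated in a single degree \<open>d\<close>: composing it with the projection to a
  degree where \<open>Y\<close> is visible gives another integral, so uniqueness applies.\<close>

lemma integral_homogeneous:
  obtains d where "d \<in> lat r" "\<And>v x. x \<in> carrier U \<Longrightarrow> L v (gr d x) = L v x"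
    "graded_integral U \<Delta> \<epsilon> S g r l W Wd K L (gr d Y)"
proof -
  obtain F where F: "finite F" "F \<subseteq> lat r" "\<forall>f. lf f \<longrightarrow> f Y = (\<Sum>m\<in>F. f (gr m Y))"
    using gr_decomp_ex[OF Y_closed] by (elim exE conjE) (rule that)
  have "(\<Sum>m\<in>F. L 0 (gr m Y)) \<noteq> 0" using F(3)[rule_format, OF mf_lf[OF mf_L[of 0]]] L_Y by simp
  then obtain d where d: "d \<in> F" "L 0 (gr d Y) \<noteq> 0" by (rule sum.not_neutral_contains_not_neutral)
  have dl: "d \<in> lat r" using d F by auto
  have int: "sw (\<lambda>p q. L \<alpha> (gr d p) * f q) x = L (\<alpha> + \<beta>) (gr d x) * f \<one>"
    if f: "mf \<beta> f" and x: "x \<in> carrier U" for \<alpha> \<beta> f x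
  proof (rule gr_lf_eqI[of "\<lambda>x. sw (\<lambda>p q. L \<alpha> (gr d p) * f q) x" "\<lambda>x. L (\<alpha> + \<beta>) (gr d x) * f \<one>", OF _ _ _ x])
    fix n x assume n: "n \<in> lat r" and x: "x \<in> Udg n"
    have b: "bf (\<lambda>p q. L \<alpha> p * f q)" by (intro bform_prod mf_lf[OF f] mf_lf[OF mf_L])
    \<comment> \<open>For x of degree n, degree d in the first leg means degree n - d in the second.
      The projection thus moves from the integral to f, and f(gr (n - d) 1) can be nonzero only for
      n = d.\<close>
    have "sw (\<lambda>p q. L \<alpha> (gr d p) * f q) x = sw (\<lambda>p q. L \<alpha> p * f (gr (n - d) q)) x"
      using sw_gr(1)[OF n x b, of d] sw_gr(2)[OF n x b, of "n - d"] by simp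
    also have "\<dots> = L (\<alpha> + \<beta>) x * f (gr (n - d) \<one>)"
      by (rule right_integral[OF mf_gr[OF f] Udg_closed[OF n x]])
    also have "\<dots> = L (\<alpha> + \<beta>) (gr d x) * f \<one>"
      by (auto simp: gr_Udg_eq[OF n x] gr_Udg_eq[OF lat_zero one_Udg] lform_zero[OF cspace mf_lf[OF f]]
          lform_zero[OF cspace mf_lf[OF mf_L]])
    finally show "sw (\<lambda>p q. L \<alpha> (gr d p) * f q) x = L (\<alpha> + \<beta>) (gr d x) * f \<one>" .
  qed ((intro lin lform_lmap[OF mf_lf[OF f]])?; simp)+
  have u: "L v (gr d x) = L 0 (gr d Y) * L v x" if "x \<in> carrier U" for v x
    by (rule integral_unique[of "\<lambda>v x. L v (gr d x)", OF mf_gr[OF mf_L] int that])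
  \<comment> \<open>By uniqueness this number equals its own square; d was chosen to make it
    nonzero, so it is 1.\<close>
  have "L 0 (gr d Y) = L 0 (gr d Y) * L 0 (gr d Y)"
    using u[of "gr d Y" 0] by (simp add: gr_gr)
  then have c: "L 0 (gr d Y) = 1" using d(2) by simp
  have "gcoalgebra_integral U \<Delta> \<epsilon> S g qideal L (gr d Y)"
  proof unfold_locales
    show "gr d Y \<in> carrier U" by simp
    show "L 0 (gr d Y) = 1" by (rule c)
    fix f x assume f: "mf 0 f" and x: "x \<in> carrier U"
    note [lin] = lform_lmap[OF mf_lf[OF f]]
    show "f (x \<otimes> gr d Y) = \<epsilon> x * f (gr d Y)"
    proof (rule gr_lf_eqI[of "\<lambda>x. f (x \<otimes> gr d Y)" "\<lambda>x. \<epsilon> x * f (gr d Y)", OF _ _ _ x])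
      fix n x assume n: "n \<in> lat r" and x: "x \<in> Udg n"
      have "f (x \<otimes> gr d Y) = \<epsilon> x * f (gr (n + d) Y)"
        using Y_left[OF mf_gr[OF f] Udg_closed[OF n x], of "n + d"] by (simp add: gr_mult_left[OF n x])
      then show "f (x \<otimes> gr d Y) = \<epsilon> x * f (gr d Y)"
        using hdeg_counit[OF n x] by (cases "n = 0") auto
    qed ((intro lin)?; simp)+
    show "f (gr d Y \<otimes> x) = \<epsilon> x * f (gr d Y)"
    proof (rule gr_lf_eqI[of "\<lambda>x. f (gr d Y \<otimes> x)" "\<lambda>x. \<epsilon> x * f (gr d Y)", OF _ _ _ x])
      fix n x assume n: "n \<in> lat r" and x: "x \<in> Udg n"
      have "f (gr d Y \<otimes> x) = \<epsilon> x * f (gr (d + n) Y)"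
        using Y_right[OF mf_gr[OF f] Udg_closed[OF n x], of "d + n"] by (simp add: gr_mult_right[OF n x])
      then show "f (gr d Y \<otimes> x) = \<epsilon> x * f (gr d Y)"
        using hdeg_counit[OF n x] by (cases "n = 0") auto
    qed ((intro lin)?; simp)+
  qed (use mf_L right_integral in auto)
  then have "graded_integral U \<Delta> \<epsilon> S g r l W Wd K L (gr d Y)"
    by (intro graded_integral.intro graded_hopf_axioms)
  with that[OF dl] u c show ?thesis by simp
qed

text \<open>Y_1 \<lambda>(Y_2), the second leg being read in the quotient at -v. The results about
  it are equalities in the quotient at v.\<close>

definition dist_elt :: "cvec \<Rightarrow> 'a" where
  "dist_elt v = form_right U (L (- v)) (\<Delta> Y)"

lemma dist_elt_closed [simp]: "dist_elt v \<in> carrier U"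
  and lf_dist_elt: "lf f \<Longrightarrow> f (dist_elt v) = sw (\<lambda>p q. f p * L (- v) q) Y"
proof -
  show 1: "dist_elt v \<in> carrier U"
    unfolding dist_elt_def form_right_def by (rule UU.tens_lift_eval(2)[OF cspace lf_counit]) simp_all
  assume f: "lf f"
  have "f (dist_elt v) = sw (\<lambda>p q. f (L (- v) q \<odot> p)) Y"
    unfolding dist_elt_def form_right_def by (rule UU.tens_lift_eval(1)[OF cspace f]) simp_all
  also have "\<dots> = sw (\<lambda>p q. f p * L (- v) q) Y"
    by (intro sw_cong) (simp_all add: lform_smult[OF f] mult.commute)
  finally show "f (dist_elt v) = sw (\<lambda>p q. f p * L (- v) q) Y" .
qed

text \<open>By nondegeneracy \<lambda>(S(x)) = \<lambda>(S(b) x) with b = \<lambda>(S(Y_1)) Y_2,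
  which is \<lambda>(x Si(b)) by \<open>L_commute\<close>. Substituting into f(1) = f(Y_1)
  \<lambda>(S(Y_2)) and moving b to the first leg exhibits Si(Si(b)) as the inverse.\<close>

lemma dist_elt_right_inverse:
  obtains c where "c \<in> carrier U" "\<And>f. mf v f \<Longrightarrow> f (dist_elt v \<otimes> c) = f \<one>"
proof -
  define b where "b = form_left U (\<lambda>p. L v (S p)) (\<Delta> Y)"
  have b [simp]: "b \<in> carrier U"
    unfolding b_def form_left_def by (rule UU.tens_lift_eval(2)[OF cspace lf_counit]) simp_all
  have fb: "f b = sw (\<lambda>p q. L v (S p) * f q) Y" if f: "lf f" for f
  proof -
    have "f b = sw (\<lambda>p q. f (L v (S p) \<odot> q)) Y"
      unfolding b_def form_left_def by (rule UU.tens_lift_eval(1)[OF cspace f]) simp_all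
    also have "\<dots> = sw (\<lambda>p q. L v (S p) * f q) Y"
      by (intro sw_cong) (simp_all add: lform_smult[OF f])
    finally show ?thesis .
  qed
  have eq: "L v (S x) = L (- v) (x \<otimes> Si b)" if x: "x \<in> carrier U" for x
  proof -
    let ?D = "\<lambda>x. L v (S x) - L (- v) (S b \<otimes> x)"
    have "?D x = 0"
    proof (rule mf_zero_left[of "- v", OF _ _ x])
      show "mf (- v) ?D" by (intro mf_minus modlin) simp_all
      fix f assume "mf (- (- v)) f"
      then have f: "mf v f" by simp
      have h: "bmf (- v) (- (- v)) (\<lambda>p q. L (- v) p * f q)"
        by (intro bmfI mf_mult_left mf_mult_right mf_L) (simp add: f)
      have "sw (\<lambda>p q. L (- v) (S b \<otimes> p) * f q) Y = sw (\<lambda>p q. L (- v) p * f (b \<otimes> q)) Y"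
        by (rule Y_move_left[OF h b, symmetric])
      also have "\<dots> = f b"
        using integral_Y[of "- v" "\<lambda>q. f (b \<otimes> q)"] mf_lmod[OF f lmod_mult_left[OF b lmod_id[OF refl]]] by simp
      finally show "sw (\<lambda>p q. ?D p * f q) Y = 0"
        by (simp add: left_diff_distrib tev_diff fb[OF mf_lf[OF f]])
    qed
    then show ?thesis using L_commute[of "Si b" x "- v"] x by simp
  qed
  have "f (dist_elt v \<otimes> Si (Si b)) = f \<one>" if f: "mf v f" for f
  proof -
    have h: "bmf v (- v) (\<lambda>p q. f p * L (- v) q)"
      by (intro bmfI mf_mult_left mf_mult_right mf_L f)
    have "f \<one> = sw (\<lambda>p q. f p * L v (S q)) Y"
      using antipode_integral[OF f Y_closed, of "- v"] by (simp add: L_antipode_Y)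
    also have "\<dots> = sw (\<lambda>p q. f p * L (- v) (q \<otimes> S (Si (Si b)))) Y"
      by (intro sw_cong) (simp_all add: eq)
    also have "\<dots> = sw (\<lambda>p q. f (p \<otimes> Si (Si b)) * L (- v) q) Y"
      by (rule Y_move_right[OF h, symmetric]) simp
    also have "\<dots> = f (dist_elt v \<otimes> Si (Si b))"
      by (rule lf_dist_elt[symmetric]) ((intro lin lform_lmap[OF mf_lf[OF f]])?; simp)
    finally show ?thesis ..
  qed
  then show ?thesis using that[of "Si (Si b)"] by simp
qed

end

section \<open>The inverse of the R-matrix, its square antipode invariance, and Theta\<close>

section \<open>Twisted R-matrices\<close>

text \<open>Only summands x_i \<otimes> y_i of opposite degrees occur; \<open>dg i\<close> is the
  degree of x_i. Accordingly the factor B_{|y_j|}^{-1} of the first coproduct formula appears in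
  \<open>hex_left\<close> as \<open>K (Bd (dg j))\<close>.\<close>

locale twisted_R = graded_hopf U \<Delta> \<epsilon> S g r l W Wd K
  for U :: "'a calg" (structure) and \<Delta> \<epsilon> S g r l W Wd K +
  fixes Bd :: "cvec \<Rightarrow> cvec" and J :: "nat set" and Rx Ry :: "nat \<Rightarrow> 'a" and dg :: "nat \<Rightarrow> cvec"
    and Ri :: "('a, 'a) tens"
  assumes Bd_lat [simp]: "m \<in> lat r \<Longrightarrow> Bd m \<in> lat r"
    and Bd_add: "Bd (m + n) = Bd m + Bd n"
    and Bd_sym: "m \<in> lat r \<Longrightarrow> n \<in> lat r \<Longrightarrow> pairing r (Bd m) n = pairing r (Bd n) m"
    and J: "finite J" and dg [simp]: "i \<in> J \<Longrightarrow> dg i \<in> lat r"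
    and Rx: "i \<in> J \<Longrightarrow> Rx i \<in> Udg (dg i)" and Ry: "i \<in> J \<Longrightarrow> Ry i \<in> Udg (- dg i)"
    and Ri_closed [simp]: "Ri \<in> carrier (U \<otimes>\<^sub>A U)"
    and R_Ri: "bf h \<Longrightarrow> (\<Sum>i\<in>J. tev (\<lambda>p q. h (Rx i \<otimes> p) (Ry i \<otimes> q)) Ri) = h \<one> \<one>"
    and Ri_R: "bf h \<Longrightarrow> (\<Sum>i\<in>J. tev (\<lambda>p q. h (p \<otimes> Rx i) (q \<otimes> Ry i)) Ri) = h \<one> \<one>"
    and hex_left: "tf k \<Longrightarrow> (\<Sum>i\<in>J. sw (\<lambda>a b. k a b (Ry i)) (Rx i))
      = (\<Sum>j\<in>J. \<Sum>i\<in>J. k (Rx j) (K (Bd (dg j)) \<otimes> Rx i) (Ry j \<otimes> Ry i))"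
    and hex_right: "tf k \<Longrightarrow> (\<Sum>i\<in>J. sw (\<lambda>a b. k (Rx i) a b) (Ry i))
      = (\<Sum>j\<in>J. \<Sum>i\<in>J. k (Rx j \<otimes> Rx i) (K (- Bd (dg j)) \<otimes> Ry i) (Ry j))"
    and ribbon: "lf f \<Longrightarrow> (\<Sum>i\<in>J. f (Ry i \<otimes> g \<otimes> Rx i \<otimes> K (Bd (dg i))))
      = (\<Sum>i\<in>J. f (Rx i \<otimes> gi \<otimes> Ry i \<otimes> K (- Bd (dg i))))"
begin

abbreviation "kb m \<equiv> K (Bd m)"
abbreviation "kn m \<equiv> K (- Bd m)"

lemma Bd_zero [simp]: "Bd 0 = 0"
  using Bd_add[of 0 0] by simp

lemma Bd_uminus: "Bd (- m) = - Bd m"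
  using Bd_add[of m "- m"] by (simp add: eq_neg_iff_add_eq_0 add.commute)

lemma Rx_closed [simp]: "i \<in> J \<Longrightarrow> Rx i \<in> carrier U" and Ry_closed [simp]: "i \<in> J \<Longrightarrow> Ry i \<in> carrier U"
  using Udg_closed[OF _ Rx] Udg_closed[OF _ Ry] by auto

lemma lf_tev_Ri [lin]:
  "(\<And>p q. p \<in> carrier U \<Longrightarrow> q \<in> carrier U \<Longrightarrow> lform A (\<lambda>z. h z p q)) \<Longrightarrow> lform A (\<lambda>z. tev (h z) Ri)"
  by (rule UU.lform_tev_param[OF Ri_closed])

lemma Ri_cong:
  "(\<And>p q. p \<in> carrier U \<Longrightarrow> q \<in> carrier U \<Longrightarrow> h p q = h' p q) \<Longrightarrow> tev h Ri = tev h' Ri"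
  by (rule UU.tev_cong[OF Ri_closed])

text \<open>A left inverse of the R-matrix equals \<open>Ri\<close>: insert the product of R and
  \<open>Ri\<close> behind it.\<close>

lemma tev_Ri_unique:
  assumes h: "bf h" and c: "\<And>j. j \<in> J \<Longrightarrow> a j \<in> carrier U" "\<And>j. j \<in> J \<Longrightarrow> b j \<in> carrier U"
    and inv: "\<And>k. bf k \<Longrightarrow> (\<Sum>j\<in>J. \<Sum>i\<in>J. k (a j \<otimes> Rx i) (b j \<otimes> Ry i)) = k \<one> \<one>"
  shows "tev h Ri = (\<Sum>j\<in>J. h (a j) (b j))"
proof -
  note [lin] = bform_lform1[OF h] bform_lform2[OF h]
  let ?k = "\<lambda>u v. tev (\<lambda>p q. h (u \<otimes> p) (v \<otimes> q)) Ri"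
  have k: "bf ?k" by ((intro lin)?; simp)
  have "(\<Sum>j\<in>J. h (a j) (b j)) = (\<Sum>j\<in>J. \<Sum>i\<in>J. tev (\<lambda>p q. h (a j \<otimes> (Rx i \<otimes> p)) (b j \<otimes> (Ry i \<otimes> q))) Ri)"
  proof (rule sum.cong[OF refl])
    fix j assume j: "j \<in> J"
    have "bf (\<lambda>u v. h (a j \<otimes> u) (b j \<otimes> v))" by ((intro lin)?; simp add: c j)
    from R_Ri[OF this] show "h (a j) (b j) = (\<Sum>i\<in>J. tev (\<lambda>p q. h (a j \<otimes> (Rx i \<otimes> p)) (b j \<otimes> (Ry i \<otimes> q))) Ri)"
      using c j by simp
  qed
  also have "\<dots> = (\<Sum>j\<in>J. \<Sum>i\<in>J. ?k (a j \<otimes> Rx i) (b j \<otimes> Ry i))"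
    by (intro sum.cong refl Ri_cong) (simp add: c m_assoc)
  also have "\<dots> = ?k \<one> \<one>" by (rule inv[OF k])
  also have "\<dots> = tev h Ri" by (intro Ri_cong) simp
  finally show ?thesis by simp
qed

text \<open>The same insertion: an element that fixes the R-matrix under left multiplication is
  1.\<close>

lemma R_cancel:
  assumes h: "bf h" and c: "\<And>j. j \<in> J \<Longrightarrow> a j \<in> carrier U" "\<And>j. j \<in> J \<Longrightarrow> b j \<in> carrier U"
    and eq: "\<And>k. bf k \<Longrightarrow> (\<Sum>j\<in>J. \<Sum>i\<in>J. k (a j \<otimes> Rx i) (b j \<otimes> Ry i)) = (\<Sum>i\<in>J. k (Rx i) (Ry i))"
  shows "(\<Sum>j\<in>J. h (a j) (b j)) = h \<one> \<one>"
proof -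
  note [lin] = bform_lform1[OF h] bform_lform2[OF h]
  let ?k = "\<lambda>u v. tev (\<lambda>p q. h (u \<otimes> p) (v \<otimes> q)) Ri"
  have k: "bf ?k" by ((intro lin)?; simp)
  have "(\<Sum>j\<in>J. h (a j) (b j)) = (\<Sum>j\<in>J. \<Sum>i\<in>J. tev (\<lambda>p q. h (a j \<otimes> (Rx i \<otimes> p)) (b j \<otimes> (Ry i \<otimes> q))) Ri)"
  proof (rule sum.cong[OF refl])
    fix j assume j: "j \<in> J"
    have "bf (\<lambda>u v. h (a j \<otimes> u) (b j \<otimes> v))" by ((intro lin)?; simp add: c j)
    from R_Ri[OF this] show "h (a j) (b j) = (\<Sum>i\<in>J. tev (\<lambda>p q. h (a j \<otimes> (Rx i \<otimes> p)) (b j \<otimes> (Ry i \<otimes> q))) Ri)"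
      using c j by simp
  qed
  also have "\<dots> = (\<Sum>j\<in>J. \<Sum>i\<in>J. ?k (a j \<otimes> Rx i) (b j \<otimes> Ry i))"
    by (intro sum.cong refl Ri_cong) (simp add: c m_assoc)
  also have "\<dots> = (\<Sum>i\<in>J. ?k (Rx i) (Ry i))" by (rule eq[OF k])
  also have "\<dots> = h \<one> \<one>" by (rule R_Ri[OF h])
  finally show ?thesis .
qed

text \<open>The counit on the first leg of the left hexagon writes R as a product (sum of
  \<epsilon>(x_j) B_{|x_j|} \<otimes> y_j) R. Cancel R, and apply the counit once more to remove
  B.\<close>

lemma counit_Rx: "lf f \<Longrightarrow> (\<Sum>j\<in>J. \<epsilon> (Rx j) * f (Ry j)) = f \<one>"
proof -
  assume f: "lf f"
  have h: "bf (\<lambda>a b. \<epsilon> a * f b)" by (intro bform_prod f lf_counit)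
  have "(\<Sum>j\<in>J. (\<lambda>a b. \<epsilon> a * f b) (\<epsilon> (Rx j) \<odot> kb (dg j)) (Ry j)) = \<epsilon> \<one> * f \<one>"
  proof (rule R_cancel[OF h])
    fix k assume k: "bf k"
    note [lin] = bform_lform1[OF k] bform_lform2[OF k]
    have t: "tf (\<lambda>a b c. \<epsilon> a * k b c)" by ((intro lin)?; simp)
    have "(\<Sum>i\<in>J. k (Rx i) (Ry i)) = (\<Sum>i\<in>J. sw (\<lambda>a b. \<epsilon> a * k b (Ry i)) (Rx i))"
      by (intro sum.cong refl sw_counit_left[symmetric]) ((intro lin)?; simp)+
    also have "\<dots> = (\<Sum>j\<in>J. \<Sum>i\<in>J. \<epsilon> (Rx j) * k (kb (dg j) \<otimes> Rx i) (Ry j \<otimes> Ry i))"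
      using hex_left[OF t] by simp
    also have "\<dots> = (\<Sum>j\<in>J. \<Sum>i\<in>J. k (\<epsilon> (Rx j) \<odot> kb (dg j) \<otimes> Rx i) (Ry j \<otimes> Ry i))"
      by (intro sum.cong refl) (simp add: smult_mult lform_smult[OF bform1[OF k]])
    finally show "(\<Sum>j\<in>J. \<Sum>i\<in>J. k (\<epsilon> (Rx j) \<odot> kb (dg j) \<otimes> Rx i) (Ry j \<otimes> Ry i)) = (\<Sum>i\<in>J. k (Rx i) (Ry i))" ..
  qed simp_all
  then show ?thesis by (simp add: lform_smult[OF lf_counit] cong: sum.cong)
qed

lemma counit_Ry: "lf f \<Longrightarrow> (\<Sum>j\<in>J. \<epsilon> (Ry j) * f (Rx j)) = f \<one>"
proof -
  assume f: "lf f"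
  have h: "bf (\<lambda>a b. f a * \<epsilon> b)" by (intro bform_prod f lf_counit)
  have "(\<Sum>j\<in>J. (\<lambda>a b. f a * \<epsilon> b) (Rx j) (\<epsilon> (Ry j) \<odot> kn (dg j))) = f \<one> * \<epsilon> \<one>"
  proof (rule R_cancel[OF h])
    fix k assume k: "bf k"
    note [lin] = bform_lform1[OF k] bform_lform2[OF k]
    have t: "tf (\<lambda>a b c. k a b * \<epsilon> c)" by ((intro lin)?; simp)
    have "(\<Sum>i\<in>J. k (Rx i) (Ry i)) = (\<Sum>i\<in>J. sw (\<lambda>a b. k (Rx i) a * \<epsilon> b) (Ry i))"
      by (intro sum.cong refl sw_counit_right[symmetric]) ((intro lin)?; simp)+
    also have "\<dots> = (\<Sum>j\<in>J. \<Sum>i\<in>J. k (Rx j \<otimes> Rx i) (kn (dg j) \<otimes> Ry i) * \<epsilon> (Ry j))"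
      using hex_right[OF t] by simp
    also have "\<dots> = (\<Sum>j\<in>J. \<Sum>i\<in>J. k (Rx j \<otimes> Rx i) (\<epsilon> (Ry j) \<odot> kn (dg j) \<otimes> Ry i))"
      by (intro sum.cong refl) (simp add: smult_mult lform_smult[OF bform2[OF k]])
    finally show "(\<Sum>j\<in>J. \<Sum>i\<in>J. k (Rx j \<otimes> Rx i) (\<epsilon> (Ry j) \<odot> kn (dg j) \<otimes> Ry i)) = (\<Sum>i\<in>J. k (Rx i) (Ry i))" ..
  qed simp_all
  then show ?thesis by (simp add: lform_smult[OF lf_counit] mult.commute cong: sum.cong)
qed

text \<open>Contracting the first two legs of the left hexagon by S(a) b gives the inverse as the
  sum of S(x_j) B_{|x_j|} \<otimes> y_j. Its comparison with the formula of \<open>tev_Ri_Si\<close>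
  controls S \<otimes> S on the R-matrix.\<close>

lemma tev_Ri_antipode:
  assumes h: "bf h"
  shows "tev h Ri = (\<Sum>j\<in>J. h (S (Rx j) \<otimes> kb (dg j)) (Ry j))"
proof (rule tev_Ri_unique[OF h])
  fix k assume k: "bf k"
  note [lin] = bform_lform1[OF k] bform_lform2[OF k]
  have t: "tf (\<lambda>a b c. k (S a \<otimes> b) c)" by ((intro lin)?; simp)
  have "(\<Sum>j\<in>J. \<Sum>i\<in>J. k (S (Rx j) \<otimes> kb (dg j) \<otimes> Rx i) (Ry j \<otimes> Ry i))
      = (\<Sum>i\<in>J. sw (\<lambda>a b. k (S a \<otimes> b) (Ry i)) (Rx i))"
    unfolding hex_left[OF t] by (intro sum.cong refl) (simp add: m_assoc)
  also have "\<dots> = (\<Sum>i\<in>J. \<epsilon> (Rx i) * k \<one> (Ry i))"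
    by (intro sum.cong refl sw_antipode_left) ((intro lin)?; simp)+
  also have "\<dots> = k \<one> \<one>" by (rule counit_Rx) ((intro lin)?; simp)
  finally show "(\<Sum>j\<in>J. \<Sum>i\<in>J. k (S (Rx j) \<otimes> kb (dg j) \<otimes> Rx i) (Ry j \<otimes> Ry i)) = k \<one> \<one>" .
qed simp_all

lemma tev_Ri_Si:
  assumes h: "bf h"
  shows "tev h Ri = (\<Sum>j\<in>J. h (Rx j) (Si (Ry j) \<otimes> kn (dg j)))"
proof (rule tev_Ri_unique[OF h])
  fix k assume k: "bf k"
  note [lin] = bform_lform1[OF k] bform_lform2[OF k]
  have t: "tf (\<lambda>a b c. k a (Si c \<otimes> b))" by ((intro lin)?; simp)
  have "(\<Sum>j\<in>J. \<Sum>i\<in>J. k (Rx j \<otimes> Rx i) (Si (Ry j) \<otimes> kn (dg j) \<otimes> Ry i))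
      = (\<Sum>i\<in>J. sw (\<lambda>a b. k (Rx i) (Si b \<otimes> a)) (Ry i))"
    unfolding hex_right[OF t] by (intro sum.cong refl) (simp add: m_assoc)
  also have "\<dots> = (\<Sum>i\<in>J. \<epsilon> (Ry i) * k (Rx i) \<one>)"
    by (intro sum.cong refl sw_Si_left) ((intro lin)?; simp)+
  also have "\<dots> = k \<one> \<one>" by (rule counit_Ry) ((intro lin)?; simp)
  finally show "(\<Sum>j\<in>J. \<Sum>i\<in>J. k (Rx j \<otimes> Rx i) (Si (Ry j) \<otimes> kn (dg j) \<otimes> Ry i)) = k \<one> \<one>" .
qed simp_all

text \<open>Correction factors depend on the degree of x_j, so the tests wanted below vary with j.
  Gluing the forms H m along the degree projections makes them one bilinear form.\<close>

lemma bf_degree_dependent: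
  assumes H: "\<And>m. m \<in> dg ` J \<Longrightarrow> bf (H m)"
  shows "bf (\<lambda>a b. \<Sum>m\<in>dg ` J. H m (gr m a) b)"
  by (intro bformI lform_sum bform_lform1[OF H] bform2[OF H] lmap_gr gr_closed)

lemma degree_dependent:
  assumes H: "\<And>m. m \<in> dg ` J \<Longrightarrow> bf (H m)" and j: "j \<in> J" and a: "a \<in> Udg (dg j)" and b: "b \<in> carrier U"
  shows "(\<Sum>m\<in>dg ` J. H m (gr m a) b) = H (dg j) a b"
proof -
  have "H m (gr m a) b = (if m = dg j then H (dg j) a b else 0)" if "m \<in> dg ` J" for m
    using lform_zero[OF cspace bform1[OF H[OF that] b]] by (simp add: gr_Udg_eq[OF dg[OF j] a])
  then show ?thesis using J j by (simp add: sum.delta')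
qed

lemma Si_K [simp]: "a \<in> lat r \<Longrightarrow> Si (K a) = K (- a)"
  by (simp add: Si_def m_assoc flip: pivot_K)

text \<open>The two formulas for the inverse agree. Tested with S on the second leg and
  \<open>kn m\<close> on the first, one becomes S(x_j) \<otimes> S(y_j), the other the right-hand
  side.\<close>

lemma antipode_R:
  assumes H: "\<And>m. m \<in> dg ` J \<Longrightarrow> bf (H m)"
  shows "(\<Sum>j\<in>J. H (dg j) (S (Rx j)) (S (Ry j))) = (\<Sum>j\<in>J. H (dg j) (Rx j \<otimes> kn (dg j)) (kb (dg j) \<otimes> Ry j))"
proof -
  have H1: "bf (\<lambda>a b. H m (a \<otimes> kn m) (S b))" if "m \<in> dg ` J" for m
    by (intro bformI bform_lform1[OF H[OF that]] bform_lform2[OF H[OF that]] lin) (use that in auto)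
  let ?k = "\<lambda>a b. \<Sum>m\<in>dg ` J. H m (gr m a \<otimes> kn m) (S b)"
  have k: "bf ?k" by (rule bf_degree_dependent[OF H1])
  have "(\<Sum>j\<in>J. H (dg j) (S (Rx j)) (S (Ry j))) = (\<Sum>j\<in>J. ?k (S (Rx j) \<otimes> kb (dg j)) (Ry j))"
  proof (rule sum.cong[OF refl])
    fix j assume j: "j \<in> J"
    have "S (Rx j) \<otimes> kb (dg j) \<in> Udg (dg j)" by (intro Udg_K hdeg_antipode Rx j) (simp_all add: j)
    from degree_dependent[OF H1 j this Ry_closed[OF j]]
    show "H (dg j) (S (Rx j)) (S (Ry j)) = ?k (S (Rx j) \<otimes> kb (dg j)) (Ry j)"
      using j by (simp add: m_assoc K_inverse)
  qed
  also have "\<dots> = (\<Sum>j\<in>J. ?k (Rx j) (Si (Ry j) \<otimes> kn (dg j)))"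
    using tev_Ri_antipode[OF k] tev_Ri_Si[OF k] by simp
  also have "\<dots> = (\<Sum>j\<in>J. H (dg j) (Rx j \<otimes> kn (dg j)) (kb (dg j) \<otimes> Ry j))"
  proof (rule sum.cong[OF refl])
    fix j assume j: "j \<in> J"
    from degree_dependent[OF H1 j Rx[OF j], where b = "Si (Ry j) \<otimes> kn (dg j)"]
    show "?k (Rx j) (Si (Ry j) \<otimes> kn (dg j)) = H (dg j) (Rx j \<otimes> kn (dg j)) (kb (dg j) \<otimes> Ry j)"
      using j by simp
  qed
  finally show ?thesis .
qed

lemma K_conj:
  "a \<in> lat r \<Longrightarrow> m \<in> lat r \<Longrightarrow> x \<in> Udg m \<Longrightarrow> K a \<otimes> x \<otimes> K (- a) = xi l (pairing r a m) \<odot> x"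
  using Udg_closed[of m x] by (simp add: K_commute smult_mult m_assoc K_inverse)

text \<open>Two applications of \<open>antipode_R\<close> leave a conjugation by
  \<open>kb (dg j)\<close> on both legs; the legs have opposite degrees, so the two scalars are
  inverse to each other.\<close>

lemma antipode_square_R:
  assumes H: "\<And>m. m \<in> dg ` J \<Longrightarrow> bf (H m)"
  shows "(\<Sum>j\<in>J. H (dg j) (S (S (Rx j))) (S (S (Ry j)))) = (\<Sum>j\<in>J. H (dg j) (Rx j) (Ry j))"
proof -
  have H1: "bf (\<lambda>a b. H m (S a) (S b))" if "m \<in> dg ` J" for m
    by (intro bformI bform_lform1[OF H[OF that]] bform_lform2[OF H[OF that]] lin) (use that in auto)
  have H2: "bf (\<lambda>a b. H m (kb m \<otimes> a) (b \<otimes> kn m))" if "m \<in> dg ` J" for m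
    by (intro bformI bform_lform1[OF H[OF that]] bform_lform2[OF H[OF that]] lin) (use that in auto)
  have "(\<Sum>j\<in>J. H (dg j) (S (S (Rx j))) (S (S (Ry j))))
      = (\<Sum>j\<in>J. H (dg j) (kb (dg j) \<otimes> S (Rx j)) (S (Ry j) \<otimes> kn (dg j)))"
    by (subst antipode_R[OF H1]) (auto intro!: sum.cong)
  also have "\<dots> = (\<Sum>j\<in>J. H (dg j) (kb (dg j) \<otimes> (Rx j \<otimes> kn (dg j))) (kb (dg j) \<otimes> Ry j \<otimes> kn (dg j)))"
    by (rule antipode_R[OF H2])
  also have "\<dots> = (\<Sum>j\<in>J. H (dg j) (Rx j) (Ry j))"
  proof (rule sum.cong[OF refl])
    fix j assume j: "j \<in> J"
    have 1: "kb (dg j) \<otimes> (Rx j \<otimes> kn (dg j)) = xi l (pairing r (Bd (dg j)) (dg j)) \<odot> Rx j"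
      using K_conj[OF _ _ Rx[OF j]] j by (simp add: m_assoc)
    have 2: "kb (dg j) \<otimes> Ry j \<otimes> kn (dg j) = xi l (- pairing r (Bd (dg j)) (dg j)) \<odot> Ry j"
      using K_conj[OF _ _ Ry[OF j], of "Bd (dg j)"] j by (simp add: pairing_uminus_right)
    have h: "bf (H (dg j))" using H j by simp
    show "H (dg j) (kb (dg j) \<otimes> (Rx j \<otimes> kn (dg j))) (kb (dg j) \<otimes> Ry j \<otimes> kn (dg j)) = H (dg j) (Rx j) (Ry j)"
      unfolding 1 2 using j
      by (simp add: lform_smult[OF bform1[OF h]] lform_smult[OF bform2[OF h]] xi_uminus)
  qed
  finally show ?thesis .
qed

text \<open>The common value of the two sides of \<open>ribbon\<close>. Both expressions are
  essential: flipping a coproduct exchanges the order of x_i and y_i and so produces one where the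
  other started.\<close>

definition Theta :: 'a where
  "Theta = (\<Oplus>i\<in>J. Ry i \<otimes> g \<otimes> Rx i \<otimes> kb (dg i))"

lemma Theta_closed [simp]: "Theta \<in> carrier U"
  unfolding Theta_def by (auto intro!: finsum_closed)

lemma lf_Theta: "lf f \<Longrightarrow> f Theta = (\<Sum>i\<in>J. f (Ry i \<otimes> g \<otimes> Rx i \<otimes> kb (dg i)))"
  unfolding Theta_def by (rule lform_finsum[OF cspace]) auto

lemma lf_Theta': "lf f \<Longrightarrow> f Theta = (\<Sum>i\<in>J. f (Rx i \<otimes> gi \<otimes> Ry i \<otimes> kn (dg i)))"
  using lf_Theta ribbon by simp

text \<open>Each summand has total degree 0, so the scalars picked up by K a at y_i and at x_i
  cancel.\<close>

lemma Theta_K: "a \<in> lat r \<Longrightarrow> Theta \<otimes> K a = K a \<otimes> Theta"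
proof (rule lf_eqI)
  fix f assume a: "a \<in> lat r" and f: "lf f"
  note [lin] = lform_lmap[OF f]
  have "f (K a \<otimes> Theta) = (\<Sum>i\<in>J. f (K a \<otimes> (Ry i \<otimes> g \<otimes> Rx i \<otimes> kb (dg i))))"
    by (rule lf_Theta) ((intro lin)?; simp add: a)
  also have "\<dots> = (\<Sum>i\<in>J. f (Ry i \<otimes> g \<otimes> Rx i \<otimes> kb (dg i) \<otimes> K a))"
  proof (rule sum.cong[OF refl])
    fix i assume i: "i \<in> J"
    have k: "K a \<otimes> kb (dg i) = kb (dg i) \<otimes> K a"
      using K_add[of a "Bd (dg i)"] K_add[of "Bd (dg i)" a] a i by (simp add: add.commute)
    have "K a \<otimes> (Ry i \<otimes> g \<otimes> Rx i \<otimes> kb (dg i)) = K a \<otimes> Ry i \<otimes> g \<otimes> Rx i \<otimes> kb (dg i)"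
      using a i by (simp add: m_assoc)
    also have "\<dots> = xi l (pairing r a (- dg i)) \<odot> (Ry i \<otimes> (K a \<otimes> g) \<otimes> Rx i \<otimes> kb (dg i))"
      using a i by (simp add: K_commute[OF a _ Ry[OF i]] smult_mult m_assoc)
    also have "\<dots> = xi l (pairing r a (- dg i)) \<odot> (Ry i \<otimes> g \<otimes> (K a \<otimes> Rx i) \<otimes> kb (dg i))"
      using a i by (simp add: pivot_K[OF a, symmetric] m_assoc)
    also have "\<dots> = (xi l (pairing r a (- dg i)) * xi l (pairing r a (dg i))) \<odot> (Ry i \<otimes> g \<otimes> Rx i \<otimes> (K a \<otimes> kb (dg i)))"
      using a i V.smult_assoc1[of "xi l (pairing r a (- dg i))" "xi l (pairing r a (dg i))"]
      by (simp add: K_commute[OF a _ Rx[OF i]] smult_mult mult_smult m_assoc)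
    also have "\<dots> = Ry i \<otimes> g \<otimes> Rx i \<otimes> kb (dg i) \<otimes> K a"
      using a i by (simp add: k pairing_uminus_right xi_uminus m_assoc)
    finally show "f (K a \<otimes> (Ry i \<otimes> g \<otimes> Rx i \<otimes> kb (dg i))) = f (Ry i \<otimes> g \<otimes> Rx i \<otimes> kb (dg i) \<otimes> K a)" by simp
  qed
  also have "\<dots> = f (Theta \<otimes> K a)"
    by (rule lf_Theta[symmetric]) ((intro lin)?; simp add: a)
  finally show "f (Theta \<otimes> K a) = f (K a \<otimes> Theta)" ..
qed simp_all

lemma gi_K: "a \<in> lat r \<Longrightarrow> gi \<otimes> K a = K a \<otimes> gi"
proof -
  assume a: "a \<in> lat r"
  have "gi \<otimes> K a = gi \<otimes> (K a \<otimes> g) \<otimes> gi" using a by (simp add: m_assoc)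
  also have "\<dots> = K a \<otimes> gi" using a by (simp add: pivot_K[OF a, symmetric])
  finally show ?thesis .
qed

text \<open>Conjugation by g is S^2, under which the R-matrix is invariant.\<close>

lemma Theta_pivot: "Theta \<otimes> g = g \<otimes> Theta"
proof (rule lf_eqI)
  fix f assume f: "lf f"
  note [lin] = lform_lmap[OF f]
  have H: "bf (\<lambda>a b. f (b \<otimes> g \<otimes> a \<otimes> kb m \<otimes> g))" if "m \<in> dg ` J" for m
    by (intro lin) (use that in auto)
  have "f (g \<otimes> Theta) = (\<Sum>i\<in>J. f (g \<otimes> (Ry i \<otimes> g \<otimes> Rx i \<otimes> kb (dg i))))"
    by (rule lf_Theta) ((intro lin)?; simp)
  also have "\<dots> = (\<Sum>i\<in>J. f (S (S (Ry i)) \<otimes> g \<otimes> S (S (Rx i)) \<otimes> kb (dg i) \<otimes> g))"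
  proof (rule sum.cong[OF refl])
    fix i assume i: "i \<in> J"
    have "S (S (Ry i)) \<otimes> g \<otimes> S (S (Rx i)) \<otimes> kb (dg i) \<otimes> g
        = g \<otimes> Ry i \<otimes> g \<otimes> Rx i \<otimes> (gi \<otimes> kb (dg i)) \<otimes> g"
      using i by (simp add: antipode_square m_assoc)
    also have "\<dots> = g \<otimes> (Ry i \<otimes> g \<otimes> Rx i \<otimes> kb (dg i))"
      using i by (simp add: gi_K m_assoc)
    finally show "f (g \<otimes> (Ry i \<otimes> g \<otimes> Rx i \<otimes> kb (dg i)))
        = f (S (S (Ry i)) \<otimes> g \<otimes> S (S (Rx i)) \<otimes> kb (dg i) \<otimes> g)" by simp
  qed
  also have "\<dots> = (\<Sum>i\<in>J. f (Ry i \<otimes> g \<otimes> Rx i \<otimes> kb (dg i) \<otimes> g))"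
    by (rule antipode_square_R[OF H])
  also have "\<dots> = f (Theta \<otimes> g)"
    by (rule lf_Theta[symmetric]) ((intro lin)?; simp)
  finally show "f (Theta \<otimes> g) = f (g \<otimes> Theta)" ..
qed simp_all

end

text \<open>\<open>cross\<close> is the braiding axiom inside U: X stands for R \<Delta>(u) R^{-1},
  and its component of bidegree (m, n) is the opposite coproduct with the B-factors of that bidegree
  removed.\<close>

locale braided_integral = twisted_R U \<Delta> \<epsilon> S g r l W Wd K Bd J Rx Ry dg Ri
    + graded_integral U \<Delta> \<epsilon> S g r l W Wd K L Y
  for U :: "'a calg" (structure) and \<Delta> \<epsilon> S g r l W Wd K L Y Bd J Rx Ry dg Ri +
  assumes cross: "u \<in> carrier U \<Longrightarrow> \<exists>X\<in>carrier (U \<otimes>\<^sub>A U).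
    (\<forall>k. bform U U k \<longrightarrow>
      tev k X = (\<Sum>i\<in>J. tev (\<lambda>a b. tev (\<lambda>p q. k (Rx i \<otimes> p \<otimes> a) (Ry i \<otimes> q \<otimes> b)) (\<Delta> u)) Ri)) \<and>
    (\<forall>k. \<forall>m\<in>lat r. \<forall>n\<in>lat r. bform U U k \<longrightarrow>
      tev (\<lambda>p q. k (graded_hopf.gr U r W Wd K m p) (graded_hopf.gr U r W Wd K n q)) X =
      tev (\<lambda>p q. k (graded_hopf.gr U r W Wd K m q \<otimes> K (- Bd n))
        (K (- Bd m) \<otimes> graded_hopf.gr U r W Wd K n p)) (\<Delta> u))"

section \<open>Comparing the coproduct of the cointegral with its opposite\<close>

locale homogeneous_braided_integral = braided_integral +
  fixes d :: cvec
  assumes d [simp]: "d \<in> lat r" and L_gr: "x \<in> carrier U \<Longrightarrow> L v (gr d x) = L v x" and Y_Udg: "Y \<in> Udg d"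
begin

definition X where
  "X = (SOME X. X \<in> carrier (U \<otimes>\<^sub>A U) \<and>
    (\<forall>k. bf k \<longrightarrow>
      tev k X = (\<Sum>i\<in>J. tev (\<lambda>a b. sw (\<lambda>p q. k (Rx i \<otimes> p \<otimes> a) (Ry i \<otimes> q \<otimes> b)) Y) Ri)) \<and>
    (\<forall>k. \<forall>m\<in>lat r. \<forall>n\<in>lat r. bf k \<longrightarrow>
      tev (\<lambda>p q. k (gr m p) (gr n q)) X = sw (\<lambda>p q. k (gr m q \<otimes> kn n) (kn m \<otimes> gr n p)) Y))"

lemma X_props:
  shows X_closed [simp]: "X \<in> carrier (U \<otimes>\<^sub>A U)"
    and tev_X: "bf k \<Longrightarrow>
      tev k X = (\<Sum>i\<in>J. tev (\<lambda>a b. sw (\<lambda>p q. k (Rx i \<otimes> p \<otimes> a) (Ry i \<otimes> q \<otimes> b)) Y) Ri)"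
    and tev_X_gr: "m \<in> lat r \<Longrightarrow> n \<in> lat r \<Longrightarrow> bf k \<Longrightarrow>
      tev (\<lambda>p q. k (gr m p) (gr n q)) X = sw (\<lambda>p q. k (gr m q \<otimes> kn n) (kn m \<otimes> gr n p)) Y"
proof -
  have "\<exists>X. X \<in> carrier (U \<otimes>\<^sub>A U) \<and>
    (\<forall>k. bf k \<longrightarrow>
      tev k X = (\<Sum>i\<in>J. tev (\<lambda>a b. sw (\<lambda>p q. k (Rx i \<otimes> p \<otimes> a) (Ry i \<otimes> q \<otimes> b)) Y) Ri)) \<and>
    (\<forall>k. \<forall>m\<in>lat r. \<forall>n\<in>lat r. bf k \<longrightarrow>
      tev (\<lambda>p q. k (gr m p) (gr n q)) X = sw (\<lambda>p q. k (gr m q \<otimes> kn n) (kn m \<otimes> gr n p)) Y)"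
    using cross[OF Y_closed] unfolding Bex_def .
  note P = someI_ex[OF this, folded X_def]
  show "X \<in> carrier (U \<otimes>\<^sub>A U)" using P by (elim conjE)
  show "tev k X = (\<Sum>i\<in>J. tev (\<lambda>a b. sw (\<lambda>p q. k (Rx i \<otimes> p \<otimes> a) (Ry i \<otimes> q \<otimes> b)) Y) Ri)" if "bf k"
    using P[THEN conjunct2, THEN conjunct1, rule_format, OF that] .
  show "tev (\<lambda>p q. k (gr m p) (gr n q)) X = sw (\<lambda>p q. k (gr m q \<otimes> kn n) (kn m \<otimes> gr n p)) Y"
    if "m \<in> lat r" "n \<in> lat r" "bf k"
    using P[THEN conjunct2, THEN conjunct2, rule_format, OF that] .
qed

lemma X_cong:
  "(\<And>p q. p \<in> carrier U \<Longrightarrow> q \<in> carrier U \<Longrightarrow> h p q = h' p q) \<Longrightarrow> tev h X = tev h' X"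
  by (rule UU.tev_cong[OF X_closed])

lemma lf_tev_X [lin]:
  "(\<And>p q. p \<in> carrier U \<Longrightarrow> q \<in> carrier U \<Longrightarrow> lform A (\<lambda>z. h z p q)) \<Longrightarrow> lform A (\<lambda>z. tev (h z) X)"
  by (rule UU.lform_tev_param[OF X_closed])

text \<open>Finitely many elements admit one common finite set of degrees; allowing supersets makes
  room for a prescribed extra degree.\<close>

lemma gr_decomp_superset:
  assumes P: "finite P" "P \<subseteq> carrier U"
  shows "\<exists>F. finite F \<and> F \<subseteq> lat r \<and>
    (\<forall>p\<in>P. \<forall>f. lf f \<longrightarrow> (\<forall>F'. finite F' \<longrightarrow> F \<subseteq> F' \<longrightarrow> f p = (\<Sum>m\<in>F'. f (gr m p))))"
  using P
proof (induction P rule: finite_induct)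
  case empty
  show ?case by (rule exI[of _ "{}"]) simp
next
  case (insert p P)
  then have p: "p \<in> carrier U" and P: "P \<subseteq> carrier U" by auto
  obtain F where F: "finite F" "F \<subseteq> lat r"
    "\<forall>p\<in>P. \<forall>f. lf f \<longrightarrow> (\<forall>F'. finite F' \<longrightarrow> F \<subseteq> F' \<longrightarrow> f p = (\<Sum>m\<in>F'. f (gr m p)))"
    using insert.IH[OF P] by (elim exE conjE) (rule that)
  show ?case
  proof (rule gr_decomp[OF p])
    fix G assume G: "finite G" "G \<subseteq> lat r" "\<And>m. m \<notin> G \<Longrightarrow> gr m p = \<zero>"
      "\<And>f. lf f \<Longrightarrow> f p = (\<Sum>m\<in>G. f (gr m p))"
    have "f p = (\<Sum>m\<in>F'. f (gr m p))" if f: "lf f" and F': "finite F'" "F \<union> G \<subseteq> F'" for f F'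
      unfolding G(4)[OF f] using F' G(3) lform_zero[OF cspace f]
      by (intro sum.mono_neutral_left) auto
    then show ?case using F G(1,2) by (intro exI[of _ "F \<union> G"]) auto
  qed
qed

text \<open>Y has degree d, so degree m in the first leg of X occurs only with degree d - m in the
  second. This makes the factor \<open>kn (d - m)\<close> a constant and removes the second
  projection.\<close>

lemma tev_X_left:
  assumes m: "m \<in> lat r" and h: "bf h"
  shows "tev (\<lambda>p q. h (gr m p) q) X = sw (\<lambda>p q. h (gr m q \<otimes> kn (d - m)) (kn m \<otimes> p)) Y"
proof -
  note [lin] = bform_lform1[OF h] bform_lform2[OF h]
  have "\<exists>F. finite F \<and> F \<subseteq> lat r \<and> (\<forall>p\<in>snd ` Poly_Mapping.keys (rep X). \<forall>f. lf f \<longrightarrow>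
      (\<forall>F'. finite F' \<longrightarrow> F \<subseteq> F' \<longrightarrow> f p = (\<Sum>m\<in>F'. f (gr m p))))"
    using UU.rep_formals[OF X_closed] by (intro gr_decomp_superset) auto
  then obtain F where F: "finite F" "F \<subseteq> lat r" "\<forall>p\<in>snd ` Poly_Mapping.keys (rep X). \<forall>f. lf f \<longrightarrow>
      (\<forall>F'. finite F' \<longrightarrow> F \<subseteq> F' \<longrightarrow> f p = (\<Sum>m\<in>F'. f (gr m p)))"
    by (elim exE conjE) (rule that)
  \<comment> \<open>Ensures that the surviving degree is among the summands even if X has no
    component there.\<close>
  let ?F = "insert (d - m) F"
  have k: "bf (\<lambda>p q. h (q \<otimes> kn n) (kn m \<otimes> p))" if "n \<in> lat r" for n
    using that m by ((intro lin)?; simp)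
  have "tev (\<lambda>p q. h (gr m p) q) X = tev (\<lambda>p q. \<Sum>n\<in>?F. h (gr m p) (gr n q)) X"
    unfolding tev_def fev_def
  proof (intro sum.cong refl arg_cong2[where f = "(*)"])
    fix k assume k: "k \<in> Poly_Mapping.keys (rep X)"
    then have c: "fst k \<in> carrier U" "snd k \<in> carrier U"
      using UU.rep_formals[OF X_closed] by (cases k; auto)+
    have "lf (\<lambda>q. h (gr m (fst k)) q)" using c by ((intro lin)?; simp)
    then show "h (gr m (fst k)) (snd k) = (\<Sum>n\<in>?F. h (gr m (fst k)) (gr n (snd k)))"
      using F(3)[rule_format, of "snd k" "\<lambda>q. h (gr m (fst k)) q" ?F] k F(1) by blast
  qed
  also have "\<dots> = (\<Sum>n\<in>?F. sw (\<lambda>p q. h (gr m q \<otimes> kn n) (kn m \<otimes> gr n p)) Y)"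
    unfolding tev_sum using F m by (intro sum.cong refl tev_X_gr h) auto
  also have "\<dots> = (\<Sum>n\<in>?F. if n = d - m then sw (\<lambda>p q. h (gr m q \<otimes> kn n) (kn m \<otimes> p)) Y else 0)"
  proof (rule sum.cong[OF refl])
    fix n assume "n \<in> ?F"
    then have n: "n \<in> lat r" using F m by auto
    have "sw (\<lambda>p q. h (gr m q \<otimes> kn n) (kn m \<otimes> gr n p)) Y
        = sw (\<lambda>p q. h (gr m q \<otimes> kn n) (kn m \<otimes> gr n (gr (d - m) p))) Y"
      by (rule sw_gr(2)[OF d Y_Udg, of "\<lambda>p q. h (q \<otimes> kn n) (kn m \<otimes> gr n p)" m])
        ((intro lin)?; simp add: n m)+
    also have "\<dots> = (if n = d - m then sw (\<lambda>p q. h (gr m q \<otimes> kn n) (kn m \<otimes> gr (d - m) p)) Y else 0)"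
    proof (cases "n = d - m")
      case False
      then have "sw (\<lambda>p q. h (gr m q \<otimes> kn n) (kn m \<otimes> gr n (gr (d - m) p))) Y = sw (\<lambda>p q. 0) Y"
        using n m lform_zero[OF cspace bform2[OF h]] by (intro sw_cong) (simp_all add: gr_gr)
      then show ?thesis using False by simp
    next
      case True
      then show ?thesis using gr_gr by (auto intro!: sw_cong simp: gr_gr)
    qed
    also have "\<dots> = (if n = d - m then sw (\<lambda>p q. h (gr m q \<otimes> kn n) (kn m \<otimes> p)) Y else 0)"
      using sw_gr(2)[OF d Y_Udg k[OF n], of m] by (cases "n = d - m") simp_all
    finally show "sw (\<lambda>p q. h (gr m q \<otimes> kn n) (kn m \<otimes> gr n p)) Y
      = (if n = d - m then sw (\<lambda>p q. h (gr m q \<otimes> kn n) (kn m \<otimes> p)) Y else 0)" .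
  qed
  also have "\<dots> = sw (\<lambda>p q. h (gr m q \<otimes> kn (d - m)) (kn m \<otimes> p)) Y"
    using F(1) by (simp add: sum.delta)
  finally show ?thesis .
qed

lemma tev_X_right:
  assumes n: "n \<in> lat r" and h: "bf h"
  shows "tev (\<lambda>p q. h p (gr n q)) X = sw (\<lambda>p q. h (q \<otimes> kn n) (kn (d - n) \<otimes> gr n p)) Y"
proof -
  note [lin] = bform_lform1[OF h] bform_lform2[OF h]
  have "\<exists>F. finite F \<and> F \<subseteq> lat r \<and> (\<forall>p\<in>fst ` Poly_Mapping.keys (rep X). \<forall>f. lf f \<longrightarrow>
      (\<forall>F'. finite F' \<longrightarrow> F \<subseteq> F' \<longrightarrow> f p = (\<Sum>m\<in>F'. f (gr m p))))"
    using UU.rep_formals[OF X_closed] by (intro gr_decomp_superset) auto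
  then obtain F where F: "finite F" "F \<subseteq> lat r" "\<forall>p\<in>fst ` Poly_Mapping.keys (rep X). \<forall>f. lf f \<longrightarrow>
      (\<forall>F'. finite F' \<longrightarrow> F \<subseteq> F' \<longrightarrow> f p = (\<Sum>m\<in>F'. f (gr m p)))"
    by (elim exE conjE) (rule that)
  let ?F = "insert (d - n) F"
  have k: "bf (\<lambda>p q. h (q \<otimes> kn n) (kn m \<otimes> p))" if "m \<in> lat r" for m
    using that n by ((intro lin)?; simp)
  have "tev (\<lambda>p q. h p (gr n q)) X = tev (\<lambda>p q. \<Sum>m\<in>?F. h (gr m p) (gr n q)) X"
    unfolding tev_def fev_def
  proof (intro sum.cong refl arg_cong2[where f = "(*)"])
    fix k assume k: "k \<in> Poly_Mapping.keys (rep X)"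
    then have c: "fst k \<in> carrier U" "snd k \<in> carrier U"
      using UU.rep_formals[OF X_closed] by (cases k; auto)+
    have "lf (\<lambda>p. h p (gr n (snd k)))" using c by ((intro lin)?; simp)
    then show "h (fst k) (gr n (snd k)) = (\<Sum>m\<in>?F. h (gr m (fst k)) (gr n (snd k)))"
      using F(3)[rule_format, of "fst k" "\<lambda>p. h p (gr n (snd k))" ?F] k F(1) by blast
  qed
  also have "\<dots> = (\<Sum>m\<in>?F. sw (\<lambda>p q. h (gr m q \<otimes> kn n) (kn m \<otimes> gr n p)) Y)"
    unfolding tev_sum using F n by (intro sum.cong refl tev_X_gr h) auto
  also have "\<dots> = (\<Sum>m\<in>?F. if m = d - n then sw (\<lambda>p q. h (q \<otimes> kn n) (kn m \<otimes> gr n p)) Y else 0)"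
  proof (rule sum.cong[OF refl])
    fix m assume "m \<in> ?F"
    then have m: "m \<in> lat r" using F n by auto
    have "sw (\<lambda>p q. h (gr m q \<otimes> kn n) (kn m \<otimes> gr n p)) Y
        = sw (\<lambda>p q. h (gr m (gr (d - n) q) \<otimes> kn n) (kn m \<otimes> gr n p)) Y"
      using n m by (subst sw_gr(1)[OF d Y_Udg]) ((intro lin)?; simp)+
    also have "\<dots> = (if m = d - n then sw (\<lambda>p q. h (gr (d - n) q \<otimes> kn n) (kn m \<otimes> gr n p)) Y else 0)"
    proof (cases "m = d - n")
      case False
      then have "sw (\<lambda>p q. h (gr m (gr (d - n) q) \<otimes> kn n) (kn m \<otimes> gr n p)) Y = sw (\<lambda>p q. 0) Y"
        using n m lform_zero[OF cspace bform1[OF h]] by (intro sw_cong) (simp_all add: gr_gr)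
      then show ?thesis using False by simp
    next
      case True
      then show ?thesis by (auto intro!: sw_cong simp: gr_gr)
    qed
    also have "\<dots> = (if m = d - n then sw (\<lambda>p q. h (q \<otimes> kn n) (kn m \<otimes> gr n p)) Y else 0)"
      using sw_gr(1)[OF d Y_Udg k[OF m], of n] by (cases "m = d - n") simp_all
    finally show "sw (\<lambda>p q. h (gr m q \<otimes> kn n) (kn m \<otimes> gr n p)) Y
      = (if m = d - n then sw (\<lambda>p q. h (q \<otimes> kn n) (kn m \<otimes> gr n p)) Y else 0)" .
  qed
  also have "\<dots> = sw (\<lambda>p q. h (q \<otimes> kn n) (kn (d - n) \<otimes> gr n p)) Y"
    using F(1) by (simp add: sum.delta)
  finally show ?thesis .
qed

text \<open>With X = R \<Delta>(Y) R^{-1} this is R^{-1} X = \<Delta>(Y) R^{-1}: one inverse pair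
  cancels and the other inverse stays.\<close>

lemma X_inverse_left:
  assumes k: "bf k"
  shows "tev (\<lambda>a b. tev (\<lambda>p q. k (a \<otimes> p) (b \<otimes> q)) X) Ri = tev (\<lambda>a b. sw (\<lambda>p q. k (p \<otimes> a) (q \<otimes> b)) Y) Ri"
proof -
  note [lin] = bform_lform1[OF k] bform_lform2[OF k]
  let ?k = "\<lambda>u v. tev (\<lambda>a' b'. sw (\<lambda>p q. k (u \<otimes> (p \<otimes> a')) (v \<otimes> (q \<otimes> b'))) Y) Ri"
  have k': "bf ?k" by ((intro lin)?; simp)
  have "tev (\<lambda>a b. tev (\<lambda>p q. k (a \<otimes> p) (b \<otimes> q)) X) Ri
      = tev (\<lambda>a b. \<Sum>i\<in>J. ?k (a \<otimes> Rx i) (b \<otimes> Ry i)) Ri"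
  proof (rule Ri_cong)
    fix a b assume c: "a \<in> carrier U" "b \<in> carrier U"
    have "bf (\<lambda>p q. k (a \<otimes> p) (b \<otimes> q))" by ((intro lin)?; simp add: c)
    from tev_X[OF this]
    show "tev (\<lambda>p q. k (a \<otimes> p) (b \<otimes> q)) X = (\<Sum>i\<in>J. ?k (a \<otimes> Rx i) (b \<otimes> Ry i))"
      by (auto intro!: sum.cong Ri_cong sw_cong simp: c m_assoc)
  qed
  also have "\<dots> = ?k \<one> \<one>" unfolding tev_sum by (rule Ri_R[OF k'])
  also have "\<dots> = tev (\<lambda>a b. sw (\<lambda>p q. k (p \<otimes> a) (q \<otimes> b)) Y) Ri"
    by (auto intro!: Ri_cong sw_cong)
  finally show ?thesis .
qed

lemma X_conjugate:
  assumes k: "bf k"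
  shows "(\<Sum>i\<in>J. tev (\<lambda>a b. tev (\<lambda>p q. k (a \<otimes> p \<otimes> Rx i) (b \<otimes> q \<otimes> Ry i)) X) Ri) = sw k Y"
proof -
  note [lin] = bform_lform1[OF k] bform_lform2[OF k]
  have "(\<Sum>i\<in>J. tev (\<lambda>a b. tev (\<lambda>p q. k (a \<otimes> p \<otimes> Rx i) (b \<otimes> q \<otimes> Ry i)) X) Ri)
      = (\<Sum>i\<in>J. tev (\<lambda>a b. sw (\<lambda>p q. k (p \<otimes> a \<otimes> Rx i) (q \<otimes> b \<otimes> Ry i)) Y) Ri)"
    by (intro sum.cong refl X_inverse_left) ((intro lin)?; simp)
  also have "\<dots> = (\<Sum>i\<in>J. tev (\<lambda>a b. (\<lambda>u v. sw (\<lambda>p q. k (p \<otimes> u) (q \<otimes> v)) Y) (a \<otimes> Rx i) (b \<otimes> Ry i)) Ri)"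
    by (auto intro!: sum.cong Ri_cong sw_cong simp: m_assoc)
  also have "\<dots> = sw (\<lambda>p q. k (p \<otimes> \<one>) (q \<otimes> \<one>)) Y"
    by (rule Ri_R) ((intro lin)?; simp)
  also have "\<dots> = sw k Y" by (intro sw_cong) simp_all
  finally show ?thesis .
qed

lemma L_gr_left: "m \<in> lat r \<Longrightarrow> x \<in> Udg m \<Longrightarrow> u \<in> carrier U \<Longrightarrow> L v (x \<otimes> gr (d - m) u) = L v (x \<otimes> u)"
  using L_gr[of "x \<otimes> u" v] Udg_closed[of m x] by (simp add: gr_mult_left)

lemma L_gr_both:
  assumes m: "m \<in> lat r" "x \<in> Udg m" and n: "n \<in> lat r" "y \<in> Udg n" and u: "u \<in> carrier U"
    and k: "k = d - m - n"
  shows "L v (x \<otimes> gr k u \<otimes> y) = L v (x \<otimes> u \<otimes> y)"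
proof -
  note c = Udg_closed[OF m] Udg_closed[OF n]
  have "d - n - m = k" unfolding k by (simp add: diff_diff_eq add.commute)
  then have "gr d (x \<otimes> u \<otimes> y) = x \<otimes> gr k u \<otimes> y"
    using gr_mult_right[OF n, of "x \<otimes> u" d] gr_mult_left[OF m u, of "d - n"] u c by simp
  then show ?thesis using L_gr[of "x \<otimes> u \<otimes> y" v] u c by simp
qed

text \<open>Y absorbs K a on either side with counit 1, whereas commuting the two costs this
  scalar.\<close>

lemma xi_pairing_d: "a \<in> lat r \<Longrightarrow> xi l (pairing r a d) = 1"
proof -
  assume a: "a \<in> lat r"
  have "1 = L 0 (K a \<otimes> Y)" using Y_left[OF mf_L, of "K a"] a by (simp add: L_Y)
  also have "\<dots> = xi l (pairing r a d) * L 0 (Y \<otimes> K a)"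
    using a by (simp add: K_commute[OF a d Y_Udg] lform_smult[OF mf_lf[OF mf_L]])
  also have "L 0 (Y \<otimes> K a) = 1" using Y_right[OF mf_L, of "K a"] a by (simp add: L_Y)
  finally show ?thesis by simp
qed

abbreviation z :: 'a where "z \<equiv> kn d"

text \<open>Passing an element of degree m costs \<xi>^(-B(d, m)). By symmetry of B this is the
  inverse of the scalar in \<open>xi_pairing_d\<close> for \<open>Bd m\<close>, hence 1.\<close>

lemma z_central: "m \<in> lat r \<Longrightarrow> x \<in> Udg m \<Longrightarrow> z \<otimes> x = x \<otimes> z"
  using K_commute[of "- Bd d" m x] Bd_sym[of d m] xi_pairing_d[of "Bd m"] Udg_closed[of m x]
  by (simp add: pairing_uminus_left xi_uminus)

lemma K_K: "a \<in> lat r \<Longrightarrow> b \<in> lat r \<Longrightarrow> K a \<otimes> K b = K (a + b)"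
  by (simp add: K_add)

lemma K_K_assoc: "a \<in> lat r \<Longrightarrow> b \<in> lat r \<Longrightarrow> x \<in> carrier U \<Longrightarrow> K a \<otimes> (K b \<otimes> x) = K (a + b) \<otimes> x"
  by (simp add: K_add m_assoc)

lemma pivot_K_assoc: "a \<in> lat r \<Longrightarrow> x \<in> carrier U \<Longrightarrow> g \<otimes> (K a \<otimes> x) = K a \<otimes> (g \<otimes> x)"
  by (simp add: pivot_K m_assoc[symmetric])

lemma gr_antipode: "u \<in> carrier U \<Longrightarrow> gr m (S u) = S (gr m u)"
proof (rule lf_eqI)
  fix f assume u: "u \<in> carrier U" and f: "lf f"
  note [lin] = lform_lmap[OF f]
  show "f (gr m (S u)) = f (S (gr m u))"
  proof (rule gr_lf_eqI[of "\<lambda>u. f (gr m (S u))" "\<lambda>u. f (S (gr m u))", OF _ _ _ u])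
    fix n x assume n: "n \<in> lat r" and x: "x \<in> Udg n"
    show "f (gr m (S x)) = f (S (gr m x))"
      using lmap_smult[OF lmap_antipode zero_closed, of 0]
      by (simp add: gr_Udg_eq[OF n x] gr_Udg_eq[OF n hdeg_antipode[OF n x]])
  qed ((intro lin)?; simp)+
qed simp_all

lemma Si_Udg: "m \<in> lat r \<Longrightarrow> u \<in> Udg m \<Longrightarrow> Si u \<in> Udg m"
proof -
  assume m: "m \<in> lat r" and u: "u \<in> Udg m"
  note c = Udg_closed[OF m u]
  have "S (gr m (Si u)) = u" using gr_antipode[of "Si u" m] c by (simp add: gr_Udg_eq[OF m u])
  then have "gr m (Si u) = Si u" using Si_S[of "gr m (Si u)"] c by simp
  then show ?thesis using gr_Udg[of "Si u" m] c m by simp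
qed

lemma mf_left: "mf v f \<Longrightarrow> c \<in> carrier U \<Longrightarrow> mf v (\<lambda>x. f (c \<otimes> x))"
  and mf_right: "mf v f \<Longrightarrow> c \<in> carrier U \<Longrightarrow> mf v (\<lambda>x. f (x \<otimes> c))"
  by (rule mf_lmod, assumption, intro modlin; simp)+

lemma Theta_conj:
  assumes i: "i \<in> J"
  shows "kb (dg i) \<otimes> (Ry i \<otimes> g \<otimes> Rx i) = Ry i \<otimes> g \<otimes> Rx i \<otimes> kb (dg i)"
    "kn (dg i) \<otimes> (Rx i \<otimes> gi \<otimes> Ry i) = Rx i \<otimes> gi \<otimes> Ry i \<otimes> kn (dg i)"
proof -
  have 1: "K a \<otimes> (u \<otimes> h \<otimes> v) = u \<otimes> h \<otimes> v \<otimes> K a"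
    if a: "a \<in> lat r" and u: "m \<in> lat r" "u \<in> Udg m" and v: "v \<in> Udg (- m)" and h: "h \<in> carrier U" "K a \<otimes> h = h \<otimes> K a"
    for a u h v m
  proof -
    note c = Udg_closed[OF u] Udg_closed[OF _ v]
    have "K a \<otimes> (u \<otimes> h \<otimes> v) = K a \<otimes> u \<otimes> h \<otimes> v" using c h a u by (simp add: m_assoc)
    also have "\<dots> = xi l (pairing r a m) \<odot> (u \<otimes> (K a \<otimes> h) \<otimes> v)"
      using c h(1) a u by (simp add: K_commute[OF a u] smult_mult m_assoc)
    also have "\<dots> = xi l (pairing r a m) \<odot> (u \<otimes> h \<otimes> (K a \<otimes> v))"
      unfolding h(2) using c h(1) a u by (simp add: m_assoc)
    also have "\<dots> = u \<otimes> h \<otimes> v \<otimes> K a"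
      using c h(1) a u V.smult_assoc1[of "xi l (pairing r a m)" "inverse (xi l (pairing r a m))"]
      by (simp add: K_commute[OF a _ v] mult_smult pairing_uminus_right xi_uminus m_assoc)
    finally show ?thesis .
  qed
  show "kb (dg i) \<otimes> (Ry i \<otimes> g \<otimes> Rx i) = Ry i \<otimes> g \<otimes> Rx i \<otimes> kb (dg i)"
    using i Rx[OF i] by (intro 1[OF _ _ Ry[OF i]]) (simp_all add: pivot_K)
  show "kn (dg i) \<otimes> (Rx i \<otimes> gi \<otimes> Ry i) = Rx i \<otimes> gi \<otimes> Ry i \<otimes> kn (dg i)"
    using i by (intro 1[OF _ _ Rx[OF i] Ry[OF i]]) (simp_all add: gi_K)
qed

lemma bmf_L_right: "mf v f \<Longrightarrow> bmf v (- v) (\<lambda>p q. f p * L (- v) q)"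
  by (intro bmfI mf_mult_left mf_mult_right mf_L)

lemma bmf_L_left: "mf v f \<Longrightarrow> bmf (- v) (- (- v)) (\<lambda>p q. L (- v) p * f q)"
  by (intro bmfI mf_mult_left mf_mult_right mf_L) simp

lemma integral_move:
  assumes F: "mf v F" and c: "c \<in> carrier U"
  shows "sw (\<lambda>p q. L (- v) (S c \<otimes> p) * F q) Y = F c"
proof -
  have "sw (\<lambda>p q. L (- v) (S c \<otimes> p) * F q) Y = sw (\<lambda>p q. L (- v) p * F (c \<otimes> q)) Y"
    by (rule Y_move_left[OF bmf_L_left[OF F] c, symmetric])
  also have "\<dots> = F c" using integral_Y[of "- v" "\<lambda>q. F (c \<otimes> q)"] mf_left[OF F c] c by simp
  finally show ?thesis .
qed

text \<open>Tests R^{-1} X = \<Delta>(Y) R^{-1} by f on the first leg and the integral on the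
  second. On the right the R-factors are moved across Y and assemble to Theta behind the
  distinguished element. On the left the flip lets the integral consume Y_1, and the other
  expression of Theta appears, together with z.\<close>

lemma dist_elt_Theta1:
  assumes f: "mf v f"
  shows "f (dist_elt v \<otimes> gi \<otimes> Theta) = f (Theta \<otimes> g \<otimes> z)"
proof -
  note lf = mf_lf[OF f]
  note [lin] = lform_lmap[OF lf]
  let ?k = "\<lambda>p q. f p * L (- v) q"
  have k: "bf ?k" by (intro bform_prod lf mf_lf[OF mf_L])
  have "tev (\<lambda>a b. sw (\<lambda>p q. ?k (p \<otimes> a) (q \<otimes> b)) Y) Ri
      = (\<Sum>j\<in>J. sw (\<lambda>p q. f (p \<otimes> Rx j) * L (- v) (q \<otimes> (Si (Ry j) \<otimes> kn (dg j)))) Y)"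
    by (rule tev_Ri_Si) ((intro lin)?; simp)
  also have "\<dots> = (\<Sum>j\<in>J. f (dist_elt v \<otimes> gi \<otimes> (Ry j \<otimes> g \<otimes> Rx j \<otimes> kb (dg j))))"
  proof (rule sum.cong[OF refl])
    fix j assume j: "j \<in> J"
    have "sw (\<lambda>p q. f (p \<otimes> Rx j) * L (- v) (q \<otimes> (Si (Ry j) \<otimes> kn (dg j)))) Y
        = sw (\<lambda>p q. f (p \<otimes> Rx j) * L (- v) (q \<otimes> S (kb (dg j) \<otimes> Si (Si (Ry j))))) Y"
      using j by simp
    also have "\<dots> = sw (\<lambda>p q. f (p \<otimes> (kb (dg j) \<otimes> Si (Si (Ry j))) \<otimes> Rx j) * L (- v) q) Y"
      using j by (intro Y_move_right[OF bmf_L_right[OF mf_right[OF f]], symmetric]) simp_all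
    also have "\<dots> = f (dist_elt v \<otimes> (kb (dg j) \<otimes> Si (Si (Ry j))) \<otimes> Rx j)"
      by (rule lf_dist_elt[symmetric]) ((intro lin)?; simp add: j)
    also have "dist_elt v \<otimes> (kb (dg j) \<otimes> Si (Si (Ry j))) \<otimes> Rx j
        = dist_elt v \<otimes> (kb (dg j) \<otimes> gi \<otimes> (Ry j \<otimes> g \<otimes> Rx j))"
      using j by (simp add: Si_Si m_assoc)
    also have "\<dots> = dist_elt v \<otimes> gi \<otimes> (Ry j \<otimes> g \<otimes> Rx j \<otimes> kb (dg j))"
      using j Theta_conj(1)[OF j] by (simp add: gi_K[symmetric] m_assoc)
    finally show "sw (\<lambda>p q. f (p \<otimes> Rx j) * L (- v) (q \<otimes> (Si (Ry j) \<otimes> kn (dg j)))) Y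
        = f (dist_elt v \<otimes> gi \<otimes> (Ry j \<otimes> g \<otimes> Rx j \<otimes> kb (dg j)))" .
  qed
  also have "\<dots> = f (dist_elt v \<otimes> gi \<otimes> Theta)"
    by (rule lf_Theta[symmetric]) ((intro lin)?; simp)
  finally have l: "tev (\<lambda>a b. sw (\<lambda>p q. ?k (p \<otimes> a) (q \<otimes> b)) Y) Ri = f (dist_elt v \<otimes> gi \<otimes> Theta)" .
  have "tev (\<lambda>a b. tev (\<lambda>p q. ?k (a \<otimes> p) (b \<otimes> q)) X) Ri
      = (\<Sum>j\<in>J. tev (\<lambda>p q. f (Rx j \<otimes> p) * L (- v) (Si (Ry j) \<otimes> kn (dg j) \<otimes> q)) X)"
    by (rule tev_Ri_Si) ((intro lin)?; simp)
  also have "\<dots> = (\<Sum>j\<in>J. f (Rx j \<otimes> gi \<otimes> Ry j \<otimes> kn (dg j) \<otimes> g \<otimes> z))"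
  proof (rule sum.cong[OF refl])
    fix j assume j: "j \<in> J"
    have Sy: "Si (Ry j) \<in> Udg (- dg j)"
      using j by (intro Si_Udg Ry) simp_all
    have yk: "Si (Ry j) \<otimes> kn (dg j) \<in> Udg (- dg j)" using j by (intro Udg_K Sy) simp_all
    \<comment> \<open>The integral sees only degree d and the factor in front of q has degree
      \<open>- dg j\<close>; so q may be replaced by its component of degree
      \<open>d + dg j\<close>, where X is known.\<close>
    have "tev (\<lambda>p q. f (Rx j \<otimes> p) * L (- v) (Si (Ry j) \<otimes> kn (dg j) \<otimes> q)) X
        = tev (\<lambda>p q. f (Rx j \<otimes> p) * L (- v) (Si (Ry j) \<otimes> kn (dg j) \<otimes> gr (d + dg j) q)) X"
      using L_gr_left[OF _ yk] j by (intro X_cong) simp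
    also have "\<dots> = sw (\<lambda>p q. f (Rx j \<otimes> (q \<otimes> kn (d + dg j))) *
        L (- v) (Si (Ry j) \<otimes> kn (dg j) \<otimes> (kn (d - (d + dg j)) \<otimes> gr (d + dg j) p))) Y"
      using j by (intro tev_X_right) ((intro lin)?; simp)+
    also have "\<dots> = sw (\<lambda>p q. L (- v) (S (Si (Si (Ry j))) \<otimes> p) * f (Rx j \<otimes> (q \<otimes> kn (d + dg j)))) Y"
    proof (intro sw_cong Y_closed)
      fix p q assume c: "p \<in> carrier U" "q \<in> carrier U"
      have "Si (Ry j) \<otimes> kn (dg j) \<otimes> (kn (d - (d + dg j)) \<otimes> gr (d + dg j) p) = Si (Ry j) \<otimes> gr (d + dg j) p"
        using j c by (simp add: m_assoc K_K_assoc Bd_uminus K_zero)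
      then show "f (Rx j \<otimes> (q \<otimes> kn (d + dg j))) *
        L (- v) (Si (Ry j) \<otimes> kn (dg j) \<otimes> (kn (d - (d + dg j)) \<otimes> gr (d + dg j) p))
        = L (- v) (S (Si (Si (Ry j))) \<otimes> p) * f (Rx j \<otimes> (q \<otimes> kn (d + dg j)))"
        using L_gr_left[OF _ Sy c(1)] j by simp
    qed
    also have "\<dots> = f (Rx j \<otimes> (Si (Si (Ry j)) \<otimes> kn (d + dg j)))"
      using j by (intro integral_move mf_lmod[OF f] modlin) simp_all
    also have "Rx j \<otimes> (Si (Si (Ry j)) \<otimes> kn (d + dg j)) = Rx j \<otimes> gi \<otimes> Ry j \<otimes> kn (dg j) \<otimes> g \<otimes> z"
    proof -
      have "kn (d + dg j) = kn (dg j) \<otimes> z" using j by (simp add: K_K Bd_add add.commute)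
      then show ?thesis using j by (simp add: Si_Si m_assoc pivot_K pivot_K_assoc)
    qed
    finally show "tev (\<lambda>p q. f (Rx j \<otimes> p) * L (- v) (Si (Ry j) \<otimes> kn (dg j) \<otimes> q)) X
        = f (Rx j \<otimes> gi \<otimes> Ry j \<otimes> kn (dg j) \<otimes> g \<otimes> z)" .
  qed
  also have "\<dots> = f (Theta \<otimes> g \<otimes> z)"
    by (rule lf_Theta'[symmetric]) ((intro lin)?; simp)
  finally show ?thesis using l X_inverse_left[OF k] by simp
qed

text \<open>The same identity with the tests exchanged. Now the flip leaves f with Y_1, so the
  distinguished element arises on the side of X instead.\<close>

lemma dist_elt_Theta2:
  assumes f: "mf v f"
  shows "f (g \<otimes> Theta) = f (Theta \<otimes> gi \<otimes> z \<otimes> dist_elt v)"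
proof -
  note lf = mf_lf[OF f]
  note [lin] = lform_lmap[OF lf]
  let ?k = "\<lambda>p q. L (- v) p * f q"
  have k: "bf ?k" by (intro bform_prod lf mf_lf[OF mf_L])
  have "tev (\<lambda>a b. sw (\<lambda>p q. ?k (p \<otimes> a) (q \<otimes> b)) Y) Ri
      = (\<Sum>j\<in>J. sw (\<lambda>p q. L (- v) (p \<otimes> (S (Rx j) \<otimes> kb (dg j))) * f (q \<otimes> Ry j)) Y)"
    by (rule tev_Ri_antipode) ((intro lin)?; simp)
  also have "\<dots> = (\<Sum>j\<in>J. f (g \<otimes> (Rx j \<otimes> gi \<otimes> Ry j \<otimes> kn (dg j))))"
  proof (rule sum.cong[OF refl])
    fix j assume j: "j \<in> J"
    have "sw (\<lambda>p q. L (- v) (p \<otimes> (S (Rx j) \<otimes> kb (dg j))) * f (q \<otimes> Ry j)) Y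
        = sw (\<lambda>p q. L (- v) p * f (q \<otimes> S (S (Rx j) \<otimes> kb (dg j)) \<otimes> Ry j)) Y"
      using j by (intro Y_move_right[OF bmf_L_left[OF mf_right[OF f]]]) simp_all
    also have "\<dots> = f (S (S (Rx j) \<otimes> kb (dg j)) \<otimes> Ry j)"
      using integral_Y[of "- v" "\<lambda>q. f (q \<otimes> S (S (Rx j) \<otimes> kb (dg j)) \<otimes> Ry j)"]
        mf_right[OF mf_right[OF f Ry_closed[OF j]], of "S (S (Rx j) \<otimes> kb (dg j))"] j by simp
    also have "S (S (Rx j) \<otimes> kb (dg j)) \<otimes> Ry j = g \<otimes> (kn (dg j) \<otimes> (Rx j \<otimes> gi \<otimes> Ry j))"
      using j by (simp add: antipode_square pivot_K_assoc m_assoc)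
    also have "\<dots> = g \<otimes> (Rx j \<otimes> gi \<otimes> Ry j \<otimes> kn (dg j))"
      by (simp only: Theta_conj(2)[OF j])
    finally show "sw (\<lambda>p q. L (- v) (p \<otimes> (S (Rx j) \<otimes> kb (dg j))) * f (q \<otimes> Ry j)) Y
        = f (g \<otimes> (Rx j \<otimes> gi \<otimes> Ry j \<otimes> kn (dg j)))" .
  qed
  also have "\<dots> = f (g \<otimes> Theta)"
    by (rule lf_Theta'[symmetric]) ((intro lin)?; simp)
  finally have l: "tev (\<lambda>a b. sw (\<lambda>p q. ?k (p \<otimes> a) (q \<otimes> b)) Y) Ri = f (g \<otimes> Theta)" .
  have "tev (\<lambda>a b. tev (\<lambda>p q. ?k (a \<otimes> p) (b \<otimes> q)) X) Ri
      = (\<Sum>j\<in>J. tev (\<lambda>p q. L (- v) (S (Rx j) \<otimes> kb (dg j) \<otimes> p) * f (Ry j \<otimes> q)) X)"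
    by (rule tev_Ri_antipode) ((intro lin)?; simp)
  also have "\<dots> = (\<Sum>j\<in>J. f (Ry j \<otimes> g \<otimes> Rx j \<otimes> kb (dg j) \<otimes> gi \<otimes> z \<otimes> dist_elt v))"
  proof (rule sum.cong[OF refl])
    fix j assume j: "j \<in> J"
    \<comment> \<open>The flip leaves a factor \<open>kn (dg j)\<close> behind q;
      \<open>L_commute\<close> brings it to the front unchanged, because S^2 fixes the elements
      K.\<close>
    let ?s = "kn (dg j) \<otimes> S (Rx j) \<otimes> kb (dg j)"
    have Sx: "S (Rx j) \<in> Udg (dg j)" using j by (intro hdeg_antipode Rx) simp_all
    have xk: "S (Rx j) \<otimes> kb (dg j) \<in> Udg (dg j)" using j by (intro Udg_K Sx) simp_all
    have "tev (\<lambda>p q. L (- v) (S (Rx j) \<otimes> kb (dg j) \<otimes> p) * f (Ry j \<otimes> q)) X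
        = tev (\<lambda>p q. L (- v) (S (Rx j) \<otimes> kb (dg j) \<otimes> gr (d - dg j) p) * f (Ry j \<otimes> q)) X"
      using L_gr_left[OF _ xk] j by (intro X_cong) simp
    also have "\<dots> = sw (\<lambda>p q. L (- v) (S (Rx j) \<otimes> kb (dg j) \<otimes> (gr (d - dg j) q \<otimes> kn (d - (d - dg j)))) *
        f (Ry j \<otimes> (kn (d - dg j) \<otimes> p))) Y"
      using j by (intro tev_X_left) ((intro lin)?; simp)+
    also have "\<dots> = sw (\<lambda>p q. f (Ry j \<otimes> (kn (d - dg j) \<otimes> p)) * L (- v) (?s \<otimes> q)) Y"
    proof (intro sw_cong Y_closed)
      fix p q assume c: "p \<in> carrier U" "q \<in> carrier U"
      have "L (- v) (S (Rx j) \<otimes> kb (dg j) \<otimes> (gr (d - dg j) q \<otimes> kn (d - (d - dg j))))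
          = L (- v) (S (Rx j) \<otimes> kb (dg j) \<otimes> gr (d - dg j) q \<otimes> kn (dg j))"
        using j c by (simp add: m_assoc)
      also have "\<dots> = L (- v) (S (Rx j) \<otimes> kb (dg j) \<otimes> q \<otimes> kn (dg j))"
        using j c by (intro L_gr_both[OF _ xk lat_zero K_Udg]) simp_all
      also have "\<dots> = L (- v) (?s \<otimes> q)"
        using L_commute[of "kn (dg j)" "S (Rx j) \<otimes> kb (dg j) \<otimes> q" "- v"] j c by (simp add: m_assoc)
      finally show "L (- v) (S (Rx j) \<otimes> kb (dg j) \<otimes> (gr (d - dg j) q \<otimes> kn (d - (d - dg j)))) *
        f (Ry j \<otimes> (kn (d - dg j) \<otimes> p)) = f (Ry j \<otimes> (kn (d - dg j) \<otimes> p)) * L (- v) (?s \<otimes> q)" by simp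
    qed
    also have "\<dots> = sw (\<lambda>p q. f (Ry j \<otimes> (kn (d - dg j) \<otimes> (S ?s \<otimes> p))) * L (- v) q) Y"
      using j by (intro Y_move_left[OF bmf_L_right] mf_lmod[OF f] modlin) simp_all
    also have "\<dots> = f (Ry j \<otimes> (kn (d - dg j) \<otimes> (S ?s \<otimes> dist_elt v)))"
      by (rule lf_dist_elt[symmetric]) ((intro lin)?; simp add: j)
    also have "Ry j \<otimes> (kn (d - dg j) \<otimes> (S ?s \<otimes> dist_elt v))
        = Ry j \<otimes> g \<otimes> Rx j \<otimes> kb (dg j) \<otimes> gi \<otimes> z \<otimes> dist_elt v"
    proof -
      have k: "kn (d - dg j) = z \<otimes> kb (dg j)"
        using j Bd_add[of d "- dg j"] by (simp add: K_K Bd_uminus)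
      have "kn (d - dg j) \<otimes> (S ?s \<otimes> dist_elt v) = z \<otimes> (g \<otimes> Rx j) \<otimes> gi \<otimes> kb (dg j) \<otimes> dist_elt v"
        unfolding k using j by (simp add: antipode_square m_assoc K_K_assoc K_zero)
      also have "z \<otimes> (g \<otimes> Rx j) = g \<otimes> Rx j \<otimes> z"
        using j z_central[OF _ Rx[OF j]] by (simp add: m_assoc[symmetric] pivot_K[symmetric]) (simp add: m_assoc)
      also have "g \<otimes> Rx j \<otimes> z \<otimes> gi \<otimes> kb (dg j) \<otimes> dist_elt v = g \<otimes> Rx j \<otimes> (z \<otimes> (gi \<otimes> kb (dg j))) \<otimes> dist_elt v"
        using j by (simp add: m_assoc)
      also have "z \<otimes> (gi \<otimes> kb (dg j)) = kb (dg j) \<otimes> gi \<otimes> z"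
        using j by (simp add: gi_K m_assoc) (simp add: m_assoc[symmetric] K_K add.commute)
      finally show ?thesis using j by (simp add: m_assoc)
    qed
    finally show "tev (\<lambda>p q. L (- v) (S (Rx j) \<otimes> kb (dg j) \<otimes> p) * f (Ry j \<otimes> q)) X
        = f (Ry j \<otimes> g \<otimes> Rx j \<otimes> kb (dg j) \<otimes> gi \<otimes> z \<otimes> dist_elt v)" .
  qed
  also have "\<dots> = f (Theta \<otimes> gi \<otimes> z \<otimes> dist_elt v)"
    by (rule lf_Theta[symmetric]) ((intro lin)?; simp)
  finally show ?thesis using l X_inverse_left[OF k] by simp
qed

text \<open>Read off from R^{-1} X R: the sum over the right-hand R-matrix that is left once the sum
  over R^{-1} has been assembled into Theta g.\<close>

definition Q :: 'a where
  "Q = (\<Oplus>i\<in>J. kn (dg i) \<otimes> S (Ry i) \<otimes> z \<otimes> kn (dg i) \<otimes> Rx i)"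

lemma Q_closed [simp]: "Q \<in> carrier U"
  unfolding Q_def by (auto intro!: finsum_closed)

text \<open>Tests \<Delta>(Y) = R^{-1} X R, so that the distinguished element itself stands on one
  side. On the other side the double sum over i and j splits into a product once the factors B have
  been sorted.\<close>

lemma dist_elt_Theta3:
  assumes f: "mf v f"
  shows "f (dist_elt v) = f (Theta \<otimes> g \<otimes> Q)"
proof -
  note lf = mf_lf[OF f]
  note [lin] = lform_lmap[OF lf]
  let ?k = "\<lambda>p q. f p * L (- v) q"
  have k: "bf ?k" by (intro bform_prod lf mf_lf[OF mf_L])
  have "f (dist_elt v) = (\<Sum>i\<in>J. tev (\<lambda>a b. tev (\<lambda>p q. ?k (a \<otimes> p \<otimes> Rx i) (b \<otimes> q \<otimes> Ry i)) X) Ri)"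
    using lf_dist_elt[OF lf] X_conjugate[OF k] by simp
  also have "\<dots> = (\<Sum>i\<in>J. \<Sum>j\<in>J. tev (\<lambda>p q. f (Rx j \<otimes> p \<otimes> Rx i) * L (- v) (Si (Ry j) \<otimes> kn (dg j) \<otimes> q \<otimes> Ry i)) X)"
    by (intro sum.cong refl tev_Ri_Si) ((intro lin)?; simp)
  also have "\<dots> = (\<Sum>i\<in>J. \<Sum>j\<in>J. f (Rx j \<otimes> gi \<otimes> Ry j \<otimes> kn (dg j) \<otimes> g \<otimes> (kn (dg i) \<otimes> S (Ry i) \<otimes> z \<otimes> kn (dg i) \<otimes> Rx i)))"
  proof (intro sum.cong refl)
    fix i j assume i: "i \<in> J" and j: "j \<in> J"
    let ?n = "d + dg j + dg i"
    let ?c = "kn (dg i) \<otimes> Si (Si (Ry j)) \<otimes> S (Ry i)"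
    have Sy: "Si (Ry j) \<in> Udg (- dg j)" using j by (intro Si_Udg Ry) simp_all
    have yk: "Si (Ry j) \<otimes> kn (dg j) \<in> Udg (- dg j)" using j by (intro Udg_K Sy) simp_all
    have yk': "Si (Ry j) \<otimes> kb (dg i) \<in> Udg (- dg j)" using i j by (intro Udg_K Sy) simp_all
    have n: "?n = d - (- dg j) - (- dg i)" by simp
    have "tev (\<lambda>p q. f (Rx j \<otimes> p \<otimes> Rx i) * L (- v) (Si (Ry j) \<otimes> kn (dg j) \<otimes> q \<otimes> Ry i)) X
        = tev (\<lambda>p q. f (Rx j \<otimes> p \<otimes> Rx i) * L (- v) (Si (Ry j) \<otimes> kn (dg j) \<otimes> gr ?n q \<otimes> Ry i)) X"
      using L_gr_both[OF _ yk _ Ry[OF i] _ n] i j by (intro X_cong) simp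
    also have "\<dots> = sw (\<lambda>p q. f (Rx j \<otimes> (q \<otimes> kn ?n) \<otimes> Rx i) *
        L (- v) (Si (Ry j) \<otimes> kn (dg j) \<otimes> (kn (d - ?n) \<otimes> gr ?n p) \<otimes> Ry i)) Y"
      using i j by (intro tev_X_right) ((intro lin)?; simp)+
    also have "\<dots> = sw (\<lambda>p q. L (- v) (S ?c \<otimes> p) * f (Rx j \<otimes> (q \<otimes> kn ?n) \<otimes> Rx i)) Y"
    proof (intro sw_cong Y_closed)
      fix p q assume c: "p \<in> carrier U" "q \<in> carrier U"
      have "d - ?n = - dg j + - dg i" by (simp add: algebra_simps)
      then have "kn (dg j) \<otimes> kn (d - ?n) = kb (dg i)"
        using i j Bd_add[of "- dg j" "- dg i"] by (simp add: K_K Bd_uminus)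
      then have "Si (Ry j) \<otimes> kn (dg j) \<otimes> (kn (d - ?n) \<otimes> gr ?n p) = Si (Ry j) \<otimes> kb (dg i) \<otimes> gr ?n p"
        using i j c by (simp add: m_assoc) (simp add: m_assoc[symmetric])
      then have "L (- v) (Si (Ry j) \<otimes> kn (dg j) \<otimes> (kn (d - ?n) \<otimes> gr ?n p) \<otimes> Ry i)
          = L (- v) (Si (Ry j) \<otimes> kb (dg i) \<otimes> p \<otimes> Ry i)"
        using L_gr_both[OF _ yk' _ Ry[OF i] c(1) n] i j by simp
      also have "\<dots> = L (- v) (S ?c \<otimes> p)"
        using L_commute[of "Ry i" "Si (Ry j) \<otimes> kb (dg i) \<otimes> p" "- v"] i j c by (simp add: m_assoc)
      finally show "f (Rx j \<otimes> (q \<otimes> kn ?n) \<otimes> Rx i) *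
        L (- v) (Si (Ry j) \<otimes> kn (dg j) \<otimes> (kn (d - ?n) \<otimes> gr ?n p) \<otimes> Ry i)
        = L (- v) (S ?c \<otimes> p) * f (Rx j \<otimes> (q \<otimes> kn ?n) \<otimes> Rx i)" by simp
    qed
    also have "\<dots> = f (Rx j \<otimes> (?c \<otimes> kn ?n) \<otimes> Rx i)"
      using i j by (intro integral_move mf_lmod[OF f] modlin) simp_all
    also have "Rx j \<otimes> (?c \<otimes> kn ?n) \<otimes> Rx i
        = Rx j \<otimes> gi \<otimes> Ry j \<otimes> kn (dg j) \<otimes> g \<otimes> (kn (dg i) \<otimes> S (Ry i) \<otimes> z \<otimes> kn (dg i) \<otimes> Rx i)"
    proof -
      \<comment> \<open>Symmetry of B makes the two exchanges below cost the same scalar: one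
        produces \<open>?e\<close> and the other consumes it.\<close>
      let ?e = "xi l (pairing r (Bd (dg i)) (dg j))"
      have kn: "kn ?n = kn (dg j) \<otimes> (z \<otimes> kn (dg i))"
        using i j by (simp add: K_K Bd_add algebra_simps)
      have 1: "kn (dg i) \<otimes> Si (Si (Ry j)) = ?e \<odot> (Si (Si (Ry j)) \<otimes> kn (dg i))"
        using i j K_commute[of "- Bd (dg i)" "- dg j" "Si (Si (Ry j))"] Si_Udg[OF _ Sy]
        by (simp add: pairing_uminus_left pairing_uminus_right)
      have 2: "kn (dg j) \<otimes> S (Ry i) = ?e \<odot> (S (Ry i) \<otimes> kn (dg j))"
        using i j K_commute[of "- Bd (dg j)" "- dg i" "S (Ry i)"] hdeg_antipode[OF _ Ry[OF i]] Bd_sym[of "dg i" "dg j"]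
        by (simp add: pairing_uminus_left pairing_uminus_right)
      have "Rx j \<otimes> (?c \<otimes> kn ?n) \<otimes> Rx i
          = Rx j \<otimes> (kn (dg i) \<otimes> Si (Si (Ry j))) \<otimes> S (Ry i) \<otimes> kn (dg j) \<otimes> z \<otimes> kn (dg i) \<otimes> Rx i"
        unfolding kn using i j by (simp add: m_assoc)
      also have "\<dots> = Rx j \<otimes> Si (Si (Ry j)) \<otimes> kn (dg i) \<otimes> (?e \<odot> (S (Ry i) \<otimes> kn (dg j))) \<otimes> z \<otimes> kn (dg i) \<otimes> Rx i"
        unfolding 1 using i j by (simp add: smult_mult mult_smult m_assoc)
      also have "\<dots> = Rx j \<otimes> Si (Si (Ry j)) \<otimes> (kn (dg i) \<otimes> kn (dg j)) \<otimes> S (Ry i) \<otimes> z \<otimes> kn (dg i) \<otimes> Rx i"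
        unfolding 2[symmetric] using i j by (simp add: m_assoc)
      also have "kn (dg i) \<otimes> kn (dg j) = kn (dg j) \<otimes> kn (dg i)"
        using i j by (simp add: K_K add.commute)
      finally show ?thesis using i j by (simp add: Si_Si m_assoc pivot_K_assoc)
    qed
    finally show "tev (\<lambda>p q. f (Rx j \<otimes> p \<otimes> Rx i) * L (- v) (Si (Ry j) \<otimes> kn (dg j) \<otimes> q \<otimes> Ry i)) X
      = f (Rx j \<otimes> gi \<otimes> Ry j \<otimes> kn (dg j) \<otimes> g \<otimes> (kn (dg i) \<otimes> S (Ry i) \<otimes> z \<otimes> kn (dg i) \<otimes> Rx i))" .
  qed
  also have "\<dots> = (\<Sum>i\<in>J. f (Theta \<otimes> g \<otimes> (kn (dg i) \<otimes> S (Ry i) \<otimes> z \<otimes> kn (dg i) \<otimes> Rx i)))"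
    by (intro sum.cong refl lf_Theta'[symmetric]) ((intro lin)?; simp)
  also have "\<dots> = f (Theta \<otimes> g \<otimes> Q)"
    unfolding Q_def
    by (rule lform_finsum[OF cspace, symmetric, of "\<lambda>u. f (Theta \<otimes> g \<otimes> u)"]) ((intro lin)?; simp)+
  finally show ?thesis .
qed

text \<open>If c is a right inverse of Theta g Q in the quotient, then g Q c is one of Theta. The
  free left factor u allows the cancellation behind any product.\<close>

lemma Theta_right_inverse:
  obtains c where "c \<in> carrier U" "\<And>f u. mf v f \<Longrightarrow> u \<in> carrier U \<Longrightarrow> f (u \<otimes> Theta \<otimes> c) = f u"
proof -
  obtain c where c: "c \<in> carrier U" "\<And>f. mf v f \<Longrightarrow> f (dist_elt v \<otimes> c) = f \<one>"
    using dist_elt_right_inverse by blast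
  have "f (u \<otimes> Theta \<otimes> (g \<otimes> Q \<otimes> c)) = f u" if f: "mf v f" and u: "u \<in> carrier U" for f u
  proof -
    have "f u = f (u \<otimes> (dist_elt v \<otimes> c))" using c(2)[OF mf_left[OF f u]] u by simp
    also have "\<dots> = f (u \<otimes> (Theta \<otimes> g \<otimes> Q \<otimes> c))"
      using dist_elt_Theta3[OF mf_left[OF mf_right[OF f c(1)] u]] u c(1) by (simp add: m_assoc)
    finally show ?thesis using u c(1) by (simp add: m_assoc)
  qed
  moreover have "g \<otimes> Q \<otimes> c \<in> carrier U" using c(1) by simp
  ultimately show thesis using that by blast
qed

lemma pivot_z: "g \<otimes> z = z \<otimes> g"
  by (rule pivot_K) simp

text \<open>Multiply the first Theta equation by a right inverse of Theta. As Theta commutes with g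
  and z, it can be brought next to that inverse on both sides.\<close>

lemma dist_elt_eq_z:
  assumes f: "mf v f" shows "f (dist_elt v) = f (g \<otimes> g \<otimes> z)"
proof -
  obtain c where c: "c \<in> carrier U" and r: "\<And>f u. mf v f \<Longrightarrow> u \<in> carrier U \<Longrightarrow> f (u \<otimes> Theta \<otimes> c) = f u"
    using Theta_right_inverse[of v] by metis
  have "f (dist_elt v) = f (dist_elt v \<otimes> gi \<otimes> Theta \<otimes> c \<otimes> g)"
    using r[OF mf_right[OF f pivot_closed], of "dist_elt v \<otimes> gi"] by (simp add: m_assoc)
  also have "\<dots> = f (Theta \<otimes> g \<otimes> z \<otimes> c \<otimes> g)"
    using dist_elt_Theta1[OF mf_right[OF mf_right[OF f pivot_closed], of c]] c by simp
  also have "Theta \<otimes> g \<otimes> z \<otimes> c \<otimes> g = g \<otimes> z \<otimes> Theta \<otimes> c \<otimes> g"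
    using Theta_pivot Theta_K[of "- Bd d"] c by (simp add: m_assoc)
  also have "f \<dots> = f (g \<otimes> z \<otimes> g)"
    using r[OF mf_right[OF f pivot_closed], of "g \<otimes> z"] c by simp
  also have "g \<otimes> z \<otimes> g = g \<otimes> g \<otimes> z" using arg_cong[OF pivot_z, of "\<lambda>u. g \<otimes> u"] by (simp add: m_assoc)
  finally show ?thesis .
qed

text \<open>Substituting g^2 z into the second Theta equation and cancelling Theta gives f(1) =
  f(z^2) in every quotient. The form \<open>phi v\<close> reads this as \<xi>^(-2 B(d, v)) = 1 for
  all complex v.\<close>

lemma Bd_d: "Bd d = 0"
proof -
  have eq: "f \<one> = f (K (- Bd d + - Bd d))" if f: "mf v f" for v f
  proof -
    obtain c where c: "c \<in> carrier U" and r: "\<And>f u. mf v f \<Longrightarrow> u \<in> carrier U \<Longrightarrow> f (u \<otimes> Theta \<otimes> c) = f u"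
      using Theta_right_inverse[of v] by metis
    have "f \<one> = f (gi \<otimes> g \<otimes> Theta \<otimes> c)" using r[OF f, of \<one>] c by simp
    also have "\<dots> = f (gi \<otimes> (Theta \<otimes> gi \<otimes> z \<otimes> dist_elt v) \<otimes> c)"
      using dist_elt_Theta2[OF mf_left[OF mf_right[OF f, of c] gi_closed]] c by (simp add: m_assoc)
    also have "\<dots> = f (gi \<otimes> (Theta \<otimes> gi \<otimes> z \<otimes> (g \<otimes> g \<otimes> z)) \<otimes> c)"
      using dist_elt_eq_z[OF mf_left[OF mf_right[OF f, of c], of "gi \<otimes> Theta \<otimes> gi \<otimes> z"]] c by (simp add: m_assoc)
    also have "gi \<otimes> (Theta \<otimes> gi \<otimes> z \<otimes> (g \<otimes> g \<otimes> z)) = z \<otimes> z \<otimes> Theta"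
    proof -
      have "gi \<otimes> z = z \<otimes> gi" by (rule gi_K) simp
      then have "gi \<otimes> (Theta \<otimes> gi \<otimes> z \<otimes> (g \<otimes> g \<otimes> z)) = gi \<otimes> (Theta \<otimes> z \<otimes> (g \<otimes> z))"
        by (simp add: m_assoc)
      also have "\<dots> = gi \<otimes> (Theta \<otimes> g \<otimes> (z \<otimes> z))" using arg_cong[OF pivot_z, of "\<lambda>u. u \<otimes> z"] by (simp add: m_assoc)
      also have "\<dots> = Theta \<otimes> (z \<otimes> z)" using Theta_pivot by (simp add: m_assoc)
      also have "\<dots> = z \<otimes> z \<otimes> Theta"
        using Theta_K[OF lat_uminus[OF Bd_lat[OF d]]] by (simp add: m_assoc[symmetric]) (simp add: m_assoc)
      finally show ?thesis .
    qed
    also have "f (z \<otimes> z \<otimes> Theta \<otimes> c) = f (z \<otimes> z)" by (rule r[OF f]) simp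
    finally show ?thesis by (simp add: K_K)
  qed
  have xi1: "xi l (pairing r (- Bd d + - Bd d) v) = 1" for v
    using eq[OF mf_phi[of v]] phi_K[OF lat_add[OF lat_uminus[OF Bd_lat[OF d]] lat_uminus[OF Bd_lat[OF d]]], of v]
      phi_K[OF lat_zero, of v] by (simp only: K_zero) (simp add: pairing_zero_left)
  show ?thesis
  proof (rule poly_mapping_eqI)
    fix i
    show "Poly_Mapping.lookup (Bd d) i = Poly_Mapping.lookup 0 i"
    proof (rule ccontr)
      let ?b = "Poly_Mapping.lookup (Bd d) i"
      assume "?b \<noteq> Poly_Mapping.lookup 0 i"
      then have b: "?b \<noteq> 0" by simp
      then have i: "i < r" using Bd_lat[OF d] by (auto simp: lat_def wspace_def in_keys_iff)
      \<comment> \<open>Scaled so that the exponent becomes -l/2, where \<open>xi\<close> takes the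
        value exp(-\<pi> i) = -1.\<close>
      let ?v = "Poly_Mapping.single i (of_nat l / (4 * ?b))"
      have l2: "Poly_Mapping.lookup (- Bd d + - Bd d) j = - (2 * Poly_Mapping.lookup (Bd d) j)" for j
        by (simp only: lookup_add lookup_uminus) simp
      have "pairing r (- Bd d + - Bd d) ?v = (\<Sum>j<r. if j = i then - (of_nat l / 2) else 0)"
        unfolding pairing_def using b by (intro sum.cong) (simp_all only: l2, auto simp: lookup_single when_def)
      also have "\<dots> = - (of_nat l / 2)" using i by simp
      finally have "xi l (- (of_nat l / 2)) = 1" using xi1[of ?v] by simp
      moreover have "xi l (- (of_nat l / 2)) = -1"
        using l_pos by (simp add: xi_def exp_minus mult.commute[of \<i>])
      ultimately show False by simp
    qed
  qed
qed

theorem dist_elt_eq: "mf v f \<Longrightarrow> f (dist_elt v) = f (g \<otimes> g)"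
  by (simp add: dist_elt_eq_z Bd_d K_zero)

end

text \<open>The degree-d component of Y is a cointegral for the same family L. The homogeneous case
  therefore applies with Y replaced, and its conclusion speaks of L alone.\<close>

theorem (in braided_integral) L_antipode:
  assumes x: "x \<in> carrier U" shows "L \<gamma> (g \<otimes> (g \<otimes> x)) = L (- \<gamma>) (S x)"
proof -
  obtain d where d: "d \<in> lat r" "\<And>v x. x \<in> carrier U \<Longrightarrow> L v (gr d x) = L v x"
    and "graded_integral U \<Delta> \<epsilon> S g r l W Wd K L (gr d Y)"
    using integral_homogeneous by metis
  then interpret Y: graded_integral U \<Delta> \<epsilon> S g r l W Wd K L "gr d Y" by simp
  interpret Y: homogeneous_braided_integral U \<Delta> \<epsilon> S g r l W Wd K L "gr d Y" Bd J Rx Ry dg Ri d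
    by (unfold_locales, erule cross, rule d(1), erule d(2), rule gr_Udg[OF Y_closed d(1)])
  show ?thesis
  proof (rule Y.antipode_L_if[OF _ x])
    fix \<gamma> f assume f: "mf \<gamma> f"
    show "sw (\<lambda>p q. f p * L (- \<gamma>) q) (gr d Y) = f (g \<otimes> g)"
      using Y.dist_elt_eq[OF f] Y.lf_dist_elt[OF mf_lf[OF f]] by simp
  qed
qed

section \<open>Algebra structure on tensor products\<close>

section \<open>The tensor product of two algebras\<close>

context two_algebras
begin

lemma bform_mult:
  assumes h: "bform A B h" and c: "p \<in> carrier A" "q \<in> carrier B"
  shows "bform A B (\<lambda>p' q'. h (p \<otimes>\<^bsub>A\<^esub> p') (q \<otimes>\<^bsub>B\<^esub> q'))"
    and "bform A B (\<lambda>p' q'. h (p' \<otimes>\<^bsub>A\<^esub> p) (q' \<otimes>\<^bsub>B\<^esub> q))"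
proof -
  interpret A: calgebra A by unfold_locales (rule alg_A)
  interpret B: calgebra B by unfold_locales (rule alg_B)
  note [lin] = bform_lform1[OF h] bform_lform2[OF h]
  show "bform A B (\<lambda>p' q'. h (p \<otimes>\<^bsub>A\<^esub> p') (q \<otimes>\<^bsub>B\<^esub> q'))"
    and "bform A B (\<lambda>p' q'. h (p' \<otimes>\<^bsub>A\<^esub> p) (q' \<otimes>\<^bsub>B\<^esub> q))"
    using c by ((intro lin)?; simp add: A.lmap_mult_left A.lmap_mult_right B.lmap_mult_left B.lmap_mult_right lmap_id)+
qed

lemma bform_tev_mult:
  assumes h: "bform A B h" and t: "t \<in> carrier (A \<otimes>\<^sub>A B)"
  shows "bform A B (\<lambda>p q. tev (\<lambda>p' q'. h (p \<otimes>\<^bsub>A\<^esub> p') (q \<otimes>\<^bsub>B\<^esub> q')) t)"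
    and "bform A B (\<lambda>p' q'. tev (\<lambda>p q. h (p \<otimes>\<^bsub>A\<^esub> p') (q \<otimes>\<^bsub>B\<^esub> q')) t)"
proof -
  interpret A: calgebra A by unfold_locales (rule alg_A)
  interpret B: calgebra B by unfold_locales (rule alg_B)
  note [lin] = bform_lform1[OF h] bform_lform2[OF h]
  show "bform A B (\<lambda>p q. tev (\<lambda>p' q'. h (p \<otimes>\<^bsub>A\<^esub> p') (q \<otimes>\<^bsub>B\<^esub> q')) t)"
    and "bform A B (\<lambda>p' q'. tev (\<lambda>p q. h (p \<otimes>\<^bsub>A\<^esub> p') (q \<otimes>\<^bsub>B\<^esub> q')) t)"
    by (intro bformI lform_tev_param[OF t];
      intro lin A.lmap_mult_left A.lmap_mult_right B.lmap_mult_left B.lmap_mult_right; simp)+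
qed

text \<open>Multiplication of tensors is defined through representatives; every law is therefore
  checked against bilinear forms, where \<open>tev_mult\<close> turns it into a law of the
  factors.\<close>

lemma complex_algebra_tensor: "complex_algebra (A \<otimes>\<^sub>A B)"
proof -
  let ?T = "A \<otimes>\<^sub>A B"
  interpret T: abelian_group ?T using cspace_tensor by (simp add: cspace_def)
  have sc: "c \<odot>\<^bsub>?T\<^esub> t \<in> carrier ?T" if "t \<in> carrier ?T" for c t
    using cspace_tensor that by (simp add: cspace_def)
  note tf = lform_tev
  have add: "tev h (s \<oplus>\<^bsub>?T\<^esub> t) = tev h s + tev h t" if "bform A B h" "s \<in> carrier ?T" "t \<in> carrier ?T" for h s t
    by (rule lform_add[OF tf[OF that(1)] that(2,3)])
  have sm: "tev h (c \<odot>\<^bsub>?T\<^esub> s) = c * tev h s" if "bform A B h" "s \<in> carrier ?T" for h s c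
    by (rule lform_smult[OF tf[OF that(1)] that(2)])
  have m: "Group.monoid ?T"
  proof (rule Group.monoid.intro)
    fix x y z assume c: "x \<in> carrier ?T" "y \<in> carrier ?T" "z \<in> carrier ?T"
    show "x \<otimes>\<^bsub>?T\<^esub> y \<otimes>\<^bsub>?T\<^esub> z = x \<otimes>\<^bsub>?T\<^esub> (y \<otimes>\<^bsub>?T\<^esub> z)"
    proof (rule tens_eqI)
      fix h assume h: "bform A B h"
      have "tev h (x \<otimes>\<^bsub>?T\<^esub> y \<otimes>\<^bsub>?T\<^esub> z) = tev (\<lambda>p q. tev (\<lambda>p' q'. tev (\<lambda>a b. h (p \<otimes>\<^bsub>A\<^esub> p' \<otimes>\<^bsub>A\<^esub> a) (q \<otimes>\<^bsub>B\<^esub> q' \<otimes>\<^bsub>B\<^esub> b)) z) y) x"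
        by (simp add: tev_mult[OF h] tev_mult[OF bform_tev_mult(1)[OF h c(3)]])
      also have "\<dots> = tev (\<lambda>p q. tev (\<lambda>p' q'. tev (\<lambda>a b. h (p \<otimes>\<^bsub>A\<^esub> (p' \<otimes>\<^bsub>A\<^esub> a)) (q \<otimes>\<^bsub>B\<^esub> (q' \<otimes>\<^bsub>B\<^esub> b))) z) y) x"
        by (intro tev_cong c) (simp add: RA.m_assoc RB.m_assoc)
      also have "\<dots> = tev (\<lambda>p q. tev (\<lambda>p' q'. h (p \<otimes>\<^bsub>A\<^esub> p') (q \<otimes>\<^bsub>B\<^esub> q')) (y \<otimes>\<^bsub>?T\<^esub> z)) x"
        by (intro tev_cong c) (simp add: tev_mult[OF bform_mult(1)[OF h]])
      also have "\<dots> = tev h (x \<otimes>\<^bsub>?T\<^esub> (y \<otimes>\<^bsub>?T\<^esub> z))" by (simp add: tev_mult[OF h])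
      finally show "tev h (x \<otimes>\<^bsub>?T\<^esub> y \<otimes>\<^bsub>?T\<^esub> z) = tev h (x \<otimes>\<^bsub>?T\<^esub> (y \<otimes>\<^bsub>?T\<^esub> z))" .
    qed (intro tensor_mult_closed c)+
  next
    fix x assume c: "x \<in> carrier ?T"
    show "\<one>\<^bsub>?T\<^esub> \<otimes>\<^bsub>?T\<^esub> x = x"
    proof (rule tens_eqI)
      fix h assume h: "bform A B h"
      show "tev h (\<one>\<^bsub>?T\<^esub> \<otimes>\<^bsub>?T\<^esub> x) = tev h x"
        using tev_one[OF bform_tev_mult(1)[OF h c]] tev_cong[OF c, of "\<lambda>p' q'. h (\<one>\<^bsub>A\<^esub> \<otimes>\<^bsub>A\<^esub> p') (\<one>\<^bsub>B\<^esub> \<otimes>\<^bsub>B\<^esub> q')" h]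
        by (simp add: tev_mult[OF h])
    qed (intro tensor_mult_closed tensor_one_closed c)+
    show "x \<otimes>\<^bsub>?T\<^esub> \<one>\<^bsub>?T\<^esub> = x"
    proof (rule tens_eqI)
      fix h assume h: "bform A B h"
      have "tev h (x \<otimes>\<^bsub>?T\<^esub> \<one>\<^bsub>?T\<^esub>) = tev (\<lambda>p q. tev (\<lambda>p' q'. h (p \<otimes>\<^bsub>A\<^esub> p') (q \<otimes>\<^bsub>B\<^esub> q')) \<one>\<^bsub>?T\<^esub>) x"
        by (rule tev_mult[OF h])
      also have "\<dots> = tev h x" by (intro tev_cong[OF c]) (simp add: tev_one[OF bform_mult(1)[OF h]])
      finally show "tev h (x \<otimes>\<^bsub>?T\<^esub> \<one>\<^bsub>?T\<^esub>) = tev h x" .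
    qed (intro tensor_mult_closed tensor_one_closed c)+
  qed (intro tensor_mult_closed tensor_one_closed; assumption)+
  have r: "ring ?T"
  proof (intro ring.intro T.abelian_group_axioms m ring_axioms.intro)
    fix x y z assume c: "x \<in> carrier ?T" "y \<in> carrier ?T" "z \<in> carrier ?T"
    show "(x \<oplus>\<^bsub>?T\<^esub> y) \<otimes>\<^bsub>?T\<^esub> z = x \<otimes>\<^bsub>?T\<^esub> z \<oplus>\<^bsub>?T\<^esub> y \<otimes>\<^bsub>?T\<^esub> z"
      by (rule tens_eqI) (use c in \<open>simp_all add: tensor_mult_closed add tev_mult bform_tev_mult\<close>)
    show "z \<otimes>\<^bsub>?T\<^esub> (x \<oplus>\<^bsub>?T\<^esub> y) = z \<otimes>\<^bsub>?T\<^esub> x \<oplus>\<^bsub>?T\<^esub> z \<otimes>\<^bsub>?T\<^esub> y"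
    proof (rule tens_eqI)
      fix h assume h: "bform A B h"
      have "tev h (z \<otimes>\<^bsub>?T\<^esub> (x \<oplus>\<^bsub>?T\<^esub> y)) = tev (\<lambda>p q. tev (\<lambda>p' q'. h (p \<otimes>\<^bsub>A\<^esub> p') (q \<otimes>\<^bsub>B\<^esub> q')) x + tev (\<lambda>p' q'. h (p \<otimes>\<^bsub>A\<^esub> p') (q \<otimes>\<^bsub>B\<^esub> q')) y) z"
        unfolding tev_mult[OF h] by (intro tev_cong c add bform_mult h)
      then show "tev h (z \<otimes>\<^bsub>?T\<^esub> (x \<oplus>\<^bsub>?T\<^esub> y)) = tev h (z \<otimes>\<^bsub>?T\<^esub> x \<oplus>\<^bsub>?T\<^esub> z \<otimes>\<^bsub>?T\<^esub> y)"
        using c by (simp add: tensor_mult_closed add[OF h] tev_mult[OF h] tev_add)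
    qed (use c in \<open>simp_all add: tensor_mult_closed\<close>)
  qed
  have v: "vectorspace class_ring ?T"
    by (intro vectorspace.intro module_tensor class_field)
  have "(c \<odot>\<^bsub>?T\<^esub> x) \<otimes>\<^bsub>?T\<^esub> y = c \<odot>\<^bsub>?T\<^esub> (x \<otimes>\<^bsub>?T\<^esub> y) \<and> x \<otimes>\<^bsub>?T\<^esub> (c \<odot>\<^bsub>?T\<^esub> y) = c \<odot>\<^bsub>?T\<^esub> (x \<otimes>\<^bsub>?T\<^esub> y)"
    if c: "x \<in> carrier ?T" "y \<in> carrier ?T" for c x y
  proof
    show "(c \<odot>\<^bsub>?T\<^esub> x) \<otimes>\<^bsub>?T\<^esub> y = c \<odot>\<^bsub>?T\<^esub> (x \<otimes>\<^bsub>?T\<^esub> y)"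
      by (rule tens_eqI) (use c in \<open>simp_all add: tensor_mult_closed sc sm tev_mult bform_tev_mult\<close>)
    show "x \<otimes>\<^bsub>?T\<^esub> (c \<odot>\<^bsub>?T\<^esub> y) = c \<odot>\<^bsub>?T\<^esub> (x \<otimes>\<^bsub>?T\<^esub> y)"
    proof (rule tens_eqI)
      fix h assume h: "bform A B h"
      have "tev h (x \<otimes>\<^bsub>?T\<^esub> (c \<odot>\<^bsub>?T\<^esub> y)) = tev (\<lambda>p q. c * tev (\<lambda>p' q'. h (p \<otimes>\<^bsub>A\<^esub> p') (q \<otimes>\<^bsub>B\<^esub> q')) y) x"
        unfolding tev_mult[OF h] by (intro tev_cong c sm bform_mult h)
      then show "tev h (x \<otimes>\<^bsub>?T\<^esub> (c \<odot>\<^bsub>?T\<^esub> y)) = tev h (c \<odot>\<^bsub>?T\<^esub> (x \<otimes>\<^bsub>?T\<^esub> y))"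
        using c by (simp add: tensor_mult_closed sm[OF h] tev_mult[OF h] tev_mult_left)
    qed (use c in \<open>simp_all add: tensor_mult_closed sc\<close>)
  qed
  then show ?thesis using r v by (simp add: complex_algebra_def)
qed

end

section \<open>Passing between U and its unrolled extension\<close>

section \<open>The truncated R-matrix of the unrolled algebra\<close>

lemma hdeg_Udeg: "hdeg (Ualg D) (rnk D) (Wdeg D) (Kel D) m = Udeg D m"
  by (simp add: hdeg_def Udeg_def)

locale unrolled =
  fixes D :: "('u, 'v) unrolled_data"
  assumes ell: "ell D \<ge> 1" and ax1: "axiom1 D" and ur: "unrolled_algebra D" and ax2: "axiom2 D"
begin

sublocale graded_hopf "Ualg D" "cop D" "cou D" "ant D" "piv D" "rnk D" "ell D" "Wsp D" "Wdeg D" "Kel D"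
proof -
  note a = ax1[unfolded axiom1_def]
  interpret pivotal_hopf "Ualg D" "cop D" "cou D" "ant D" "piv D"
    by unfold_locales (use a in \<open>auto simp: hopf_algebra_def\<close>)
  show "graded_hopf (Ualg D) (cop D) (cou D) (ant D) (piv D) (rnk D) (ell D) (Wsp D) (Wdeg D) (Kel D)"
    by unfold_locales (use a ell in \<open>simp_all add: linear_subset_subspace hdeg_Udeg\<close>)
qed

sublocale H: calgebra "UHalg D"
  using ur by unfold_locales (simp add: unrolled_algebra_def)

abbreviation "U \<equiv> Ualg D"
abbreviation "H \<equiv> UHalg D"

lemma Hgen_closed [simp]: "i < rnk D \<Longrightarrow> Hgen D i \<in> carrier H"
  using ur by (simp add: unrolled_algebra_def)

lemma lmap_incl: "lmap U H (incl D)"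
  using ur by (intro clinear_lmap) (simp add: unrolled_algebra_def alg_hom_def)

lemma incl_closed [simp]: "x \<in> carrier U \<Longrightarrow> incl D x \<in> carrier H"
  by (rule lmap_closed[OF lmap_incl])

lemma incl_mult: "x \<in> carrier U \<Longrightarrow> y \<in> carrier U \<Longrightarrow> incl D (x \<otimes>\<^bsub>U\<^esub> y) = incl D x \<otimes>\<^bsub>H\<^esub> incl D y"
  and incl_one: "incl D \<one>\<^bsub>U\<^esub> = \<one>\<^bsub>H\<^esub>"
  using ur by (auto simp: unrolled_algebra_def alg_hom_def Ring.ring_hom_def)

lemma lmap_incl' [lin]: "lmap A U E \<Longrightarrow> lmap A H (\<lambda>x. incl D (E x))"
  by (rule lmap_comp[OF lmap_incl])

lemma Hmon_closed [simp]: "Hmon D e \<in> carrier H"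
proof -
  have "set xs \<subseteq> {..<rnk D} \<Longrightarrow>
    foldr (\<lambda>i p. (Hgen D i [^]\<^bsub>H\<^esub> Poly_Mapping.lookup e i) \<otimes>\<^bsub>H\<^esub> p) xs \<one>\<^bsub>H\<^esub> \<in> carrier H" for xs
    by (induction xs) auto
  from this[of "[0..<rnk D]"] show ?thesis by (simp add: Hmon_def atLeast0LessThan)
qed

lemma Hmon_zero: "Hmon D 0 = \<one>\<^bsub>H\<^esub>"
proof -
  have "set xs \<subseteq> {..<rnk D} \<Longrightarrow>
    foldr (\<lambda>i p. (Hgen D i [^]\<^bsub>H\<^esub> Poly_Mapping.lookup (0 :: nat \<Rightarrow>\<^sub>0 nat) i) \<otimes>\<^bsub>H\<^esub> p) xs \<one>\<^bsub>H\<^esub> = \<one>\<^bsub>H\<^esub>" for xs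
    by (induction xs) auto
  from this[of "[0..<rnk D]"] show ?thesis by (simp add: Hmon_def atLeast0LessThan)
qed

lemma Hmon_single: "k < rnk D \<Longrightarrow> Hmon D (Poly_Mapping.single k 1) = Hgen D k"
proof -
  assume k: "k < rnk D"
  have "set xs \<subseteq> {..<rnk D} \<Longrightarrow> distinct xs \<Longrightarrow>
    foldr (\<lambda>i p. (Hgen D i [^]\<^bsub>H\<^esub> Poly_Mapping.lookup (Poly_Mapping.single k (1::nat)) i) \<otimes>\<^bsub>H\<^esub> p) xs \<one>\<^bsub>H\<^esub>
    = (if k \<in> set xs then Hgen D k else \<one>\<^bsub>H\<^esub>)" for xs
    by (induction xs) (use k in \<open>auto simp: lookup_single when_def\<close>)
  from this[of "[0..<rnk D]"] show ?thesis using k by (simp add: Hmon_def atLeast0LessThan)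
qed

lemma Hel_single: "k < rnk D \<Longrightarrow> Hel D (Poly_Mapping.single k 1) = Hgen D k"
proof -
  assume k: "k < rnk D"
  have "Hel D (Poly_Mapping.single k 1) = (\<Oplus>\<^bsub>H\<^esub>i\<in>{..<rnk D}. if k = i then Hgen D i else \<zero>\<^bsub>H\<^esub>)"
    unfolding Hel_def by (intro H.finsum_cong') (auto simp: lookup_single when_def)
  also have "\<dots> = Hgen D k" using k by (subst H.finsum_singleton) auto
  finally show ?thesis .
qed

lemma monomials_zero: "0 \<in> monomials D"
  by (simp add: monomials_def)

sublocale HD: direct_sum_decomposition U H "carrier H" "monomials D" "\<lambda>e. carrier U"
  "\<lambda>e x. incl D x \<otimes>\<^bsub>H\<^esub> Hmon D e"
proof unfold_locales
  show "direct_sum U H (carrier H) (monomials D) (\<lambda>e. carrier U) (\<lambda>e x. incl D x \<otimes>\<^bsub>H\<^esub> Hmon D e)"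
    using ur by (simp add: unrolled_algebra_def)
qed (auto simp: cspace H.cspace linear_subset_carrier H.smult_finsum' smult_zero' H.l_distr H.smult_mult
    lmap_add[OF lmap_incl] lmap_smult[OF lmap_incl])

text \<open>The coefficient at the trivial monomial: a linear retraction of \<open>incl\<close>,
  through which forms on U extend to the unrolled algebra.\<close>

definition ret :: "'v \<Rightarrow> 'u" where
  "ret v = HD.comp 0 v"

lemma ret_incl [simp]: "x \<in> carrier U \<Longrightarrow> ret (incl D x) = x"
  using HD.comp_\<phi>[OF monomials_zero _ monomials_zero, of x] by (simp add: ret_def Hmon_zero)

lemma lmap_ret: "lmap H U ret"
  unfolding ret_def using monomials_zero
  by (intro lmapI HD.comp_in HD.comp_add HD.comp_smult)

lemma ret_closed [simp]: "x \<in> carrier H \<Longrightarrow> ret x \<in> carrier U"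
  by (rule lmap_closed[OF lmap_ret])

lemma lmap_ret' [lin]: "lmap A H E \<Longrightarrow> lmap A U (\<lambda>x. ret (E x))"
  by (rule lmap_comp[OF lmap_ret])

lemma UHdeg_incl: "x \<in> Udeg D m \<Longrightarrow> m \<in> Lam D \<Longrightarrow> incl D x \<in> UHdeg D m"
  and UHdeg_Hgen: "k < rnk D \<Longrightarrow> Hgen D k \<in> UHdeg D 0"
proof -
  have c: "Udeg D m \<subseteq> carrier U" if "m \<in> Lam D" for m using Udg_closed[OF that] by (auto simp: hdeg_Udeg)
  then have sub: "{incl D x \<otimes>\<^bsub>H\<^esub> Hmon D e | x e. x \<in> Udeg D m \<and> e \<in> monomials D} \<subseteq> carrier H"
    if "m \<in> Lam D" for m using c[OF that] by auto
  have span: "incl D x \<otimes>\<^bsub>H\<^esub> Hmon D e \<in> UHdeg D m" if "m \<in> Lam D" "x \<in> Udeg D m" "e \<in> monomials D" for m x e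
    unfolding UHdeg_def using H.V.in_own_span[OF sub[OF that(1)]] that by blast
  show "incl D x \<in> UHdeg D m" if "x \<in> Udeg D m" "m \<in> Lam D"
    using span[OF that(2,1) monomials_zero] c[OF that(2)] that(1) by (auto simp: Hmon_zero)
  show "Hgen D k \<in> UHdeg D 0" if k: "k < rnk D"
  proof -
    have "Poly_Mapping.single k 1 \<in> monomials D" using k by (simp add: monomials_def)
    then show ?thesis
      using span[of 0 "\<one>\<^bsub>U\<^esub>" "Poly_Mapping.single k 1"] one_Udg k
      by (simp add: hdeg_Udeg incl_one Hmon_single del: One_nat_def)
  qed
qed

lemma lookup_Bdual: "Poly_Mapping.lookup (Bdual D m) j
    = (if j < rnk D then \<Sum>i<rnk D. of_int (Qmat D i j) * Poly_Mapping.lookup m i else 0)"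
  by (simp add: Bdual_def lookup_sum lookup_single when_def)

lemma Bdual_lat [simp]: "m \<in> Lam D \<Longrightarrow> Bdual D m \<in> Lam D"
  by (auto simp: lat_def wspace_def in_keys_iff lookup_Bdual split: if_splits intro!: Ints_sum)

lemma Bdual_add: "Bdual D (m + n) = Bdual D m + Bdual D n"
  by (rule poly_mapping_eqI) (simp add: lookup_Bdual lookup_add distrib_left sum.distrib)

lemma pairing_Bdual: "pairing (rnk D) (Bdual D m) n = Bform D m n"
proof -
  have "pairing (rnk D) (Bdual D m) n
      = (\<Sum>j<rnk D. \<Sum>i<rnk D. of_int (Qmat D i j) * Poly_Mapping.lookup m i * Poly_Mapping.lookup n j)"
    by (simp add: pairing_def lookup_Bdual sum_distrib_right)
  then show ?thesis unfolding Bform_def by (subst sum.swap) simp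
qed

lemma Bdual_sym: "m \<in> Lam D \<Longrightarrow> n \<in> Lam D \<Longrightarrow> pairing (rnk D) (Bdual D m) n = pairing (rnk D) (Bdual D n) m"
  using ax2 by (simp add: pairing_Bdual axiom2_def lat_wspace)

lemma inv_Bel: "m \<in> Lam D \<Longrightarrow> inv\<^bsub>U\<^esub> (Bel D m) = Kel D (- Bdual D m)"
  using K_inverse[of "Bdual D m"] by (simp add: Bel_def inv_char)

end

context two_spaces
begin

lemma tev_tens_map:
  assumes C: "two_spaces C E" and h: "bform C E h" and t: "t \<in> carrier (A \<otimes>\<^sub>A B)"
    and f: "\<And>x. x \<in> carrier A \<Longrightarrow> f x \<in> carrier C" and g: "\<And>y. y \<in> carrier B \<Longrightarrow> g y \<in> carrier E"
  shows "tev h (tens_map C E f g t) = tev (\<lambda>x y. h (f x) (g y)) t"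
proof -
  interpret C: two_spaces C E by (rule C)
  have "tev h (tens_map C E f g t) = tev (\<lambda>x y. tev h (ptens C E (f x) (g y))) t"
    unfolding tens_map_def by (rule tens_lift_eval(1)[OF C.cspace_tensor C.lform_tev[OF h] t]) (simp add: f g)
  then show ?thesis by (simp add: C.tev_ptens[OF h])
qed

lemma tens_map_closed:
  assumes C: "two_spaces C E" and t: "t \<in> carrier (A \<otimes>\<^sub>A B)"
    and f: "\<And>x. x \<in> carrier A \<Longrightarrow> f x \<in> carrier C" and g: "\<And>y. y \<in> carrier B \<Longrightarrow> g y \<in> carrier E"
  shows "tens_map C E f g t \<in> carrier (C \<otimes>\<^sub>A E)"
proof -
  interpret C: two_spaces C E by (rule C)
  \<comment> \<open>Provides the linear form with which \<open>tens_lift_eval\<close> has to be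
    instantiated.\<close>
  have "bform C E (\<lambda>_ _. 0)" by (simp add: bform_def lform_def)
  from C.lform_tev[OF this] show ?thesis
    unfolding tens_map_def by (rule tens_lift_eval(2)[OF C.cspace_tensor _ t]) (simp add: f g)
qed

lemma tev_tens_flip:
  assumes h: "bform B A h" and t: "t \<in> carrier (A \<otimes>\<^sub>A B)"
  shows "tev h (tens_flip A B t) = tev (\<lambda>x y. h y x) t"
proof -
  interpret C: two_spaces B A by unfold_locales (rule A B)+
  have "tev h (tens_flip A B t) = tev (\<lambda>x y. tev h (ptens B A y x)) t"
    unfolding tens_flip_def by (rule tens_lift_eval(1)[OF C.cspace_tensor C.lform_tev[OF h] t]) simp
  then show ?thesis by (simp add: C.tev_ptens[OF h])
qed

end

lemma (in graded_hopf) gr_support: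
  assumes u: "u \<in> carrier U" shows "finite {m. gr m u \<noteq> \<zero>}" "{m. gr m u \<noteq> \<zero>} \<subseteq> lat r"
    and "lf f \<Longrightarrow> finite F \<Longrightarrow> {m. gr m u \<noteq> \<zero>} \<subseteq> F \<Longrightarrow> f u = (\<Sum>m\<in>F. f (gr m u))"
proof -
  show "{m. gr m u \<noteq> \<zero>} \<subseteq> lat r" using gr_notin by blast
  show fin: "finite {m. gr m u \<noteq> \<zero>}"
  proof (rule gr_decomp[OF u])
    fix F assume "finite F" "\<And>m. m \<notin> F \<Longrightarrow> gr m u = \<zero>"
    then show ?thesis by (rule_tac finite_subset[of _ F]) blast
  qed
  assume f: "lf f" and F: "finite F" "{m. gr m u \<noteq> \<zero>} \<subseteq> F"
  show "f u = (\<Sum>m\<in>F. f (gr m u))"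
  proof (rule gr_decomp[OF u])
    fix G assume G: "finite G" "\<And>m. m \<notin> G \<Longrightarrow> gr m u = \<zero>" "\<And>f. lf f \<Longrightarrow> f u = (\<Sum>m\<in>G. f (gr m u))"
    have z: "gr m u = \<zero>" if "m \<notin> F" for m using F(2) that by auto
    have "(\<Sum>m\<in>G. f (gr m u)) = (\<Sum>m\<in>F. f (gr m u))"
      by (rule sum.mono_neutral_cong) (use F(1) z G(1,2) lform_zero[OF cspace f] in simp_all)
    then show ?thesis using G(3)[OF f] by simp
  qed
qed

lemma (in graded_hopf) bf_gr_eqI:
  assumes h: "bf h" and M: "finite M" and a: "\<And>s. s \<in> M \<Longrightarrow> a s \<in> carrier U" and b: "\<And>s. s \<in> M \<Longrightarrow> b s \<in> carrier U"
    and zero: "\<And>m n. m \<in> lat r \<Longrightarrow> n \<in> lat r \<Longrightarrow> (\<Sum>s\<in>M. c s * h (gr m (a s)) (gr n (b s))) = 0"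
  shows "(\<Sum>s\<in>M. c s * h (a s) (b s)) = 0"
proof -
  let ?F = "\<Union>s\<in>M. {m. gr m (a s) \<noteq> \<zero>}" and ?G = "\<Union>s\<in>M. {m. gr m (b s) \<noteq> \<zero>}"
  have F: "finite ?F" "?F \<subseteq> lat r" using M gr_support(1,2)[OF a] by auto
  have G: "finite ?G" "?G \<subseteq> lat r" using M gr_support(1,2)[OF b] by auto
  have "(\<Sum>s\<in>M. c s * h (a s) (b s)) = (\<Sum>s\<in>M. \<Sum>m\<in>?F. \<Sum>n\<in>?G. c s * h (gr m (a s)) (gr n (b s)))"
  proof (rule sum.cong[OF refl])
    fix s assume s: "s \<in> M"
    have "h (a s) (b s) = (\<Sum>m\<in>?F. h (gr m (a s)) (b s))"
      by (rule gr_support(3)[OF a[OF s] bform1[OF h b[OF s]] F(1)]) (use s in auto)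
    also have "\<dots> = (\<Sum>m\<in>?F. \<Sum>n\<in>?G. h (gr m (a s)) (gr n (b s)))"
      by (intro sum.cong refl gr_support(3)[OF b[OF s] bform2[OF h] G(1)] gr_closed a s) (use s in auto)
    finally show "c s * h (a s) (b s) = (\<Sum>m\<in>?F. \<Sum>n\<in>?G. c s * h (gr m (a s)) (gr n (b s)))"
      by (simp add: sum_distrib_left)
  qed
  also have "\<dots> = (\<Sum>m\<in>?F. \<Sum>n\<in>?G. \<Sum>s\<in>M. c s * h (gr m (a s)) (gr n (b s)))"
    by (subst sum.swap) (intro sum.cong refl sum.swap)
  also have "\<dots> = 0" by (intro sum.neutral ballI zero subsetD[OF F(2)] subsetD[OF G(2)])
  finally show ?thesis .
qed

context unrolled
begin

sublocale TU: calgebra "U \<otimes>\<^sub>A U" by unfold_locales (rule UU.complex_algebra_tensor)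
sublocale TH: calgebra "H \<otimes>\<^sub>A H" by unfold_locales (rule H.UU.complex_algebra_tensor)

lemma Rdx_lat [simp]: "i < nR D \<Longrightarrow> Rdx D i \<in> Lam D" and Rdy_lat [simp]: "i < nR D \<Longrightarrow> Rdy D i \<in> Lam D"
  and Rx_Udg: "i < nR D \<Longrightarrow> Rx D i \<in> Udg (Rdx D i)" and Ry_Udg: "i < nR D \<Longrightarrow> Ry D i \<in> Udg (Rdy D i)"
  and Rcheck_unit: "Rcheck D \<in> Units (U \<otimes>\<^sub>A U)"
  using ax2 by (simp_all add: axiom2_def hdeg_Udeg)

lemma Rx_carrier [simp]: "i < nR D \<Longrightarrow> Rx D i \<in> carrier U" and Ry_carrier [simp]: "i < nR D \<Longrightarrow> Ry D i \<in> carrier U"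
  using Udg_closed[OF _ Rx_Udg] Udg_closed[OF _ Ry_Udg] by auto

definition Ri where "Ri = inv\<^bsub>U \<otimes>\<^sub>A U\<^esub> (Rcheck D)"

lemma Ri_carrier [simp]: "Ri \<in> carrier (U \<otimes>\<^sub>A U)" and Rcheck_closed [simp]: "Rcheck D \<in> carrier (U \<otimes>\<^sub>A U)"
  using Rcheck_unit by (simp_all add: Ri_def Units_def TU.Units_inv_closed[OF Rcheck_unit])

lemma tev_Rcheck: "bf h \<Longrightarrow> tev h (Rcheck D) = (\<Sum>i<nR D. h (Rx D i) (Ry D i))"
  unfolding Rcheck_def
  by (subst lform_finsum[OF UU.cspace_tensor UU.lform_tev]) (auto simp: UU.tev_ptens intro!: UU.ptens_closed)

lemma Rcheck_Ri:
  assumes h: "bf h"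
  shows "(\<Sum>i<nR D. tev (\<lambda>p q. h (Rx D i \<otimes>\<^bsub>U\<^esub> p) (Ry D i \<otimes>\<^bsub>U\<^esub> q)) Ri) = h \<one>\<^bsub>U\<^esub> \<one>\<^bsub>U\<^esub>"
    and "(\<Sum>i<nR D. tev (\<lambda>p q. h (p \<otimes>\<^bsub>U\<^esub> Rx D i) (q \<otimes>\<^bsub>U\<^esub> Ry D i)) Ri) = h \<one>\<^bsub>U\<^esub> \<one>\<^bsub>U\<^esub>"
proof -
  have "tev h (Rcheck D \<otimes>\<^bsub>U \<otimes>\<^sub>A U\<^esub> Ri) = (\<Sum>i<nR D. tev (\<lambda>p q. h (Rx D i \<otimes>\<^bsub>U\<^esub> p) (Ry D i \<otimes>\<^bsub>U\<^esub> q)) Ri)"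
    by (simp add: UU.tev_mult[OF h] tev_Rcheck[OF UU.bform_tev_mult(1)[OF h Ri_carrier]])
  then show "(\<Sum>i<nR D. tev (\<lambda>p q. h (Rx D i \<otimes>\<^bsub>U\<^esub> p) (Ry D i \<otimes>\<^bsub>U\<^esub> q)) Ri) = h \<one>\<^bsub>U\<^esub> \<one>\<^bsub>U\<^esub>"
    by (simp add: Ri_def TU.Units_r_inv[OF Rcheck_unit] UU.tev_one[OF h])
  have "tev h (Ri \<otimes>\<^bsub>U \<otimes>\<^sub>A U\<^esub> Rcheck D) = tev (\<lambda>p q. \<Sum>i<nR D. h (p \<otimes>\<^bsub>U\<^esub> Rx D i) (q \<otimes>\<^bsub>U\<^esub> Ry D i)) Ri"
    unfolding UU.tev_mult[OF h] by (intro UU.tev_cong[OF Ri_carrier] tev_Rcheck UU.bform_mult(1)[OF h])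
  then show "(\<Sum>i<nR D. tev (\<lambda>p q. h (p \<otimes>\<^bsub>U\<^esub> Rx D i) (q \<otimes>\<^bsub>U\<^esub> Ry D i)) Ri) = h \<one>\<^bsub>U\<^esub> \<one>\<^bsub>U\<^esub>"
    by (simp add: Ri_def TU.Units_l_inv[OF Rcheck_unit] UU.tev_one[OF h] tev_sum)
qed

abbreviation inc2 where "inc2 \<equiv> tens_map H H (incl D) (incl D)"

lemma tev_inc2: "bform H H h \<Longrightarrow> t \<in> carrier (U \<otimes>\<^sub>A U) \<Longrightarrow> tev h (inc2 t) = tev (\<lambda>x y. h (incl D x) (incl D y)) t"
  by (rule UU.tev_tens_map[OF H.UU.two_spaces_axioms]) simp_all

lemma inc2_closed [simp]: "t \<in> carrier (U \<otimes>\<^sub>A U) \<Longrightarrow> inc2 t \<in> carrier (H \<otimes>\<^sub>A H)"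
  by (rule UU.tens_map_closed[OF H.UU.two_spaces_axioms]) simp_all

lemma bf_incl: "bform H H h \<Longrightarrow> bf (\<lambda>x y. h (incl D x) (incl D y))"
  by (rule bform_lmap[OF _ lmap_incl lmap_incl])

lemma inc2_mult:
  assumes s: "s \<in> carrier (U \<otimes>\<^sub>A U)" and t: "t \<in> carrier (U \<otimes>\<^sub>A U)"
  shows "inc2 s \<otimes>\<^bsub>H \<otimes>\<^sub>A H\<^esub> inc2 t = inc2 (s \<otimes>\<^bsub>U \<otimes>\<^sub>A U\<^esub> t)"
proof (rule H.UU.tens_eqI)
  fix h assume h: "bform H H h"
  have "tev h (inc2 s \<otimes>\<^bsub>H \<otimes>\<^sub>A H\<^esub> inc2 t)
      = tev (\<lambda>p q. tev (\<lambda>p' q'. h (incl D p \<otimes>\<^bsub>H\<^esub> p') (incl D q \<otimes>\<^bsub>H\<^esub> q')) (inc2 t)) s"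
    by (simp add: H.UU.tev_mult[OF h] tev_inc2[OF H.UU.bform_tev_mult(1)[OF h inc2_closed[OF t]] s])
  also have "\<dots> = tev (\<lambda>p q. tev (\<lambda>p' q'. h (incl D (p \<otimes>\<^bsub>U\<^esub> p')) (incl D (q \<otimes>\<^bsub>U\<^esub> q'))) t) s"
    by (intro UU.tev_cong[OF s])
      (auto simp: tev_inc2[OF H.UU.bform_mult(1)[OF h] t] incl_mult intro!: UU.tev_cong[OF t])
  also have "\<dots> = tev h (inc2 (s \<otimes>\<^bsub>U \<otimes>\<^sub>A U\<^esub> t))"
    by (simp add: tev_inc2[OF h UU.tensor_mult_closed[OF s t]] UU.tev_mult[OF bf_incl[OF h]])
  finally show "tev h (inc2 s \<otimes>\<^bsub>H \<otimes>\<^sub>A H\<^esub> inc2 t) = tev h (inc2 (s \<otimes>\<^bsub>U \<otimes>\<^sub>A U\<^esub> t))" .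
qed (use s t in simp_all)

lemma inc2_one: "inc2 \<one>\<^bsub>U \<otimes>\<^sub>A U\<^esub> = \<one>\<^bsub>H \<otimes>\<^sub>A H\<^esub>"
  by (rule H.UU.tens_eqI)
    (simp_all add: UU.tensor_one_closed H.UU.tensor_one_closed tev_inc2 H.UU.tev_one UU.tev_one bf_incl incl_one)

lemma inv_RcheckH: "inv\<^bsub>H \<otimes>\<^sub>A H\<^esub> (RcheckH D) = inc2 Ri"
  unfolding RcheckH_def Ri_def
  using TU.Units_r_inv[OF Rcheck_unit] TU.Units_l_inv[OF Rcheck_unit] TU.Units_inv_closed[OF Rcheck_unit]
  by (intro TH.inv_char) (simp_all add: inc2_mult inc2_one)

definition Ht where
  "Ht = (SOME Ht. is_Htilde D Ht \<and>
        (\<forall>u\<in>carrier H. tens_flip H H (copH D u) =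
           Ht (RcheckH D \<otimes>\<^bsub>H \<otimes>\<^sub>A H\<^esub> copH D u \<otimes>\<^bsub>H \<otimes>\<^sub>A H\<^esub> inv\<^bsub>H \<otimes>\<^sub>A H\<^esub> (RcheckH D))))"

lemma Ht: "is_Htilde D Ht" "u \<in> carrier H \<Longrightarrow> tens_flip H H (copH D u) =
           Ht (RcheckH D \<otimes>\<^bsub>H \<otimes>\<^sub>A H\<^esub> copH D u \<otimes>\<^bsub>H \<otimes>\<^sub>A H\<^esub> inc2 Ri)"
proof -
  have "\<exists>Ht. is_Htilde D Ht \<and>
        (\<forall>u\<in>carrier H. tens_flip H H (copH D u) =
           Ht (RcheckH D \<otimes>\<^bsub>H \<otimes>\<^sub>A H\<^esub> copH D u \<otimes>\<^bsub>H \<otimes>\<^sub>A H\<^esub> inv\<^bsub>H \<otimes>\<^sub>A H\<^esub> (RcheckH D)))"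
    using ax2 unfolding axiom2_def by (elim conjE)
  from someI_ex[OF this] show "is_Htilde D Ht" "u \<in> carrier H \<Longrightarrow> tens_flip H H (copH D u) =
           Ht (RcheckH D \<otimes>\<^bsub>H \<otimes>\<^sub>A H\<^esub> copH D u \<otimes>\<^bsub>H \<otimes>\<^sub>A H\<^esub> inc2 Ri)"
    by (auto simp: Ht_def inv_RcheckH)
qed

lemma lmap_Ht: "lmap (H \<otimes>\<^sub>A H) (H \<otimes>\<^sub>A H) Ht"
  using Ht(1) by (intro clinear_lmap) (simp add: is_Htilde_def)

definition twist where "twist k p q = tev k (Ht (ptens H H p q))"

lemma bform_twist: "bform H H k \<Longrightarrow> bform H H (twist k)"
  unfolding twist_def by (intro H.UU.bform_ptens lform_lmap[OF H.UU.lform_tev lmap_Ht])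

lemma twist_eq:
  assumes "bform H H k" "m \<in> Lam D" "n \<in> Lam D" "x \<in> UHdeg D m" "y \<in> UHdeg D n"
  shows "twist k x y = k (x \<otimes>\<^bsub>H\<^esub> incl D (Bel D n)) (incl D (Bel D m) \<otimes>\<^bsub>H\<^esub> y)"
  using Ht(1) assms(2-) by (simp add: twist_def is_Htilde_def H.UU.tev_ptens[OF assms(1)])

text \<open>The braiding axiom paired with k, after the inverse of \<open>RcheckH\<close> has been
  computed inside U as the image of \<open>Ri\<close>.\<close>

lemma tev_copH_flip:
  assumes k: "bform H H k" and u: "u \<in> carrier H"
  shows "tev (\<lambda>a b. k b a) (copH D u) = (\<Sum>i<nR D. tev (\<lambda>p q. tev (\<lambda>a b.
    twist k (incl D (Rx D i) \<otimes>\<^bsub>H\<^esub> a \<otimes>\<^bsub>H\<^esub> incl D p) (incl D (Ry D i) \<otimes>\<^bsub>H\<^esub> b \<otimes>\<^bsub>H\<^esub> incl D q)) (copH D u)) Ri)"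
proof -
  let ?T = "H \<otimes>\<^sub>A H" and ?k = "twist k"
  have c: "copH D u \<in> carrier ?T" "RcheckH D \<in> carrier ?T"
    using ur u by (auto simp: unrolled_algebra_def alg_hom_def LinearCombinations.module_hom_def RcheckH_def)
  let ?X = "RcheckH D \<otimes>\<^bsub>?T\<^esub> (copH D u \<otimes>\<^bsub>?T\<^esub> inc2 Ri)"
  note b = bform_twist[OF k]
  have "tev (\<lambda>a b. k b a) (copH D u) = tev k (Ht ?X)"
    using H.UU.tev_tens_flip[OF k c(1)] Ht(2)[OF u] c by (simp add: TH.m_assoc)
  also have "\<dots> = tev ?k ?X" unfolding twist_def
    by (rule H.UU.lform_as_tev[OF lform_lmap[OF H.UU.lform_tev[OF k] lmap_Ht]]) (use c in simp)
  also have "\<dots> = tev (\<lambda>x y. tev (\<lambda>p q. ?k (incl D x \<otimes>\<^bsub>H\<^esub> p) (incl D y \<otimes>\<^bsub>H\<^esub> q)) (copH D u \<otimes>\<^bsub>?T\<^esub> inc2 Ri)) (Rcheck D)"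
    using c by (simp add: H.UU.tev_mult[OF b] RcheckH_def tev_inc2[OF H.UU.bform_tev_mult(1)[OF b]])
  also have "\<dots> = (\<Sum>i<nR D. tev (\<lambda>p q. ?k (incl D (Rx D i) \<otimes>\<^bsub>H\<^esub> p) (incl D (Ry D i) \<otimes>\<^bsub>H\<^esub> q)) (copH D u \<otimes>\<^bsub>?T\<^esub> inc2 Ri))"
    by (rule tev_Rcheck[OF bf_incl[OF H.UU.bform_tev_mult(1)[OF b]]]) (use c in simp)
  also have "\<dots> = (\<Sum>i<nR D. tev (\<lambda>a b. tev (\<lambda>p q.
    ?k (incl D (Rx D i) \<otimes>\<^bsub>H\<^esub> a \<otimes>\<^bsub>H\<^esub> incl D p) (incl D (Ry D i) \<otimes>\<^bsub>H\<^esub> b \<otimes>\<^bsub>H\<^esub> incl D q)) Ri) (copH D u))"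
  proof (rule sum.cong[OF refl])
    fix i assume "i \<in> {..<nR D}"
    then have ic: "incl D (Rx D i) \<in> carrier H" "incl D (Ry D i) \<in> carrier H" by auto
    note b2 = H.UU.bform_mult(1)[OF b ic]
    show "tev (\<lambda>p q. ?k (incl D (Rx D i) \<otimes>\<^bsub>H\<^esub> p) (incl D (Ry D i) \<otimes>\<^bsub>H\<^esub> q)) (copH D u \<otimes>\<^bsub>?T\<^esub> inc2 Ri)
      = tev (\<lambda>a b. tev (\<lambda>p q. ?k (incl D (Rx D i) \<otimes>\<^bsub>H\<^esub> a \<otimes>\<^bsub>H\<^esub> incl D p) (incl D (Ry D i) \<otimes>\<^bsub>H\<^esub> b \<otimes>\<^bsub>H\<^esub> incl D q)) Ri) (copH D u)"
      unfolding H.UU.tev_mult[OF b2]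
      by (intro H.UU.tev_cong[OF c(1)])
        (simp add: tev_inc2[OF H.UU.bform_mult(1)[OF b2]] H.m_assoc ic cong: UU.tev_cong)
  qed
  also have "\<dots> = (\<Sum>i<nR D. tev (\<lambda>p q. tev (\<lambda>a b.
    ?k (incl D (Rx D i) \<otimes>\<^bsub>H\<^esub> a \<otimes>\<^bsub>H\<^esub> incl D p) (incl D (Ry D i) \<otimes>\<^bsub>H\<^esub> b \<otimes>\<^bsub>H\<^esub> incl D q)) (copH D u)) Ri)"
    by (intro sum.cong refl tev_swap)
  finally show ?thesis .
qed

abbreviation "Kb m \<equiv> Kel D (Bdual D m)"
abbreviation "Kn m \<equiv> Kel D (- Bdual D m)"

text \<open>\<open>untwist h m n\<close> undoes \<open>Ht\<close> on the component of bidegree \<open>(m, n)\<close> and then tests with \<open>h\<close>.\<close>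

definition untwist where
  "untwist h m n a b = h (gr m (ret a) \<otimes>\<^bsub>U\<^esub> Kn n) (Kn m \<otimes>\<^bsub>U\<^esub> gr n (ret b))"

lemma bform_untwist:
  assumes h: "bf h" and mn: "m \<in> Lam D" "n \<in> Lam D" shows "bform H H (untwist h m n)"
  unfolding untwist_def
  using bform_lmap[OF h, of H "\<lambda>a. gr m (ret a) \<otimes>\<^bsub>U\<^esub> Kn n" H "\<lambda>b. Kn m \<otimes>\<^bsub>U\<^esub> gr n (ret b)"] mn
  by (simp add: lmap_mult_left lmap_mult_right lmap_comp[OF lmap_gr lmap_ret])

text \<open>On homogeneous x and y the B-factors inserted by \<open>Ht\<close> and removed by
  \<open>untwist\<close> cancel, and both sides vanish unless the degrees are m and n. Both sides
  being bilinear, this suffices.\<close>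

lemma twist_untwist:
  assumes h: "bf h" and mn: "m \<in> Lam D" "n \<in> Lam D" and c: "x \<in> carrier U" "y \<in> carrier U"
  shows "twist (untwist h m n) (incl D x) (incl D y) = h (gr m x) (gr n y)"
proof -
  note b = bf_incl[OF bform_twist[OF bform_untwist[OF h mn]]]
  have b': "bf (\<lambda>x y. h (gr m x) (gr n y))" by (rule bform_lmap[OF h lmap_gr lmap_gr])
  have hom: "twist (untwist h m n) (incl D x) (incl D y) = h (gr m x) (gr n y)"
    if m': "m' \<in> Lam D" and n': "n' \<in> Lam D" and x: "x \<in> Udg m'" and y: "y \<in> Udg n'" for m' n' x y
  proof -
    note xy = Udg_closed[OF m' x] Udg_closed[OF n' y]
    have "twist (untwist h m n) (incl D x) (incl D y)
      = h (gr m (x \<otimes>\<^bsub>U\<^esub> Kb n') \<otimes>\<^bsub>U\<^esub> Kn n) (Kn m \<otimes>\<^bsub>U\<^esub> gr n (Kb m' \<otimes>\<^bsub>U\<^esub> y))"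
      using twist_eq[OF bform_untwist[OF h mn] m' n' UHdeg_incl[OF x[unfolded hdeg_Udeg] m'] UHdeg_incl[OF y[unfolded hdeg_Udeg] n']] m' n' xy
      by (simp add: untwist_def Bel_def incl_mult[symmetric])
    also have "\<dots> = h (gr m x) (gr n y)"
    proof (cases "m = m' \<and> n = n'")
      case True
      then show ?thesis using m' n' xy x y
        by (simp add: gr_Udg_eq[OF m'] gr_Udg_eq[OF n'] Udg_K Udg_K_left m_assoc K_inverse)
          (simp add: m_assoc[symmetric] K_inverse)
    next
      case False
      then show ?thesis using m' n' xy x y mn lform_zero[OF cspace bform1[OF h]] lform_zero[OF cspace bform2[OF h]]
        by (auto simp add: gr_Udg_eq[OF m'] gr_Udg_eq[OF n'] Udg_K Udg_K_left)
    qed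
    finally show ?thesis .
  qed
  have "twist (untwist h m n) (incl D x) (incl D y) = h (gr m x) (gr n y)" if m': "m' \<in> Lam D" and x: "x \<in> Udg m'" for m' x
    by (rule gr_lf_eqI[OF bform2[OF b] bform2[OF b'] hom c(2)]) (use Udg_closed[OF m' x] that in auto)
  then show ?thesis by (intro gr_lf_eqI[OF bform1[OF b] bform1[OF b'] _ c(1)] c)
qed

lemma H_commute:
  assumes k: "k < rnk D" and m: "m \<in> Lam D" and x: "x \<in> Udg m" and f: "lform H f"
    and c: "c \<in> carrier H"
  shows "f (incl D x \<otimes>\<^bsub>H\<^esub> Hgen D k \<otimes>\<^bsub>H\<^esub> c)
    = f (Hgen D k \<otimes>\<^bsub>H\<^esub> (incl D x \<otimes>\<^bsub>H\<^esub> c)) - Poly_Mapping.lookup m k * f (incl D x \<otimes>\<^bsub>H\<^esub> c)"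
proof -
  note xc = Udg_closed[OF m x]
  have w: "Poly_Mapping.single k 1 \<in> wspace (rnk D)" using k by (simp add: wspace_def)
  have p: "pairing (rnk D) (Poly_Mapping.single k 1) m = Poly_Mapping.lookup m k"
    using k by (simp add: pairing_def lookup_single when_def if_distrib[of "\<lambda>z. z * _"] cong: if_cong)
  have "Hgen D k \<otimes>\<^bsub>H\<^esub> incl D x = incl D x \<otimes>\<^bsub>H\<^esub> (Hgen D k \<oplus>\<^bsub>H\<^esub> Poly_Mapping.lookup m k \<odot>\<^bsub>H\<^esub> \<one>\<^bsub>H\<^esub>)"
    using ur w m x Hel_single[OF k] p unfolding unrolled_algebra_def by (metis hdeg_Udeg)
  also have "\<dots> = incl D x \<otimes>\<^bsub>H\<^esub> Hgen D k \<oplus>\<^bsub>H\<^esub> Poly_Mapping.lookup m k \<odot>\<^bsub>H\<^esub> incl D x"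
    using k xc by (simp add: H.r_distr H.mult_smult)
  finally have "Hgen D k \<otimes>\<^bsub>H\<^esub> (incl D x \<otimes>\<^bsub>H\<^esub> c)
    = incl D x \<otimes>\<^bsub>H\<^esub> Hgen D k \<otimes>\<^bsub>H\<^esub> c \<oplus>\<^bsub>H\<^esub> Poly_Mapping.lookup m k \<odot>\<^bsub>H\<^esub> (incl D x \<otimes>\<^bsub>H\<^esub> c)"
    using k xc c by (simp add: H.m_assoc[symmetric] H.l_distr H.smult_mult)
  then show ?thesis using k xc c by (simp add: lform_add[OF f] lform_smult[OF f])
qed

lemma copH_Hgen: "k < rnk D \<Longrightarrow> bform H H h \<Longrightarrow> tev h (copH D (Hgen D k)) = h (Hgen D k) \<one>\<^bsub>H\<^esub> + h \<one>\<^bsub>H\<^esub> (Hgen D k)"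
proof -
  assume k: "k < rnk D" and h: "bform H H h"
  have w: "Poly_Mapping.single k 1 \<in> wspace (rnk D)" using k by (simp add: wspace_def)
  have "copH D (Hgen D k) = ptens H H (Hgen D k) \<one>\<^bsub>H\<^esub> \<oplus>\<^bsub>H \<otimes>\<^sub>A H\<^esub> ptens H H \<one>\<^bsub>H\<^esub> (Hgen D k)"
    using ur w Hel_single[OF k] unfolding unrolled_algebra_def by metis
  then show ?thesis using k
    by (simp add: lform_add[OF H.UU.lform_tev[OF h]] H.UU.tev_ptens[OF h])
qed

lemma twist_Hgen:
  assumes h: "bform H H h" and k: "k < rnk D"
  shows "twist h (Hgen D k) \<one>\<^bsub>H\<^esub> = h (Hgen D k) \<one>\<^bsub>H\<^esub>" "twist h \<one>\<^bsub>H\<^esub> (Hgen D k) = h \<one>\<^bsub>H\<^esub> (Hgen D k)"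
proof -
  have B0: "Bel D 0 = \<one>\<^bsub>U\<^esub>" using Bdual_add[of 0 0] by (simp add: Bel_def K_zero)
  have o: "\<one>\<^bsub>H\<^esub> \<in> UHdeg D 0" using UHdeg_incl[of "\<one>\<^bsub>U\<^esub>" 0] one_Udg by (simp add: hdeg_Udeg incl_one)
  show "twist h (Hgen D k) \<one>\<^bsub>H\<^esub> = h (Hgen D k) \<one>\<^bsub>H\<^esub>" "twist h \<one>\<^bsub>H\<^esub> (Hgen D k) = h \<one>\<^bsub>H\<^esub> (Hgen D k)"
    using twist_eq[OF h lat_zero lat_zero UHdeg_Hgen[OF k] o] twist_eq[OF h lat_zero lat_zero o UHdeg_Hgen[OF k]] k
    by (simp_all add: B0 incl_one)
qed

text \<open>Comparing \<open>\<Delta> H\<close> with its opposite: conjugation by the truncated R-matrix fixes \<open>\<Delta> H\<close>, hence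
  each weight component of total degree \<open>\<noteq> 0\<close> of the R-matrix vanishes.\<close>

lemma R_weight:
  assumes k: "k < rnk D" and h: "bf h"
  shows "(\<Sum>i<nR D. Poly_Mapping.lookup (Rdx D i + Rdy D i) k * h (Rx D i) (Ry D i)) = 0"
proof -
  let ?c = "\<lambda>i. Poly_Mapping.lookup (Rdx D i + Rdy D i) k"
  let ?Hk = "Hgen D k"
  have 1: "(\<Sum>i<nR D. ?c i * tev (\<lambda>p q. h (gr m (Rx D i \<otimes>\<^bsub>U\<^esub> p)) (gr n (Ry D i \<otimes>\<^bsub>U\<^esub> q))) Ri) = 0"
    if h: "bf h" and mn: "m \<in> Lam D" "n \<in> Lam D" for h m n
  proof -
    let ?u = "untwist h m n" and ?t = "twist (untwist h m n)"
    note u = bform_untwist[OF h mn] note t = bform_twist[OF u]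
    have "?u ?Hk \<one>\<^bsub>H\<^esub> + ?u \<one>\<^bsub>H\<^esub> ?Hk = tev (\<lambda>a b. ?u b a) (copH D ?Hk)"
    proof -
      have "bform H H (\<lambda>a b. ?u b a)" using u by (simp add: bform_def)
      from copH_Hgen[OF k this] show ?thesis by simp
    qed
    also have "\<dots> = (\<Sum>i<nR D. tev (\<lambda>p q. tev (\<lambda>a b.
        ?t (incl D (Rx D i) \<otimes>\<^bsub>H\<^esub> a \<otimes>\<^bsub>H\<^esub> incl D p) (incl D (Ry D i) \<otimes>\<^bsub>H\<^esub> b \<otimes>\<^bsub>H\<^esub> incl D q)) (copH D ?Hk)) Ri)"
      by (rule tev_copH_flip[OF u]) (simp add: k)
    \<comment> \<open>Moving \<open>?Hk\<close> leftwards past x_i or y_i costs the matching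
      coordinate of the degree; together these are \<open>?c i\<close>. In the other two terms the
      R-matrix meets its inverse, and they reproduce the left-hand side.\<close>
    also have "\<dots> = (\<Sum>i<nR D. tev (\<lambda>p q. ?t (?Hk \<otimes>\<^bsub>H\<^esub> incl D (Rx D i \<otimes>\<^bsub>U\<^esub> p)) (incl D (Ry D i \<otimes>\<^bsub>U\<^esub> q))
         + ?t (incl D (Rx D i \<otimes>\<^bsub>U\<^esub> p)) (?Hk \<otimes>\<^bsub>H\<^esub> incl D (Ry D i \<otimes>\<^bsub>U\<^esub> q))
         - ?c i * h (gr m (Rx D i \<otimes>\<^bsub>U\<^esub> p)) (gr n (Ry D i \<otimes>\<^bsub>U\<^esub> q))) Ri)"
    proof (intro sum.cong refl UU.tev_cong[OF Ri_carrier])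
      fix i p q assume i: "i \<in> {..<nR D}" and c: "p \<in> carrier U" "q \<in> carrier U"
      then have i: "i < nR D" by simp
      note ic = incl_closed[OF Rx_carrier[OF i]] incl_closed[OF Ry_carrier[OF i]]
      let ?f = "\<lambda>a b. ?t (incl D (Rx D i) \<otimes>\<^bsub>H\<^esub> a \<otimes>\<^bsub>H\<^esub> incl D p) (incl D (Ry D i) \<otimes>\<^bsub>H\<^esub> b \<otimes>\<^bsub>H\<^esub> incl D q)"
      have f: "bform H H ?f"
        using H.UU.bform_mult(1)[OF H.UU.bform_mult(2)[OF t incl_closed[OF c(1)] incl_closed[OF c(2)]] ic] .
      have "tev ?f (copH D ?Hk) = ?t (incl D (Rx D i) \<otimes>\<^bsub>H\<^esub> ?Hk \<otimes>\<^bsub>H\<^esub> incl D p) (incl D (Ry D i \<otimes>\<^bsub>U\<^esub> q))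
         + ?t (incl D (Rx D i \<otimes>\<^bsub>U\<^esub> p)) (incl D (Ry D i) \<otimes>\<^bsub>H\<^esub> ?Hk \<otimes>\<^bsub>H\<^esub> incl D q)"
        using copH_Hgen[OF k f] i c by (simp add: incl_mult)
      also have "\<dots> = ?t (?Hk \<otimes>\<^bsub>H\<^esub> incl D (Rx D i \<otimes>\<^bsub>U\<^esub> p)) (incl D (Ry D i \<otimes>\<^bsub>U\<^esub> q))
         + ?t (incl D (Rx D i \<otimes>\<^bsub>U\<^esub> p)) (?Hk \<otimes>\<^bsub>H\<^esub> incl D (Ry D i \<otimes>\<^bsub>U\<^esub> q))
         - ?c i * ?t (incl D (Rx D i \<otimes>\<^bsub>U\<^esub> p)) (incl D (Ry D i \<otimes>\<^bsub>U\<^esub> q))"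
        using H_commute[OF k Rdx_lat[OF i] Rx_Udg[OF i] bform1[OF t], of "incl D (Ry D i \<otimes>\<^bsub>U\<^esub> q)" "incl D p"]
          H_commute[OF k Rdy_lat[OF i] Ry_Udg[OF i] bform2[OF t], of "incl D (Rx D i \<otimes>\<^bsub>U\<^esub> p)" "incl D q"] i c
        by (simp add: incl_mult lookup_add distrib_right)
      also have "?t (incl D (Rx D i \<otimes>\<^bsub>U\<^esub> p)) (incl D (Ry D i \<otimes>\<^bsub>U\<^esub> q)) = h (gr m (Rx D i \<otimes>\<^bsub>U\<^esub> p)) (gr n (Ry D i \<otimes>\<^bsub>U\<^esub> q))"
        using i c by (intro twist_untwist h mn) simp_all
      finally show "tev ?f (copH D ?Hk) = ?t (?Hk \<otimes>\<^bsub>H\<^esub> incl D (Rx D i \<otimes>\<^bsub>U\<^esub> p)) (incl D (Ry D i \<otimes>\<^bsub>U\<^esub> q))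
         + ?t (incl D (Rx D i \<otimes>\<^bsub>U\<^esub> p)) (?Hk \<otimes>\<^bsub>H\<^esub> incl D (Ry D i \<otimes>\<^bsub>U\<^esub> q))
         - ?c i * h (gr m (Rx D i \<otimes>\<^bsub>U\<^esub> p)) (gr n (Ry D i \<otimes>\<^bsub>U\<^esub> q))" .
    qed
    also have "\<dots> = (\<Sum>i<nR D. tev (\<lambda>p q. ?t (?Hk \<otimes>\<^bsub>H\<^esub> incl D (Rx D i \<otimes>\<^bsub>U\<^esub> p)) (incl D (Ry D i \<otimes>\<^bsub>U\<^esub> q))) Ri)
         + (\<Sum>i<nR D. tev (\<lambda>p q. ?t (incl D (Rx D i \<otimes>\<^bsub>U\<^esub> p)) (?Hk \<otimes>\<^bsub>H\<^esub> incl D (Ry D i \<otimes>\<^bsub>U\<^esub> q))) Ri)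
         - (\<Sum>i<nR D. ?c i * tev (\<lambda>p q. h (gr m (Rx D i \<otimes>\<^bsub>U\<^esub> p)) (gr n (Ry D i \<otimes>\<^bsub>U\<^esub> q))) Ri)"
      by (simp add: tev_add tev_diff tev_mult_left sum.distrib sum_subtractf)
    also have "(\<Sum>i<nR D. tev (\<lambda>p q. ?t (?Hk \<otimes>\<^bsub>H\<^esub> incl D (Rx D i \<otimes>\<^bsub>U\<^esub> p)) (incl D (Ry D i \<otimes>\<^bsub>U\<^esub> q))) Ri)
      = ?t (?Hk \<otimes>\<^bsub>H\<^esub> incl D \<one>\<^bsub>U\<^esub>) (incl D \<one>\<^bsub>U\<^esub>)"
      by (rule Rcheck_Ri(1)[of "\<lambda>x y. ?t (?Hk \<otimes>\<^bsub>H\<^esub> incl D x) (incl D y)"],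
          rule bform_lmap[OF t H.lmap_mult_left[OF _ lmap_incl] lmap_incl]) (simp add: k)
    also have "(\<Sum>i<nR D. tev (\<lambda>p q. ?t (incl D (Rx D i \<otimes>\<^bsub>U\<^esub> p)) (?Hk \<otimes>\<^bsub>H\<^esub> incl D (Ry D i \<otimes>\<^bsub>U\<^esub> q))) Ri)
      = ?t (incl D \<one>\<^bsub>U\<^esub>) (?Hk \<otimes>\<^bsub>H\<^esub> incl D \<one>\<^bsub>U\<^esub>)"
      by (rule Rcheck_Ri(1)[of "\<lambda>x y. ?t (incl D x) (?Hk \<otimes>\<^bsub>H\<^esub> incl D y)"],
          rule bform_lmap[OF t lmap_incl H.lmap_mult_left[OF _ lmap_incl]]) (simp add: k)
    finally show ?thesis using k by (simp add: incl_one twist_Hgen[OF u])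
  qed
  \<comment> \<open>All bidegree components vanish, hence so does the weighted R-matrix multiplied
    by the inverse; \<open>?M\<close> lists the pure tensors of this product.\<close>
  have 2: "(\<Sum>i<nR D. ?c i * tev (\<lambda>p q. h (Rx D i \<otimes>\<^bsub>U\<^esub> p) (Ry D i \<otimes>\<^bsub>U\<^esub> q)) Ri) = 0" if h: "bf h" for h
  proof -
    let ?M = "{..<nR D} \<times> Poly_Mapping.keys (rep Ri)" and ?w = "\<lambda>(i, k). ?c i * Poly_Mapping.lookup (rep Ri) k"
    have e: "(\<Sum>i<nR D. ?c i * tev (\<lambda>p q. h' (Rx D i \<otimes>\<^bsub>U\<^esub> p) (Ry D i \<otimes>\<^bsub>U\<^esub> q)) Ri)
      = (\<Sum>s\<in>?M. ?w s * h' (Rx D (fst s) \<otimes>\<^bsub>U\<^esub> fst (snd s)) (Ry D (fst s) \<otimes>\<^bsub>U\<^esub> snd (snd s)))" for h'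
      by (simp add: tev_def fev_def sum_distrib_left sum.cartesian_product split_beta mult.assoc)
    have c: "fst k \<in> carrier U \<and> snd k \<in> carrier U" if "k \<in> Poly_Mapping.keys (rep Ri)" for k
      using UU.rep_formals[OF Ri_carrier] that by auto
    show ?thesis unfolding e
      by (rule bf_gr_eqI[OF h]) (use c 1[OF h] e[of "\<lambda>x y. h (gr _ x) (gr _ y)"] in auto)
  qed
  \<comment> \<open>The product of \<open>Ri\<close> and R is inserted on the right, so that the
    identity just proved applies in front of the last R.\<close>
  have "h (Rx D i) (Ry D i) = (\<Sum>j<nR D. tev (\<lambda>p q. h (Rx D i \<otimes>\<^bsub>U\<^esub> (p \<otimes>\<^bsub>U\<^esub> Rx D j)) (Ry D i \<otimes>\<^bsub>U\<^esub> (q \<otimes>\<^bsub>U\<^esub> Ry D j))) Ri)"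
    if i: "i < nR D" for i
    using Rcheck_Ri(2)[OF UU.bform_mult(1)[OF h Rx_carrier[OF i] Ry_carrier[OF i]]] i by simp
  then have "(\<Sum>i<nR D. ?c i * h (Rx D i) (Ry D i))
    = (\<Sum>i<nR D. \<Sum>j<nR D. ?c i * tev (\<lambda>p q. h (Rx D i \<otimes>\<^bsub>U\<^esub> (p \<otimes>\<^bsub>U\<^esub> Rx D j)) (Ry D i \<otimes>\<^bsub>U\<^esub> (q \<otimes>\<^bsub>U\<^esub> Ry D j))) Ri)"
    by (simp add: sum_distrib_left)
  also have "\<dots> = (\<Sum>j<nR D. \<Sum>i<nR D. ?c i * tev (\<lambda>p q. h (Rx D i \<otimes>\<^bsub>U\<^esub> p \<otimes>\<^bsub>U\<^esub> Rx D j) (Ry D i \<otimes>\<^bsub>U\<^esub> q \<otimes>\<^bsub>U\<^esub> Ry D j)) Ri)"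
    by (subst sum.swap) (intro sum.cong refl arg_cong2[where f="(*)"] UU.tev_cong[OF Ri_carrier], simp add: m_assoc)
  also have "\<dots> = 0"
    by (rule sum.neutral, rule ballI, rule 2[OF UU.bform_mult(2)[OF h]]) simp_all
  finally show ?thesis .
qed

section \<open>Reduction to summands of total degree zero; hexagons and ribbon identity\<close>

definition J where "J = {i. i < nR D \<and> Rdy D i = - Rdx D i}"

text \<open>Indices outside J are grouped by bidegree (m, n). There m + n has a nonzero coordinate
  k, and \<open>R_weight\<close> for the form cut down to that bidegree kills the group. Degrees are
  constant within a group, so h may depend on them.\<close>

lemma sum_J:
  assumes h: "\<And>m n. m \<in> Lam D \<Longrightarrow> n \<in> Lam D \<Longrightarrow> bf (h m n)"
  shows "(\<Sum>i<nR D. h (Rdx D i) (Rdy D i) (Rx D i) (Ry D i)) = (\<Sum>i\<in>J. h (Rdx D i) (Rdy D i) (Rx D i) (Ry D i))"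
proof -
  let ?F = "\<lambda>i. h (Rdx D i) (Rdy D i) (Rx D i) (Ry D i)"
  let ?d = "\<lambda>i. (Rdx D i, Rdy D i)"
  let ?N = "{..<nR D} - J"
  have cls: "(\<Sum>i\<in>{i\<in>?N. ?d i = (m, n)}. ?F i) = 0" if mn: "(m, n) \<in> ?d ` ?N" for m n
  proof -
    have l: "m \<in> Lam D" "n \<in> Lam D" and s: "m + n \<noteq> 0"
      using mn by (auto simp: J_def eq_neg_iff_add_eq_0 add.commute)
    obtain k where k: "Poly_Mapping.lookup (m + n) k \<noteq> 0" using s by (metis poly_mapping_eqI lookup_zero)
    have kr: "k < rnk D" using k lat_add[OF l] by (auto simp: lat_def wspace_def in_keys_iff subset_iff)
    have "bf (\<lambda>x y. h m n (gr m x) (gr n y))" by (rule bform_lmap[OF h[OF l] lmap_gr lmap_gr])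
    from R_weight[OF kr this]
    have "(\<Sum>i<nR D. Poly_Mapping.lookup (Rdx D i + Rdy D i) k * h m n (gr m (Rx D i)) (gr n (Ry D i))) = 0" .
    also have "(\<Sum>i<nR D. Poly_Mapping.lookup (Rdx D i + Rdy D i) k * h m n (gr m (Rx D i)) (gr n (Ry D i)))
      = (\<Sum>i<nR D. if ?d i = (m, n) then Poly_Mapping.lookup (m + n) k * ?F i else 0)"
      using l lform_zero[OF cspace bform1[OF h[OF l]]] lform_zero[OF cspace bform2[OF h[OF l]]]
      by (intro sum.cong) (auto simp: gr_Udg_eq[OF Rdx_lat Rx_Udg] gr_Udg_eq[OF Rdy_lat Ry_Udg])
    also have "\<dots> = Poly_Mapping.lookup (m + n) k * (\<Sum>i\<in>{i\<in>{..<nR D}. ?d i = (m, n)}. ?F i)"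
      by (simp add: sum.inter_filter[symmetric] sum_distrib_left)
    also have "{i\<in>{..<nR D}. ?d i = (m, n)} = {i\<in>?N. ?d i = (m, n)}"
      using s by (auto simp: J_def)
    finally show ?thesis using k by simp
  qed
  have "(\<Sum>i\<in>?N. ?F i) = (\<Sum>p\<in>?d ` ?N. \<Sum>i\<in>{i\<in>?N. ?d i = p}. ?F i)"
    by (rule sum.group[symmetric]) auto
  also have "\<dots> = 0" using cls by (intro sum.neutral) auto
  finally have "(\<Sum>i\<in>?N. ?F i) = 0" .
  moreover have "J \<subseteq> {..<nR D}" by (auto simp: J_def)
  ultimately show ?thesis by (simp add: sum.subset_diff[of J "{..<nR D}"])
qed

end

lemma (in two_algebras) tev_finsum_mult:
  assumes h: "bform A B h" and a: "\<And>j. j \<in> M \<Longrightarrow> a j \<in> carrier (A \<otimes>\<^sub>A B)" and b: "\<And>i. i \<in> N \<Longrightarrow> b i \<in> carrier (A \<otimes>\<^sub>A B)"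
  shows "tev h ((\<Oplus>\<^bsub>A \<otimes>\<^sub>A B\<^esub>j\<in>M. a j) \<otimes>\<^bsub>A \<otimes>\<^sub>A B\<^esub> (\<Oplus>\<^bsub>A \<otimes>\<^sub>A B\<^esub>i\<in>N. b i))
    = (\<Sum>j\<in>M. \<Sum>i\<in>N. tev h (a j \<otimes>\<^bsub>A \<otimes>\<^sub>A B\<^esub> b i))"
proof -
  interpret T: calgebra "A \<otimes>\<^sub>A B" by unfold_locales (rule complex_algebra_tensor)
  note l = lform_lmap[OF lform_tev[OF h]]
  have bs: "(\<Oplus>\<^bsub>A \<otimes>\<^sub>A B\<^esub>i\<in>N. b i) \<in> carrier (A \<otimes>\<^sub>A B)" using b by (intro T.finsum_closed) auto
  have "tev h ((\<Oplus>\<^bsub>A \<otimes>\<^sub>A B\<^esub>j\<in>M. a j) \<otimes>\<^bsub>A \<otimes>\<^sub>A B\<^esub> (\<Oplus>\<^bsub>A \<otimes>\<^sub>A B\<^esub>i\<in>N. b i))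
      = (\<Sum>j\<in>M. tev h (a j \<otimes>\<^bsub>A \<otimes>\<^sub>A B\<^esub> (\<Oplus>\<^bsub>A \<otimes>\<^sub>A B\<^esub>i\<in>N. b i)))"
    by (rule lform_finsum[OF T.cspace l[OF T.lmap_mult_right[OF bs lmap_id]]]) (use a in auto)
  also have "\<dots> = (\<Sum>j\<in>M. \<Sum>i\<in>N. tev h (a j \<otimes>\<^bsub>A \<otimes>\<^sub>A B\<^esub> b i))"
    by (intro sum.cong refl lform_finsum[OF T.cspace l[OF T.lmap_mult_left[OF _ lmap_id]]]) (use a b in auto)
  finally show ?thesis .
qed

context unrolled
begin

lemma J_less: "i \<in> J \<Longrightarrow> i < nR D" and J_finite: "finite J" and Rdy_J: "i \<in> J \<Longrightarrow> Rdy D i = - Rdx D i"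
  by (auto simp: J_def)

lemma sum_J': "bf h \<Longrightarrow> (\<Sum>i<nR D. h (Rx D i) (Ry D i)) = (\<Sum>i\<in>J. h (Rx D i) (Ry D i))"
  using sum_J[of "\<lambda>_ _. h"] by simp

text \<open>The witness is R \<Delta>(u) R^{-1}, formed in U \<otimes> U. Its components follow from
  the braiding axiom tested with \<open>untwist\<close>, applied to \<open>incl D u\<close>.\<close>

lemma cross:
  assumes u: "u \<in> carrier U"
  shows "\<exists>X\<in>carrier (U \<otimes>\<^sub>A U).
    (\<forall>k. bf k \<longrightarrow> tev k X = (\<Sum>i\<in>J. tev (\<lambda>a b. sw (\<lambda>p q.
        k (Rx D i \<otimes>\<^bsub>U\<^esub> p \<otimes>\<^bsub>U\<^esub> a) (Ry D i \<otimes>\<^bsub>U\<^esub> q \<otimes>\<^bsub>U\<^esub> b)) u) Ri)) \<and>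
    (\<forall>k. \<forall>m\<in>Lam D. \<forall>n\<in>Lam D. bf k \<longrightarrow>
      tev (\<lambda>p q. k (gr m p) (gr n q)) X = sw (\<lambda>p q. k (gr m q \<otimes>\<^bsub>U\<^esub> Kn n) (Kn m \<otimes>\<^bsub>U\<^esub> gr n p)) u)"
proof -
  let ?T = "U \<otimes>\<^sub>A U"
  let ?X = "Rcheck D \<otimes>\<^bsub>?T\<^esub> (cop D u \<otimes>\<^bsub>?T\<^esub> Ri)"
  let ?f = "\<lambda>k x y. tev (\<lambda>a b. sw (\<lambda>p q. k (x \<otimes>\<^bsub>U\<^esub> p \<otimes>\<^bsub>U\<^esub> a) (y \<otimes>\<^bsub>U\<^esub> q \<otimes>\<^bsub>U\<^esub> b)) u) Ri"
  have c: "cop D u \<in> carrier ?T" using u by simp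
  have f: "?f k x y = tev (\<lambda>p q. k (x \<otimes>\<^bsub>U\<^esub> p) (y \<otimes>\<^bsub>U\<^esub> q)) (cop D u \<otimes>\<^bsub>?T\<^esub> Ri)"
    if k: "bf k" and xy: "x \<in> carrier U" "y \<in> carrier U" for k x y
  proof -
    have "?f k x y = sw (\<lambda>p q. tev (\<lambda>a b. k (x \<otimes>\<^bsub>U\<^esub> p \<otimes>\<^bsub>U\<^esub> a) (y \<otimes>\<^bsub>U\<^esub> q \<otimes>\<^bsub>U\<^esub> b)) Ri) u"
      by (rule tev_swap)
    also have "\<dots> = sw (\<lambda>p q. tev (\<lambda>a b. k (x \<otimes>\<^bsub>U\<^esub> (p \<otimes>\<^bsub>U\<^esub> a)) (y \<otimes>\<^bsub>U\<^esub> (q \<otimes>\<^bsub>U\<^esub> b))) Ri) u"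
      by (intro UU.tev_cong c Ri_carrier) (simp add: m_assoc xy)
    finally show ?thesis by (simp add: UU.tev_mult[OF UU.bform_mult(1)[OF k xy]])
  qed
  have X: "tev k ?X = (\<Sum>i<nR D. ?f k (Rx D i) (Ry D i))" if k: "bf k" for k
  proof -
    have "tev k ?X = (\<Sum>i<nR D. tev (\<lambda>p q. k (Rx D i \<otimes>\<^bsub>U\<^esub> p) (Ry D i \<otimes>\<^bsub>U\<^esub> q)) (cop D u \<otimes>\<^bsub>?T\<^esub> Ri))"
      unfolding UU.tev_mult[OF k] by (rule tev_Rcheck[OF UU.bform_tev_mult(1)[OF k]]) (simp add: c)
    then show ?thesis using f[OF k] by simp
  qed
  show ?thesis
  proof (intro bexI conjI allI ballI impI)
    show "?X \<in> carrier ?T" using c by simp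
    fix k assume k: "bf k"
    have "bf (?f k)"
    proof (rule iffD1[OF _ UU.bform_tev_mult(1)[OF k TU.m_closed[OF c Ri_carrier]]])
      show "bf (\<lambda>p q. tev (\<lambda>p' q'. k (p \<otimes>\<^bsub>U\<^esub> p') (q \<otimes>\<^bsub>U\<^esub> q')) (cop D u \<otimes>\<^bsub>?T\<^esub> Ri)) = bf (?f k)"
        unfolding bform_def lform_def by (simp add: f[OF k])
    qed
    from sum_J'[OF this] show "tev k ?X = (\<Sum>i\<in>J. ?f k (Rx D i) (Ry D i))" using X[OF k] by simp
  next
    fix k m n assume mn: "m \<in> Lam D" "n \<in> Lam D" and k: "bf k"
    let ?u = "untwist k m n"
    note bu = bform_untwist[OF k mn]
    have b': "bf (\<lambda>p q. k (gr m p) (gr n q))" by (rule bform_lmap[OF k lmap_gr lmap_gr])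
    have bu': "bform H H (\<lambda>a b. ?u b a)" using bu by (simp add: bform_def)
    have cu: "copH D (incl D u) = inc2 (cop D u)" using ur u by (simp add: unrolled_algebra_def)
    have "sw (\<lambda>p q. k (gr m q \<otimes>\<^bsub>U\<^esub> Kn n) (Kn m \<otimes>\<^bsub>U\<^esub> gr n p)) u = sw (\<lambda>p q. ?u (incl D q) (incl D p)) u"
      by (intro UU.tev_cong[OF c]) (simp add: untwist_def)
    also have "\<dots> = tev (\<lambda>a b. ?u b a) (copH D (incl D u))"
      unfolding cu by (rule tev_inc2[OF bu' c, symmetric])
    also have "\<dots> = (\<Sum>i<nR D. tev (\<lambda>p q. tev (\<lambda>a b.
      twist ?u (incl D (Rx D i) \<otimes>\<^bsub>H\<^esub> a \<otimes>\<^bsub>H\<^esub> incl D p) (incl D (Ry D i) \<otimes>\<^bsub>H\<^esub> b \<otimes>\<^bsub>H\<^esub> incl D q)) (copH D (incl D u))) Ri)"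
      by (rule tev_copH_flip[OF bu]) (simp add: u)
    also have "\<dots> = (\<Sum>i<nR D. ?f (\<lambda>p q. k (gr m p) (gr n q)) (Rx D i) (Ry D i))"
    proof (intro sum.cong refl UU.tev_cong[OF Ri_carrier])
      fix i p q assume i: "i \<in> {..<nR D}" and pq: "p \<in> carrier U" "q \<in> carrier U"
      then have i: "i < nR D" by simp
      let ?g = "\<lambda>a b. twist ?u (incl D (Rx D i) \<otimes>\<^bsub>H\<^esub> a \<otimes>\<^bsub>H\<^esub> incl D p) (incl D (Ry D i) \<otimes>\<^bsub>H\<^esub> b \<otimes>\<^bsub>H\<^esub> incl D q)"
      have "bform H H ?g"
        using H.UU.bform_mult(1)[OF H.UU.bform_mult(2)[OF bform_twist[OF bu] incl_closed[OF pq(1)] incl_closed[OF pq(2)]]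
          incl_closed[OF Rx_carrier[OF i]] incl_closed[OF Ry_carrier[OF i]]] .
      then have "tev ?g (copH D (incl D u)) = sw (\<lambda>a b. ?g (incl D a) (incl D b)) u"
        unfolding cu by (rule tev_inc2[OF _ c])
      also have "\<dots> = sw (\<lambda>a b. k (gr m (Rx D i \<otimes>\<^bsub>U\<^esub> a \<otimes>\<^bsub>U\<^esub> p)) (gr n (Ry D i \<otimes>\<^bsub>U\<^esub> b \<otimes>\<^bsub>U\<^esub> q))) u"
      proof (rule UU.tev_cong[OF c])
        fix a b assume "a \<in> carrier U" "b \<in> carrier U"
        then show "?g (incl D a) (incl D b) = k (gr m (Rx D i \<otimes>\<^bsub>U\<^esub> a \<otimes>\<^bsub>U\<^esub> p)) (gr n (Ry D i \<otimes>\<^bsub>U\<^esub> b \<otimes>\<^bsub>U\<^esub> q))"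
          using twist_untwist[OF k mn, of "Rx D i \<otimes>\<^bsub>U\<^esub> a \<otimes>\<^bsub>U\<^esub> p" "Ry D i \<otimes>\<^bsub>U\<^esub> b \<otimes>\<^bsub>U\<^esub> q"] i pq
          by (simp add: incl_mult)
      qed
      finally show "tev ?g (copH D (incl D u))
        = sw (\<lambda>a b. k (gr m (Rx D i \<otimes>\<^bsub>U\<^esub> a \<otimes>\<^bsub>U\<^esub> p)) (gr n (Ry D i \<otimes>\<^bsub>U\<^esub> b \<otimes>\<^bsub>U\<^esub> q))) u" .
    qed
    finally show "tev (\<lambda>p q. k (gr m p) (gr n q)) ?X
      = sw (\<lambda>p q. k (gr m q \<otimes>\<^bsub>U\<^esub> Kn n) (Kn m \<otimes>\<^bsub>U\<^esub> gr n p)) u"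
      by (simp add: X[OF b'])
  qed
qed

lemma sum_J2:
  assumes h: "\<And>m n x y. m \<in> Lam D \<Longrightarrow> n \<in> Lam D \<Longrightarrow> x \<in> carrier U \<Longrightarrow> y \<in> carrier U \<Longrightarrow> bf (h m n x y)"
    "\<And>m n x y. m \<in> Lam D \<Longrightarrow> n \<in> Lam D \<Longrightarrow> x \<in> carrier U \<Longrightarrow> y \<in> carrier U \<Longrightarrow> bf (\<lambda>x' y'. h m n x' y' x y)"
  shows "(\<Sum>j<nR D. \<Sum>i<nR D. h (Rdx D j) (Rdy D j) (Rx D j) (Ry D j) (Rx D i) (Ry D i))
    = (\<Sum>j\<in>J. \<Sum>i\<in>J. h (Rdx D j) (Rdy D j) (Rx D j) (Ry D j) (Rx D i) (Ry D i))"
proof -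
  have "(\<Sum>j<nR D. \<Sum>i<nR D. h (Rdx D j) (Rdy D j) (Rx D j) (Ry D j) (Rx D i) (Ry D i))
    = (\<Sum>j<nR D. \<Sum>i\<in>J. h (Rdx D j) (Rdy D j) (Rx D j) (Ry D j) (Rx D i) (Ry D i))"
    by (intro sum.cong refl sum_J' h) simp_all
  also have "\<dots> = (\<Sum>i\<in>J. \<Sum>j<nR D. h (Rdx D j) (Rdy D j) (Rx D j) (Ry D j) (Rx D i) (Ry D i))"
    by (rule sum.swap)
  also have "\<dots> = (\<Sum>i\<in>J. \<Sum>j\<in>J. h (Rdx D j) (Rdy D j) (Rx D j) (Ry D j) (Rx D i) (Ry D i))"
  proof (rule sum.cong[OF refl])
    fix i assume "i \<in> J"
    then have i: "i < nR D" by (rule J_less)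
    show "(\<Sum>j<nR D. h (Rdx D j) (Rdy D j) (Rx D j) (Ry D j) (Rx D i) (Ry D i))
      = (\<Sum>j\<in>J. h (Rdx D j) (Rdy D j) (Rx D j) (Ry D j) (Rx D i) (Ry D i))"
      by (rule sum_J[of "\<lambda>m n x' y'. h m n x' y' (Rx D i) (Ry D i)"]) (intro h; simp add: i)
  qed
  also have "\<dots> = (\<Sum>j\<in>J. \<Sum>i\<in>J. h (Rdx D j) (Rdy D j) (Rx D j) (Ry D j) (Rx D i) (Ry D i))"
    by (rule sum.swap)
  finally show ?thesis .
qed

sublocale TUU: two_algebras "U \<otimes>\<^sub>A U" U by unfold_locales (rule UU.complex_algebra_tensor calg)+
sublocale UTU: two_algebras U "U \<otimes>\<^sub>A U" by unfold_locales (rule UU.complex_algebra_tensor calg)+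

lemma tform_lform:
  assumes k: "tf k"
  shows "y \<in> carrier U \<Longrightarrow> z \<in> carrier U \<Longrightarrow> lmap A U E \<Longrightarrow> lform A (\<lambda>x. k (E x) y z)"
  and "x \<in> carrier U \<Longrightarrow> z \<in> carrier U \<Longrightarrow> lmap A U E \<Longrightarrow> lform A (\<lambda>y. k x (E y) z)"
  and "x \<in> carrier U \<Longrightarrow> y \<in> carrier U \<Longrightarrow> lmap A U E \<Longrightarrow> lform A (\<lambda>z. k x y (E z))"
  using k lform_lmap[of U "\<lambda>x. k x y z" A E] lform_lmap[of U "\<lambda>y. k x y z" A E] lform_lmap[of U "\<lambda>z. k x y z" A E]
  by (simp_all add: tform_def)

lemma Bdual_uminus: "Bdual D (- m) = - Bdual D m"
  by (rule poly_mapping_eqI) (simp add: lookup_Bdual sum_negf)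

text \<open>The axiom paired with the form that k induces on (U \<otimes> U) \<otimes> U.
  Restricting both sums to J turns the inverse of B at the degree of y_j into B at the degree of
  x_j.\<close>

lemma hexagon_left:
  assumes k: "tf k"
  shows "(\<Sum>i\<in>J. sw (\<lambda>a b. k a b (Ry D i)) (Rx D i))
      = (\<Sum>j\<in>J. \<Sum>i\<in>J. k (Rx D j) (Kb (Rdx D j) \<otimes>\<^bsub>U\<^esub> Rx D i) (Ry D j \<otimes>\<^bsub>U\<^esub> Ry D i))"
proof -
  let ?T = "U \<otimes>\<^sub>A U" let ?T3 = "?T \<otimes>\<^sub>A U"
  note [lin] = tform_lform[OF k]
  let ?k = "\<lambda>t z. tev (\<lambda>x y. k x y z) t"
  have kz: "bf (\<lambda>x y. k x y z)" if "z \<in> carrier U" for z using that by ((intro lin)?; simp)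
  have K: "bform ?T U ?k"
    by (intro bformI UU.lform_tev kz UU.lform_tev_param) ((intro lin)?; simp)+
  let ?A = "\<lambda>j. ptens ?T U (ptens U U (Rx D j) (inv\<^bsub>U\<^esub> (Bel D (Rdy D j)))) (Ry D j)"
  let ?B = "\<lambda>i. ptens ?T U (ptens U U \<one>\<^bsub>U\<^esub> (Rx D i)) (Ry D i)"
  have Bc: "inv\<^bsub>U\<^esub> (Bel D (Rdy D j)) \<in> carrier U" if "j < nR D" for j
    using that by (simp add: inv_Bel)
  have Ac: "?A j \<in> carrier ?T3" if "j < nR D" for j
    using that Bc by (intro TUU.ptens_closed UU.ptens_closed) simp_all
  have Bc': "?B j \<in> carrier ?T3" if "j < nR D" for j
    using that by (intro TUU.ptens_closed UU.ptens_closed) simp_all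
  have ax: "tens_map ?T U (cop D) (\<lambda>x. x) (Rcheck D)
    = (\<Oplus>\<^bsub>?T3\<^esub> j\<in>{..<nR D}. ?A j) \<otimes>\<^bsub>?T3\<^esub> (\<Oplus>\<^bsub>?T3\<^esub> i\<in>{..<nR D}. ?B i)"
    using ax2 unfolding axiom2_def Let_def by (elim conjE)
  have "(\<Sum>i\<in>J. sw (\<lambda>a b. k a b (Ry D i)) (Rx D i)) = (\<Sum>i<nR D. sw (\<lambda>a b. k a b (Ry D i)) (Rx D i))"
    by (rule sum_J'[of "\<lambda>x y. sw (\<lambda>a b. k a b y) x", symmetric]) ((intro lin)?; simp)
  also have "\<dots> = tev (\<lambda>x y. ?k (cop D x) y) (Rcheck D)"
    by (rule tev_Rcheck[symmetric]) ((intro lin)?; simp)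
  also have "\<dots> = tev ?k (tens_map ?T U (cop D) (\<lambda>x. x) (Rcheck D))"
    by (rule UU.tev_tens_map[OF TUU.two_spaces_axioms K, symmetric]) simp_all
  also have "\<dots> = (\<Sum>j<nR D. \<Sum>i<nR D. k (Rx D j) (inv\<^bsub>U\<^esub> (Bel D (Rdy D j)) \<otimes>\<^bsub>U\<^esub> Rx D i) (Ry D j \<otimes>\<^bsub>U\<^esub> Ry D i))"
  proof -
    have "tev ?k (?A j \<otimes>\<^bsub>?T3\<^esub> ?B i) = k (Rx D j) (inv\<^bsub>U\<^esub> (Bel D (Rdy D j)) \<otimes>\<^bsub>U\<^esub> Rx D i) (Ry D j \<otimes>\<^bsub>U\<^esub> Ry D i)"
      if j: "j < nR D" and i: "i < nR D" for i j
    proof -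
      note Pj = UU.ptens_closed[OF Rx_carrier[OF j] Bc[OF j]]
      have "tev ?k (?A j \<otimes>\<^bsub>?T3\<^esub> ?B i)
        = ?k (ptens U U (Rx D j) (inv\<^bsub>U\<^esub> (Bel D (Rdy D j))) \<otimes>\<^bsub>?T\<^esub> ptens U U \<one>\<^bsub>U\<^esub> (Rx D i)) (Ry D j \<otimes>\<^bsub>U\<^esub> Ry D i)"
        using TUU.tev_mult[OF K, of "?A j" "?B i"] TUU.tev_ptens[OF TUU.bform_tev_mult(1)[OF K Bc'[OF i]]]
          TUU.tev_ptens[OF TUU.bform_mult(1)[OF K Pj Ry_carrier[OF j]]] by simp
      also have "\<dots> = k (Rx D j) (inv\<^bsub>U\<^esub> (Bel D (Rdy D j)) \<otimes>\<^bsub>U\<^esub> Rx D i) (Ry D j \<otimes>\<^bsub>U\<^esub> Ry D i)"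
      proof -
        have z: "Ry D j \<otimes>\<^bsub>U\<^esub> Ry D i \<in> carrier U" using i j by simp
        have P: "ptens U U \<one>\<^bsub>U\<^esub> (Rx D i) \<in> carrier ?T" using i by (intro UU.ptens_closed) simp_all
        show ?thesis
          using UU.tev_mult[OF kz[OF z]] UU.tev_ptens[OF UU.bform_tev_mult(1)[OF kz[OF z] P]]
            UU.tev_ptens[OF UU.bform_mult(1)[OF kz[OF z] Rx_carrier[OF j] Bc[OF j]]] j by simp
      qed
      finally show ?thesis .
    qed
    moreover have "tev ?k ((\<Oplus>\<^bsub>?T3\<^esub> j\<in>{..<nR D}. ?A j) \<otimes>\<^bsub>?T3\<^esub> (\<Oplus>\<^bsub>?T3\<^esub> i\<in>{..<nR D}. ?B i))
      = (\<Sum>j<nR D. \<Sum>i<nR D. tev ?k (?A j \<otimes>\<^bsub>?T3\<^esub> ?B i))"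
      by (rule TUU.tev_finsum_mult[OF K]) (use Ac Bc' in auto)
    ultimately show ?thesis unfolding ax by simp
  qed
  also have "\<dots> = (\<Sum>j<nR D. \<Sum>i<nR D. k (Rx D j) (Kn (Rdy D j) \<otimes>\<^bsub>U\<^esub> Rx D i) (Ry D j \<otimes>\<^bsub>U\<^esub> Ry D i))"
    by (intro sum.cong refl) (simp add: inv_Bel)
  also have "\<dots> = (\<Sum>j\<in>J. \<Sum>i\<in>J. k (Rx D j) (Kn (Rdy D j) \<otimes>\<^bsub>U\<^esub> Rx D i) (Ry D j \<otimes>\<^bsub>U\<^esub> Ry D i))"
    by (rule sum_J2[of "\<lambda>m n x y x' y'. k x (Kn n \<otimes>\<^bsub>U\<^esub> x') (y \<otimes>\<^bsub>U\<^esub> y')"]) ((intro lin)?; simp)+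
  also have "\<dots> = (\<Sum>j\<in>J. \<Sum>i\<in>J. k (Rx D j) (Kb (Rdx D j) \<otimes>\<^bsub>U\<^esub> Rx D i) (Ry D j \<otimes>\<^bsub>U\<^esub> Ry D i))"
    by (intro sum.cong refl) (simp add: Rdy_J Bdual_uminus)
  finally show ?thesis .
qed

lemma hexagon_right:
  assumes k: "tf k"
  shows "(\<Sum>i\<in>J. sw (\<lambda>a b. k (Rx D i) a b) (Ry D i))
      = (\<Sum>j\<in>J. \<Sum>i\<in>J. k (Rx D j \<otimes>\<^bsub>U\<^esub> Rx D i) (Kn (Rdx D j) \<otimes>\<^bsub>U\<^esub> Ry D i) (Ry D j))"
proof -
  let ?T = "U \<otimes>\<^sub>A U" let ?T3 = "U \<otimes>\<^sub>A ?T"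
  note [lin] = tform_lform[OF k]
  let ?k = "\<lambda>x t. tev (\<lambda>y z. k x y z) t"
  have kz: "bf (\<lambda>y z. k x y z)" if "x \<in> carrier U" for x using that by ((intro lin)?; simp)
  have K: "bform U ?T ?k"
    by (intro bformI UU.lform_tev kz UU.lform_tev_param) ((intro lin)?; simp)+
  let ?A = "\<lambda>j. ptens U ?T (Rx D j) (ptens U U (inv\<^bsub>U\<^esub> (Bel D (Rdx D j))) (Ry D j))"
  let ?B = "\<lambda>i. ptens U ?T (Rx D i) (ptens U U (Ry D i) \<one>\<^bsub>U\<^esub>)"
  have Bc: "inv\<^bsub>U\<^esub> (Bel D (Rdx D j)) \<in> carrier U" if "j < nR D" for j
    using that by (simp add: inv_Bel)
  have Ac: "?A j \<in> carrier ?T3" if "j < nR D" for j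
    using that Bc by (intro UTU.ptens_closed UU.ptens_closed) simp_all
  have Bc': "?B j \<in> carrier ?T3" if "j < nR D" for j
    using that by (intro UTU.ptens_closed UU.ptens_closed) simp_all
  have ax: "tens_map U ?T (\<lambda>x. x) (cop D) (Rcheck D)
    = (\<Oplus>\<^bsub>?T3\<^esub> j\<in>{..<nR D}. ?A j) \<otimes>\<^bsub>?T3\<^esub> (\<Oplus>\<^bsub>?T3\<^esub> i\<in>{..<nR D}. ?B i)"
    using ax2 unfolding axiom2_def Let_def by (elim conjE)
  have "(\<Sum>i\<in>J. sw (\<lambda>a b. k (Rx D i) a b) (Ry D i)) = (\<Sum>i<nR D. sw (\<lambda>a b. k (Rx D i) a b) (Ry D i))"
    by (rule sum_J'[of "\<lambda>x y. sw (\<lambda>a b. k x a b) y", symmetric]) ((intro lin)?; simp)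
  also have "\<dots> = tev (\<lambda>x y. ?k x (cop D y)) (Rcheck D)"
    by (rule tev_Rcheck[symmetric]) ((intro lin)?; simp)
  also have "\<dots> = tev ?k (tens_map U ?T (\<lambda>x. x) (cop D) (Rcheck D))"
    by (rule UU.tev_tens_map[OF UTU.two_spaces_axioms K, symmetric]) simp_all
  also have "\<dots> = (\<Sum>j<nR D. \<Sum>i<nR D. k (Rx D j \<otimes>\<^bsub>U\<^esub> Rx D i) (inv\<^bsub>U\<^esub> (Bel D (Rdx D j)) \<otimes>\<^bsub>U\<^esub> Ry D i) (Ry D j))"
  proof -
    have "tev ?k (?A j \<otimes>\<^bsub>?T3\<^esub> ?B i) = k (Rx D j \<otimes>\<^bsub>U\<^esub> Rx D i) (inv\<^bsub>U\<^esub> (Bel D (Rdx D j)) \<otimes>\<^bsub>U\<^esub> Ry D i) (Ry D j)"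
      if j: "j < nR D" and i: "i < nR D" for i j
    proof -
      note Pj = UU.ptens_closed[OF Bc[OF j] Ry_carrier[OF j]]
      have "tev ?k (?A j \<otimes>\<^bsub>?T3\<^esub> ?B i)
        = ?k (Rx D j \<otimes>\<^bsub>U\<^esub> Rx D i) (ptens U U (inv\<^bsub>U\<^esub> (Bel D (Rdx D j))) (Ry D j) \<otimes>\<^bsub>?T\<^esub> ptens U U (Ry D i) \<one>\<^bsub>U\<^esub>)"
        using UTU.tev_mult[OF K, of "?A j" "?B i"] UTU.tev_ptens[OF UTU.bform_tev_mult(1)[OF K Bc'[OF i]]]
          UTU.tev_ptens[OF UTU.bform_mult(1)[OF K Rx_carrier[OF j] Pj]] by simp
      also have "\<dots> = k (Rx D j \<otimes>\<^bsub>U\<^esub> Rx D i) (inv\<^bsub>U\<^esub> (Bel D (Rdx D j)) \<otimes>\<^bsub>U\<^esub> Ry D i) (Ry D j)"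
      proof -
        have z: "Rx D j \<otimes>\<^bsub>U\<^esub> Rx D i \<in> carrier U" using i j by simp
        have P: "ptens U U (Ry D i) \<one>\<^bsub>U\<^esub> \<in> carrier ?T" using i by (intro UU.ptens_closed) simp_all
        show ?thesis
          using UU.tev_mult[OF kz[OF z]] UU.tev_ptens[OF UU.bform_tev_mult(1)[OF kz[OF z] P]]
            UU.tev_ptens[OF UU.bform_mult(1)[OF kz[OF z] Bc[OF j] Ry_carrier[OF j]]] j by simp
      qed
      finally show ?thesis .
    qed
    moreover have "tev ?k ((\<Oplus>\<^bsub>?T3\<^esub> j\<in>{..<nR D}. ?A j) \<otimes>\<^bsub>?T3\<^esub> (\<Oplus>\<^bsub>?T3\<^esub> i\<in>{..<nR D}. ?B i))
      = (\<Sum>j<nR D. \<Sum>i<nR D. tev ?k (?A j \<otimes>\<^bsub>?T3\<^esub> ?B i))"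
      by (rule UTU.tev_finsum_mult[OF K]) (use Ac Bc' in auto)
    ultimately show ?thesis unfolding ax by simp
  qed
  also have "\<dots> = (\<Sum>j<nR D. \<Sum>i<nR D. k (Rx D j \<otimes>\<^bsub>U\<^esub> Rx D i) (Kn (Rdx D j) \<otimes>\<^bsub>U\<^esub> Ry D i) (Ry D j))"
    by (intro sum.cong refl) (simp add: inv_Bel)
  also have "\<dots> = (\<Sum>j\<in>J. \<Sum>i\<in>J. k (Rx D j \<otimes>\<^bsub>U\<^esub> Rx D i) (Kn (Rdx D j) \<otimes>\<^bsub>U\<^esub> Ry D i) (Ry D j))"
    by (rule sum_J2[of "\<lambda>m n x y x' y'. k (x \<otimes>\<^bsub>U\<^esub> x') (Kn m \<otimes>\<^bsub>U\<^esub> y') y"]) ((intro lin)?; simp)+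
  finally show ?thesis .
qed

sublocale twisted_R "Ualg D" "cop D" "cou D" "ant D" "piv D" "rnk D" "ell D" "Wsp D" "Wdeg D" "Kel D"
  "Bdual D" J "Rx D" "Ry D" "Rdx D" Ri
proof unfold_locales
  show "Rdx D i \<in> Lam D" "Rx D i \<in> Udg (Rdx D i)" "Ry D i \<in> Udg (- Rdx D i)" if "i \<in> J" for i
    using J_less[OF that] Rdy_J[OF that] Rx_Udg Ry_Udg[of i] by auto
  show "(\<Sum>i\<in>J. tev (\<lambda>p q. h (Rx D i \<otimes>\<^bsub>U\<^esub> p) (Ry D i \<otimes>\<^bsub>U\<^esub> q)) Ri) = h \<one>\<^bsub>U\<^esub> \<one>\<^bsub>U\<^esub>" if "bf h" for h
    using Rcheck_Ri(1)[OF that] sum_J'[OF UU.bform_tev_mult(1)[OF that Ri_carrier]] by simp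
  show "(\<Sum>i\<in>J. tev (\<lambda>p q. h (p \<otimes>\<^bsub>U\<^esub> Rx D i) (q \<otimes>\<^bsub>U\<^esub> Ry D i)) Ri) = h \<one>\<^bsub>U\<^esub> \<one>\<^bsub>U\<^esub>" if "bf h" for h
    using Rcheck_Ri(2)[OF that] sum_J'[OF UU.bform_tev_mult(2)[OF that Ri_carrier]] by simp
  show "(\<Sum>i\<in>J. f (Ry D i \<otimes>\<^bsub>U\<^esub> piv D \<otimes>\<^bsub>U\<^esub> Rx D i \<otimes>\<^bsub>U\<^esub> Kb (Rdx D i)))
      = (\<Sum>i\<in>J. f (Rx D i \<otimes>\<^bsub>U\<^esub> gi \<otimes>\<^bsub>U\<^esub> Ry D i \<otimes>\<^bsub>U\<^esub> Kn (Rdx D i)))" if f: "lf f" for f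
  proof -
    note [lin] = lform_lmap[OF f]
    have ax: "(\<Oplus>\<^bsub>U\<^esub> i\<in>{..<nR D}. Ry D i \<otimes>\<^bsub>U\<^esub> piv D \<otimes>\<^bsub>U\<^esub> Rx D i \<otimes>\<^bsub>U\<^esub> Bel D (Rdx D i)) =
      (\<Oplus>\<^bsub>U\<^esub> i\<in>{..<nR D}. Rx D i \<otimes>\<^bsub>U\<^esub> gi \<otimes>\<^bsub>U\<^esub> Ry D i \<otimes>\<^bsub>U\<^esub> inv\<^bsub>U\<^esub> (Bel D (Rdx D i)))"
      using ax2 unfolding axiom2_def by (elim conjE)
    have "(\<Sum>i<nR D. f (Ry D i \<otimes>\<^bsub>U\<^esub> piv D \<otimes>\<^bsub>U\<^esub> Rx D i \<otimes>\<^bsub>U\<^esub> Kb (Rdx D i)))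
      = f (\<Oplus>\<^bsub>U\<^esub> i\<in>{..<nR D}. Ry D i \<otimes>\<^bsub>U\<^esub> piv D \<otimes>\<^bsub>U\<^esub> Rx D i \<otimes>\<^bsub>U\<^esub> Bel D (Rdx D i))"
      by (subst lform_finsum[OF cspace f]) (auto simp: Bel_def)
    also have "\<dots> = (\<Sum>i<nR D. f (Rx D i \<otimes>\<^bsub>U\<^esub> gi \<otimes>\<^bsub>U\<^esub> Ry D i \<otimes>\<^bsub>U\<^esub> Kn (Rdx D i)))"
      unfolding ax by (subst lform_finsum[OF cspace f]) (auto simp: inv_Bel)
    finally have all: "(\<Sum>i<nR D. f (Ry D i \<otimes>\<^bsub>U\<^esub> piv D \<otimes>\<^bsub>U\<^esub> Rx D i \<otimes>\<^bsub>U\<^esub> Kb (Rdx D i)))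
      = (\<Sum>i<nR D. f (Rx D i \<otimes>\<^bsub>U\<^esub> gi \<otimes>\<^bsub>U\<^esub> Ry D i \<otimes>\<^bsub>U\<^esub> Kn (Rdx D i)))" .
    have "(\<Sum>i<nR D. f (Ry D i \<otimes>\<^bsub>U\<^esub> piv D \<otimes>\<^bsub>U\<^esub> Rx D i \<otimes>\<^bsub>U\<^esub> Kb (Rdx D i)))
      = (\<Sum>i\<in>J. f (Ry D i \<otimes>\<^bsub>U\<^esub> piv D \<otimes>\<^bsub>U\<^esub> Rx D i \<otimes>\<^bsub>U\<^esub> Kb (Rdx D i)))"
      by (rule sum_J[of "\<lambda>m n x y. f (y \<otimes>\<^bsub>U\<^esub> piv D \<otimes>\<^bsub>U\<^esub> x \<otimes>\<^bsub>U\<^esub> Kb m)"]) ((intro lin)?; simp)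
    moreover have "(\<Sum>i<nR D. f (Rx D i \<otimes>\<^bsub>U\<^esub> gi \<otimes>\<^bsub>U\<^esub> Ry D i \<otimes>\<^bsub>U\<^esub> Kn (Rdx D i)))
      = (\<Sum>i\<in>J. f (Rx D i \<otimes>\<^bsub>U\<^esub> gi \<otimes>\<^bsub>U\<^esub> Ry D i \<otimes>\<^bsub>U\<^esub> Kn (Rdx D i)))"
      by (rule sum_J[of "\<lambda>m n x y. f (x \<otimes>\<^bsub>U\<^esub> gi \<otimes>\<^bsub>U\<^esub> y \<otimes>\<^bsub>U\<^esub> Kn m)"]) ((intro lin)?; simp)
    ultimately show ?thesis using all by simp
  qed
qed (rule Bdual_lat Bdual_add Bdual_sym J_finite Ri_carrier hexagon_left hexagon_right; assumption?)+

end

section \<open>Quotients by ideals and descent of forms\<close>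

section \<open>Quotient algebras\<close>

locale alg_quotient = calgebra U for U :: "'u calg" (structure) +
  fixes N :: "'u set"
  assumes N: "ideal N U"
begin

sublocale N: ideal N U by (rule N)

abbreviation "Q \<equiv> quot_alg U N"
abbreviation "pr x \<equiv> N +> x"

lemma pr_eq_iff: "x \<in> carrier U \<Longrightarrow> y \<in> carrier U \<Longrightarrow> pr x = pr y \<longleftrightarrow> x \<ominus> y \<in> N"
  by (rule quotient_eq_iff_same_a_r_cos[OF N, symmetric])

lemma quot_simps: "carrier Q = a_rcosets N" "\<one>\<^bsub>Q\<^esub> = pr \<one>" "\<zero>\<^bsub>Q\<^esub> = N" "X \<oplus>\<^bsub>Q\<^esub> Y = X <+> Y"
  "X \<otimes>\<^bsub>Q\<^esub> Y = rcoset_mult U N X Y" "c \<odot>\<^bsub>Q\<^esub> X = pr (c \<odot> rep X)"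
  by (simp_all add: quot_alg_def ring.defs module.defs FactRing_def)

lemma pr_closed [simp]: "x \<in> carrier U \<Longrightarrow> pr x \<in> carrier Q"
  by (simp add: quot_simps a_rcosetsI[OF N.a_subset])

lemma pr_cases: assumes "X \<in> carrier Q" obtains x where "x \<in> carrier U" "X = pr x"
  using assms by (auto simp: quot_simps A_RCOSETS_def' )

lemma pr_add: "x \<in> carrier U \<Longrightarrow> y \<in> carrier U \<Longrightarrow> pr x \<oplus>\<^bsub>Q\<^esub> pr y = pr (x \<oplus> y)"
  and pr_mult: "x \<in> carrier U \<Longrightarrow> y \<in> carrier U \<Longrightarrow> pr x \<otimes>\<^bsub>Q\<^esub> pr y = pr (x \<otimes> y)"
  by (simp_all add: quot_simps N.a_rcos_sum N.rcoset_mult_add)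

lemma pr_zero: "\<zero>\<^bsub>Q\<^esub> = pr \<zero>" and pr_one: "\<one>\<^bsub>Q\<^esub> = pr \<one>"
  using a_coset_add_zero[OF N.a_subset] by (simp_all add: quot_simps)

lemma rep_pr: assumes x: "x \<in> carrier U" shows "rep (pr x) \<in> carrier U" "pr (rep (pr x)) = pr x"
proof -
  have r: "rep (pr x) \<in> pr x" unfolding rep_def by (rule someI, rule N.a_rcos_self[OF x])
  then show c: "rep (pr x) \<in> carrier U" using N.a_rcosets_carrier[OF a_rcosetsI[OF N.a_subset x]] by auto
  show "pr (rep (pr x)) = pr x"
    using a_repr_independence[OF r x N.a_subgroup] by simp
qed

lemma rep_closed: "X \<in> carrier Q \<Longrightarrow> rep X \<in> carrier U" and pr_rep [simp]: "X \<in> carrier Q \<Longrightarrow> pr (rep X) = X"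
  by (auto elim!: pr_cases simp: rep_pr)

lemma N_smult: "x \<in> N \<Longrightarrow> c \<odot> x \<in> N"
  using N.I_l_closed[of x "c \<odot> \<one>"] N.a_subset by (auto simp: smult_mult)

text \<open>Scalars act on a coset through its chosen representative; the choice is harmless because
  an ideal contains the products with c times 1.\<close>

lemma pr_smult: assumes x: "x \<in> carrier U" shows "c \<odot>\<^bsub>Q\<^esub> pr x = pr (c \<odot> x)"
proof -
  have "rep (pr x) \<ominus> x \<in> N" using rep_pr[OF x] x by (simp flip: pr_eq_iff)
  then have "c \<odot> (rep (pr x) \<ominus> x) \<in> N" by (rule N_smult)
  also have "c \<odot> (rep (pr x) \<ominus> x) = c \<odot> rep (pr x) \<ominus> c \<odot> x"
    using x rep_pr[OF x] by (simp add: a_minus_def V.smult_r_distr V.smult_r_minus)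
  finally show ?thesis using x rep_pr[OF x] by (simp add: quot_simps pr_eq_iff)
qed

lemma complex_algebra_quot: "complex_algebra Q"
proof -
  have g: "abelian_group Q"
  proof (rule abelian_groupI)
    show "\<exists>y\<in>carrier Q. y \<oplus>\<^bsub>Q\<^esub> X = \<zero>\<^bsub>Q\<^esub>" if "X \<in> carrier Q" for X
      using that
    proof (rule pr_cases)
      fix x assume "x \<in> carrier U" "X = pr x"
      then show ?thesis by (intro bexI[of _ "pr (\<ominus> x)"]) (simp_all add: pr_add pr_zero l_neg)
    qed
  qed (auto elim!: pr_cases simp: pr_add pr_zero a_ac)
  have "Group.monoid Q"
    by (rule Group.monoid.intro) (auto elim!: pr_cases simp: pr_mult pr_one m_assoc)
  then have r: "ring Q"
    by (intro ring.intro g ring_axioms.intro) (auto elim!: pr_cases simp: pr_add pr_mult l_distr r_distr)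
  have "Module.module class_ring Q"
    by (rule moduleI) (use g in \<open>auto elim!: pr_cases simp: pr_smult pr_add class_cring.cring_axioms
      V.smult_l_distr[simplified] V.smult_r_distr V.smult_assoc1[simplified] class_ring_simps\<close>)
  then have v: "vectorspace class_ring Q"
    by (intro vectorspace.intro class_field)
  show ?thesis unfolding complex_algebra_def using r v
    by (auto elim!: pr_cases simp: pr_smult pr_mult smult_mult mult_smult)
qed

sublocale Q: calgebra Q by unfold_locales (rule complex_algebra_quot)

lemma lmap_pr: "lmap U Q (\<lambda>x. pr x)"
  by (intro lmapI) (simp_all add: pr_add pr_smult)

lemma lmap_pr' [lin]: "lmap A U E \<Longrightarrow> lmap A Q (\<lambda>x. pr (E x))"
  by (rule lmap_comp[OF lmap_pr])

lemma pr_N: "x \<in> N \<Longrightarrow> pr x = \<zero>\<^bsub>Q\<^esub>"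
  using N.a_rcos_const[of x] by (simp add: quot_simps)

lemma form_pr:
  assumes "lform Q F" shows "lform U (\<lambda>x. F (pr x))" "x \<in> N \<Longrightarrow> F (pr x) = 0"
  using lform_lmap[OF assms lmap_pr] lform_zero[OF Q.cspace assms] by (simp_all add: pr_N)

lemma form_rep:
  assumes f: "lform U f" "\<And>x. x \<in> N \<Longrightarrow> f x = 0"
  shows "lform Q (\<lambda>X. f (rep X))" "x \<in> carrier U \<Longrightarrow> f (rep (pr x)) = f x"
proof -
  show e: "f (rep (pr x)) = f x" if x: "x \<in> carrier U" for x
  proof -
    have "rep (pr x) \<ominus> x \<in> N" using rep_pr[OF x] x by (simp flip: pr_eq_iff)
    then show ?thesis using f(2) lform_a_minus[OF cspace f(1)] rep_pr[OF x] x by fastforce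
  qed
  show "lform Q (\<lambda>X. f (rep X))"
    by (intro lformI) (auto elim!: pr_cases simp: pr_add pr_smult e lform_add[OF f(1)] lform_smult[OF f(1)])
qed

end

section \<open>From the data record to the abstract integral\<close>

section \<open>The G-coalgebra and its integral\<close>

context unrolled
begin

lemma quot_ideal_ideal: "ideal (quot_ideal D \<alpha>) U"
  unfolding quot_ideal_def by (rule genideal_ideal) auto

sublocale quo: alg_quotient "Ualg D" "quot_ideal D \<alpha>"
  rewrites "quot_alg (Ualg D) (quot_ideal D \<alpha>) = Uq D \<alpha>"
    and "\<And>x. quot_ideal D \<alpha> +>\<^bsub>Ualg D\<^esub> x = proj D \<alpha> x"
  for \<alpha>
  by (intro alg_quotient.intro calgebra_axioms alg_quotient_axioms.intro quot_ideal_ideal)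
    (simp_all add: Uq_def proj_def)

lemma rep_proj_closed [simp]: "x \<in> carrier U \<Longrightarrow> rep (proj D \<alpha> x) \<in> carrier U"
  by (rule quo.rep_pr)

abbreviation "gc \<equiv> gclass (rnk D)"

definition res :: "cvec \<Rightarrow> cvec" where
  "res v = Poly_Mapping.mapp (\<lambda>i c. if i < rnk D then c else 0) v"

lemma lookup_res: "Poly_Mapping.lookup (res v) i = (if i < rnk D then Poly_Mapping.lookup v i else 0)"
  by (simp add: res_def mapp.rep_eq when_def in_keys_iff)

lemma res_add: "res (v + w) = res v + res w" and res_zero: "res 0 = 0"
  by (rule poly_mapping_eqI; simp add: lookup_res lookup_add)+

lemma res_wspace: "res v \<in> wspace (rnk D)"
  by (auto simp: wspace_def in_keys_iff lookup_res split: if_splits)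

lemma res_id: "v \<in> wspace (rnk D) \<Longrightarrow> res v = v"
  by (rule poly_mapping_eqI) (auto simp: wspace_def in_keys_iff lookup_res)

lemma GG_res: "gc (res v) \<in> GG D"
  using res_wspace by (simp add: ggroup_def)

lemma GG_cases: assumes "\<alpha> \<in> GG D" obtains v where "v \<in> wspace (rnk D)" "\<alpha> = gc v" "res v = v"
  using assms res_id by (auto simp: ggroup_def)

lemma gplus_gc: "gplus (gc v) (gc w) = gc (v + w)"
proof
  show "gplus (gc v) (gc w) \<subseteq> gc (v + w)"
  proof
    fix x assume "x \<in> gplus (gc v) (gc w)"
    then obtain m n where "m \<in> Lam D" "n \<in> Lam D" "x = v + m + (w + n)" by (auto simp: gplus_def gclass_def)
    then show "x \<in> gc (v + w)"
      unfolding gclass_def by (auto intro!: exI[of _ "m + n"] simp: add_ac)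
  qed
  show "gc (v + w) \<subseteq> gplus (gc v) (gc w)"
  proof
    fix x assume "x \<in> gc (v + w)"
    then obtain m where m: "m \<in> Lam D" "x = v + (w + m)" by (auto simp: gclass_def add.assoc)
    moreover have "v \<in> gc v" unfolding gclass_def using lat_zero by force
    moreover have "w + m \<in> gc w" unfolding gclass_def using m(1) by blast
    ultimately show "x \<in> gplus (gc v) (gc w)" unfolding gplus_def by blast
  qed
qed

text \<open>The generators taken over the whole coset reduce to those at v: a lattice shift changes
  the exponent of \<xi> by a multiple of \<ell>, and pairings ignore the coordinates that
  \<open>res\<close> cuts off.\<close>

lemma quot_ideal_gc: "quot_ideal D (gc (res v)) = qideal v"
proof -
  have "xi (ell D) (of_nat (ell D) * pairing (rnk D) a (res v + m)) = chi v a" if "a \<in> Lam D" "m \<in> Lam D" for a m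
  proof -
    have "pairing (rnk D) a (res v) = pairing (rnk D) a v"
      by (simp add: pairing_def lookup_res)
    then show ?thesis
      using xi_int[OF pairing_lat[OF that] ell] by (simp add: pairing_add_right distrib_left xi_add chi_def)
  qed
  then have e: "xi (ell D) (of_nat (ell D) * pairing (rnk D) a w) = chi v a" if "a \<in> Lam D" "w \<in> gc (res v)" for a w
    using that by (auto simp: gclass_def)
  have r: "res v \<in> gc (res v)" unfolding gclass_def using lat_zero by force
  let ?G = "\<lambda>a c. Kl a \<ominus>\<^bsub>U\<^esub> c \<odot>\<^bsub>U\<^esub> \<one>\<^bsub>U\<^esub>"
  have "{?G a (xi (ell D) (of_nat (ell D) * pairing (rnk D) a w)) | a w. a \<in> Lam D \<and> w \<in> gc (res v)}
      = {?G a (chi v a) | a. a \<in> Lam D}" (is "?A = ?B")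
  proof
    show "?A \<subseteq> ?B" using e by auto
    show "?B \<subseteq> ?A"
    proof
      fix x assume "x \<in> ?B"
      then obtain a where a: "a \<in> Lam D" "x = ?G a (chi v a)" by blast
      then have "x = ?G a (xi (ell D) (of_nat (ell D) * pairing (rnk D) a (res v)))" using e[OF a(1) r] by simp
      then show "x \<in> ?A" using a(1) r by blast
    qed
  qed
  then show ?thesis by (simp add: quot_ideal_def qideal_def)
qed

lemma mf_proj: "lform (Uq D (gc (res v))) F \<Longrightarrow> mf v (\<lambda>x. F (proj D (gc (res v)) x))"
  using quo.form_pr[of "gc (res v)" F] by (simp add: mf_def quot_ideal_gc)

lemma mf_rep:
  assumes f: "mf v f"
  shows "lform (Uq D (gc (res v))) (\<lambda>X. f (rep X))" "x \<in> carrier U \<Longrightarrow> f (rep (proj D (gc (res v)) x)) = f x"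
  using quo.form_rep[of f "gc (res v)"] f by (auto simp: mf_def quot_ideal_gc)

lemma bmf_proj:
  assumes h: "bform (Uq D (gc (res v))) (Uq D (gc (res w))) h"
  shows "bmf v w (\<lambda>x y. h (proj D (gc (res v)) x) (proj D (gc (res w)) y))"
  by (intro bmfI mf_proj bform1[OF h] bform2[OF h]) simp_all

lemma two_quotients: "two_algebras (Uq D \<alpha>) (Uq D \<beta>)"
  by unfold_locales (rule quo.complex_algebra_quot)+

text \<open>\<open>copq\<close> takes the coproduct of an arbitrary representative. The pulled-back
  form vanishes on the ideal at v + w, so x itself may be used.\<close>

lemma copq_eval:
  assumes h: "bform (Uq D (gc (res v))) (Uq D (gc (res w))) h" and x: "x \<in> carrier U"
  shows "tev h (copq D (gc (res v)) (gc (res w)) (proj D (gc (res (v + w))) x))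
    = sw (\<lambda>p q. h (proj D (gc (res v)) p) (proj D (gc (res w)) q)) x"
proof -
  interpret Q: two_algebras "Uq D (gc (res v))" "Uq D (gc (res w))" by (rule two_quotients)
  let ?h = "\<lambda>p q. h (proj D (gc (res v)) p) (proj D (gc (res w)) q)"
  let ?x = "rep (proj D (gc (res (v + w))) x)"
  have "tev h (copq D (gc (res v)) (gc (res w)) (proj D (gc (res (v + w))) x)) = sw ?h ?x"
    unfolding copq_def
    by (rule UU.tev_tens_map[OF Q.two_spaces_axioms h]) (use x in simp_all)
  also have "\<dots> = sw ?h x"
    by (rule mf_rep(2)[OF mf_sw[OF bmf_proj[OF h] lmod_id[OF refl]] x])
  finally show ?thesis .
qed

lemma copq_closed:
  assumes x: "x \<in> carrier U"
  shows "copq D \<alpha> \<beta> (proj D \<gamma> x) \<in> carrier (Uq D \<alpha> \<otimes>\<^sub>A Uq D \<beta>)"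
proof -
  interpret Q: two_algebras "Uq D \<alpha>" "Uq D \<beta>" by (rule two_quotients)
  show ?thesis unfolding copq_def
    by (rule UU.tens_map_closed[OF Q.two_spaces_axioms]) (use x in simp_all)
qed

end

locale unrolled_integral = unrolled D for D :: "('u, 'v) unrolled_data" +
  fixes lam :: "cvec set \<Rightarrow> 'u set \<Rightarrow> complex" and \<Upsilon> :: "'u set"
  assumes unimodular: "axiom3 D \<Upsilon>" and integral: "right_G_integral D lam" and lam_unit: "lam (gzero D) \<Upsilon> = 1"
begin

text \<open>The forms are indexed by arbitrary vectors, truncated to their first \<open>rnk D\<close> coordinates, because
  the index type of \<open>gcoalgebra_integral\<close> has to be a group.\<close>

definition L where "L v u = lam (gc (res v)) (proj D (gc (res v)) u)"

lemma lform_lam: "\<alpha> \<in> GG D \<Longrightarrow> lform (Uq D \<alpha>) (lam \<alpha>)"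
  using integral by (intro clinear_lform) (simp add: right_G_integral_def)

lemma mf_lam: "mf v (L v)"
  unfolding L_def by (intro mf_proj lform_lam GG_res)

text \<open>The given identity holds between elements of a quotient. Testing it with the form that f
  induces there gives the scalar identity for L.\<close>

lemma lam_integral:
  assumes f: "mf w f" and x: "x \<in> carrier U"
  shows "sw (\<lambda>p q. L v p * f q) x = L (v + w) x * f \<one>\<^bsub>U\<^esub>"
proof -
  let ?a = "gc (res v)" and ?b = "gc (res w)" and ?c = "gc (res (v + w))"
  interpret Q: two_algebras "Uq D ?a" "Uq D ?b" by (rule two_quotients)
  note F = mf_rep[OF f]
  have lam: "lform (Uq D ?a) (lam ?a)" by (intro lform_lam GG_res)
  have gp: "gplus ?a ?b = ?c" by (simp add: gplus_gc res_add)
  have h: "bform (Uq D ?a) (Uq D ?b) (\<lambda>X Z. lam ?a X * f (rep Z))" by (rule bform_prod[OF lam F(1)])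
  have "sw (\<lambda>p q. L v p * f q) x = sw (\<lambda>p q. lam ?a (proj D ?a p) * f (rep (proj D ?b q))) x"
    by (intro UU.tev_cong cop_closed x) (simp add: L_def F(2))
  also have "\<dots> = tev (\<lambda>X Z. lam ?a X * f (rep Z)) (copq D ?a ?b (proj D ?c x))"
    by (rule copq_eval[OF h x, symmetric])
  also have "\<dots> = tev (\<lambda>X Z. f (rep (lam ?a X \<odot>\<^bsub>Uq D ?b\<^esub> Z))) (copq D ?a ?b (proj D ?c x))"
    by (intro Q.tev_cong copq_closed x) (simp add: lform_smult[OF F(1)])
  also have "\<dots> = f (rep (form_left (Uq D ?b) (lam ?a) (copq D ?a ?b (proj D ?c x))))"
    unfolding form_left_def
    by (rule Q.tens_lift_eval(1)[OF quo.Q.cspace F(1) copq_closed[OF x], symmetric]) simp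
  also have "form_left (Uq D ?b) (lam ?a) (copq D ?a ?b (proj D ?c x)) = L (v + w) x \<odot>\<^bsub>Uq D ?b\<^esub> \<one>\<^bsub>Uq D ?b\<^esub>"
    using integral GG_res[of v] GG_res[of w] x unfolding right_G_integral_def gp[symmetric] L_def by simp
  also have "f (rep \<dots>) = L (v + w) x * f \<one>\<^bsub>U\<^esub>"
    using lform_smult[OF F(1), of "\<one>\<^bsub>Uq D ?b\<^esub>"] F(2)[of "\<one>\<^bsub>U\<^esub>"] by (simp add: quo.pr_one)
  finally show ?thesis .
qed

definition Y where "Y = rep \<Upsilon>"

lemma Upsilon: "\<Upsilon> \<in> carrier (Uq D (gc (res 0)))" "proj D (gc (res 0)) Y = \<Upsilon>" "Y \<in> carrier U"
  "X \<in> carrier (Uq D (gc (res 0))) \<Longrightarrow> X \<otimes>\<^bsub>Uq D (gc (res 0))\<^esub> \<Upsilon> = cou D (rep X) \<odot>\<^bsub>Uq D (gc (res 0))\<^esub> \<Upsilon>"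
  "X \<in> carrier (Uq D (gc (res 0))) \<Longrightarrow> \<Upsilon> \<otimes>\<^bsub>Uq D (gc (res 0))\<^esub> X = cou D (rep X) \<odot>\<^bsub>Uq D (gc (res 0))\<^esub> \<Upsilon>"
  using unimodular by (auto simp: axiom3_def Let_def res_zero cou0_def Y_def intro: quo.rep_closed)

lemma Y_absorb:
  assumes f: "mf 0 f" and x: "x \<in> carrier U"
  shows "f (x \<otimes>\<^bsub>U\<^esub> Y) = cou D x * f Y" "f (Y \<otimes>\<^bsub>U\<^esub> x) = cou D x * f Y"
proof -
  note F = mf_rep[OF f] and e = mf_rep(2)[OF mf_counit x]
  show "f (x \<otimes>\<^bsub>U\<^esub> Y) = cou D x * f Y"
    using F(2)[of "x \<otimes>\<^bsub>U\<^esub> Y"] F(2)[of Y] Upsilon(4)[of "proj D (gc (res 0)) x"] lform_smult[OF F(1) Upsilon(1)] Upsilon(2,3) x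
    by (simp add: e flip: quo.pr_mult)
  show "f (Y \<otimes>\<^bsub>U\<^esub> x) = cou D x * f Y"
    using F(2)[of "Y \<otimes>\<^bsub>U\<^esub> x"] F(2)[of Y] Upsilon(5)[of "proj D (gc (res 0)) x"] lform_smult[OF F(1) Upsilon(1)] Upsilon(2,3) x
    by (simp add: e flip: quo.pr_mult)
qed

sublocale braided_integral "Ualg D" "cop D" "cou D" "ant D" "piv D" "rnk D" "ell D" "Wsp D" "Wdeg D" "Kel D"
  L Y "Bdual D" J "Rx D" "Ry D" "Rdx D" Ri
proof unfold_locales
  show "L 0 Y = 1" by (simp add: L_def Upsilon(2)) (simp add: res_zero lam_unit)
qed (rule mf_lam lam_integral Upsilon Y_absorb cross; assumption?)+

end

section \<open>Dual systems, the trace form and its nondegeneracy\<close>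

section \<open>Traces on finite dimensional algebras\<close>

context calgebra
begin

text \<open>The resolution u = sum of xf_i(u) x_i, stated against linear forms. The sum of
  xf_i(T(x_i)) is then the trace of T, and two dual systems give the same value.\<close>

definition dual_system :: "'i set \<Rightarrow> ('i \<Rightarrow> 'u) \<Rightarrow> ('i \<Rightarrow> 'u \<Rightarrow> complex) \<Rightarrow> bool" where
  "dual_system M x xf \<longleftrightarrow> (\<forall>i\<in>M. x i \<in> carrier U \<and> lform U (xf i)) \<and>
     (\<forall>f. \<forall>u\<in>carrier U. lform U f \<longrightarrow> (\<Sum>i\<in>M. xf i u * f (x i)) = f u)"

lemma dual_system_sum: "dual_system M x xf \<Longrightarrow> lform U f \<Longrightarrow> u \<in> carrier U \<Longrightarrow> (\<Sum>i\<in>M. xf i u * f (x i)) = f u"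
  and dual_systemD: "dual_system M x xf \<Longrightarrow> i \<in> M \<Longrightarrow> x i \<in> carrier U" "dual_system M x xf \<Longrightarrow> i \<in> M \<Longrightarrow> lform U (xf i)"
  by (auto simp: dual_system_def)

lemma dual_system_trace_eq:
  assumes x: "dual_system M x xf" and y: "dual_system N y yf" and T: "lmap U U T"
  shows "(\<Sum>i\<in>M. xf i (T (x i))) = (\<Sum>j\<in>N. yf j (T (y j)))"
proof -
  have "(\<Sum>i\<in>M. xf i (T (x i))) = (\<Sum>i\<in>M. \<Sum>j\<in>N. yf j (T (x i)) * xf i (y j))"
    by (intro sum.cong refl dual_system_sum[OF y, symmetric] dual_systemD[OF x] lmap_closed[OF T])
  also have "\<dots> = (\<Sum>j\<in>N. \<Sum>i\<in>M. xf i (y j) * yf j (T (x i)))"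
    by (subst sum.swap) (simp add: mult.commute)
  also have "\<dots> = (\<Sum>j\<in>N. yf j (T (y j)))"
    by (intro sum.cong refl dual_system_sum[OF x lform_lmap[OF dual_systemD(2)[OF y] T]] dual_systemD[OF y])
  finally show ?thesis .
qed

lemma dual_system_cyclic:
  assumes x: "dual_system M x xf" and S: "lmap U U E" and T: "lmap U U T"
  shows "(\<Sum>i\<in>M. xf i (E (T (x i)))) = (\<Sum>i\<in>M. xf i (T (E (x i))))"
proof -
  have "(\<Sum>i\<in>M. xf i (E (T (x i)))) = (\<Sum>i\<in>M. \<Sum>j\<in>M. xf j (T (x i)) * xf i (E (x j)))"
    by (intro sum.cong refl dual_system_sum[OF x lform_lmap[OF dual_systemD(2)[OF x] S], symmetric]
        dual_systemD[OF x] lmap_closed[OF T])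
  also have "\<dots> = (\<Sum>j\<in>M. \<Sum>i\<in>M. xf i (E (x j)) * xf j (T (x i)))"
    by (subst sum.swap) (simp add: mult.commute)
  also have "\<dots> = (\<Sum>j\<in>M. xf j (T (E (x j))))"
    by (intro sum.cong refl dual_system_sum[OF x lform_lmap[OF dual_systemD(2)[OF x] T]]
        dual_systemD[OF x] lmap_closed[OF S])
  finally show ?thesis .
qed

lemma lform_lincomb: "lform U f \<Longrightarrow> M \<subseteq> carrier U \<Longrightarrow> f (V.lincomb a M) = (\<Sum>b\<in>M. a b * f b)"
  unfolding V.lincomb_def
  by (subst lform_finsum[OF cspace]) (auto simp: lform_smult subset_iff intro!: sum.cong)

lemma lincomb_closed: "M \<subseteq> carrier U \<Longrightarrow> V.lincomb a M \<in> carrier U"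
  unfolding V.lincomb_def by (rule finsum_closed) auto

context
  fixes B assumes B: "finite B" "V.basis B"
begin

lemma basis_carrier: "B \<subseteq> carrier U"
  using B by (simp add: V.basis_def)

lemma coord_props:
  assumes "v \<in> carrier U"
  shows "V.lincomb (coord U B v) B = v"
    "\<And>c. V.lincomb c B = v \<Longrightarrow> b \<in> B \<Longrightarrow> coord U B v b = c b"
proof -
  have "\<exists>!a. a \<in> B \<rightarrow>\<^sub>E UNIV \<and> V.lincomb a B = v"
    using V.basis_criterion[OF B(1) basis_carrier] B(2) assms by (simp add: class_ring_simps)
  note 1 = theI'[OF this, folded coord_def] and 2 = the1_equality[OF this, folded coord_def]
  show "V.lincomb (coord U B v) B = v" using 1 by simp
  fix c assume c: "V.lincomb c B = v" and b: "b \<in> B"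
  have "V.lincomb (restrict c B) B = V.lincomb c B"
    unfolding V.lincomb_def using basis_carrier by (intro finsum_cong') (auto simp: subset_iff)
  then show "coord U B v b = c b" using 2[of "restrict c B"] c b by simp
qed

lemma lform_coord: "b \<in> B \<Longrightarrow> lform U (\<lambda>v. coord U B v b)"
proof (rule lformI)
  fix v w c assume b: "b \<in> B" and v: "v \<in> carrier U"
  have Bc: "x \<in> B \<Longrightarrow> x \<in> carrier U" for x using basis_carrier by auto
  have "V.lincomb (\<lambda>b. c * coord U B v b) B = c \<odot> V.lincomb (coord U B v) B"
    unfolding V.lincomb_def
    by (subst smult_finsum') (auto simp: Bc V.smult_assoc1[simplified class_ring_simps] intro!: finsum_cong')
  then show "coord U B (c \<odot> v) b = c * coord U B v b"
    using v by (intro coord_props(2)[OF _ _ b]) (simp_all add: coord_props(1))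
  assume w: "w \<in> carrier U"
  have "V.lincomb (\<lambda>b. coord U B v b + coord U B w b) B = V.lincomb (coord U B v) B \<oplus> V.lincomb (coord U B w) B"
  proof -
    have "(a + a') \<odot> x = a \<odot> x \<oplus> a' \<odot> x" if "x \<in> carrier U" for a a' x
      using V.smult_l_distr[of a a' x] that by (simp add: class_ring_simps)
    then have "V.lincomb (\<lambda>b. coord U B v b + coord U B w b) B = (\<Oplus>b\<in>B. coord U B v b \<odot> b \<oplus> coord U B w b \<odot> b)"
      unfolding V.lincomb_def by (intro finsum_cong') (auto simp: Bc)
    then show ?thesis unfolding V.lincomb_def using Bc by (simp add: finsum_addf Pi_iff)
  qed
  then show "coord U B (v \<oplus> w) b = coord U B v b + coord U B w b"
    using v w by (intro coord_props(2)[OF _ _ b]) (simp_all add: coord_props(1))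
qed

lemma dual_system_coord: "dual_system B (\<lambda>b. b) (\<lambda>b v. coord U B v b)"
  unfolding dual_system_def
proof (intro conjI ballI allI impI)
  fix f u assume u: "u \<in> carrier U" and f: "lform U f"
  show "(\<Sum>b\<in>B. coord U B u b * f b) = f u"
    using lform_lincomb[OF f basis_carrier, of "coord U B u"] by (simp add: coord_props(1) u)
qed (use basis_carrier lform_coord in auto)

end

end

locale finite_calgebra = calgebra +
  assumes fin: "V.fin_dim"
begin

definition base :: "'a set" where "base = (SOME B. finite B \<and> V.basis B)"

lemma base: "finite base" "V.basis base"
proof -
  have "finite base \<and> V.basis base" unfolding base_def by (rule someI_ex[OF V.finite_basis_exists[OF fin]])
  then show "finite base" "V.basis base" by auto
qed

lemmas base_dual = dual_system_coord[OF base]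

lemma lin_trace_base: "lin_trace U T = (\<Sum>b\<in>base. coord U base (T b) b)"
  by (simp add: lin_trace_def base_def Let_def)

lemma lin_trace_eq: "dual_system M x xf \<Longrightarrow> lmap U U T \<Longrightarrow> lin_trace U T = (\<Sum>i\<in>M. xf i (T (x i)))"
  unfolding lin_trace_base by (rule dual_system_trace_eq[OF base_dual])

lemma lin_trace_cong:
  assumes "\<And>x. x \<in> carrier U \<Longrightarrow> T x = T' x" shows "lin_trace U T = lin_trace U T'"
  unfolding lin_trace_base using basis_carrier[OF base] assms by (intro sum.cong) (auto simp: subset_iff)

definition tr :: "'a \<Rightarrow> complex" where "tr u = lin_trace U (\<lambda>y. u \<otimes> y)"

lemma tr_eq: "dual_system M x xf \<Longrightarrow> u \<in> carrier U \<Longrightarrow> tr u = (\<Sum>i\<in>M. xf i (u \<otimes> x i))"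
  unfolding tr_def by (intro lin_trace_eq lin)

lemma lform_tr: "lform U tr"
proof -
  have "lform U (\<lambda>u. \<Sum>b\<in>base. coord U base (u \<otimes> b) b)"
    using dual_systemD[OF base_dual]
    by (intro lform_sum) (auto intro!: lform_lmap[OF dual_systemD(2)[OF base_dual]] lin)
  then show ?thesis by (rule lform_cong[OF cspace]) (simp add: tr_eq[OF base_dual])
qed

lemma tr_commute:
  assumes c: "u \<in> carrier U" "v \<in> carrier U" shows "tr (u \<otimes> v) = tr (v \<otimes> u)"
proof -
  have "tr (u \<otimes> v) = (\<Sum>b\<in>base. coord U base (u \<otimes> (v \<otimes> b)) b)"
    using c dual_systemD(1)[OF base_dual] by (simp add: tr_eq[OF base_dual] m_assoc)
  also have "\<dots> = (\<Sum>b\<in>base. coord U base (v \<otimes> (u \<otimes> b)) b)"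
    by (rule dual_system_cyclic[OF base_dual]) (intro lin c)+
  also have "\<dots> = tr (v \<otimes> u)"
    using c dual_systemD(1)[OF base_dual] by (simp add: tr_eq[OF base_dual] m_assoc)
  finally show ?thesis .
qed

text \<open>A basis contained in \<open>eB \<union> (1 - e)B\<close> consists of eigenvectors of \<open>e\<close>, so the trace counts those
  with eigenvalue one.\<close>

lemma tr_idempotent:
  assumes e: "e \<in> carrier U" "e \<otimes> e = e" "e \<noteq> \<zero>" shows "tr e \<noteq> 0"
proof
  assume z: "tr e = 0"
  have bc: "b \<in> carrier U" if "b \<in> base" for b using basis_carrier[OF base] that by auto
  let ?G = "(\<lambda>b. e \<otimes> b) ` base \<union> (\<lambda>b. (\<one> \<ominus> e) \<otimes> b) ` base"
  have G: "finite ?G" "?G \<subseteq> carrier U" using base(1) bc e(1) by auto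
  have sub: "submodule class_ring (V.span ?G) U" by (rule V.span_is_submodule[OF G(2)])
  have "base \<subseteq> V.span ?G"
  proof
    fix b assume b: "b \<in> base"
    have "e \<otimes> b \<in> V.span ?G" "(\<one> \<ominus> e) \<otimes> b \<in> V.span ?G" using V.in_own_span[OF G(2)] b by blast+
    then have "e \<otimes> b \<oplus> (\<one> \<ominus> e) \<otimes> b \<in> V.span ?G" using submodule.m_closed[OF sub] by blast
    moreover have "e \<otimes> b \<oplus> (\<one> \<ominus> e) \<otimes> b = b"
      using bc[OF b] e(1) by (simp add: l_distr[symmetric] a_minus_def) (simp add: a_assoc[symmetric] a_comm r_neg l_neg a_ac)
    ultimately show "b \<in> V.span ?G" by simp
  qed
  from V.span_is_subset[OF this sub] have "V.span ?G = carrier U"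
    using base(2) V.span_is_subset2[OF G(2)] unfolding V.basis_def by auto
  then have "\<exists>\<beta>. \<beta> \<subseteq> ?G \<and> minimal \<beta> (\<lambda>S. S \<subseteq> carrier U \<and> V.gen_set S)"
    using G by (intro minimal_exists) auto
  then obtain \<beta> where \<beta>: "\<beta> \<subseteq> ?G" "minimal \<beta> (\<lambda>S. S \<subseteq> carrier U \<and> V.gen_set S)" by blast
  have B: "finite \<beta>" "V.basis \<beta>"
    using finite_subset[OF \<beta>(1) G(1)] V.min_gen_is_li[OF \<beta>(2)] \<beta>(2) by (auto simp: V.basis_def minimal_def)
  have \<beta>c: "x \<in> carrier U" if "x \<in> \<beta>" for x using basis_carrier[OF B] that by auto
  have ee: "e \<otimes> (\<one> \<ominus> e) = \<zero>" using e by (simp add: a_minus_def r_distr r_minus r_neg)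
  have ev: "e \<otimes> x = x \<or> e \<otimes> x = \<zero>" if x: "x \<in> \<beta>" for x
  proof -
    from x \<beta>(1) consider b where "b \<in> base" "x = e \<otimes> b" | b where "b \<in> base" "x = (\<one> \<ominus> e) \<otimes> b" by blast
    then show ?thesis
      by cases (use bc e ee in \<open>simp_all flip: m_assoc\<close>)
  qed
  note d = dual_system_coord[OF B]
  have diag: "coord U \<beta> x x = 1" if "x \<in> \<beta>" for x
  proof -
    have "V.lincomb (\<lambda>b. if b = x then 1 else 0) \<beta> = (\<Oplus>b\<in>\<beta>. if x = b then b else \<zero>)"
      unfolding V.lincomb_def by (intro finsum_cong') (auto simp: \<beta>c)
    also have "\<dots> = x" using finsum_singleton[OF that B(1), of "\<lambda>b. b"] \<beta>c by auto
    finally show ?thesis using coord_props(2)[OF B \<beta>c[OF that] _ that] by simp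
  qed
  have "tr e = (\<Sum>x\<in>\<beta>. if e \<otimes> x = x \<and> x \<noteq> \<zero> then 1 else 0)"
    unfolding tr_eq[OF d e(1)]
  proof (rule sum.cong[OF refl])
    fix x assume x: "x \<in> \<beta>"
    have "coord U \<beta> \<zero> x = 0" by (rule lform_zero[OF cspace lform_coord[OF B x]])
    then show "coord U \<beta> (e \<otimes> x) x = (if e \<otimes> x = x \<and> x \<noteq> \<zero> then 1 else 0)"
      using ev[OF x] diag[OF x] e(1) by auto
  qed
  also have "\<dots> = of_nat (card {x\<in>\<beta>. e \<otimes> x = x \<and> x \<noteq> \<zero>})"
    using B(1) by (simp add: sum.If_cases Int_def)
  finally have "{x\<in>\<beta>. e \<otimes> x = x \<and> x \<noteq> \<zero>} = {}" using z B(1) by simp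
  then have "e \<otimes> x = \<zero>" if "x \<in> \<beta>" for x using ev[OF that] that by auto
  moreover have "\<one> = V.lincomb (coord U \<beta> \<one>) \<beta>" by (simp add: coord_props(1)[OF B])
  ultimately have "e \<otimes> \<one> = \<zero>"
  proof -
    assume ez: "\<And>x. x \<in> \<beta> \<Longrightarrow> e \<otimes> x = \<zero>" and o: "\<one> = V.lincomb (coord U \<beta> \<one>) \<beta>"
    have "e \<otimes> V.lincomb (coord U \<beta> \<one>) \<beta> = (\<Oplus>x\<in>\<beta>. e \<otimes> (coord U \<beta> \<one> x \<odot> x))"
      unfolding V.lincomb_def by (rule finsum_rdistr[OF B(1) e(1)]) (auto simp: \<beta>c)
    also have "\<dots> = (\<Oplus>x\<in>\<beta>. \<zero>)"
      by (intro finsum_cong') (auto simp: \<beta>c e(1) mult_smult ez smult_zero')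
    finally show ?thesis using o by simp
  qed
  then show False using e by simp
qed

text \<open>The radical N of the trace form is a two-sided ideal. If n in N is nonzero, then for
  some simple summand L with idempotent e the left ideal N e is nonzero inside L, hence equal to L.
  So e lies in N and has trace 0, which \<open>tr_idempotent\<close> excludes.\<close>

theorem semisimple_tr_nondegenerate:
  assumes ss: "semisimple_algebra U" and n: "n \<in> carrier U" "\<And>y. y \<in> carrier U \<Longrightarrow> tr (n \<otimes> y) = 0"
  shows "n = \<zero>"
proof (rule ccontr)
  assume nz: "n \<noteq> \<zero>"
  obtain J where J: "\<And>L. L \<in> J \<Longrightarrow> simple_left_ideal U L" and ds: "direct_sum U U (carrier U) J (\<lambda>L. L) (\<lambda>L x. x)"
    using ss by (auto simp: semisimple_algebra_def)
  have li: "left_ideal U L" if "L \<in> J" for L using J[OF that] by (simp add: simple_left_ideal_def)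
  have sub: "linear_subset U L" if "L \<in> J" for L
  proof -
    interpret L: additive_subgroup L U using li[OF that] by (simp add: left_ideal_def)
    have "c \<odot> x \<in> L" if x: "x \<in> L" for c x
    proof -
      have xc: "x \<in> carrier U" using L.a_subset x by auto
      have "(c \<odot> \<one>) \<otimes> x \<in> L" using li[OF \<open>L \<in> J\<close>] x by (simp add: left_ideal_def)
      then show ?thesis using xc by (simp add: smult_mult)
    qed
    then show ?thesis using L.a_subset L.zero_closed L.a_closed by (simp add: linear_subset_def)
  qed
  interpret DS: direct_sum_decomposition U U "carrier U" J "\<lambda>L. L" "\<lambda>L x. x"
    by unfold_locales (auto simp: cspace ds sub linear_subset_carrier smult_finsum' smult_zero')
  \<comment> \<open>Projections to left ideals are left linear, hence right multiplications by the
    components of 1; these are the idempotents used below.\<close>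
  have comp_mult: "DS.comp L (x \<otimes> u) = x \<otimes> DS.comp L u"
    if L: "L \<in> J" and c: "x \<in> carrier U" "u \<in> carrier U" for L x u
  proof (rule DS.comp_unique[OF _ _ _ _ _ _ L])
    let ?F = "{L\<in>J. DS.comp L u \<noteq> \<zero>}"
    show "finite ?F" "?F \<subseteq> J" using DS.comp_props(2)[OF c(2)] by auto
    have cc: "DS.comp L u \<in> carrier U" if "L \<in> J" for L using DS.D_carrier[OF that DS.comp_in[OF c(2) that]] .
    have "x \<otimes> u = x \<otimes> (\<Oplus>L\<in>?F. DS.comp L u)" using DS.comp_props(3)[OF c(2)] by simp
    also have "\<dots> = (\<Oplus>L\<in>?F. x \<otimes> DS.comp L u)"
      by (rule finsum_rdistr) (use DS.comp_props(2)[OF c(2)] c cc in auto)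
    finally show "x \<otimes> u = (\<Oplus>L\<in>?F. x \<otimes> DS.comp L u)" .
    show "x \<otimes> DS.comp L u \<in> L" if "L \<in> J" for L
      using li[OF that] DS.comp_in[OF c(2) that] c(1) by (simp add: left_ideal_def)
  qed (use c in auto)
  let ?e = "\<lambda>L. DS.comp L \<one>"
  have eL: "?e L \<in> L" and ec: "?e L \<in> carrier U" if "L \<in> J" for L
    using DS.comp_in[of \<one>, OF _ that] DS.D_carrier[OF that] by auto
  have xe: "x \<otimes> ?e L = x" if L: "L \<in> J" and x: "x \<in> L" for L x
    using comp_mult[OF L DS.D_carrier[OF L x] one_closed] DS.comp_\<phi>[OF L x L] DS.D_carrier[OF L x] by simp
  obtain L where L: "L \<in> J" and ne: "n \<otimes> ?e L \<noteq> \<zero>"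
  proof (rule ccontr)
    assume "\<not> thesis"
    then have "DS.comp L n = \<zero>" if "L \<in> J" for L
      using that comp_mult[OF _ n(1) one_closed] n(1) \<open>\<And>L. L \<in> J \<Longrightarrow> n \<otimes> ?e L \<noteq> \<zero> \<Longrightarrow> thesis\<close> by fastforce
    then have "{L\<in>J. DS.comp L n \<noteq> \<zero>} = {}" by auto
    with DS.comp_props(3)[OF n(1)] have "n = \<zero>" by simp
    with nz show False ..
  qed
  define N where "N = {n \<in> carrier U. \<forall>y\<in>carrier U. tr (n \<otimes> y) = 0}"
  let ?N = "(\<lambda>m. m \<otimes> ?e L) ` N"
  have NL: "?N \<subseteq> L" using li[OF L] eL[OF L] by (auto simp: N_def left_ideal_def)
  have N_add: "m \<oplus> m' \<in> N" if "m \<in> N" "m' \<in> N" for m m'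
    using that lform_add[OF lform_tr] by (simp add: N_def l_distr)
  have N_minus: "\<ominus> m \<in> N" if "m \<in> N" for m
    using that lform_uminus[OF cspace lform_tr] by (simp add: N_def l_minus)
  have N_zero: "\<zero> \<in> N" using lform_zero[OF cspace lform_tr] by (simp add: N_def)
  have N_left: "a \<otimes> m \<in> N" if "m \<in> N" "a \<in> carrier U" for a m
  proof -
    have "tr (a \<otimes> m \<otimes> y) = 0" if "y \<in> carrier U" for y
      using that \<open>m \<in> N\<close> \<open>a \<in> carrier U\<close> tr_commute[of a "m \<otimes> y"] by (simp add: N_def m_assoc)
    then show ?thesis using that by (simp add: N_def)
  qed
  have N_right: "m \<otimes> a \<in> N" if "m \<in> N" "a \<in> carrier U" for a m
    using that by (simp add: N_def m_assoc)
  have "subgroup ?N (add_monoid U)"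
  proof (rule add.subgroupI)
    show "?N \<subseteq> carrier U" using ec[OF L] by (auto simp: N_def)
    show "?N \<noteq> {}" using N_zero by auto
    show "\<ominus> a \<in> ?N" if a: "a \<in> ?N" for a
    proof -
      obtain m where m: "m \<in> N" "a = m \<otimes> ?e L" using a by blast
      then have "\<ominus> a = (\<ominus> m) \<otimes> ?e L" using ec[OF L] by (simp add: N_def l_minus)
      then show ?thesis using N_minus[OF m(1)] by blast
    qed
    show "a \<oplus> b \<in> ?N" if ab: "a \<in> ?N" "b \<in> ?N" for a b
    proof -
      obtain m m' where m: "m \<in> N" "a = m \<otimes> ?e L" "m' \<in> N" "b = m' \<otimes> ?e L" using ab by blast
      then have "a \<oplus> b = (m \<oplus> m') \<otimes> ?e L" using ec[OF L] by (simp add: N_def l_distr)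
      then show ?thesis using N_add[OF m(1,3)] by blast
    qed
  qed
  then have "additive_subgroup ?N U" by (rule additive_subgroup.intro)
  moreover have "a \<otimes> x \<in> ?N" if ax: "a \<in> carrier U" "x \<in> ?N" for a x
  proof -
    obtain m where m: "m \<in> N" "x = m \<otimes> ?e L" using ax(2) by blast
    then have "a \<otimes> x = a \<otimes> m \<otimes> ?e L" using ec[OF L] ax(1) by (simp add: N_def m_assoc)
    then show ?thesis using N_left[OF m(1) ax(1)] by blast
  qed
  ultimately have "left_ideal U ?N" by (simp add: left_ideal_def)
  then have "?N = {\<zero>} \<or> ?N = L" using J[OF L] NL unfolding simple_left_ideal_def by blast
  moreover have "n \<otimes> ?e L \<in> ?N" using n by (auto simp: N_def)
  ultimately have "?N = L" using ne by blast
  with eL[OF L] have "?e L \<in> ?N" by (simp only:)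
  then obtain m where m: "?e L = m \<otimes> ?e L" "m \<in> N" by (rule imageE)
  have "?e L \<in> N" by (subst m(1)) (rule N_right[OF m(2) ec[OF L]])
  then have "tr (?e L \<otimes> \<one>) = 0" unfolding N_def by blast
  then have "tr (?e L) = 0" using ec[OF L] by simp
  moreover have "?e L \<noteq> \<zero>" using ne n by auto
  ultimately show False using tr_idempotent[OF ec[OF L] xe[OF L eL[OF L]]] by simp
qed

text \<open>By nondegeneracy z -> tr(z _) is injective, so it is onto the dual space by dimension.
  The dual space is modelled inside U: \<open>T z\<close> has the values of tr(z _) on the basis as
  coordinates, and \<open>T\<close> of the basis is again a basis.\<close>

theorem semisimple_tr_represents:
  assumes ss: "semisimple_algebra U" and f: "lform U f"
  obtains z where "z \<in> carrier U" "\<And>x. x \<in> carrier U \<Longrightarrow> f x = tr (z \<otimes> x)"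
proof -
  have bc: "b \<in> carrier U" if "b \<in> base" for b using basis_carrier[OF base] that by auto
  define T where "T z = V.lincomb (\<lambda>b. tr (z \<otimes> b)) base" for z
  have Tc: "T z \<in> carrier U" for z unfolding T_def by (rule lincomb_closed) (auto simp: bc)
  have cT: "coord U base (T z) b = tr (z \<otimes> b)" if "b \<in> base" for z b
    by (rule coord_props(2)[OF base Tc _ that]) (simp add: T_def)
  have z0: "z = \<zero>" if z: "z \<in> carrier U" and "\<And>b. b \<in> base \<Longrightarrow> tr (z \<otimes> b) = 0" for z
  proof (rule semisimple_tr_nondegenerate[OF ss z])
    fix y assume y: "y \<in> carrier U"
    have l: "lform U (\<lambda>y. tr (z \<otimes> y))" by (intro lform_lmap[OF lform_tr] lin z)
    show "tr (z \<otimes> y) = 0"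
      using dual_system_sum[OF base_dual l y] that by simp
  qed
  let ?z = "\<lambda>a. V.lincomb a base"
  have zc: "?z a \<in> carrier U" for a by (rule lincomb_closed) (auto simp: bc)
  have trz: "tr (?z a \<otimes> c) = (\<Sum>b\<in>base. a b * tr (b \<otimes> c))" if "c \<in> carrier U" for a c
    by (rule lform_lincomb[of "\<lambda>u. tr (u \<otimes> c)"]) (use that bc in \<open>auto intro!: lform_lmap[OF lform_tr] lin\<close>)
  have inj: "inj_on T base"
  proof (rule inj_onI)
    fix b c assume bcs: "b \<in> base" "c \<in> base" and eq: "T b = T c"
    have "b \<ominus> c = \<zero>"
    proof (rule z0)
      fix x assume x: "x \<in> base"
      have "tr (b \<otimes> x) = tr (c \<otimes> x)" using cT[OF x, of b] cT[OF x, of c] eq by simp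
      then show "tr ((b \<ominus> c) \<otimes> x) = 0"
        using bcs x bc by (simp add: a_minus_def l_distr l_minus lform_add[OF lform_tr] lform_uminus[OF cspace lform_tr])
    qed (use bcs bc in simp)
    then show "b = c" using bcs bc minus_equality[of b "\<ominus> c"] by (simp add: a_minus_def)
  qed
  have "V.lin_indpt (T ` base)"
  proof (rule V.finite_lin_indpt2)
    show "finite (T ` base)" "T ` base \<subseteq> carrier U" using base(1) Tc by auto
    fix a assume lc: "V.lincomb a (T ` base) = \<zero>"
    have "?z (\<lambda>b. a (T b)) = \<zero>"
    proof (rule z0[OF zc])
      fix c assume c: "c \<in> base"
      note lf = lform_coord[OF base c]
      have "tr (?z (\<lambda>b. a (T b)) \<otimes> c) = (\<Sum>b\<in>base. a (T b) * coord U base (T b) c)"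
        using trz[OF bc[OF c]] cT[OF c] by simp
      also have "\<dots> = (\<Sum>t\<in>T ` base. a t * coord U base t c)"
        by (simp add: sum.reindex[OF inj])
      also have "\<dots> = coord U base (V.lincomb a (T ` base)) c"
        by (rule lform_lincomb[OF lf, symmetric]) (use Tc in auto)
      also have "\<dots> = 0" unfolding lc by (rule lform_zero[OF cspace lf])
      finally show "tr (?z (\<lambda>b. a (T b)) \<otimes> c) = 0" .
    qed
    then have "a (T b) = coord U base \<zero> b" if "b \<in> base" for b
      using coord_props(2)[OF base zero_closed _ that] by simp
    then show "\<forall>v\<in>T ` base. a v = \<zero>\<^bsub>class_ring\<^esub>"
      using lform_zero[OF cspace lform_coord[OF base]] by (auto simp: class_ring_simps)
  qed
  then have "V.basis (T ` base)"
    using base(1) Tc V.dim_basis[OF base] card_image[OF inj]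
    by (intro V.dim_li_is_basis fin) auto
  then have B: "finite (T ` base)" "V.basis (T ` base)" using base(1) by auto
  let ?u = "?z f"
  have uc: "?u \<in> carrier U" by (rule zc)
  let ?z0 = "?z (\<lambda>b. coord U (T ` base) ?u (T b))"
  show thesis
  proof (rule that[OF zc[of "\<lambda>b. coord U (T ` base) ?u (T b)"]])
    have on_base: "f c = tr (?z0 \<otimes> c)" if c: "c \<in> base" for c
    proof -
      note lf = lform_coord[OF base c]
      have "f c = coord U base ?u c" by (rule coord_props(2)[OF base uc _ c, symmetric]) simp
      also have "\<dots> = coord U base (V.lincomb (coord U (T ` base) ?u) (T ` base)) c"
        by (simp add: coord_props(1)[OF B uc])
      also have "\<dots> = (\<Sum>t\<in>T ` base. coord U (T ` base) ?u t * coord U base t c)"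
        by (rule lform_lincomb[OF lf]) (use Tc in auto)
      also have "\<dots> = (\<Sum>b\<in>base. coord U (T ` base) ?u (T b) * tr (b \<otimes> c))"
        by (simp add: sum.reindex[OF inj] cT[OF c])
      also have "\<dots> = tr (?z0 \<otimes> c)" by (rule trz[OF bc[OF c], symmetric])
      finally show ?thesis .
    qed
    fix x assume x: "x \<in> carrier U"
    have l: "lform U (\<lambda>y. tr (?z0 \<otimes> y))" by (intro lform_lmap[OF lform_tr] lin zc)
    show "f x = tr (?z0 \<otimes> x)"
      using dual_system_sum[OF base_dual f x] dual_system_sum[OF base_dual l x] on_base by simp
  qed
qed

end

section \<open>Finitely many exponents suffice in each quotient\<close>

section \<open>Finite dimensionality of the quotients\<close>

lemma lmap_finsum:
  assumes A: "cspace A" and B: "cspace B" and E: "lmap A B E" and f: "f \<in> M \<rightarrow> carrier A" and M: "finite M"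
  shows "E (\<Oplus>\<^bsub>A\<^esub>k\<in>M. f k) = (\<Oplus>\<^bsub>B\<^esub>k\<in>M. E (f k))"
proof -
  interpret A: abelian_group A using A by (simp add: cspace_def)
  interpret B: abelian_group B using B by (simp add: cspace_def)
  have z: "E \<zero>\<^bsub>A\<^esub> = \<zero>\<^bsub>B\<^esub>"
    using lmap_add[OF E, of "\<zero>\<^bsub>A\<^esub>" "\<zero>\<^bsub>A\<^esub>"] lmap_closed[OF E] by (simp add: B.add.l_cancel_one')
  show ?thesis using M f
    by (induction M) (simp_all add: z lmap_add[OF E] lmap_closed[OF E] Pi_iff)
qed

lemma (in calgebra) span_finsum:
  assumes G: "G \<subseteq> carrier U" and f: "\<And>k. k \<in> M \<Longrightarrow> f k \<in> V.span G"
  shows "(\<Oplus>k\<in>M. f k) \<in> V.span G"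
proof -
  note sub = V.span_is_submodule[OF G]
  note c = subsetD[OF V.span_is_subset2[OF G]]
  have z: "\<zero> \<in> V.span G"
    using linear_subset_subspace[of "V.span G" U] sub
    by (simp add: VectorSpace.subspace_def V.vectorspace_axioms linear_subset_def)
  show ?thesis using f
    by (induction M rule: infinite_finite_induct) (auto simp: z Pi_iff c submodule.m_closed[OF sub])
qed

lemma finite_box: "finite {a \<in> lat r. \<forall>i. Poly_Mapping.lookup a i \<in> of_nat ` {..<l}}" (is "finite ?I")
proof (rule finite_subset)
  let ?F = "\<lambda>\<phi>. \<Sum>i<r. Poly_Mapping.single i (of_nat (\<phi> i) :: complex)"
  show "?I \<subseteq> ?F ` ({..<r} \<rightarrow>\<^sub>E {..<l})"
  proof
    fix a assume a: "a \<in> ?I"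
    then have "\<forall>i. \<exists>k<l. Poly_Mapping.lookup a i = of_nat k" by (auto simp: image_iff)
    then obtain \<phi> where \<phi>: "\<And>i. \<phi> i < l" "\<And>i. Poly_Mapping.lookup a i = of_nat (\<phi> i)" by metis
    have "a = ?F (restrict \<phi> {..<r})"
      using a by (intro poly_mapping_eqI) (auto simp: lookup_sum lookup_single when_def \<phi>(2)[symmetric] lat_def wspace_def in_keys_iff)
    moreover have "restrict \<phi> {..<r} \<in> {..<r} \<rightarrow>\<^sub>E {..<l}" using \<phi>(1) by auto
    ultimately show "a \<in> ?F ` ({..<r} \<rightarrow>\<^sub>E {..<l})" by blast
  qed
  show "finite (?F ` ({..<r} \<rightarrow>\<^sub>E {..<l}))" by (intro finite_imageI finite_PiE) auto
qed

text \<open>Division with remainder by l in every coordinate; the remainders lie in the set of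
  \<open>finite_box\<close>.\<close>

lemma lat_div_mod:
  assumes a: "a \<in> lat r" and l: "l \<ge> 1"
  obtains b c where "b \<in> lat r" "c \<in> lat r" "\<And>i. Poly_Mapping.lookup c i \<in> of_nat ` {..<l}" "a = fscale (of_nat l) b + c"
proof -
  have "\<forall>i. \<exists>k. Poly_Mapping.lookup a i = of_int k" using a by (auto simp: lat_def elim!: Ints_cases)
  then obtain k where k: "\<And>i. Poly_Mapping.lookup a i = of_int (k i)" by metis
  have k0: "k i = 0" if "\<not> i < r" for i
  proof -
    have "Poly_Mapping.lookup a i = 0" using a that by (auto simp: lat_def wspace_def in_keys_iff subset_iff)
    then show ?thesis using k[of i] by simp
  qed
  let ?s = "\<lambda>h. \<Sum>i<r. Poly_Mapping.single i (of_int (h i) :: complex)"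
  have ls: "Poly_Mapping.lookup (?s h) i = (if i < r then of_int (h i) else 0)" for h i
    by (simp add: lookup_sum lookup_single when_def)
  have sl: "?s h \<in> lat r" for h by (auto simp: lat_def wspace_def in_keys_iff ls split: if_splits)
  show thesis
  proof (rule that[OF sl sl])
    show "Poly_Mapping.lookup (?s (\<lambda>i. k i mod int l)) i \<in> of_nat ` {..<l}" for i
    proof -
      let ?n = "if i < r then nat (k i mod int l) else 0"
      have "?n < l" using l by (simp add: nat_less_iff)
      moreover have "Poly_Mapping.lookup (?s (\<lambda>i. k i mod int l)) i = of_nat ?n" using l by (simp add: ls of_nat_nat)
      ultimately show ?thesis by blast
    qed
    have "of_int (k i) = of_nat l * of_int (k i div int l) + (of_int (k i mod int l) :: complex)" for i
      by (metis mult_div_mod_eq of_int_add of_int_mult of_int_of_nat_eq)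
    then show "a = fscale (of_nat l) (?s (\<lambda>i. k i div int l)) + ?s (\<lambda>i. k i mod int l)"
      by (intro poly_mapping_eqI) (simp add: lookup_add fscale_def Poly_Mapping.map.rep_eq when_def ls k k0)
  qed
qed

lemma (in alg_quotient) fin_dim_quot:
  assumes F: "finite F" "F \<subseteq> carrier U" and I: "finite I" "\<And>a. a \<in> I \<Longrightarrow> K a \<in> carrier U"
    and gen: "\<And>u. u \<in> carrier U \<Longrightarrow> \<exists>M w c b. finite M \<and> (\<forall>a\<in>M. w a \<in> V.span F \<and> b a \<in> I) \<and>
      pr u = (\<Oplus>\<^bsub>Q\<^esub>a\<in>M. c a \<odot>\<^bsub>Q\<^esub> pr (w a \<otimes> K (b a)))"
  shows "Q.V.fin_dim"
proof -
  let ?G = "(\<lambda>(w, a). pr (w \<otimes> K a)) ` (F \<times> I)"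
  have Fc: "w \<in> carrier U" if "w \<in> F" for w using F(2) that by auto
  have G: "finite ?G" "?G \<subseteq> carrier Q" using F(1) I Fc by (auto intro!: finite_imageI)
  note sub = Q.V.span_is_submodule[OF G(2)]
  have sm: "c \<odot>\<^bsub>Q\<^esub> x \<in> Q.V.span ?G" if "x \<in> Q.V.span ?G" for c x
    using submodule.smult_closed[OF sub _ that] by (simp add: class_ring_simps)
  have box: "pr (w \<otimes> K a) \<in> Q.V.span ?G" if w: "w \<in> V.span F" and a: "a \<in> I" for w a
  proof -
    obtain c where c: "V.lincomb c F = w" using V.finite_in_span[OF F w] by blast
    have l: "lmap U Q (\<lambda>x. pr (x \<otimes> K a))" using a I(2) by (intro lin) simp
    have "pr (w \<otimes> K a) = (\<Oplus>\<^bsub>Q\<^esub>x\<in>F. pr ((c x \<odot> x) \<otimes> K a))"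
      unfolding c[symmetric] V.lincomb_def
      by (rule lmap_finsum[OF cspace Q.cspace l _ F(1)]) (use Fc in auto)
    also have "\<dots> = (\<Oplus>\<^bsub>Q\<^esub>x\<in>F. c x \<odot>\<^bsub>Q\<^esub> pr (x \<otimes> K a))"
      using Fc a I(2) by (intro Q.finsum_cong') (auto simp: lmap_smult[OF l])
    also have "\<dots> \<in> Q.V.span ?G"
      by (intro Q.span_finsum G(2) sm subsetD[OF Q.V.in_own_span[OF G(2)]]) (use a in blast)
    finally show ?thesis .
  qed
  have "carrier Q \<subseteq> Q.V.span ?G"
  proof
    fix X assume "X \<in> carrier Q"
    then obtain u where u: "u \<in> carrier U" "X = pr u" by (rule pr_cases)
    show "X \<in> Q.V.span ?G"
      using gen[OF u(1)]
    proof (elim exE conjE)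
      fix M w c b assume M: "\<forall>a\<in>M. w a \<in> V.span F \<and> b a \<in> I"
        and eq: "pr u = (\<Oplus>\<^bsub>Q\<^esub>a\<in>M. c a \<odot>\<^bsub>Q\<^esub> pr (w a \<otimes> K (b a)))"
      show ?thesis unfolding u(2) eq using M by (intro Q.span_finsum G(2) sm box) auto
    qed
  qed
  then show ?thesis
    unfolding Q.V.fin_dim_def using G Q.V.span_is_subset2[OF G(2)] by blast
qed

context unrolled
begin

lemma proj_Kl: "a \<in> Lam D \<Longrightarrow> proj D (gc (res v)) (Kl a) = chi v a \<odot>\<^bsub>Uq D (gc (res v))\<^esub> \<one>\<^bsub>Uq D (gc (res v))\<^esub>"
  using qideal_gen[of a v] quo.pr_eq_iff[of "Kl a" "chi v a \<odot>\<^bsub>U\<^esub> \<one>\<^bsub>U\<^esub>" "gc (res v)"]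
  by (simp add: quot_ideal_gc quo.pr_one quo.pr_smult)

text \<open>In the quotient the central part \<open>Kl b\<close> of K^a is a scalar, so a matters
  only modulo \<ell>. The classes of w K^a, with w from a finite spanning set of W and a from the
  box, therefore span.\<close>

lemma fin_dim_Uq: "vectorspace.fin_dim class_ring (Uq D (gc (res v)))"
proof -
  let ?\<alpha> = "gc (res v)" let ?A = "Uq D ?\<alpha>" and ?\<pi> = "proj D ?\<alpha>"
  obtain F where F: "finite F" "F \<subseteq> Wsp D" "cspan U F = Wsp D"
    using ax1 unfolding axiom1_def by blast
  let ?I = "{a \<in> Lam D. \<forall>i. Poly_Mapping.lookup a i \<in> of_nat ` {..<ell D}}"
  show ?thesis
  proof (rule quo.fin_dim_quot[OF F(1) _ finite_box[of "rnk D" "ell D"], where K = "Kel D"])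
    show "F \<subseteq> carrier U" using F(2) W_closed by auto
    fix u assume u: "u \<in> carrier U"
    let ?S = "{a\<in>Lam D. UD.comp a u \<noteq> \<zero>\<^bsub>U\<^esub>}"
    have S: "finite ?S" and us: "u = (\<Oplus>\<^bsub>U\<^esub>a\<in>?S. UD.comp a u \<otimes>\<^bsub>U\<^esub> Kel D a)"
      using UD.comp_props(2,3)[OF u] by auto
    have wW: "UD.comp a u \<in> Wsp D" if "a \<in> Lam D" for a by (rule UD.comp_in[OF u that])
    have c: "UD.comp a u \<otimes>\<^bsub>U\<^esub> Kel D b \<in> carrier U" if "a \<in> Lam D" "b \<in> Lam D" for a b
      using W_closed[OF wW[OF that(1)]] that(2) by simp
    have "\<exists>bc. fst bc \<in> Lam D \<and> snd bc \<in> ?I \<and> a = fscale (of_nat (ell D)) (fst bc) + snd bc" if "a \<in> Lam D" for a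
      by (rule lat_div_mod[OF that ell]) auto
    then have "\<exists>f. \<forall>a\<in>Lam D. fst (f a) \<in> Lam D \<and> snd (f a) \<in> ?I \<and> a = fscale (of_nat (ell D)) (fst (f a)) + snd (f a)"
      by (intro bchoice ballI)
    then obtain f where f: "\<And>a. a \<in> Lam D \<Longrightarrow> fst (f a) \<in> Lam D \<and> snd (f a) \<in> ?I \<and> a = fscale (of_nat (ell D)) (fst (f a)) + snd (f a)"
      by blast
    have gen: "?\<pi> (UD.comp a u \<otimes>\<^bsub>U\<^esub> Kel D a) = chi v (fst (f a)) \<odot>\<^bsub>?A\<^esub> ?\<pi> (UD.comp a u \<otimes>\<^bsub>U\<^esub> Kel D (snd (f a)))"
      if a: "a \<in> Lam D" for a
    proof -
      have bc: "fst (f a) \<in> Lam D" "snd (f a) \<in> Lam D" using f[OF a] by auto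
      have w: "UD.comp a u \<in> carrier U" by (rule W_closed[OF wW[OF a]])
      have "Kel D a = Kl (fst (f a)) \<otimes>\<^bsub>U\<^esub> Kel D (snd (f a))"
        using f[OF a] K_add[of "fscale (of_nat (ell D)) (fst (f a))" "snd (f a)"] bc by simp
      then have "?\<pi> (UD.comp a u \<otimes>\<^bsub>U\<^esub> Kel D a)
          = ?\<pi> (UD.comp a u) \<otimes>\<^bsub>?A\<^esub> (?\<pi> (Kl (fst (f a))) \<otimes>\<^bsub>?A\<^esub> ?\<pi> (Kel D (snd (f a))))"
        using bc w by (simp only: quo.pr_mult K_closed lat_fscale m_closed)
      also have "\<dots> = chi v (fst (f a)) \<odot>\<^bsub>?A\<^esub> ?\<pi> (UD.comp a u \<otimes>\<^bsub>U\<^esub> Kel D (snd (f a)))"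
        using bc w by (simp add: proj_Kl quo.Q.smult_mult quo.Q.mult_smult quo.pr_mult)
      finally show ?thesis .
    qed
    have "?\<pi> u = (\<Oplus>\<^bsub>?A\<^esub>a\<in>?S. ?\<pi> (UD.comp a u \<otimes>\<^bsub>U\<^esub> Kel D a))"
      by (subst us, rule lmap_finsum[OF cspace quo.Q.cspace quo.lmap_pr _ S]) (use c in auto)
    also have "\<dots> = (\<Oplus>\<^bsub>?A\<^esub>a\<in>?S. chi v (fst (f a)) \<odot>\<^bsub>?A\<^esub> ?\<pi> (UD.comp a u \<otimes>\<^bsub>U\<^esub> Kel D (snd (f a))))"
      using gen f c by (intro quo.Q.finsum_cong') auto
    finally have eq: "?\<pi> u = \<dots>" .
    show "\<exists>(M :: cvec set) w c b. finite M \<and> (\<forall>a\<in>M. w a \<in> cspan U F \<and> b a \<in> ?I) \<and>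
      ?\<pi> u = (\<Oplus>\<^bsub>?A\<^esub>a\<in>M. c a \<odot>\<^bsub>?A\<^esub> ?\<pi> (w a \<otimes>\<^bsub>U\<^esub> Kel D (b a)))"
      by (rule exI[of _ ?S], rule exI[of _ "\<lambda>a. UD.comp a u"], rule exI[of _ "\<lambda>a. chi v (fst (f a))"],
          rule exI[of _ "\<lambda>a. snd (f a)"]) (use S eq f wW F(3) in simp)
  qed simp
qed

end

section \<open>Central elements representing the integral, and the final identity\<close>

section \<open>The modified integral\<close>

lemma (in two_spaces) tev_keys:
  assumes h: "bform A B h" and t: "t \<in> carrier (A \<otimes>\<^sub>A B)"
  shows "tev h t = (\<Sum>k\<in>Poly_Mapping.keys (rep t). h (Poly_Mapping.lookup (rep t) k \<odot>\<^bsub>A\<^esub> fst k) (snd k))"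
proof -
  have "fst k \<in> carrier A \<and> snd k \<in> carrier B" if "k \<in> Poly_Mapping.keys (rep t)" for k
    using rep_formals[OF t] that by auto
  then show ?thesis unfolding tev_def fev_def
    using lform_smult[OF bform1[OF h]] by (intro sum.cong) auto
qed

context unrolled_integral
begin

abbreviation "\<mu> \<equiv> symm_integral D lam"

lemma mu_eq: "x \<in> carrier U \<Longrightarrow> mu v x = \<mu> (gc (res v)) (proj D (gc (res v)) x)"
  by (simp add: mu_def L_def symm_integral_def pivq_def quo.pr_mult)

lemma pivq_closed [simp]: "pivq D \<alpha> \<in> carrier (Uq D \<alpha>)"
  by (simp add: pivq_def)

lemma inv_pivq: "inv\<^bsub>Uq D \<alpha>\<^esub> (pivq D \<alpha>) = proj D \<alpha> gi"
  by (rule quo.Q.inv_char) (simp_all add: pivq_def quo.pr_mult quo.pr_one)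

lemma lform_symm: "\<alpha> \<in> GG D \<Longrightarrow> lform (Uq D \<alpha>) (\<mu> \<alpha>)"
  unfolding symm_integral_def by (intro lform_lmap[OF lform_lam] quo.Q.lmap_mult_left lmap_id pivq_closed)

lemma symm_commute:
  assumes X: "X \<in> carrier (Uq D (gc (res v)))" and Z: "Z \<in> carrier (Uq D (gc (res v)))"
  shows "\<mu> (gc (res v)) (X \<otimes>\<^bsub>Uq D (gc (res v))\<^esub> Z) = \<mu> (gc (res v)) (Z \<otimes>\<^bsub>Uq D (gc (res v))\<^esub> X)"
proof -
  obtain x where x: "x \<in> carrier U" "X = proj D (gc (res v)) x" using X by (rule quo.pr_cases)
  obtain z where z: "z \<in> carrier U" "Z = proj D (gc (res v)) z" using Z by (rule quo.pr_cases)
  show ?thesis using mu_commute[of x z v] x z by (simp add: mu_eq quo.pr_mult)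
qed

lemma finite_Uq: "finite_calgebra (Uq D (gc (res v)))"
  by (intro finite_calgebra.intro quo.Q.calgebra_axioms finite_calgebra_axioms.intro fin_dim_Uq)

text \<open>Centrality follows since both the integral and the trace are symmetric: z x and x z pair
  equally with every y under the trace form, which is nondegenerate.\<close>

lemma trace_element:
  assumes ss: "semisimple_algebra (Uq D (gc (res v)))"
  shows "\<exists>z. z \<in> alg_center (Uq D (gc (res v))) \<and>
    (\<forall>x\<in>carrier (Uq D (gc (res v))). \<mu> (gc (res v)) x = finite_calgebra.tr (Uq D (gc (res v))) (z \<otimes>\<^bsub>Uq D (gc (res v))\<^esub> x))"
proof -
  let ?A = "Uq D (gc (res v))" and ?\<mu> = "\<mu> (gc (res v))"
  note fA = finite_Uq[of v] and cA = quo.Q.m_closed[of _ "gc (res v)"]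
  let ?tr = "finite_calgebra.tr ?A"
  obtain z where z: "z \<in> carrier ?A" "\<And>x. x \<in> carrier ?A \<Longrightarrow> ?\<mu> x = ?tr (z \<otimes>\<^bsub>?A\<^esub> x)"
    by (rule finite_calgebra.semisimple_tr_represents[OF fA ss lform_symm[OF GG_res]]) (rule that)
  have "z \<otimes>\<^bsub>?A\<^esub> x = x \<otimes>\<^bsub>?A\<^esub> z" if x: "x \<in> carrier ?A" for x
  proof -
    let ?n = "z \<otimes>\<^bsub>?A\<^esub> x \<ominus>\<^bsub>?A\<^esub> x \<otimes>\<^bsub>?A\<^esub> z"
    have "?n = \<zero>\<^bsub>?A\<^esub>"
    proof (rule finite_calgebra.semisimple_tr_nondegenerate[OF fA ss])
      show "?n \<in> carrier ?A" using z x by simp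
      fix y assume y: "y \<in> carrier ?A"
      have "?tr (z \<otimes>\<^bsub>?A\<^esub> x \<otimes>\<^bsub>?A\<^esub> y) = ?tr (z \<otimes>\<^bsub>?A\<^esub> (x \<otimes>\<^bsub>?A\<^esub> y))"
        using z x y by (simp add: quo.Q.m_assoc)
      also have "\<dots> = ?tr (z \<otimes>\<^bsub>?A\<^esub> (y \<otimes>\<^bsub>?A\<^esub> x))"
        using z(2)[of "x \<otimes>\<^bsub>?A\<^esub> y"] z(2)[of "y \<otimes>\<^bsub>?A\<^esub> x"] symm_commute[OF x y] x y by simp
      also have "\<dots> = ?tr (x \<otimes>\<^bsub>?A\<^esub> (z \<otimes>\<^bsub>?A\<^esub> y))"
        using finite_calgebra.tr_commute[OF fA, of "z \<otimes>\<^bsub>?A\<^esub> y" x] z x y by (simp add: quo.Q.m_assoc)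
      finally have e: "?tr (z \<otimes>\<^bsub>?A\<^esub> x \<otimes>\<^bsub>?A\<^esub> y) = ?tr (x \<otimes>\<^bsub>?A\<^esub> z \<otimes>\<^bsub>?A\<^esub> y)"
        using z x y by (simp add: quo.Q.m_assoc)
      have "lform ?A (\<lambda>u. ?tr (u \<otimes>\<^bsub>?A\<^esub> y))"
        by (intro lform_lmap[OF finite_calgebra.lform_tr[OF fA]] quo.Q.lmap_mult_right lmap_id y)
      from lform_a_minus[OF quo.Q.cspace this, of "z \<otimes>\<^bsub>?A\<^esub> x" "x \<otimes>\<^bsub>?A\<^esub> z"]
      show "?tr (?n \<otimes>\<^bsub>?A\<^esub> y) = 0" using e z x by simp
    qed
    then have "\<ominus>\<^bsub>?A\<^esub> (\<ominus>\<^bsub>?A\<^esub> (x \<otimes>\<^bsub>?A\<^esub> z)) = z \<otimes>\<^bsub>?A\<^esub> x"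
      using z x by (intro quo.Q.minus_equality) (simp_all add: a_minus_def)
    then show ?thesis using z x by simp
  qed
  then show ?thesis using z by (intro exI[of _ z]) (auto simp: alg_center_def)
qed

lemma dual_mod:
  assumes d: "calgebra.dual_system (Uq D (gc (res v))) B b bf'" and f: "mf v f" and u: "u \<in> carrier U"
  shows "(\<Sum>i\<in>B. bf' i (proj D (gc (res v)) u) * f (rep (b i))) = f u"
  using calgebra.dual_system_sum[OF quo.Q.calgebra_axioms d mf_rep(1)[OF f], of "proj D (gc (res v)) u"] mf_rep(2)[OF f u] u
  by simp

text \<open>The factor za \<otimes> zb keeps t in the centraliser. It also turns traces into
  integrals, tr(g y z) being \<mu>(g y), while the integrals of x za and y zb are those of za x and
  zb y.\<close>

theorem modified_integral_eq:
  fixes v w :: cvec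
  defines "\<alpha> \<equiv> gc (res v)" and "\<beta> \<equiv> gc (res w)"
  assumes ssa: "za \<in> alg_center (Uq D \<alpha>)" "\<And>x. x \<in> carrier (Uq D \<alpha>) \<Longrightarrow> \<mu> \<alpha> x = finite_calgebra.tr (Uq D \<alpha>) (za \<otimes>\<^bsub>Uq D \<alpha>\<^esub> x)"
    and ssb: "zb \<in> alg_center (Uq D \<beta>)" "\<And>x. x \<in> carrier (Uq D \<beta>) \<Longrightarrow> \<mu> \<beta> x = finite_calgebra.tr (Uq D \<beta>) (zb \<otimes>\<^bsub>Uq D \<beta>\<^esub> x)"
    and t: "t \<in> Zcop D \<alpha> \<beta>"
  shows "\<mu> \<beta> (zb \<otimes>\<^bsub>Uq D \<beta>\<^esub> form_left (Uq D \<beta>) (\<lambda>x. \<mu> \<alpha> (inv\<^bsub>Uq D \<alpha>\<^esub> (pivq D \<alpha>) \<otimes>\<^bsub>Uq D \<alpha>\<^esub> x)) t)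
    = \<mu> \<alpha> (za \<otimes>\<^bsub>Uq D \<alpha>\<^esub> form_right (Uq D \<alpha>) (\<lambda>y. \<mu> \<beta> (pivq D \<beta> \<otimes>\<^bsub>Uq D \<beta>\<^esub> y)) t)"
proof -
  let ?A = "Uq D \<alpha>" and ?B = "Uq D \<beta>" let ?T = "?A \<otimes>\<^sub>A ?B"
  interpret T: two_algebras ?A ?B by (rule two_quotients)
  have fA: "finite_calgebra ?A" and fB: "finite_calgebra ?B" unfolding \<alpha>_def \<beta>_def by (rule finite_Uq)+
  have la: "lform ?A (\<mu> \<alpha>)" and lb: "lform ?B (\<mu> \<beta>)" unfolding \<alpha>_def \<beta>_def by (intro lform_symm GG_res)+
  let ?tra = "finite_calgebra.tr ?A" and ?trb = "finite_calgebra.tr ?B"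
  note lta = lform_lmap[OF finite_calgebra.lform_tr[OF fA]] and ltb = lform_lmap[OF finite_calgebra.lform_tr[OF fB]]
  note Al = quo.Q.lmap_mult_left[of _ \<alpha>] and Ar = quo.Q.lmap_mult_right[of _ \<alpha>]
    and Bl = quo.Q.lmap_mult_left[of _ \<beta>] and Br = quo.Q.lmap_mult_right[of _ \<beta>]
  have za: "za \<in> carrier ?A" "\<And>x. x \<in> carrier ?A \<Longrightarrow> za \<otimes>\<^bsub>?A\<^esub> x = x \<otimes>\<^bsub>?A\<^esub> za"
    and zb: "zb \<in> carrier ?B" "\<And>x. x \<in> carrier ?B \<Longrightarrow> zb \<otimes>\<^bsub>?B\<^esub> x = x \<otimes>\<^bsub>?B\<^esub> zb"
    using ssa(1) ssb(1) by (auto simp: alg_center_def)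
  have tT: "t \<in> carrier ?T" using t by (simp add: Zcop_def Let_def)
  define ga where "ga = proj D \<alpha> gi"
  define gb where "gb = proj D \<beta> (piv D)"
  have ga: "ga \<in> carrier ?A" and gb: "gb \<in> carrier ?B" by (simp_all add: ga_def gb_def)
  let ?M = "Poly_Mapping.keys (rep t)"
  define x where "x k = Poly_Mapping.lookup (rep t) k \<odot>\<^bsub>?A\<^esub> fst k" for k
  define y where "y k = snd k" for k :: "'u set \<times> 'u set"
  have xy: "x k \<in> carrier ?A" "y k \<in> carrier ?B" if "k \<in> ?M" for k
    using T.rep_formals[OF tT] that by (auto simp: x_def y_def)
  have tev: "tev h t = (\<Sum>k\<in>?M. h (x k) (y k))" if "bform ?A ?B h" for h
    unfolding x_def y_def by (rule T.tev_keys[OF that tT])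
  \<comment> \<open>Lifts to U of the two legs of t multiplied by the central elements.\<close>
  define p where "p k = rep (x k \<otimes>\<^bsub>?A\<^esub> za)" for k
  define q where "q k = rep (y k \<otimes>\<^bsub>?B\<^esub> zb)" for k
  have pq: "p k \<in> carrier U" "q k \<in> carrier U" and pr_p: "proj D \<alpha> (p k) = x k \<otimes>\<^bsub>?A\<^esub> za" and pr_q: "proj D \<beta> (q k) = y k \<otimes>\<^bsub>?B\<^esub> zb"
    if "k \<in> ?M" for k
    using xy[OF that] za(1) zb(1) quo.rep_closed[of "x k \<otimes>\<^bsub>?A\<^esub> za" \<alpha>] quo.rep_closed[of "y k \<otimes>\<^bsub>?B\<^esub> zb" \<beta>]
    by (simp_all add: p_def q_def)
  obtain Ba where Ba: "finite Ba" "vectorspace.basis class_ring ?A Ba"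
    using finite_calgebra.base[OF fA] by blast
  obtain Bb where Bb: "finite Bb" "vectorspace.basis class_ring ?B Bb"
    using finite_calgebra.base[OF fB] by blast
  note da = calgebra.dual_system_coord[OF quo.Q.calgebra_axioms Ba] and db = calgebra.dual_system_coord[OF quo.Q.calgebra_axioms Bb]
  \<comment> \<open>The centralising property of t(za \<otimes> zb), transported to forms on U:
    \<open>?H\<close> is the test with za and zb multiplied in, and t commutes with the coproduct
    \<open>?d\<close> of c.\<close>
  have cen: "(\<Sum>k\<in>?M. sw (\<lambda>c1 c2. h (p k \<otimes>\<^bsub>U\<^esub> c1) (q k \<otimes>\<^bsub>U\<^esub> c2)) c)
      = (\<Sum>k\<in>?M. sw (\<lambda>c1 c2. h (c1 \<otimes>\<^bsub>U\<^esub> p k) (c2 \<otimes>\<^bsub>U\<^esub> q k)) c)"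
    if h: "bmf v w h" and c: "c \<in> carrier U" for h c
  proof -
    let ?h = "\<lambda>X Z. h (rep X) (rep Z)"
    have rc: "X \<in> carrier (Uq D \<gamma>) \<Longrightarrow> rep X \<in> carrier U" for X \<gamma> by (rule quo.rep_closed)
    have bh: "bform ?A ?B ?h"
      unfolding \<alpha>_def \<beta>_def
      by (intro bformI mf_rep(1)[OF bmf1[OF h]] mf_rep(1)[OF bmf2[OF h]] rc)
    have hpr: "?h (proj D \<alpha> a) (proj D \<beta> b) = h a b" if "a \<in> carrier U" "b \<in> carrier U" for a b
      using mf_rep(2)[OF bmf1[OF h, of "rep (proj D \<beta> b)"], of a] mf_rep(2)[OF bmf2[OF h, of a], of b] that
      by (simp add: \<alpha>_def \<beta>_def)
    let ?H = "\<lambda>X Z. ?h (X \<otimes>\<^bsub>?A\<^esub> za) (Z \<otimes>\<^bsub>?B\<^esub> zb)"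
    have bH: "bform ?A ?B ?H" by (rule T.bform_mult(2)[OF bh za(1) zb(1)])
    let ?d = "copq D \<alpha> \<beta> (proj D (gc (res (v + w))) c)"
    have dT: "?d \<in> carrier ?T" by (rule copq_closed[OF c])
    have ev: "tev k ?d = sw (\<lambda>a b. k (proj D \<alpha> a) (proj D \<beta> b)) c" if "bform ?A ?B k" for k
      using copq_eval[of v w k c] that c unfolding \<alpha>_def \<beta>_def by simp
    have "gplus \<alpha> \<beta> = gc (res (v + w))" by (simp add: \<alpha>_def \<beta>_def gplus_gc res_add)
    then have comm: "t \<otimes>\<^bsub>?T\<^esub> ?d = ?d \<otimes>\<^bsub>?T\<^esub> t"
      using t c by (simp add: Zcop_def Let_def)
    have "(\<Sum>k\<in>?M. sw (\<lambda>c1 c2. h (p k \<otimes>\<^bsub>U\<^esub> c1) (q k \<otimes>\<^bsub>U\<^esub> c2)) c)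
        = (\<Sum>k\<in>?M. sw (\<lambda>a b. ?H (x k \<otimes>\<^bsub>?A\<^esub> proj D \<alpha> a) (y k \<otimes>\<^bsub>?B\<^esub> proj D \<beta> b)) c)"
    proof (intro sum.cong refl sw_cong c)
      fix k a b assume k: "k \<in> ?M" and ab: "a \<in> carrier U" "b \<in> carrier U"
      have "h (p k \<otimes>\<^bsub>U\<^esub> a) (q k \<otimes>\<^bsub>U\<^esub> b) = ?h (x k \<otimes>\<^bsub>?A\<^esub> za \<otimes>\<^bsub>?A\<^esub> proj D \<alpha> a) (y k \<otimes>\<^bsub>?B\<^esub> zb \<otimes>\<^bsub>?B\<^esub> proj D \<beta> b)"
        using hpr[of "p k \<otimes>\<^bsub>U\<^esub> a" "q k \<otimes>\<^bsub>U\<^esub> b"] pq[OF k] pr_p[OF k] pr_q[OF k] ab by (simp flip: quo.pr_mult)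
      also have "x k \<otimes>\<^bsub>?A\<^esub> za \<otimes>\<^bsub>?A\<^esub> proj D \<alpha> a = x k \<otimes>\<^bsub>?A\<^esub> proj D \<alpha> a \<otimes>\<^bsub>?A\<^esub> za"
        using xy[OF k] za ab by (simp add: quo.Q.m_assoc)
      also have "y k \<otimes>\<^bsub>?B\<^esub> zb \<otimes>\<^bsub>?B\<^esub> proj D \<beta> b = y k \<otimes>\<^bsub>?B\<^esub> proj D \<beta> b \<otimes>\<^bsub>?B\<^esub> zb"
        using xy[OF k] zb ab by (simp add: quo.Q.m_assoc)
      finally show "h (p k \<otimes>\<^bsub>U\<^esub> a) (q k \<otimes>\<^bsub>U\<^esub> b) = ?H (x k \<otimes>\<^bsub>?A\<^esub> proj D \<alpha> a) (y k \<otimes>\<^bsub>?B\<^esub> proj D \<beta> b)" .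
    qed
    also have "\<dots> = (\<Sum>k\<in>?M. tev (\<lambda>a b. ?H (x k \<otimes>\<^bsub>?A\<^esub> a) (y k \<otimes>\<^bsub>?B\<^esub> b)) ?d)"
      by (intro sum.cong refl ev[symmetric] T.bform_mult(1)[OF bH] xy)
    also have "\<dots> = tev (\<lambda>X Z. tev (\<lambda>a b. ?H (X \<otimes>\<^bsub>?A\<^esub> a) (Z \<otimes>\<^bsub>?B\<^esub> b)) ?d) t"
      by (rule tev[OF T.bform_tev_mult(1)[OF bH dT], symmetric])
    also have "\<dots> = tev ?H (t \<otimes>\<^bsub>?T\<^esub> ?d)" by (rule T.tev_mult[OF bH, symmetric])
    also have "\<dots> = tev ?H (?d \<otimes>\<^bsub>?T\<^esub> t)" by (simp only: comm)
    also have "\<dots> = tev (\<lambda>a b. tev (\<lambda>X Z. ?H (a \<otimes>\<^bsub>?A\<^esub> X) (b \<otimes>\<^bsub>?B\<^esub> Z)) t) ?d" by (rule T.tev_mult[OF bH])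
    also have "\<dots> = tev (\<lambda>X Z. tev (\<lambda>a b. ?H (a \<otimes>\<^bsub>?A\<^esub> X) (b \<otimes>\<^bsub>?B\<^esub> Z)) ?d) t" by (rule tev_swap)
    also have "\<dots> = (\<Sum>k\<in>?M. tev (\<lambda>a b. ?H (a \<otimes>\<^bsub>?A\<^esub> x k) (b \<otimes>\<^bsub>?B\<^esub> y k)) ?d)"
      by (rule tev[OF T.bform_tev_mult(2)[OF bH dT]])
    also have "\<dots> = (\<Sum>k\<in>?M. sw (\<lambda>a b. ?H (proj D \<alpha> a \<otimes>\<^bsub>?A\<^esub> x k) (proj D \<beta> b \<otimes>\<^bsub>?B\<^esub> y k)) c)"
      by (intro sum.cong refl ev T.bform_mult(2)[OF bH] xy)
    also have "\<dots> = (\<Sum>k\<in>?M. sw (\<lambda>c1 c2. h (c1 \<otimes>\<^bsub>U\<^esub> p k) (c2 \<otimes>\<^bsub>U\<^esub> q k)) c)"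
    proof (intro sum.cong refl sw_cong c)
      fix k a b assume k: "k \<in> ?M" and ab: "a \<in> carrier U" "b \<in> carrier U"
      show "?H (proj D \<alpha> a \<otimes>\<^bsub>?A\<^esub> x k) (proj D \<beta> b \<otimes>\<^bsub>?B\<^esub> y k) = h (a \<otimes>\<^bsub>U\<^esub> p k) (b \<otimes>\<^bsub>U\<^esub> q k)"
        using hpr[of "a \<otimes>\<^bsub>U\<^esub> p k" "b \<otimes>\<^bsub>U\<^esub> q k"] pq[OF k] pr_p[OF k] pr_q[OF k] ab xy[OF k] za(1) zb(1)
        by (simp add: quo.Q.m_assoc flip: quo.pr_mult)
    qed
    finally show ?thesis .
  qed
  have main: "(\<Sum>k\<in>?M. mu v (p k) * (\<Sum>b\<in>Bb. coord ?B Bb (proj D \<beta> (piv D \<otimes>\<^bsub>U\<^esub> (q k \<otimes>\<^bsub>U\<^esub> rep b))) b))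
    = (\<Sum>k\<in>?M. (\<Sum>b\<in>Ba. coord ?A Ba (proj D \<alpha> (gi \<otimes>\<^bsub>U\<^esub> (p k \<otimes>\<^bsub>U\<^esub> rep b))) b) * mu w (q k))"
  proof (rule partial_traces_agree[OF L_antipode pq cen])
    show "rep b \<in> carrier U" if "b \<in> Ba" for b
      using calgebra.dual_systemD(1)[OF quo.Q.calgebra_axioms da that] by (rule quo.rep_closed)
    show "rep b \<in> carrier U" if "b \<in> Bb" for b
      using calgebra.dual_systemD(1)[OF quo.Q.calgebra_axioms db that] by (rule quo.rep_closed)
    show "mf v (\<lambda>u. coord ?A Ba (proj D \<alpha> u) b)" if "b \<in> Ba" for b
      using mf_proj[OF calgebra.dual_systemD(2)[OF quo.Q.calgebra_axioms da[unfolded \<alpha>_def] that]] by (simp add: \<alpha>_def)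
    show "mf w (\<lambda>u. coord ?B Bb (proj D \<beta> u) b)" if "b \<in> Bb" for b
      using mf_proj[OF calgebra.dual_systemD(2)[OF quo.Q.calgebra_axioms db[unfolded \<beta>_def] that]] by (simp add: \<beta>_def)
    show "(\<Sum>b\<in>Ba. coord ?A Ba (proj D \<alpha> u) b * f (rep b)) = f u" if "mf v f" "u \<in> carrier U" for f u
      using dual_mod[OF da[unfolded \<alpha>_def] that] by (simp add: \<alpha>_def)
    show "(\<Sum>b\<in>Bb. coord ?B Bb (proj D \<beta> u) b * f (rep b)) = f u" if "mf w f" "u \<in> carrier U" for f u
      using dual_mod[OF db[unfolded \<beta>_def] that] by (simp add: \<beta>_def)
  qed
  have trb: "(\<Sum>b\<in>Bb. coord ?B Bb (proj D \<beta> (piv D \<otimes>\<^bsub>U\<^esub> (q k \<otimes>\<^bsub>U\<^esub> rep b))) b) = \<mu> \<beta> (gb \<otimes>\<^bsub>?B\<^esub> y k)" if k: "k \<in> ?M" for k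
  proof -
    have "(\<Sum>b\<in>Bb. coord ?B Bb (proj D \<beta> (piv D \<otimes>\<^bsub>U\<^esub> (q k \<otimes>\<^bsub>U\<^esub> rep b))) b)
      = (\<Sum>b\<in>Bb. coord ?B Bb (gb \<otimes>\<^bsub>?B\<^esub> (y k \<otimes>\<^bsub>?B\<^esub> zb) \<otimes>\<^bsub>?B\<^esub> b) b)"
    proof (rule sum.cong[OF refl])
      fix b assume "b \<in> Bb"
      then have b: "b \<in> carrier ?B" "rep b \<in> carrier U"
        using calgebra.dual_systemD(1)[OF quo.Q.calgebra_axioms db] quo.rep_closed by auto
      show "coord ?B Bb (proj D \<beta> (piv D \<otimes>\<^bsub>U\<^esub> (q k \<otimes>\<^bsub>U\<^esub> rep b))) b = coord ?B Bb (gb \<otimes>\<^bsub>?B\<^esub> (y k \<otimes>\<^bsub>?B\<^esub> zb) \<otimes>\<^bsub>?B\<^esub> b) b"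
        using b pq[OF k] pr_q[OF k] xy[OF k] zb(1) gb by (simp add: gb_def quo.Q.m_assoc flip: quo.pr_mult)
    qed
    also have "\<dots> = ?trb (gb \<otimes>\<^bsub>?B\<^esub> (y k \<otimes>\<^bsub>?B\<^esub> zb))"
      using xy[OF k] zb(1) gb by (intro finite_calgebra.tr_eq[OF fB db, symmetric]) simp
    also have "gb \<otimes>\<^bsub>?B\<^esub> (y k \<otimes>\<^bsub>?B\<^esub> zb) = zb \<otimes>\<^bsub>?B\<^esub> (gb \<otimes>\<^bsub>?B\<^esub> y k)"
      using xy[OF k] zb gb by (simp add: quo.Q.m_assoc)
    also have "?trb \<dots> = \<mu> \<beta> (gb \<otimes>\<^bsub>?B\<^esub> y k)"
      using xy[OF k] gb by (intro ssb(2)[symmetric]) simp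
    finally show ?thesis .
  qed
  have tra: "(\<Sum>b\<in>Ba. coord ?A Ba (proj D \<alpha> (gi \<otimes>\<^bsub>U\<^esub> (p k \<otimes>\<^bsub>U\<^esub> rep b))) b) = \<mu> \<alpha> (ga \<otimes>\<^bsub>?A\<^esub> x k)" if k: "k \<in> ?M" for k
  proof -
    have "(\<Sum>b\<in>Ba. coord ?A Ba (proj D \<alpha> (gi \<otimes>\<^bsub>U\<^esub> (p k \<otimes>\<^bsub>U\<^esub> rep b))) b)
      = (\<Sum>b\<in>Ba. coord ?A Ba (ga \<otimes>\<^bsub>?A\<^esub> (x k \<otimes>\<^bsub>?A\<^esub> za) \<otimes>\<^bsub>?A\<^esub> b) b)"
    proof (rule sum.cong[OF refl])
      fix b assume "b \<in> Ba"
      then have b: "b \<in> carrier ?A" "rep b \<in> carrier U"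
        using calgebra.dual_systemD(1)[OF quo.Q.calgebra_axioms da] quo.rep_closed by auto
      show "coord ?A Ba (proj D \<alpha> (gi \<otimes>\<^bsub>U\<^esub> (p k \<otimes>\<^bsub>U\<^esub> rep b))) b = coord ?A Ba (ga \<otimes>\<^bsub>?A\<^esub> (x k \<otimes>\<^bsub>?A\<^esub> za) \<otimes>\<^bsub>?A\<^esub> b) b"
        using b pq[OF k] pr_p[OF k] xy[OF k] za(1) ga by (simp add: ga_def quo.Q.m_assoc flip: quo.pr_mult)
    qed
    also have "\<dots> = ?tra (ga \<otimes>\<^bsub>?A\<^esub> (x k \<otimes>\<^bsub>?A\<^esub> za))"
      using xy[OF k] za(1) ga by (intro finite_calgebra.tr_eq[OF fA da, symmetric]) simp
    also have "ga \<otimes>\<^bsub>?A\<^esub> (x k \<otimes>\<^bsub>?A\<^esub> za) = za \<otimes>\<^bsub>?A\<^esub> (ga \<otimes>\<^bsub>?A\<^esub> x k)"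
      using xy[OF k] za ga by (simp add: quo.Q.m_assoc)
    also have "?tra \<dots> = \<mu> \<alpha> (ga \<otimes>\<^bsub>?A\<^esub> x k)"
      using xy[OF k] ga by (intro ssa(2)[symmetric]) simp
    finally show ?thesis .
  qed
  have mup: "mu v (p k) = \<mu> \<alpha> (za \<otimes>\<^bsub>?A\<^esub> x k)" and muq: "mu w (q k) = \<mu> \<beta> (zb \<otimes>\<^bsub>?B\<^esub> y k)" if k: "k \<in> ?M" for k
    using mu_eq[OF pq(1)[OF k], of v] mu_eq[OF pq(2)[OF k], of w] pr_p[OF k] pr_q[OF k] za(2)[OF xy(1)[OF k]] zb(2)[OF xy(2)[OF k]]
    by (simp_all add: \<alpha>_def \<beta>_def)
  have lza: "lform ?A (\<lambda>X. \<mu> \<alpha> (za \<otimes>\<^bsub>?A\<^esub> X))" by (intro lform_lmap[OF la] Al lmap_id za)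
  have lzb: "lform ?B (\<lambda>Z. \<mu> \<beta> (zb \<otimes>\<^bsub>?B\<^esub> Z))" by (intro lform_lmap[OF lb] Bl lmap_id zb)
  have lga: "lform ?A (\<lambda>X. \<mu> \<alpha> (ga \<otimes>\<^bsub>?A\<^esub> X))" by (intro lform_lmap[OF la] Al lmap_id ga)
  have lgb: "lform ?B (\<lambda>Z. \<mu> \<beta> (gb \<otimes>\<^bsub>?B\<^esub> Z))" by (intro lform_lmap[OF lb] Bl lmap_id gb)
  have "\<mu> \<beta> (zb \<otimes>\<^bsub>?B\<^esub> form_left ?B (\<lambda>x. \<mu> \<alpha> (inv\<^bsub>?A\<^esub> (pivq D \<alpha>) \<otimes>\<^bsub>?A\<^esub> x)) t)
    = tev (\<lambda>X Z. \<mu> \<alpha> (ga \<otimes>\<^bsub>?A\<^esub> X) * \<mu> \<beta> (zb \<otimes>\<^bsub>?B\<^esub> Z)) t"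
    unfolding form_left_def inv_pivq ga_def[symmetric]
    by (subst T.tens_lift_eval(1)[OF quo.Q.cspace lzb tT]) (auto intro!: T.tev_cong[OF tT] simp: lform_smult[OF lzb])
  also have "\<dots> = (\<Sum>k\<in>?M. \<mu> \<alpha> (ga \<otimes>\<^bsub>?A\<^esub> x k) * \<mu> \<beta> (zb \<otimes>\<^bsub>?B\<^esub> y k))"
    by (rule tev[OF bform_prod[OF lga lzb]])
  \<comment> \<open>This is \<open>main\<close> after its traces have become integrals: the central
    factor changes leg, and the pivot changes from the inverse on the first leg to g on the
    second.\<close>
  also have "\<dots> = (\<Sum>k\<in>?M. \<mu> \<alpha> (za \<otimes>\<^bsub>?A\<^esub> x k) * \<mu> \<beta> (gb \<otimes>\<^bsub>?B\<^esub> y k))"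
    using main by (simp add: tra trb mup muq)
  also have "\<dots> = tev (\<lambda>X Z. \<mu> \<alpha> (za \<otimes>\<^bsub>?A\<^esub> X) * \<mu> \<beta> (gb \<otimes>\<^bsub>?B\<^esub> Z)) t"
    by (rule tev[OF bform_prod[OF lza lgb], symmetric])
  also have "\<dots> = \<mu> \<alpha> (za \<otimes>\<^bsub>?A\<^esub> form_right ?A (\<lambda>y. \<mu> \<beta> (pivq D \<beta> \<otimes>\<^bsub>?B\<^esub> y)) t)"
    unfolding form_right_def pivq_def gb_def[symmetric]
    by (subst T.tens_lift_eval(1)[OF quo.Q.cspace lza tT]) (auto intro!: T.tev_cong[OF tT] simp: lform_smult[OF lza])
  finally show ?thesis .
qed

end

theorem theorem7p3:
  fixes D :: "('u, 'v) unrolled_data"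
    and \<Upsilon> :: "'u set"
    and lam :: "cvec set \<Rightarrow> 'u set \<Rightarrow> complex"
    and X :: "cvec set set"
  assumes "ell D \<ge> 1"
    and "axiom1 D"
    and "unrolled_algebra D"
    and "axiom2 D"
    and "axiom3 D \<Upsilon>"
    and "right_G_integral D lam" and "lam (gzero D) \<Upsilon> = 1"
    and "axiom4 D lam"
    and "axiom5 D"
    and "X \<subseteq> GG D"
    and "GG D - X = {\<alpha> \<in> GG D. semisimple_algebra (Uq D \<alpha>)}"
  shows "\<exists>z :: cvec set \<Rightarrow> 'u set.
    (\<forall>\<alpha>\<in>GG D - X.
       z \<alpha> \<in> alg_center (Uq D \<alpha>) \<and>
       (\<forall>x\<in>carrier (Uq D \<alpha>).
          symm_integral D lam \<alpha> x =
          lin_trace (Uq D \<alpha>) ((\<lambda>y. z \<alpha> \<otimes>\<^bsub>Uq D \<alpha>\<^esub> y) \<circ> (\<lambda>y. x \<otimes>\<^bsub>Uq D \<alpha>\<^esub> y)))) \<and>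
    (\<exists>\<mu>' :: cvec set \<Rightarrow> 'u set \<Rightarrow> complex.
       modified_integral D lam X \<mu>' \<and>
       (\<forall>\<alpha>\<in>GG D - X. \<forall>w\<in>alg_center (Uq D \<alpha>).
          \<mu>' \<alpha> w = symm_integral D lam \<alpha> (z \<alpha> \<otimes>\<^bsub>Uq D \<alpha>\<^esub> w) \<and>
          \<mu>' \<alpha> w = lin_trace (Uq D \<alpha>)
            (\<lambda>y. (z \<alpha> \<otimes>\<^bsub>Uq D \<alpha>\<^esub> z \<alpha> \<otimes>\<^bsub>Uq D \<alpha>\<^esub> w) \<otimes>\<^bsub>Uq D \<alpha>\<^esub> y)))"
proof -
  interpret unrolled_integral D lam \<Upsilon>
    by unfold_locales (use assms in auto)
  let ?A = "Uq D"
  define z where "z \<alpha> = (SOME z. z \<in> alg_center (?A \<alpha>) \<and>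
    (\<forall>x\<in>carrier (?A \<alpha>). \<mu> \<alpha> x = finite_calgebra.tr (?A \<alpha>) (z \<otimes>\<^bsub>?A \<alpha>\<^esub> x)))" for \<alpha>
  have z: "z \<alpha> \<in> alg_center (?A \<alpha>)"
      "\<And>x. x \<in> carrier (?A \<alpha>) \<Longrightarrow> \<mu> \<alpha> x = finite_calgebra.tr (?A \<alpha>) (z \<alpha> \<otimes>\<^bsub>?A \<alpha>\<^esub> x)"
      "finite_calgebra (?A \<alpha>)"
      "\<exists>v. \<alpha> = gc (res v)"
    if \<alpha>: "\<alpha> \<in> GG D - X" for \<alpha>
  proof -
    have "\<alpha> \<in> GG D" and ss: "semisimple_algebra (?A \<alpha>)" using \<alpha> assms(11) by auto
    then obtain v where v: "\<alpha> = gc (res v)" by (metis GG_cases)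
    then show "\<exists>v. \<alpha> = gc (res v)" "finite_calgebra (?A \<alpha>)" using finite_Uq by auto
    from someI_ex[OF trace_element[OF ss[unfolded v]]] show "z \<alpha> \<in> alg_center (?A \<alpha>)"
      "\<And>x. x \<in> carrier (?A \<alpha>) \<Longrightarrow> \<mu> \<alpha> x = finite_calgebra.tr (?A \<alpha>) (z \<alpha> \<otimes>\<^bsub>?A \<alpha>\<^esub> x)"
      unfolding z_def v by auto
  qed
  have zc: "z \<alpha> \<in> carrier (?A \<alpha>)" if "\<alpha> \<in> GG D - X" for \<alpha>
    using z(1)[OF that] by (simp add: alg_center_def)
  have tr: "finite_calgebra.tr (?A \<alpha>) u = lin_trace (?A \<alpha>) (\<lambda>y. u \<otimes>\<^bsub>?A \<alpha>\<^esub> y)" if "\<alpha> \<in> GG D - X" for \<alpha> u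
    by (rule finite_calgebra.tr_def[OF z(3)[OF that]])
  define \<mu>' where "\<mu>' \<alpha> w = \<mu> \<alpha> (z \<alpha> \<otimes>\<^bsub>?A \<alpha>\<^esub> w)" for \<alpha> w
  show ?thesis
  proof (rule exI[of _ z], intro conjI ballI exI[of _ \<mu>'])
    fix \<alpha> x assume \<alpha>: "\<alpha> \<in> GG D - X"
    show "z \<alpha> \<in> alg_center (?A \<alpha>)" by (rule z(1)[OF \<alpha>])
    assume x: "x \<in> carrier (?A \<alpha>)"
    show "\<mu> \<alpha> x = lin_trace (?A \<alpha>) ((\<lambda>y. z \<alpha> \<otimes>\<^bsub>?A \<alpha>\<^esub> y) \<circ> (\<lambda>y. x \<otimes>\<^bsub>?A \<alpha>\<^esub> y))"
      unfolding z(2)[OF \<alpha> x] tr[OF \<alpha>]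
      by (rule finite_calgebra.lin_trace_cong[OF z(3)[OF \<alpha>]]) (simp add: zc[OF \<alpha>] x quo.Q.m_assoc)
  next
    fix \<alpha> w assume \<alpha>: "\<alpha> \<in> GG D - X" and w: "w \<in> alg_center (?A \<alpha>)"
    have wc: "w \<in> carrier (?A \<alpha>)" using w by (simp add: alg_center_def)
    show "\<mu>' \<alpha> w = \<mu> \<alpha> (z \<alpha> \<otimes>\<^bsub>?A \<alpha>\<^esub> w)" by (simp add: \<mu>'_def)
    have "\<mu>' \<alpha> w = finite_calgebra.tr (?A \<alpha>) (z \<alpha> \<otimes>\<^bsub>?A \<alpha>\<^esub> z \<alpha> \<otimes>\<^bsub>?A \<alpha>\<^esub> w)"
      using z(2)[OF \<alpha>, of "z \<alpha> \<otimes>\<^bsub>?A \<alpha>\<^esub> w"] zc[OF \<alpha>] wc by (simp add: \<mu>'_def quo.Q.m_assoc)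
    then show "\<mu>' \<alpha> w = lin_trace (?A \<alpha>) (\<lambda>y. (z \<alpha> \<otimes>\<^bsub>?A \<alpha>\<^esub> z \<alpha> \<otimes>\<^bsub>?A \<alpha>\<^esub> w) \<otimes>\<^bsub>?A \<alpha>\<^esub> y)"
      by (simp only: tr[OF \<alpha>])
  next
    show "modified_integral D lam X \<mu>'"
      unfolding modified_integral_def
    proof (intro conjI ballI)
      fix \<alpha> assume \<alpha>: "\<alpha> \<in> GG D - X"
      have l: "lform (?A \<alpha>) (\<mu>' \<alpha>)" unfolding \<mu>'_def using \<alpha>
        by (intro lform_lmap[OF lform_symm] quo.Q.lmap_mult_left lmap_id zc) auto
      show "\<mu>' \<alpha> \<in> clinear (?A \<alpha>\<lparr>carrier := alg_center (?A \<alpha>)\<rparr>) Calg"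
        by (auto simp: LinearCombinations.module_hom_def Calg_def alg_center_def lform_add[OF l] lform_smult[OF l])
    next
      fix \<alpha> \<beta> t assume \<alpha>: "\<alpha> \<in> GG D - X" and \<beta>: "\<beta> \<in> GG D - X" and t: "t \<in> Zcop D \<alpha> \<beta>"
      obtain v w where v: "\<alpha> = gc (res v)" and w: "\<beta> = gc (res w)" using z(4)[OF \<alpha>] z(4)[OF \<beta>] by blast
      show "\<mu>' \<beta> (form_left (?A \<beta>) (\<lambda>x. \<mu> \<alpha> (inv\<^bsub>?A \<alpha>\<^esub> (pivq D \<alpha>) \<otimes>\<^bsub>?A \<alpha>\<^esub> x)) t)
        = \<mu>' \<alpha> (form_right (?A \<alpha>) (\<lambda>y. \<mu> \<beta> (pivq D \<beta> \<otimes>\<^bsub>?A \<beta>\<^esub> y)) t)"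
        unfolding \<mu>'_def v w
        by (rule modified_integral_eq) (use z(1,2)[OF \<alpha>] z(1,2)[OF \<beta>] t in \<open>simp_all add: v w\<close>)
    qed
  qed
qed

end
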